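(* Fix $N\ge2$ and assume (A1), (A2), (A5) and Gaussian initial data. For $i\in[N]$ let $(X^i_T,\alpha^i_T)$ and $(X^i,\alpha^i)$ be the finite-horizon and ergodic equilibrium pairs defined in the context, driven by the same Brownian motion $W^i$ and the same initial state $x^i_0$. Then there exist $\widetilde K^{(N)},\widetilde\lambda^{(N)}>0$, independent of $t,T$, such that for all $T>0$ and $t\in[0,T]$, $$\sup_{i\in[N]}\mathbb E\big[|X^i_T(t)-X^i(t)|^2+|\alpha^i_T(t)-\alpha^i(t)|^2\big]\le\widetilde K^{(N)}\big(e^{-\widetilde\lambda^{(N)}t}+e^{-\widetilde\lambda^{(N)}(T-t)}\big).$$ If in addition (A3), (A4), (A6) hold, there exist $\widetilde K,\widetilde\lambda>0$, independent of $t,T,N$, such that for all $T>0$, $t\in[0,T]$, $$\sup_N\frac1N\mathbb E\big[|\bm X_T(t)-\bm X(t)|^2+|\bm\alpha_T(t)-\bm\alpha(t)|^2\big]\le\widetilde K\big(e^{-\widetilde\lambda t}+e^{-\widetilde\lambda(T-t)}\big),$$ where $\bm X_T=(X^1_T,\dots,X^N_T)$, $\bm X=(X^1,\dots,X^N)$, $\bm\alpha_T=(\alpha^1_T,\dots,\alpha^N_T)$, $\bm\alpha=(\alpha^1,\dots,\alpha^N)$ take values in $\mathbb R^{Nd}$.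
   Context: Notation: $[N]=\{1,\dots,N\}$; $\mathbb S^d,\mathbb S^d_{++}$ symmetric / symmetric positive definite; $P\le Q$ means $Q-P$ positive semidefinite; $\|\cdot\|$ spectral norm; $\bm y^{-i}$ removes the $i$-th block. Data (for each $N\ge2$ in the uniform part): for $i\in[N]$, $A^i,\sigma^i\in\mathbb R^{d\times d}$, $R^i\in\mathbb S^d$, $\bm Q^i\in\mathbb S^{Nd}$ with blocks $Q^i_{jk}$, $\bar x^j_i\in\mathbb R^d$, $\mu^i_0\in\mathbb R^d$, $\Sigma^i_0\in\mathbb S^d_{++}$; $\varsigma^i=\frac12\sigma^i(\sigma^i)^\top$. Gaussian initial data: $x^i_0\sim\mathcal N(\mu^i_0,(\Sigma^i_0)^{-1})$, independent of independent $d$-dimensional Brownian motions $W^1,\dots,W^N$. (A1): $\sigma^i$ invertible, $R^i,Q^i_{ii}\in\mathbb S^d_{++}$. $F^i_1(\bm y^{-i})=-Q^i_{ii}\bar x^i_i+\sum_{j\ne i}Q^i_{ij}(y^j-\bar x^j_i)$; $F^i_0(\bm y^{-i},\Upsilon)=(\bar x^i_i)^\top Q^i_{ii}\bar x^i_i-(\bar x^i_i)^\top\sum_{j\ne i}Q^i_{ij}(y^j-\bar x^j_i)-\sum_{j\ne i}(y^j-\bar x^j_i)^\top Q^i_{ji}\bar x^i_i+\sum_{j,k\ne i,j\ne k}(y^j-\bar x^j_i)^\top Q^i_{jk}(y^k-\bar x^k_i)+\sum_{j\ne i}[\mathrm{tr}(Q^i_{jj}\Upsilon^{-1})+(y^j-\bar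 x^j_i)^\top Q^i_{jj}(y^j-\bar x^j_i)]$. (FR$_T$) on $[0,T]$: $\dot\Lambda^i_T+\Lambda^i_TA^i+(A^i)^\top\Lambda^i_T-\Lambda^i_T(R^i)^{-1}\Lambda^i_T+2Q^i_{ii}=0$; $\dot\Sigma^i_T+2\Sigma^i_T\varsigma^i\Sigma^i_T+2\Sigma^i_T(A^i-(R^i)^{-1}\Lambda^i_T)=0$; $\dot\mu^i_T-(A^i-(R^i)^{-1}\Lambda^i_T)\mu^i_T+(R^i)^{-1}\rho^i_T=0$; $\dot\rho^i_T+(A^i-(R^i)^{-1}\Lambda^i_T)^\top\rho^i_T+2F^i_1(\bm\mu^{-i}_T)=0$; $\dot\kappa^i_T+\mathrm{tr}(\varsigma^i\Lambda^i_T)-\frac12(\rho^i_T)^\top(R^i)^{-1}\rho^i_T+F^i_0(\bm\mu^{-i}_T,\Sigma^i_T)=0$; $\Sigma^i_T(0)=\Sigma^i_0$, $\mu^i_T(0)=\mu^i_0$, $\Lambda^i_T(T)=0$, $\rho^i_T(T)=0$, $\kappa^i_T(T)=0$. (AR): $\Lambda^iA^i+(A^i)^\top\Lambda^i-\Lambda^i(R^i)^{-1}\Lambda^i+2Q^i_{ii}=0$; $\Sigma^i\varsigma^i\Sigma^i+\Sigma^i(A^i-(R^i)^{-1}\Lambda^i)=0$; $(A^i-(R^i)^{-1}\Lambda^i)\mu^i-(R^i)^{-1}\rho^i=0$; $(A^i-(R^i)^{-1}\Lambda^i)^\top\rho^i+2F^i_1(\bm\mu^{-i})=0$; $c^i=\mathrm{tr}(\varsigma^i\Lambda^i)-\frac12(\rho^i)^\top(R^i)^{-1}\rho^i+F^i_0(\bm\mu^{-i},\Sigma^i)$,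 $\Lambda^i\in\mathbb S^d$, $\Sigma^i\in\mathbb S^d_{++}$; unique solution under (A1),(A5). Equilibrium pairs: finite-horizon: $dX^i_T=\big((A^i-(R^i)^{-1}\Lambda^i_T(t))X^i_T-(R^i)^{-1}\rho^i_T(t)\big)dt+\sigma^idW^i$, $X^i_T(0)=x^i_0$, and $\alpha^i_T(t)=(R^i)^{-1}\Lambda^i_T(t)X^i_T(t)+(R^i)^{-1}\rho^i_T(t)$ (the Nash equilibrium of the finite-horizon game); ergodic: $dX^i=\big((A^i-(R^i)^{-1}\Lambda^i)X^i-(R^i)^{-1}\rho^i\big)dt+\sigma^idW^i$, $X^i(0)=x^i_0$, and $\alpha^i(t)=(R^i)^{-1}\Lambda^iX^i(t)+(R^i)^{-1}\rho^i$ (the Nash equilibrium of the ergodic game). (A5): for each $i$, every $\Sigma\in\mathbb S^d_{++}$ with $\Sigma\varsigma^iR^i\varsigma^i\Sigma-(A^i)^\top R^iA^i=2Q^i_{ii}$ satisfies $\Sigma\varsigma^iR^i-R^i\varsigma^i\Sigma=R^iA^i-(A^i)^\top R^i$; and $\bm M=(Q^i_{ij}+\frac12\delta_{ij}(A^i)^\top R^iA^i)_{i,j}$ is invertible. Constants: $K_i,\lambda_i,K_{\Lambda^i},\lambda_{\Lambda^i}>0$ independent of $t,T$ with $\|e^{(A^i-(R^i)^{-1}\Lambda^i)t}\|\le K_ie^{-\lambda_it}$ and $\|\Lambda^i_T(t)-\Lambda^i\|\le K_{\Lambda^i}e^{-\lambda_{\Lambda^i}(T-t)}$; $K^{(N)}=\max_iK_ie^{K_{\Lambda^i}\|(R^i)^{-1}\|/\lambda_{\Lambda^i}}$,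 $\lambda^{(N)}=\min_i\lambda_i$; $\bm R=\mathrm{blockdiag}((R^i)^{-1})$ with smallest eigenvalue $\lambda_{\bm R,\min}$; $\bm Q$ the $Nd\times Nd$ matrix with $(i,j)$ block $Q^i_{ij}$ ($i\ne j$), zero diagonal blocks. (A2): some $\gamma^{(N)}\in(0,\frac{(\lambda^{(N)})^2}{2(K^{(N)})^2\|\bm R\|^2}\lambda_{\bm R,\min})$ has $\bm Q+\frac{\gamma^{(N)}}2I_{Nd}\in\mathbb S^{Nd}_{++}$. (A3): either (i) a $\bar c>0$ bounds all real parts of eigenvalues of all $A^i$ above by $-\bar c$, with $\beta_*I_d\le R^i\le\beta^*I_d$, $\Lambda^i\le c^*I_d$ for all $i,N$; or (ii) $\beta_*I_d\le R^i\le\beta^*I_d$, $2Q^i_{ii}\ge\beta_1I_d$, $c_*I_d\le\Lambda^i\le c^*I_d$ for all $i,N$. (A4): with $K_i,\lambda_i,K_{\Lambda^i},\lambda_{\Lambda^i}$ chosen independent of $i,N$ (possible under (A3)), $\bar\gamma=\liminf_N\frac{(\lambda^{(N)})^2}{2(K^{(N)})^2\|\bm R\|^2}\lambda_{\bm R,\min}$; there is $\gamma\in(0,\bar\gamma)$ with $\bm Q+\frac\gamma2I_{Nd}\in\mathbb S^{Nd}_{++}$ for all $N$, and $\sup_N\|\bm Q\|\le\beta_2<\infty$. (A6): a constant $\beta_3$ bounds, for all $N,i$: $\max_j|\bar x^i_j|$, $\|\varsigma^i\|$, $\|(\Sigma^i_0)^{-1}\|$, $|\mu^i_0|$, $\|(\Sigma^i)^{-1}\|$,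 $|\mu^i|$, $|\rho^i|$, $\sum_i\sup_{j\ne i}\|Q^i_{ij}\|$, $\sum_i\sum_{j\ne i}\sup_{k\ne j,i}\|Q^i_{jk}\|$, $\sum_i\sum_{k\ne i}\sup_{j\ne k,i}\|Q^i_{jk}\|$, $\sum_{j\ne i}\|Q^i_{jj}\|$, $\sum_i\sup_{j\ne i}\|Q^i_{jj}\|$. *)

theory Defs
  imports "HOL-Analysis.Analysis" "HOL-Probability.Probability"
begin

type_synonym 'd mat = "real^'d^'d"
type_synonym 'd bvec = "nat \<Rightarrow> real^'d"          (* block vector, blocks indexed by 1..N *)
type_synonym 'd bmat = "nat \<Rightarrow> nat \<Rightarrow> real^'d^'d"  (* block matrix, blocks indexed by 1..N *)

definition msym :: "'d::finite mat \<Rightarrow> bool" where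
  "msym S \<longleftrightarrow> transpose S = S"

definition spd :: "'d::finite mat \<Rightarrow> bool" where
  "spd S \<longleftrightarrow> msym S \<and> (\<forall>x. x \<noteq> 0 \<longrightarrow> 0 < x \<bullet> (S *v x))"

definition loewner_le :: "'d::finite mat \<Rightarrow> 'd mat \<Rightarrow> bool" where
  "loewner_le P Q \<longleftrightarrow> msym (Q - P) \<and> (\<forall>x. 0 \<le> x \<bullet> ((Q - P) *v x))"

definition opnorm :: "'d::finite mat \<Rightarrow> real" where
  "opnorm A = onorm (\<lambda>x. A *v x)"

fun matpow :: "'d::finite mat \<Rightarrow> nat \<Rightarrow> 'd mat" where
  "matpow A 0 = mat 1"
| "matpow A (Suc n) = A ** matpow A n"

definition mexp :: "'d::finite mat \<Rightarrow> 'd mat" where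
  "mexp A = (\<Sum>n. (1 / fact n) *\<^sub>R matpow A n)"

definition cmat :: "'d::finite mat \<Rightarrow> complex^'d^'d" where
  "cmat A = (\<chi> i j. complex_of_real (A $ i $ j))"

definition ceigenvalues :: "'d::finite mat \<Rightarrow> complex set" where
  "ceigenvalues A = {l. \<exists>z::complex^'d. z \<noteq> 0 \<and> cmat A *v z = l *s z}"

definition fsup :: "'i set \<Rightarrow> ('i \<Rightarrow> real) \<Rightarrow> real" where
  "fsup S f = (if S = {} then 0 else Max (f ` S))"

definition bnz :: "nat \<Rightarrow> 'd::finite bvec \<Rightarrow> bool" where
  "bnz N y \<longleftrightarrow> (\<exists>i\<in>{1..N}. y i \<noteq> 0)"

definition bmult :: "nat \<Rightarrow> 'd::finite bmat \<Rightarrow> 'd bvec \<Rightarrow> 'd bvec" where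
  "bmult N M y = (\<lambda>i. \<Sum>j\<in>{1..N}. M i j *v y j)"

definition bnorm2 :: "nat \<Rightarrow> 'd::finite bvec \<Rightarrow> real" where
  "bnorm2 N y = (\<Sum>i\<in>{1..N}. (norm (y i))\<^sup>2)"

definition bspd :: "nat \<Rightarrow> 'd::finite bmat \<Rightarrow> bool" where
  "bspd N M \<longleftrightarrow> (\<forall>i\<in>{1..N}. \<forall>j\<in>{1..N}. M i j = transpose (M j i))
     \<and> (\<forall>y. bnz N y \<longrightarrow> 0 < (\<Sum>i\<in>{1..N}. y i \<bullet> bmult N M y i))"

definition bopnorm :: "nat \<Rightarrow> 'd::finite bmat \<Rightarrow> real" where
  "bopnorm N M = Sup {sqrt (bnorm2 N (bmult N M y)) | y. bnorm2 N y \<le> 1}"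

definition beigenvalues :: "nat \<Rightarrow> 'd::finite bmat \<Rightarrow> real set" where
  "beigenvalues N M = {l. \<exists>y. bnz N y \<and> (\<forall>i\<in>{1..N}. bmult N M y i = l *\<^sub>R y i)}"

definition binvertible :: "nat \<Rightarrow> 'd::finite bmat \<Rightarrow> bool" where
  "binvertible N M \<longleftrightarrow> (\<exists>B. \<forall>i\<in>{1..N}. \<forall>j\<in>{1..N}.
      (\<Sum>k\<in>{1..N}. M i k ** B k j) = (if i = j then mat 1 else 0)
    \<and> (\<Sum>k\<in>{1..N}. B i k ** M k j) = (if i = j then mat 1 else 0))"

definition bRinv :: "(nat \<Rightarrow> 'd::finite mat) \<Rightarrow> 'd bmat" where
  "bRinv R = (\<lambda>i j. if i = j then matrix_inv (R i) else 0)"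

text \<open>Conventions (for one fixed N): A i, sg i (= sigma^i), R i :: d x d;
  Q i j k = Q^i_{jk}; xb i j = xbar^i_j (superscript i, subscript j);
  players are indexed by i in {1..N}.\<close>

definition vsig :: "('i \<Rightarrow> 'd::finite mat) \<Rightarrow> 'i \<Rightarrow> 'd mat" where
  "vsig sg i = (1/2) *\<^sub>R (sg i ** transpose (sg i))"

definition F1 :: "nat \<Rightarrow> (nat \<Rightarrow> nat \<Rightarrow> nat \<Rightarrow> 'd::finite mat) \<Rightarrow> (nat \<Rightarrow> nat \<Rightarrow> real^'d)
                   \<Rightarrow> nat \<Rightarrow> 'd bvec \<Rightarrow> real^'d" where
  "F1 N Q xb i y = - (Q i i i *v xb i i)
      + (\<Sum>j\<in>{1..N}-{i}. Q i i j *v (y j - xb j i))"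

definition F0 :: "nat \<Rightarrow> (nat \<Rightarrow> nat \<Rightarrow> nat \<Rightarrow> 'd::finite mat) \<Rightarrow> (nat \<Rightarrow> nat \<Rightarrow> real^'d)
                   \<Rightarrow> nat \<Rightarrow> 'd bvec \<Rightarrow> 'd mat \<Rightarrow> real" where
  "F0 N Q xb i y U =
      xb i i \<bullet> (Q i i i *v xb i i)
    - xb i i \<bullet> (\<Sum>j\<in>{1..N}-{i}. Q i i j *v (y j - xb j i))
    - (\<Sum>j\<in>{1..N}-{i}. (y j - xb j i) \<bullet> (Q i j i *v xb i i))
    + (\<Sum>j\<in>{1..N}-{i}. \<Sum>k\<in>{1..N}-{i}-{j}. (y j - xb j i) \<bullet> (Q i j k *v (y k - xb k i)))
    + (\<Sum>j\<in>{1..N}-{i}. trace (Q i j j ** matrix_inv U)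
                          + (y j - xb j i) \<bullet> (Q i j j *v (y j - xb j i)))"

(* X ~ N(m, C) on R^d (C positive definite): every nonzero linear functional is normal *)
definition gaussian_vec :: "'a measure \<Rightarrow> ('a \<Rightarrow> real^'d::finite) \<Rightarrow> real^'d \<Rightarrow> 'd mat \<Rightarrow> bool" where
  "gaussian_vec M X m C \<longleftrightarrow> X \<in> borel_measurable M \<and>
     (\<forall>v. v \<noteq> 0 \<longrightarrow> distributed M lborel (\<lambda>\<omega>. v \<bullet> X \<omega>)
        (\<lambda>x. ennreal (normal_density (v \<bullet> m) (sqrt (v \<bullet> (C *v v))) x)))"

definition brownian :: "'a measure \<Rightarrow> (real \<Rightarrow> 'a \<Rightarrow> real^'d::finite) \<Rightarrow> bool" where
  "brownian M W \<longleftrightarrow>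
     (\<forall>t\<ge>0. W t \<in> borel_measurable M)
   \<and> (AE \<omega> in M. W 0 \<omega> = 0 \<and> continuous_on {0..} (\<lambda>t. W t \<omega>))
   \<and> (\<forall>(n::nat) (ts::nat \<Rightarrow> real). 0 \<le> ts 0 \<and> (\<forall>k<n. ts k < ts (Suc k)) \<longrightarrow>
        prob_space.indep_vars M (\<lambda>_. borel) (\<lambda>k \<omega>. W (ts (Suc k)) \<omega> - W (ts k) \<omega>) {..<n}
      \<and> (\<forall>k<n. gaussian_vec M (\<lambda>\<omega>. W (ts (Suc k)) \<omega> - W (ts k) \<omega>) 0
                 ((ts (Suc k) - ts k) *\<^sub>R mat 1)))"

definition path :: "(real \<Rightarrow> 'a \<Rightarrow> real^'d::finite) \<Rightarrow> 'a \<Rightarrow> real \<Rightarrow> real^'d" where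
  "path W \<omega> = restrict (\<lambda>t. W t \<omega>) {0..}"

definition pathM :: "(real \<Rightarrow> real^'d::finite) measure" where
  "pathM = (\<Pi>\<^sub>M t\<in>{0..}. borel)"

definition A1 :: "nat \<Rightarrow> (nat \<Rightarrow> 'd::finite mat) \<Rightarrow> (nat \<Rightarrow> 'd mat) \<Rightarrow> (nat \<Rightarrow> 'd mat)
                   \<Rightarrow> (nat \<Rightarrow> nat \<Rightarrow> nat \<Rightarrow> 'd mat) \<Rightarrow> bool" where
  "A1 N A sg R Q \<longleftrightarrow> (\<forall>i\<in>{1..N}. invertible (sg i) \<and> spd (R i) \<and> spd (Q i i i))"

definition data_ok :: "nat \<Rightarrow> (nat \<Rightarrow> 'd::finite mat) \<Rightarrow> (nat \<Rightarrow> nat \<Rightarrow> nat \<Rightarrow> 'd mat)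
                        \<Rightarrow> (nat \<Rightarrow> 'd mat) \<Rightarrow> bool" where
  "data_ok N R Q Sig0 \<longleftrightarrow> (\<forall>i\<in>{1..N}. msym (R i) \<and> spd (Sig0 i)
       \<and> (\<forall>j\<in>{1..N}. \<forall>k\<in>{1..N}. Q i j k = transpose (Q i k j)))"

definition bQ :: "(nat \<Rightarrow> nat \<Rightarrow> nat \<Rightarrow> 'd::finite mat) \<Rightarrow> 'd bmat" where
  "bQ Q = (\<lambda>i j. if i = j then 0 else Q i i j)"

definition bshift :: "'d::finite bmat \<Rightarrow> real \<Rightarrow> 'd bmat" where
  "bshift M c = (\<lambda>i j. M i j + (if i = j then c *\<^sub>R mat 1 else 0))"

definition AR_sol :: "nat \<Rightarrow> (nat \<Rightarrow> 'd::finite mat) \<Rightarrow> (nat \<Rightarrow> 'd mat) \<Rightarrow> (nat \<Rightarrow> 'd mat)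
     \<Rightarrow> (nat \<Rightarrow> nat \<Rightarrow> nat \<Rightarrow> 'd mat) \<Rightarrow> (nat \<Rightarrow> nat \<Rightarrow> real^'d)
     \<Rightarrow> (nat \<Rightarrow> 'd mat) \<Rightarrow> (nat \<Rightarrow> 'd mat) \<Rightarrow> 'd bvec \<Rightarrow> 'd bvec \<Rightarrow> (nat \<Rightarrow> real) \<Rightarrow> bool" where
  "AR_sol N A sg R Q xb Lam Sig mu rho c \<longleftrightarrow> (\<forall>i\<in>{1..N}.
      Lam i ** A i + transpose (A i) ** Lam i - Lam i ** matrix_inv (R i) ** Lam i + 2 *\<^sub>R Q i i i = 0
    \<and> Sig i ** vsig sg i ** Sig i + Sig i ** (A i - matrix_inv (R i) ** Lam i) = 0
    \<and> (A i - matrix_inv (R i) ** Lam i) *v mu i - matrix_inv (R i) *v rho i = 0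
    \<and> transpose (A i - matrix_inv (R i) ** Lam i) *v rho i + 2 *\<^sub>R F1 N Q xb i mu = 0
    \<and> c i = trace (vsig sg i ** Lam i) - (1/2) * (rho i \<bullet> (matrix_inv (R i) *v rho i))
            + F0 N Q xb i mu (Sig i)
    \<and> msym (Lam i) \<and> spd (Sig i))"

definition FR_sol :: "nat \<Rightarrow> (nat \<Rightarrow> 'd::finite mat) \<Rightarrow> (nat \<Rightarrow> 'd mat) \<Rightarrow> (nat \<Rightarrow> 'd mat)
     \<Rightarrow> (nat \<Rightarrow> nat \<Rightarrow> nat \<Rightarrow> 'd mat) \<Rightarrow> (nat \<Rightarrow> nat \<Rightarrow> real^'d)
     \<Rightarrow> (nat \<Rightarrow> real^'d) \<Rightarrow> (nat \<Rightarrow> 'd mat) \<Rightarrow> real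
     \<Rightarrow> (nat \<Rightarrow> real \<Rightarrow> 'd mat) \<Rightarrow> (nat \<Rightarrow> real \<Rightarrow> 'd mat) \<Rightarrow> (nat \<Rightarrow> real \<Rightarrow> real^'d)
     \<Rightarrow> (nat \<Rightarrow> real \<Rightarrow> real^'d) \<Rightarrow> (nat \<Rightarrow> real \<Rightarrow> real) \<Rightarrow> bool" where
  "FR_sol N A sg R Q xb mu0 Sig0 T LamT SigT muT rhoT kapT \<longleftrightarrow> (\<forall>i\<in>{1..N}.
      (\<forall>t\<in>{0..T}.
         (LamT i has_vector_derivative
            (- (LamT i t ** A i + transpose (A i) ** LamT i t
                - LamT i t ** matrix_inv (R i) ** LamT i t + 2 *\<^sub>R Q i i i))) (at t within {0..T})
       \<and> (SigT i has_vector_derivative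
            (- (2 *\<^sub>R (SigT i t ** vsig sg i ** SigT i t)
                + 2 *\<^sub>R (SigT i t ** (A i - matrix_inv (R i) ** LamT i t))))) (at t within {0..T})
       \<and> (muT i has_vector_derivative
            ((A i - matrix_inv (R i) ** LamT i t) *v muT i t - matrix_inv (R i) *v rhoT i t))
            (at t within {0..T})
       \<and> (rhoT i has_vector_derivative
            (- (transpose (A i - matrix_inv (R i) ** LamT i t) *v rhoT i t
                + 2 *\<^sub>R F1 N Q xb i (\<lambda>j. muT j t)))) (at t within {0..T})
       \<and> (kapT i has_vector_derivative
            (- (trace (vsig sg i ** LamT i t) - (1/2) * (rhoT i t \<bullet> (matrix_inv (R i) *v rhoT i t))
                + F0 N Q xb i (\<lambda>j. muT j t) (SigT i t)))) (at t within {0..T}))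
    \<and> SigT i 0 = Sig0 i \<and> muT i 0 = mu0 i
    \<and> LamT i T = 0 \<and> rhoT i T = 0 \<and> kapT i T = 0)"

definition rate_consts :: "nat \<Rightarrow> (nat \<Rightarrow> 'd::finite mat) \<Rightarrow> (nat \<Rightarrow> 'd mat) \<Rightarrow> (nat \<Rightarrow> 'd mat)
     \<Rightarrow> (nat \<Rightarrow> real \<Rightarrow> real \<Rightarrow> 'd mat) \<Rightarrow> (nat \<Rightarrow> real) \<Rightarrow> (nat \<Rightarrow> real) \<Rightarrow> (nat \<Rightarrow> real)
     \<Rightarrow> (nat \<Rightarrow> real) \<Rightarrow> bool" where
  "rate_consts N A R Lam LamT K lam KL lamL \<longleftrightarrow> (\<forall>i\<in>{1..N}.
      K i > 0 \<and> lam i > 0 \<and> KL i > 0 \<and> lamL i > 0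
    \<and> (\<forall>t\<ge>0. opnorm (mexp (t *\<^sub>R (A i - matrix_inv (R i) ** Lam i))) \<le> K i * exp (- lam i * t))
    \<and> (\<forall>T>0. \<forall>t\<in>{0..T}. opnorm (LamT i T t - Lam i) \<le> KL i * exp (- lamL i * (T - t))))"

definition KN :: "nat \<Rightarrow> (nat \<Rightarrow> 'd::finite mat) \<Rightarrow> (nat \<Rightarrow> real) \<Rightarrow> (nat \<Rightarrow> real) \<Rightarrow> (nat \<Rightarrow> real) \<Rightarrow> real" where
  "KN N R K KL lamL = Max ((\<lambda>i. K i * exp (KL i * opnorm (matrix_inv (R i)) / lamL i)) ` {1..N})"

definition lamN :: "nat \<Rightarrow> (nat \<Rightarrow> real) \<Rightarrow> real" where
  "lamN N lam = Min (lam ` {1..N})"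

definition gamma_bound :: "nat \<Rightarrow> (nat \<Rightarrow> 'd::finite mat) \<Rightarrow> (nat \<Rightarrow> real) \<Rightarrow> (nat \<Rightarrow> real)
     \<Rightarrow> (nat \<Rightarrow> real) \<Rightarrow> (nat \<Rightarrow> real) \<Rightarrow> real" where
  "gamma_bound N R K lam KL lamL =
     (lamN N lam)\<^sup>2 / (2 * (KN N R K KL lamL)\<^sup>2 * (bopnorm N (bRinv R))\<^sup>2)
       * Min (beigenvalues N (bRinv R))"

definition A2 :: "nat \<Rightarrow> (nat \<Rightarrow> 'd::finite mat) \<Rightarrow> (nat \<Rightarrow> 'd mat) \<Rightarrow> (nat \<Rightarrow> nat \<Rightarrow> nat \<Rightarrow> 'd mat)
     \<Rightarrow> (nat \<Rightarrow> 'd mat) \<Rightarrow> (nat \<Rightarrow> real \<Rightarrow> real \<Rightarrow> 'd mat) \<Rightarrow> bool" where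
  "A2 N A R Q Lam LamT \<longleftrightarrow> (\<exists>K lam KL lamL. rate_consts N A R Lam LamT K lam KL lamL
      \<and> (\<exists>\<gamma>. 0 < \<gamma> \<and> \<gamma> < gamma_bound N R K lam KL lamL \<and> bspd N (bshift (bQ Q) (\<gamma>/2))))"

definition A5 :: "nat \<Rightarrow> (nat \<Rightarrow> 'd::finite mat) \<Rightarrow> (nat \<Rightarrow> 'd mat) \<Rightarrow> (nat \<Rightarrow> 'd mat)
     \<Rightarrow> (nat \<Rightarrow> nat \<Rightarrow> nat \<Rightarrow> 'd mat) \<Rightarrow> bool" where
  "A5 N A sg R Q \<longleftrightarrow>
     (\<forall>i\<in>{1..N}. \<forall>S. spd S \<and>
         S ** vsig sg i ** R i ** vsig sg i ** S - transpose (A i) ** R i ** A i = 2 *\<^sub>R Q i i i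
         \<longrightarrow> S ** vsig sg i ** R i - R i ** vsig sg i ** S = R i ** A i - transpose (A i) ** R i)
   \<and> binvertible N (\<lambda>i j. Q i i j + (if i = j then (1/2) *\<^sub>R (transpose (A i) ** R i ** A i) else 0))"

definition prob_setup :: "'a measure \<Rightarrow> nat \<Rightarrow> (nat \<Rightarrow> real^'d::finite) \<Rightarrow> (nat \<Rightarrow> 'd mat)
     \<Rightarrow> (nat \<Rightarrow> 'a \<Rightarrow> real^'d) \<Rightarrow> (nat \<Rightarrow> real \<Rightarrow> 'a \<Rightarrow> real^'d) \<Rightarrow> bool" where
  "prob_setup M N mu0 Sig0 x0 W \<longleftrightarrow> prob_space M
     \<and> (\<forall>i\<in>{1..N}. gaussian_vec M (x0 i) (mu0 i) (matrix_inv (Sig0 i))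
                   \<and> brownian M (W i)
                   \<and> prob_space.indep_set M
                       (sigma_sets (space M) {x0 i -` B \<inter> space M | B. B \<in> sets borel})
                       (sigma_sets (space M) {path (W i) -` B \<inter> space M | B. B \<in> sets pathM}))
     \<and> prob_space.indep_vars M (\<lambda>_. borel \<Otimes>\<^sub>M pathM) (\<lambda>i \<omega>. (x0 i \<omega>, path (W i) \<omega>)) {1..N}"

(* X_T solves dX = ((A - R^{-1}\<Lambda>_T)X - R^{-1}\<rho>_T)dt + \<sigma> dW on [0,T], X(0) = x0
   (additive noise: strong solution written pathwise) *)
definition FH_state :: "'a measure \<Rightarrow> nat \<Rightarrow> (nat \<Rightarrow> 'd::finite mat) \<Rightarrow> (nat \<Rightarrow> 'd mat) \<Rightarrow> (nat \<Rightarrow> 'd mat)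
     \<Rightarrow> (nat \<Rightarrow> 'a \<Rightarrow> real^'d) \<Rightarrow> (nat \<Rightarrow> real \<Rightarrow> 'a \<Rightarrow> real^'d) \<Rightarrow> real
     \<Rightarrow> (nat \<Rightarrow> real \<Rightarrow> 'd mat) \<Rightarrow> (nat \<Rightarrow> real \<Rightarrow> real^'d)
     \<Rightarrow> (nat \<Rightarrow> real \<Rightarrow> 'a \<Rightarrow> real^'d) \<Rightarrow> bool" where
  "FH_state M N A sg R x0 W T LamT rhoT XT \<longleftrightarrow> (\<forall>i\<in>{1..N}.
      (\<forall>t\<in>{0..T}. XT i t \<in> borel_measurable M)
    \<and> (AE \<omega> in M. continuous_on {0..T} (\<lambda>t. XT i t \<omega>) \<and> (\<forall>t\<in>{0..T}.
         XT i t \<omega> = x0 i \<omega>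
           + integral {0..t} (\<lambda>s. (A i - matrix_inv (R i) ** LamT i s) *v XT i s \<omega>
                                   - matrix_inv (R i) *v rhoT i s)
           + sg i *v W i t \<omega>)))"

definition ER_state :: "'a measure \<Rightarrow> nat \<Rightarrow> (nat \<Rightarrow> 'd::finite mat) \<Rightarrow> (nat \<Rightarrow> 'd mat) \<Rightarrow> (nat \<Rightarrow> 'd mat)
     \<Rightarrow> (nat \<Rightarrow> 'a \<Rightarrow> real^'d) \<Rightarrow> (nat \<Rightarrow> real \<Rightarrow> 'a \<Rightarrow> real^'d)
     \<Rightarrow> (nat \<Rightarrow> 'd mat) \<Rightarrow> (nat \<Rightarrow> real^'d) \<Rightarrow> (nat \<Rightarrow> real \<Rightarrow> 'a \<Rightarrow> real^'d) \<Rightarrow> bool" where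
  "ER_state M N A sg R x0 W Lam rho X \<longleftrightarrow> (\<forall>i\<in>{1..N}.
      (\<forall>t\<ge>0. X i t \<in> borel_measurable M)
    \<and> (AE \<omega> in M. continuous_on {0..} (\<lambda>t. X i t \<omega>) \<and> (\<forall>t\<ge>0.
         X i t \<omega> = x0 i \<omega>
           + integral {0..t} (\<lambda>s. (A i - matrix_inv (R i) ** Lam i) *v X i s \<omega>
                                   - matrix_inv (R i) *v rho i)
           + sg i *v W i t \<omega>)))"

definition ctrl :: "'d::finite mat \<Rightarrow> 'd mat \<Rightarrow> real^'d \<Rightarrow> real^'d \<Rightarrow> real^'d" where
  "ctrl R L r x = matrix_inv R *v (L *v x) + matrix_inv R *v r"

definition A3 :: "(nat \<Rightarrow> nat \<Rightarrow> 'd::finite mat) \<Rightarrow> (nat \<Rightarrow> nat \<Rightarrow> 'd mat)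
     \<Rightarrow> (nat \<Rightarrow> nat \<Rightarrow> nat \<Rightarrow> nat \<Rightarrow> 'd mat) \<Rightarrow> (nat \<Rightarrow> nat \<Rightarrow> 'd mat) \<Rightarrow> bool" where
  "A3 A R Q Lam \<longleftrightarrow>
     (\<exists>cb bl bu cu. 0 < cb \<and> 0 < bl \<and> 0 < bu \<and> 0 < cu \<and> (\<forall>N\<ge>2. \<forall>i\<in>{1..N}.
         (\<forall>l\<in>ceigenvalues (A N i). Re l \<le> - cb)
       \<and> loewner_le (bl *\<^sub>R mat 1) (R N i) \<and> loewner_le (R N i) (bu *\<^sub>R mat 1)
       \<and> loewner_le (Lam N i) (cu *\<^sub>R mat 1)))
   \<or> (\<exists>bl bu b1 cl cu. 0 < bl \<and> 0 < bu \<and> 0 < b1 \<and> 0 < cl \<and> 0 < cu \<and> (\<forall>N\<ge>2. \<forall>i\<in>{1..N}.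
         loewner_le (bl *\<^sub>R mat 1) (R N i) \<and> loewner_le (R N i) (bu *\<^sub>R mat 1)
       \<and> loewner_le (b1 *\<^sub>R mat 1) (2 *\<^sub>R Q N i i i)
       \<and> loewner_le (cl *\<^sub>R mat 1) (Lam N i) \<and> loewner_le (Lam N i) (cu *\<^sub>R mat 1)))"

definition A4 :: "(nat \<Rightarrow> nat \<Rightarrow> 'd::finite mat) \<Rightarrow> (nat \<Rightarrow> nat \<Rightarrow> 'd mat)
     \<Rightarrow> (nat \<Rightarrow> nat \<Rightarrow> nat \<Rightarrow> nat \<Rightarrow> 'd mat) \<Rightarrow> (nat \<Rightarrow> nat \<Rightarrow> 'd mat)
     \<Rightarrow> (nat \<Rightarrow> nat \<Rightarrow> real \<Rightarrow> real \<Rightarrow> 'd mat) \<Rightarrow> bool" where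
  "A4 A R Q Lam LamT \<longleftrightarrow> (\<exists>K lam KL lamL::real.
      (\<forall>N\<ge>2. rate_consts N (A N) (R N) (Lam N) (LamT N) (\<lambda>_. K) (\<lambda>_. lam) (\<lambda>_. KL) (\<lambda>_. lamL))
    \<and> (\<exists>\<gamma>. 0 < \<gamma>
        \<and> ereal \<gamma> < Liminf sequentially
              (\<lambda>N. ereal (gamma_bound N (R N) (\<lambda>_. K) (\<lambda>_. lam) (\<lambda>_. KL) (\<lambda>_. lamL)))
        \<and> (\<forall>N\<ge>2. bspd N (bshift (bQ (Q N)) (\<gamma>/2))))
    \<and> (\<exists>b2. \<forall>N\<ge>2. bopnorm N (bQ (Q N)) \<le> b2))"

definition A6 :: "(nat \<Rightarrow> nat \<Rightarrow> 'd::finite mat) \<Rightarrow> (nat \<Rightarrow> nat \<Rightarrow> nat \<Rightarrow> nat \<Rightarrow> 'd mat)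
     \<Rightarrow> (nat \<Rightarrow> nat \<Rightarrow> nat \<Rightarrow> real^'d) \<Rightarrow> (nat \<Rightarrow> nat \<Rightarrow> real^'d) \<Rightarrow> (nat \<Rightarrow> nat \<Rightarrow> 'd mat)
     \<Rightarrow> (nat \<Rightarrow> nat \<Rightarrow> 'd mat) \<Rightarrow> (nat \<Rightarrow> nat \<Rightarrow> real^'d) \<Rightarrow> (nat \<Rightarrow> nat \<Rightarrow> real^'d) \<Rightarrow> bool" where
  "A6 sg Q xb mu0 Sig0 Sig mu rho \<longleftrightarrow> (\<exists>b3. \<forall>N\<ge>2.
      (\<forall>i\<in>{1..N}.
          fsup {1..N} (\<lambda>j. norm (xb N i j)) \<le> b3
        \<and> opnorm (vsig (sg N) i) \<le> b3
        \<and> opnorm (matrix_inv (Sig0 N i)) \<le> b3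
        \<and> norm (mu0 N i) \<le> b3
        \<and> opnorm (matrix_inv (Sig N i)) \<le> b3
        \<and> norm (mu N i) \<le> b3
        \<and> norm (rho N i) \<le> b3
        \<and> (\<Sum>j\<in>{1..N}-{i}. opnorm (Q N i j j)) \<le> b3)
    \<and> (\<Sum>i\<in>{1..N}. fsup ({1..N}-{i}) (\<lambda>j. opnorm (Q N i i j))) \<le> b3
    \<and> (\<Sum>i\<in>{1..N}. \<Sum>j\<in>{1..N}-{i}. fsup ({1..N}-{j,i}) (\<lambda>k. opnorm (Q N i j k))) \<le> b3
    \<and> (\<Sum>i\<in>{1..N}. \<Sum>k\<in>{1..N}-{i}. fsup ({1..N}-{k,i}) (\<lambda>j. opnorm (Q N i j k))) \<le> b3
    \<and> (\<Sum>i\<in>{1..N}. fsup ({1..N}-{i}) (\<lambda>j. opnorm (Q N i j j))) \<le> b3)"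

definition setting :: "'a measure \<Rightarrow> nat
     \<Rightarrow> (nat \<Rightarrow> 'd::finite mat) \<Rightarrow> (nat \<Rightarrow> 'd mat) \<Rightarrow> (nat \<Rightarrow> 'd mat)
     \<Rightarrow> (nat \<Rightarrow> nat \<Rightarrow> nat \<Rightarrow> 'd mat) \<Rightarrow> (nat \<Rightarrow> nat \<Rightarrow> real^'d)
     \<Rightarrow> (nat \<Rightarrow> real^'d) \<Rightarrow> (nat \<Rightarrow> 'd mat)
     \<Rightarrow> (nat \<Rightarrow> 'a \<Rightarrow> real^'d) \<Rightarrow> (nat \<Rightarrow> real \<Rightarrow> 'a \<Rightarrow> real^'d)
     \<Rightarrow> (nat \<Rightarrow> 'd mat) \<Rightarrow> (nat \<Rightarrow> 'd mat) \<Rightarrow> (nat \<Rightarrow> real^'d) \<Rightarrow> (nat \<Rightarrow> real^'d) \<Rightarrow> (nat \<Rightarrow> real)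
     \<Rightarrow> (nat \<Rightarrow> real \<Rightarrow> real \<Rightarrow> 'd mat) \<Rightarrow> (nat \<Rightarrow> real \<Rightarrow> real \<Rightarrow> 'd mat)
     \<Rightarrow> (nat \<Rightarrow> real \<Rightarrow> real \<Rightarrow> real^'d) \<Rightarrow> (nat \<Rightarrow> real \<Rightarrow> real \<Rightarrow> real^'d)
     \<Rightarrow> (nat \<Rightarrow> real \<Rightarrow> real \<Rightarrow> real)
     \<Rightarrow> (nat \<Rightarrow> real \<Rightarrow> real \<Rightarrow> 'a \<Rightarrow> real^'d) \<Rightarrow> (nat \<Rightarrow> real \<Rightarrow> 'a \<Rightarrow> real^'d) \<Rightarrow> bool" where
  "setting M N A sg R Q xb mu0 Sig0 x0 W Lam Sig mu rho c LamT SigT muT rhoT kapT XT X \<longleftrightarrow>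
     2 \<le> N
   \<and> data_ok N R Q Sig0
   \<and> A1 N A sg R Q
   \<and> A5 N A sg R Q
   \<and> AR_sol N A sg R Q xb Lam Sig mu rho c
   \<and> (\<forall>T>0. FR_sol N A sg R Q xb mu0 Sig0 T (\<lambda>i. LamT i T) (\<lambda>i. SigT i T) (\<lambda>i. muT i T)
              (\<lambda>i. rhoT i T) (\<lambda>i. kapT i T))
   \<and> A2 N A R Q Lam LamT
   \<and> prob_setup M N mu0 Sig0 x0 W
   \<and> (\<forall>T>0. FH_state M N A sg R x0 W T (\<lambda>i. LamT i T) (\<lambda>i. rhoT i T) (\<lambda>i. XT i T))
   \<and> ER_state M N A sg R x0 W Lam rho X"

definition gap :: "'a measure \<Rightarrow> (nat \<Rightarrow> 'd::finite mat) \<Rightarrow> (nat \<Rightarrow> 'd mat)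
     \<Rightarrow> (nat \<Rightarrow> real^'d) \<Rightarrow> (nat \<Rightarrow> real \<Rightarrow> real \<Rightarrow> 'd mat) \<Rightarrow> (nat \<Rightarrow> real \<Rightarrow> real \<Rightarrow> real^'d)
     \<Rightarrow> (nat \<Rightarrow> real \<Rightarrow> real \<Rightarrow> 'a \<Rightarrow> real^'d) \<Rightarrow> (nat \<Rightarrow> real \<Rightarrow> 'a \<Rightarrow> real^'d)
     \<Rightarrow> real \<Rightarrow> real \<Rightarrow> nat \<Rightarrow> 'a \<Rightarrow> real" where
  "gap M R Lam rho LamT rhoT XT X T t i \<omega> =
      (norm (XT i T t \<omega> - X i t \<omega>))\<^sup>2
    + (norm (ctrl (R i) (LamT i T t) (rhoT i T t) (XT i T t \<omega>) - ctrl (R i) (Lam i) (rho i) (X i t \<omega>)))\<^sup>2"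

end

(* The noise cancels in X_T - X, so with B = A - R^{-1} Lambda, E = Lambda - Lambda_T and z = rho_T - rho the
   difference e = X_T - X of the states solves the pathwise linear equation
   e' = (B + R^{-1} E) e + R^{-1} E X - R^{-1} z.  Since B is exponentially stable and E decays like
   exp (- l (T - t)), it suffices to bound E|X|^2 uniformly in time and to show that z is small away from both
   ends of [0,T].

   The pair (x, z), where x = mu_T - mu, solves a linear forward-backward system with the energy <x, z>, whose
   derivative is - <z, R^{-1} z> - 2 <Q x, x> up to exponentially small forcing.  As Q >= - gamma / 2, one has
   to know that gamma |x|^2 is dominated, in L^2, by half of <z, R^{-1} z>.  With v = x' - (B + R^{-1} E) x and
   w = x' - B x, the Riccati equation for E gives
   int <w, R w> = int <v, R v> + <x, E x>, and a comparison argument bounds int <w, R w> by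
   exp (|R^{-1}| k / l) int <v, R v>; the gain from w to x is that of the constant matrix B.  Multiplying x and z
   by 1 / (exp (- eps t) + exp (- eps (T - t))) turns the resulting L^2 bound into the two-sided decay.

   All constants depend only on the quantities that are uniform in N; in particular the norm of B, on which
   there is no uniform bound, never enters.  For the finitely many N before the liminf in (A4) becomes
   effective, the estimate for a single N is used. *)

theory Submission
  imports Defs
begin

section \<open>Matrices and the matrix exponential\<close>

text \<open>The obstacle is the size of the admissible \<gamma>. The bound in (A2) contains an
  exponential of |R^-1| k / l with no factor \<open>K\<close> in the exponent, whereas Gronwall's
  inequality for the perturbed system puts one there. The step from the control deviation to
  \<open>x\<close> is therefore measured in L^2 with the quadratic form of \<open>R\<close>;
  Gronwall is kept for terms where a large constant does no harm.

  The factor 1/2 in (A2) gives a gain of at most 1/2 where anything below 1 would close the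
  estimate. This slack pays for the Young inequalities, for the nonzero initial deviation and for
  the weight, whose logarithmic derivative is at most \<epsilon>. The weight converts a bound on
  integrals into a rate: forcing of order exp (- l (T - t)) stays square integrable if \<epsilon> is
  at most l / 2, and the boundary data do not grow.

  The coupling by \<open>Q\<close> is controlled only after summation over the players. Hence the
  bound on \<open>z\<close> concerns the sum of the |z_i|^2 and grows like N. The second claim
  divides by N, the first absorbs N in its constant.\<close>

lemma inner_matrix_vector_left:
  fixes A :: "real^'n^'m"
  shows "(A *v x) \<bullet> y = x \<bullet> (transpose A *v y)"
  by (metis dot_lmul_matrix inner_commute transpose_transpose transpose_matrix_vector)

lemma bounded_bilinear_matrix_vector_mult:
  "bounded_bilinear ((*v) :: real^'n^'m \<Rightarrow> real^'n \<Rightarrow> real^'m)"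
  unfolding bilinear_conv_bounded_bilinear[symmetric] bilinear_def
  by (auto intro!: linearI simp: matrix_vector_mult_add_rdistrib matrix_vector_right_distrib
      scaleR_matrix_vector_assoc matrix_vector_mult_scaleR)

lemma bounded_bilinear_matrix_matrix_mult:
  "bounded_bilinear ((**) :: real^'n^'m \<Rightarrow> real^'k^'n \<Rightarrow> real^'k^'m)"
  unfolding bilinear_conv_bounded_bilinear[symmetric] bilinear_def
  by (auto intro!: linearI simp: vec_eq_iff matrix_matrix_mult_def sum.distrib algebra_simps sum_distrib_left)

lemmas continuous_on_mat [continuous_intros] =
  bounded_bilinear.continuous_on[OF bounded_bilinear_matrix_vector_mult]
  bounded_bilinear.continuous_on[OF bounded_bilinear_matrix_matrix_mult]

lemma norm_matrix_vector_le_opnorm: "norm (A *v x) \<le> opnorm A * norm x"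
  unfolding opnorm_def by (rule onorm) simp

lemma opnorm_nonneg: "0 \<le> opnorm A"
  unfolding opnorm_def by (rule onorm_pos_le) simp

lemma opnorm_leI: "(\<And>x. norm (A *v x) \<le> b * norm x) \<Longrightarrow> opnorm A \<le> b"
  unfolding opnorm_def
  by (rule onorm_le)

lemma norm_mult_vec_le: "opnorm A \<le> b \<Longrightarrow> norm (A *v x) \<le> b * norm x"
  by (meson mult_right_mono norm_ge_zero norm_matrix_vector_le_opnorm order_trans)

lemma opnorm_transpose_le: "opnorm (transpose A) \<le> opnorm A"
proof (rule opnorm_leI)
  fix x
  let ?y = "transpose A *v x"
  have "(norm ?y)\<^sup>2 = (A *v ?y) \<bullet> x"
    by (simp add: power2_norm_eq_inner inner_matrix_vector_left)
  also have "\<dots> \<le> norm (A *v ?y) * norm x" by (rule norm_cauchy_schwarz)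
  also have "\<dots> \<le> (opnorm A * norm ?y) * norm x"
    by (intro mult_right_mono norm_matrix_vector_le_opnorm) simp
  finally have "norm ?y * norm ?y \<le> (opnorm A * norm x) * norm ?y"
    by (simp add: power2_eq_square algebra_simps)
  then show "norm ?y \<le> opnorm A * norm x"
    by (cases "norm ?y = 0") (auto simp: opnorm_nonneg)
qed

lemma opnorm_transpose: "opnorm (transpose A) = opnorm A"
  using opnorm_transpose_le[of A] opnorm_transpose_le[of "transpose A"] by simp

lemma norm_transpose_vec_le: "opnorm A \<le> b \<Longrightarrow> norm (transpose A *v x) \<le> b * norm x"
  by (rule norm_mult_vec_le) (simp add: opnorm_transpose)

lemma abs_entry_le_opnorm: "\<bar>A $ i $ j\<bar> \<le> opnorm A"
  unfolding opnorm_def by (rule matrix_component_le_onorm)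

lemma opnorm_matpow_le: "opnorm (matpow A n) \<le> opnorm A ^ n"
proof (induction n)
  case 0
  show ?case by (auto intro!: opnorm_leI)
next
  case (Suc n)
  show ?case
  proof (rule opnorm_leI)
    fix x
    have "norm (matpow A (Suc n) *v x) \<le> opnorm A * norm (matpow A n *v x)"
      by (simp add: matrix_vector_mul_assoc[symmetric] norm_matrix_vector_le_opnorm)
    also have "\<dots> \<le> opnorm A * (opnorm A ^ n * norm x)"
      by (intro mult_left_mono norm_mult_vec_le Suc opnorm_nonneg)
    finally show "norm (matpow A (Suc n) *v x) \<le> opnorm A ^ Suc n * norm x" by simp
  qed
qed

lemma matpow_scaleR: "matpow (t *\<^sub>R A) n = t ^ n *\<^sub>R matpow A n"
  by (induction n) (auto simp:
      bounded_bilinear.scaleR_left[OF bounded_bilinear_matrix_matrix_mult]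
      bounded_bilinear.scaleR_right[OF bounded_bilinear_matrix_matrix_mult] ac_simps)

lemma matpow_commute: "A ** matpow A n = matpow A n ** A"
  by (induction n) (auto simp: matrix_mul_assoc)

lemma matpow_transpose: "matpow (transpose A) n = transpose (matpow A n)"
  by (induction n) (auto simp: matrix_transpose_mul matpow_commute transpose_mat)

text \<open>The topology of the matrix type comes from the Frobenius norm, while all hypotheses
  speak of the spectral norm. A crude dimensional factor is enough, because the comparison serves
  only the convergence of the exponential series.\<close>

lemma norm_matrix_le_opnorm: 
  fixes A :: "real^'d::finite^'d"
  shows "norm A \<le> real CARD('d) * real CARD('d) * opnorm A"
proof -
  have "norm (A $ i) \<le> real CARD('d) * opnorm A" for i
  proof -
    have "norm (A $ i) \<le> (\<Sum>j\<in>UNIV. \<bar>A $ i $ j\<bar>)" by (rule norm_le_l1_cart)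
    also have "\<dots> \<le> (\<Sum>j\<in>(UNIV::'d set). opnorm A)" by (intro sum_mono abs_entry_le_opnorm)
    finally show ?thesis by simp
  qed
  then have "(\<Sum>i\<in>UNIV. norm (A $ i)) \<le> (\<Sum>i\<in>(UNIV::'d set). real CARD('d) * opnorm A)"
    by (intro sum_mono)
  moreover have "norm A \<le> (\<Sum>i\<in>UNIV. norm (A $ i))"
    unfolding norm_vec_def by (rule L2_set_le_sum) simp
  ultimately show ?thesis by simp
qed

lemma summable_mexp: "summable (\<lambda>n. (1 / fact n) *\<^sub>R matpow A n)" for A :: "real^'d::finite^'d"
proof (rule summable_comparison_test')
  let ?c = "real CARD('d) * real CARD('d)"
  show "summable (\<lambda>n. ?c * (inverse (fact n) * opnorm A ^ n))"
    by (intro summable_mult summable_exp)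
  show "norm ((1 / fact n) *\<^sub>R matpow A n) \<le> ?c * (inverse (fact n) * opnorm A ^ n)"
    if "n \<ge> 0" for n
  proof -
    have "norm (matpow A n) \<le> ?c * opnorm A ^ n"
      by (rule order_trans[OF norm_matrix_le_opnorm]) (intro mult_left_mono opnorm_matpow_le, simp)
    then show ?thesis by (simp add: field_simps)
  qed
qed

lemma mexp_mult_commute: "A ** mexp A = mexp A ** A"
proof -
  note bl = bounded_bilinear_matrix_matrix_mult
  have "A ** mexp A = (\<Sum>n. A ** ((1 / fact n) *\<^sub>R matpow A n))"
    unfolding mexp_def
    by (rule bounded_linear.suminf[OF bounded_bilinear.bounded_linear_right[OF bl] summable_mexp])
  also have "\<dots> = (\<Sum>n. ((1 / fact n) *\<^sub>R matpow A n) ** A)"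
    by (simp add: bounded_bilinear.scaleR_left[OF bl] bounded_bilinear.scaleR_right[OF bl] matpow_commute)
  also have "\<dots> = mexp A ** A"
    unfolding mexp_def
    by (rule bounded_linear.suminf[OF bounded_bilinear.bounded_linear_left[OF bl] summable_mexp, symmetric])
  finally show ?thesis .
qed

lemma mexp_0: "mexp 0 = mat 1"
proof -
  have "matpow (0 :: 'a mat) n = (if n = 0 then mat 1 else 0)" for n
    using matpow_scaleR[of 0 "0::'a mat" n] by (cases n) auto
  then have "(\<lambda>n. (1 / fact n) *\<^sub>R matpow (0 :: 'a mat) n) = (\<lambda>n. if n = 0 then mat 1 else 0)"
    by (auto simp: fun_eq_iff)
  then show ?thesis unfolding mexp_def
    using sums_unique[OF sums_single[of 0 "\<lambda>_. mat 1 :: 'a mat"]] by simp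
qed

lemma mexp_scale_commute: "A ** mexp (t *\<^sub>R A) = mexp (t *\<^sub>R A) ** A"
proof (cases "t = 0")
  case False
  note bl = bounded_bilinear_matrix_matrix_mult
  show ?thesis
    using mexp_mult_commute[of "t *\<^sub>R A"] False
    by (simp add: bounded_bilinear.scaleR_left[OF bl] bounded_bilinear.scaleR_right[OF bl])
qed (simp add: mexp_0)

text \<open>Entrywise the exponential is a scalar power series in \<open>t\<close>, which makes
  termwise differentiation of real power series applicable.\<close>

lemma mexp_entry:
  "mexp (t *\<^sub>R A) $ i $ j = (\<Sum>n. (matpow A n $ i $ j / fact n) * t ^ n)"
proof -
  have bl: "bounded_linear (\<lambda>M::real^'a^'a. M $ i $ j)"
    by (intro bounded_linear_compose[OF bounded_linear_vec_nth bounded_linear_vec_nth])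
  show ?thesis
    unfolding mexp_def
    by (subst bounded_linear.suminf[OF bl summable_mexp]) (simp add: matpow_scaleR field_simps)
qed

text \<open>The equation for \<open>z\<close> runs with \<open>transpose B\<close>. Together with
  \<open>opnorm_transpose\<close> this hands it the same decay constants as the equation for
  \<open>x\<close>.\<close>

lemma mexp_transpose: "mexp (transpose A) = transpose (mexp A)"
  using mexp_entry[of 1 "transpose A"] mexp_entry[of 1 A]
  by (simp add: vec_eq_iff transpose_def[of "mexp A"] matpow_transpose) (simp add: transpose_def)

lemma summable_mexp_entry: "summable (\<lambda>n. (matpow A n $ i $ j / fact n) * t ^ n)"
proof -
  have bl: "bounded_linear (\<lambda>M::real^'a^'a. M $ i $ j)"
    by (intro bounded_linear_compose[OF bounded_linear_vec_nth bounded_linear_vec_nth])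
  show ?thesis
    using bounded_linear.summable[OF bl summable_mexp[of "t *\<^sub>R A"]]
    by (simp add: matpow_scaleR field_simps)
qed

lemma has_vector_derivative_matrix_entries:
  fixes f :: "real \<Rightarrow> real^'n^'m"
  assumes "\<And>i j. ((\<lambda>t. f t $ i $ j) has_real_derivative D $ i $ j) (at t within S)"
  shows "(f has_vector_derivative D) (at t within S)"
  unfolding has_vector_derivative_def
proof (subst has_derivative_componentwise_within, rule ballI)
  fix b :: "real^'n^'m" assume "b \<in> Basis"
  then obtain i j where b: "b = axis i (axis j 1)"
    by (auto simp: Basis_vec_def)
  have "x \<bullet> b = x $ i $ j" for x :: "real^'n^'m"
    by (simp add: b inner_axis)
  then show "((\<lambda>x. f x \<bullet> b) has_derivative (\<lambda>x. (x *\<^sub>R D) \<bullet> b)) (at t within S)"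
    using assms[of i j] by (simp add: has_field_derivative_def mult_commute_abs)
qed

text \<open>Differentiating the scalar series of an entry shifts its coefficients:
  \<open>diffs\<close> turns the n-th one into an entry of \<open>matpow A (Suc n)\<close> divided
  by \<open>fact n\<close>, and the recursion for \<open>matpow\<close> splits off the factor
  \<open>A\<close>.\<close>

lemma mexp_has_vector_derivative:
  "((\<lambda>t. mexp (t *\<^sub>R A)) has_vector_derivative (A ** mexp (t *\<^sub>R A))) (at t within S)"
proof (rule has_vector_derivative_matrix_entries)
  fix i j
  let ?c = "\<lambda>n. matpow A n $ i $ j / fact n"
  have "((\<lambda>x. \<Sum>n. ?c n * x ^ n) has_field_derivative (\<Sum>n. diffs ?c n * t ^ n)) (at t)"
    by (rule termdiffs_strong_converges_everywhere) (rule summable_mexp_entry)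
  moreover have "(\<Sum>n. diffs ?c n * t ^ n) = (A ** mexp (t *\<^sub>R A)) $ i $ j"
  proof -
    have "diffs ?c n * t ^ n = (\<Sum>k\<in>UNIV. A $ i $ k * ((matpow A n $ k $ j / fact n) * t ^ n))" for n
      by (simp add: diffs_def matrix_matrix_mult_def sum_distrib_right sum_distrib_left
          sum_divide_distrib field_simps del: of_nat_Suc)
    then have "(\<Sum>n. diffs ?c n * t ^ n)
        = (\<Sum>n. \<Sum>k\<in>UNIV. A $ i $ k * ((matpow A n $ k $ j / fact n) * t ^ n))" by simp
    also have "\<dots> = (\<Sum>k\<in>UNIV. \<Sum>n. A $ i $ k * ((matpow A n $ k $ j / fact n) * t ^ n))"
      by (rule suminf_sum) (intro summable_mult summable_mexp_entry)
    also have "\<dots> = (\<Sum>k\<in>UNIV. A $ i $ k * mexp (t *\<^sub>R A) $ k $ j)"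
      by (subst suminf_mult[OF summable_mexp_entry]) (simp add: mexp_entry)
    finally show ?thesis by (simp add: matrix_matrix_mult_def)
  qed
  ultimately show "((\<lambda>t. mexp (t *\<^sub>R A) $ i $ j) has_real_derivative (A ** mexp (t *\<^sub>R A)) $ i $ j)
      (at t within S)"
    unfolding mexp_entry by (simp add: has_field_derivative_at_within)
qed

lemmas has_vector_derivative_mv = bounded_bilinear.has_vector_derivative[OF bounded_bilinear_matrix_vector_mult]
lemmas has_vector_derivative_mm = bounded_bilinear.has_vector_derivative[OF bounded_bilinear_matrix_matrix_mult]
lemmas has_vector_derivative_inner = bounded_bilinear.has_vector_derivative[OF bounded_bilinear_inner]

lemma continuous_on_mexp [continuous_intros]:
  assumes "continuous_on S f"
  shows "continuous_on S (\<lambda>t. mexp (f t *\<^sub>R A))"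
proof -
  have "continuous_on UNIV (\<lambda>t. mexp (t *\<^sub>R A))"
    using mexp_has_vector_derivative[of A _ UNIV]
    by (meson continuous_on_eq_continuous_within has_vector_derivative_continuous)
  from continuous_on_compose2[OF this assms] show ?thesis by auto
qed

section \<open>Perturbed linear differential equations\<close>

lemma deriv_nonpos_imp_le:
  fixes f :: "real \<Rightarrow> real"
  assumes "a \<le> b"
    and d: "\<And>t. t \<in> {a..b} \<Longrightarrow> (f has_real_derivative f' t) (at t within {a..b})"
    and n: "\<And>t. t \<in> {a..b} \<Longrightarrow> f' t \<le> 0"
  shows "f b \<le> f a"
proof -
  have "(f' has_integral (f b - f a)) {a..b}"
    using d by (intro fundamental_theorem_of_calculus assms)
      (auto simp: has_real_derivative_iff_has_vector_derivative)
  from has_integral_neg[OF this] have "0 \<le> - (f b - f a)"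
    by (rule has_integral_nonneg) (use n in auto)
  then show ?thesis by simp
qed

lemma has_real_derivative_integral:
  fixes f :: "real \<Rightarrow> real"
  assumes "continuous_on {0..T} f" "t \<in> {0..T}"
  shows "((\<lambda>u. integral {0..u} f) has_real_derivative f t) (at t within {0..T})"
  using integral_has_vector_derivative[OF assms]
  by (simp add: has_real_derivative_iff_has_vector_derivative)

lemma mexp_reverse_has_vector_derivative:
  "((\<lambda>s. mexp ((t - s) *\<^sub>R B)) has_vector_derivative - (B ** mexp ((t - s) *\<^sub>R B))) (at s within S)"
proof -
  have "((\<lambda>s. t - s) has_real_derivative -1) (at s within S)"
    by (auto intro!: derivative_eq_intros)
  then show ?thesis
    using vector_diff_chain_within[of "\<lambda>s. t - s" "-1" s S "\<lambda>u. mexp (u *\<^sub>R B)" "B ** mexp ((t - s) *\<^sub>R B)"]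
      mexp_has_vector_derivative[of B "t - s"]
    by (simp add: o_def has_real_derivative_iff_has_vector_derivative)
qed

text \<open>The product \<open>mexp ((t - s) *\<^sub>R B) *v x s\<close> has derivative
  \<open>mexp ((t - s) *\<^sub>R B) *v p s\<close>, since the two terms with \<open>B\<close>
  cancel. The form with \<open>has_integral\<close> delivers integrability of the integrand along
  with its value, so nothing has to be known about the regularity of \<open>p\<close>.\<close>

lemma variation_of_constants:
  fixes x :: "real \<Rightarrow> real^'d::finite"
  assumes d: "\<And>t. t \<in> {0..T} \<Longrightarrow> (x has_vector_derivative (B *v x t + p t)) (at t within {0..T})"
    and t: "t \<in> {0..T}"
  shows "((\<lambda>s. mexp ((t - s) *\<^sub>R B) *v p s) has_integral (x t - mexp (t *\<^sub>R B) *v x 0)) {0..t}"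
proof -
  let ?M = "\<lambda>s. mexp ((t - s) *\<^sub>R B)"
  have "((\<lambda>s. ?M s *v x s) has_vector_derivative ?M s *v p s) (at s within {0..t})"
    if s: "s \<in> {0..t}" for s
  proof -
    have "(x has_vector_derivative (B *v x s + p s)) (at s within {0..t})"
      by (rule has_vector_derivative_within_subset[OF d]) (use s t in auto)
    from has_vector_derivative_mv[OF mexp_reverse_has_vector_derivative[of t B s "{0..t}"] this]
    show ?thesis
      by (simp add: matrix_vector_right_distrib matrix_vector_mul_assoc mexp_scale_commute
          bounded_bilinear.minus_left[OF bounded_bilinear_matrix_vector_mult])
  qed
  from fundamental_theorem_of_calculus[OF _ this] t
  show ?thesis by (simp add: mexp_0)
qed

text \<open>This is the solution of the scalar equation y' = G - \<nu> y with y(0) = 0. It records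
  what a forcing of size \<open>G\<close> can do to a system with decay rate \<nu>.\<close>

definition decay_conv :: "real \<Rightarrow> (real \<Rightarrow> real) \<Rightarrow> real \<Rightarrow> real" where
  "decay_conv \<nu> G t = integral {0..t} (\<lambda>s. exp (- \<nu> * (t - s)) * G s)"

lemma decay_conv_eq: "decay_conv \<nu> G t = exp (- \<nu> * t) * integral {0..t} (\<lambda>s. exp (\<nu> * s) * G s)"
proof -
  have "exp (- \<nu> * (t - s)) = exp (- \<nu> * t) * exp (\<nu> * s)" for s
    by (simp add: exp_add[symmetric] algebra_simps)
  then show ?thesis
    unfolding decay_conv_def by (simp only: mult.assoc integral_mult_right)
qed

lemma decay_conv_cmult: "decay_conv \<nu> (\<lambda>s. c * G s) t = c * decay_conv \<nu> G t"
  unfolding decay_conv_def by (simp only: mult.left_commute[of _ c] integral_mult_right)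

lemma decay_conv_integrable:
  fixes G :: "real \<Rightarrow> real"
  assumes "continuous_on {0..t} G"
  shows "(\<lambda>s. exp (- \<nu> * (t - s)) * G s) integrable_on {0..t}"
  by (intro integrable_continuous_real continuous_intros assms)

lemma decay_conv_add:
  assumes "continuous_on {0..t} G" "continuous_on {0..t} H"
  shows "decay_conv \<nu> (\<lambda>s. G s + H s) t = decay_conv \<nu> G t + decay_conv \<nu> H t"
  unfolding decay_conv_def distrib_left
  by (rule integral_add) (intro decay_conv_integrable assms)+

lemma decay_conv_nonneg:
  assumes "continuous_on {0..t} G" "\<And>s. s \<in> {0..t} \<Longrightarrow> 0 \<le> G s"
  shows "0 \<le> decay_conv \<nu> G t"
  unfolding decay_conv_def
  by (rule integral_nonneg[OF decay_conv_integrable]) (use assms in auto)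

lemma decay_conv_mono:
  assumes "continuous_on {0..t} G" "continuous_on {0..t} H" "\<And>s. s \<in> {0..t} \<Longrightarrow> G s \<le> H s"
  shows "decay_conv \<nu> G t \<le> decay_conv \<nu> H t"
  unfolding decay_conv_def
  by (rule integral_le[OF decay_conv_integrable decay_conv_integrable]) (use assms in auto)

lemma decay_conv_has_real_derivative:
  assumes c: "continuous_on {0..T} G" and t: "t \<in> {0..T}"
  shows "(decay_conv \<nu> G has_real_derivative (G t - \<nu> * decay_conv \<nu> G t)) (at t within {0..T})"
proof -
  have "continuous_on {0..T} (\<lambda>s. exp (\<nu> * s) * G s)" by (intro continuous_intros c)
  note d = has_real_derivative_integral[OF this t]
  have "decay_conv \<nu> G = (\<lambda>t. exp (- \<nu> * t) * integral {0..t} (\<lambda>s. exp (\<nu> * s) * G s))"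
    by (rule ext) (rule decay_conv_eq)
  moreover have "((\<lambda>t. exp (- \<nu> * t) * integral {0..t} (\<lambda>s. exp (\<nu> * s) * G s)) has_real_derivative
      (G t - \<nu> * decay_conv \<nu> G t)) (at t within {0..T})"
    by (rule derivative_eq_intros d refl)+
      (simp add: decay_conv_eq algebra_simps flip: exp_add)
  ultimately show ?thesis by simp
qed

lemma decay_conv_continuous:
  assumes c: "continuous_on {0..T} G"
  shows "continuous_on {0..T} (decay_conv \<nu> G)"
  by (rule DERIV_continuous_on) (rule decay_conv_has_real_derivative[OF c])

lemma decay_conv_one_le:
  assumes "\<nu> > 0" "0 \<le> t"
  shows "decay_conv \<nu> (\<lambda>_. 1) t \<le> 1 / \<nu>"
proof -
  have "((\<lambda>s. exp (- \<nu> * (t - s)) * 1) has_integral (exp (- \<nu> * (t - t)) / \<nu> - exp (- \<nu> * (t - 0)) / \<nu>)) {0..t}"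
    by (rule fundamental_theorem_of_calculus)
      (use assms in \<open>auto intro!: derivative_eq_intros simp flip: has_real_derivative_iff_has_vector_derivative\<close>)
  then have "decay_conv \<nu> (\<lambda>_. 1) t = 1 / \<nu> - exp (- \<nu> * t) / \<nu>"
    unfolding decay_conv_def by (simp add: integral_unique)
  then show ?thesis using assms by simp
qed

text \<open>Jensen's inequality for the kernel exp (- \<nu> (t - s)), whose mass on [0,t] is at most
  1/\<nu>.\<close>

lemma decay_conv_square_le:
  assumes \<nu>: "\<nu> > 0" and t: "0 \<le> t" and c: "continuous_on {0..t} G"
  shows "(decay_conv \<nu> G t)\<^sup>2 \<le> decay_conv \<nu> (\<lambda>s. (G s)\<^sup>2) t / \<nu>"
proof -
  let ?I = "decay_conv \<nu> G t" and ?J = "decay_conv \<nu> (\<lambda>s. (G s)\<^sup>2) t"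
  \<comment> \<open>The constant that is optimal in 2 c I \<le> c^2 / \<nu> + J, the integrated form
    of 2 c G \<le> c^2 + G^2.\<close>
  let ?c = "\<nu> * ?I"
  have "2 * ?c * ?I = decay_conv \<nu> (\<lambda>s. 2 * ?c * G s) t"
    by (simp only: decay_conv_cmult)
  also have "\<dots> \<le> decay_conv \<nu> (\<lambda>s. ?c\<^sup>2 + (G s)\<^sup>2) t"
    by (intro decay_conv_mono continuous_intros c) (simp add: sum_squares_bound)
  also have "\<dots> = ?c\<^sup>2 * decay_conv \<nu> (\<lambda>_. 1) t + ?J"
    using decay_conv_cmult[of \<nu> "?c\<^sup>2" "\<lambda>_. 1" t]
    by (subst decay_conv_add) (auto intro!: continuous_intros c)
  also have "\<dots> \<le> ?c\<^sup>2 * (1 / \<nu>) + ?J"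
    by (intro add_right_mono mult_left_mono decay_conv_one_le \<nu> t) simp
  finally show ?thesis using \<nu> by (simp add: field_simps power2_eq_square)
qed

text \<open>Integrating y' = G - \<nu> y over [0,T] and dropping y(T) \<ge> 0 gives the bound
  without exchanging two integrals.\<close>

lemma integral_decay_conv_le:
  assumes \<nu>: "\<nu> > 0" and T: "0 \<le> T" and c: "continuous_on {0..T} G"
    and n: "\<And>s. s \<in> {0..T} \<Longrightarrow> 0 \<le> G s"
  shows "integral {0..T} (decay_conv \<nu> G) \<le> integral {0..T} G / \<nu>"
proof -
  have "((\<lambda>t. G t - \<nu> * decay_conv \<nu> G t) has_integral (decay_conv \<nu> G T - decay_conv \<nu> G 0)) {0..T}"
    by (rule fundamental_theorem_of_calculus[OF T])
      (use decay_conv_has_real_derivative[OF c] in \<open>simp add: has_real_derivative_iff_has_vector_derivative\<close>)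
  then have "integral {0..T} (\<lambda>t. G t - \<nu> * decay_conv \<nu> G t) = decay_conv \<nu> G T"
    by (simp add: integral_unique decay_conv_def)
  moreover have "integral {0..T} (\<lambda>t. G t - \<nu> * decay_conv \<nu> G t)
      = integral {0..T} G - \<nu> * integral {0..T} (decay_conv \<nu> G)"
    by (subst integral_diff) (auto intro!: integrable_continuous_real continuous_intros c decay_conv_continuous)
  moreover have "0 \<le> decay_conv \<nu> G T" by (rule decay_conv_nonneg[OF c n])
  ultimately show ?thesis using \<nu> by (simp add: field_simps)
qed

lemma decay_conv_le_integral:
  assumes \<nu>: "\<nu> \<ge> 0" and t: "t \<in> {0..T}" and c: "continuous_on {0..T} G"
    and n: "\<And>s. s \<in> {0..T} \<Longrightarrow> 0 \<le> G s"
  shows "decay_conv \<nu> G t \<le> integral {0..T} G"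
proof -
  have ct: "continuous_on {0..t} G" by (rule continuous_on_subset[OF c]) (use t in auto)
  have "decay_conv \<nu> G t \<le> integral {0..t} G"
    unfolding decay_conv_def
    by (rule integral_le[OF decay_conv_integrable[OF ct] integrable_continuous_real[OF ct]])
       (use t n \<nu> in \<open>auto intro!: mult_left_le_one_le simp: mult_nonneg_nonneg\<close>)
  also have "\<dots> \<le> integral {0..T} G"
    by (rule integral_subset_le) (use t n in \<open>auto intro!: integrable_continuous_real c ct\<close>)
  finally show ?thesis .
qed

text \<open>Gronwall's inequality in a form that keeps the rate \<nu>. A perturbation proportional
  to \<open>x\<close> with coefficient \<open>k\<close> costs only the factor exp (K \<kappa>),
  because the integral of \<open>k\<close> has a bound that need not depend on the horizon; the
  remaining forcing \<open>G\<close> is convolved with the undisturbed kernel.\<close>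

lemma perturbed_linear_ode_bound:
  fixes x :: "real \<Rightarrow> real^'d::finite"
  assumes d: "\<And>t. t \<in> {0..T} \<Longrightarrow> (x has_vector_derivative (B *v x t + p t)) (at t within {0..T})"
    and K: "K > 0" and B: "\<And>s. 0 \<le> s \<Longrightarrow> opnorm (mexp (s *\<^sub>R B)) \<le> K * exp (- \<nu> * s)"
    and p: "\<And>t. t \<in> {0..T} \<Longrightarrow> norm (p t) \<le> k t * norm (x t) + G t"
    and k: "continuous_on {0..T} k" "\<And>t. t \<in> {0..T} \<Longrightarrow> 0 \<le> k t"
    and G: "continuous_on {0..T} G" "\<And>t. t \<in> {0..T} \<Longrightarrow> 0 \<le> G t"
    and k_le: "integral {0..T} k \<le> \<kappa>"
    and t: "t \<in> {0..T}"
  shows "norm (x t) \<le> K * exp (K * \<kappa>) * (exp (- \<nu> * t) * norm (x 0) + decay_conv \<nu> G t)"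
proof -
  have cx: "continuous_on {0..T} x" using d by (rule continuous_on_vector_derivative)
  define q where "q = (\<lambda>s. k s * norm (x s) + G s)"
  have cq: "continuous_on {0..T} q" unfolding q_def by (intro continuous_intros k G cx)
  \<comment> \<open>Majorant of exp (\<nu> t) |x t| obtained from variation of constants; unlike the
    norm of \<open>x\<close> it is differentiable.\<close>
  define U where "U = (\<lambda>t. K * (norm (x 0) + integral {0..t} (\<lambda>s. exp (\<nu> * s) * q s)))"
  have xU: "exp (\<nu> * t) * norm (x t) \<le> U t" if t: "t \<in> {0..T}" for t
  proof -
    have ct: "continuous_on {0..t} q" by (rule continuous_on_subset[OF cq]) (use t in auto)
    have hi: "((\<lambda>s. mexp ((t - s) *\<^sub>R B) *v p s) has_integral (x t - mexp (t *\<^sub>R B) *v x 0)) {0..t}"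
      by (rule variation_of_constants[OF d t])
    have "norm (x t - mexp (t *\<^sub>R B) *v x 0)
        \<le> integral {0..t} (\<lambda>s. K * exp (- \<nu> * (t - s)) * q s)"
    proof (subst integral_unique[OF hi, symmetric], rule integral_norm_bound_integral)
      show "(\<lambda>s. mexp ((t - s) *\<^sub>R B) *v p s) integrable_on {0..t}"
        using hi by blast
      show "(\<lambda>s. K * exp (- \<nu> * (t - s)) * q s) integrable_on {0..t}"
        by (intro integrable_continuous_real continuous_intros ct)
      fix s assume s: "s \<in> {0..t}"
      have "norm (mexp ((t - s) *\<^sub>R B) *v p s) \<le> K * exp (- \<nu> * (t - s)) * norm (p s)"
        by (rule norm_mult_vec_le) (use s B in auto)
      also have "\<dots> \<le> K * exp (- \<nu> * (t - s)) * q s"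
        unfolding q_def by (rule mult_left_mono) (use s t p K in auto)
      finally show "norm (mexp ((t - s) *\<^sub>R B) *v p s) \<le> K * exp (- \<nu> * (t - s)) * q s" .
    qed
    moreover have "norm (mexp (t *\<^sub>R B) *v x 0) \<le> K * exp (- \<nu> * t) * norm (x 0)"
      by (rule norm_mult_vec_le) (use t B in auto)
    moreover have "norm (x t) \<le> norm (x t - mexp (t *\<^sub>R B) *v x 0) + norm (mexp (t *\<^sub>R B) *v x 0)"
      by (metis add.commute norm_triangle_sub)
    moreover have "integral {0..t} (\<lambda>s. K * exp (- \<nu> * (t - s)) * q s) = K * decay_conv \<nu> q t"
      unfolding decay_conv_def by (simp only: mult.assoc integral_mult_right)
    ultimately have "norm (x t) \<le> K * exp (- \<nu> * t) * norm (x 0) + K * decay_conv \<nu> q t"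
      by linarith
    then have "norm (x t) \<le> exp (- \<nu> * t) * U t"
      unfolding U_def decay_conv_eq by (simp add: algebra_simps)
    then show ?thesis by (simp add: exp_minus field_simps)
  qed
  define h where "h = (\<lambda>t. integral {0..t} k)"
  have hd: "(h has_real_derivative k t) (at t within {0..T})" if "t \<in> {0..T}" for t
    unfolding h_def by (rule has_real_derivative_integral[OF k(1) that])
  have h0: "0 \<le> h t" if "t \<in> {0..T}" for t
    unfolding h_def by (rule integral_nonneg)
      (use that k in \<open>auto intro!: integrable_continuous_real continuous_on_subset[OF k(1)]\<close>)
  have hk: "h t \<le> \<kappa>"
  proof -
    have "continuous_on {0..t} k" by (rule continuous_on_subset[OF k(1)]) (use t in auto)
    then have "h t \<le> integral {0..T} k" unfolding h_def
      by (intro integral_subset_le) (use t k in \<open>auto intro!: integrable_continuous_real\<close>)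
    with k_le show ?thesis by simp
  qed
  \<comment> \<open>The integrating factor exp (- K h) removes the term with \<open>k\<close>. The
    forcing is subtracted without that factor, which is at most 1, so \<open>V\<close> is
    nonincreasing rather than constant.\<close>
  define V where "V = (\<lambda>t. U t * exp (- K * h t) - K * integral {0..t} (\<lambda>s. exp (\<nu> * s) * G s))"
  have Ud: "(U has_real_derivative K * (exp (\<nu> * t) * q t)) (at t within {0..T})" if t: "t \<in> {0..T}" for t
  proof -
    have "continuous_on {0..T} (\<lambda>s. exp (\<nu> * s) * q s)" by (intro continuous_intros cq)
    note d = has_real_derivative_integral[OF this t]
    show ?thesis unfolding U_def by (rule derivative_eq_intros d refl)+ simp
  qed
  define V' where "V' = (\<lambda>s. K * (exp (\<nu> * s) * q s) * exp (- K * h s)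
      + exp (- K * h s) * (- K * k s) * U s - K * (exp (\<nu> * s) * G s))"
  have "V t \<le> V 0"
  proof (rule deriv_nonpos_imp_le[where f' = V' and f = V and a = 0 and b = t])
    show "0 \<le> t" using t by simp
    fix s assume s: "s \<in> {0..t}"
    then have sT: "s \<in> {0..T}" using t by auto
    have cG: "continuous_on {0..T} (\<lambda>s. exp (\<nu> * s) * G s)" by (intro continuous_intros G)
    have "(V has_real_derivative V' s) (at s within {0..T})" unfolding V_def V'_def
      by (intro DERIV_diff DERIV_mult DERIV_chain2[OF DERIV_exp] DERIV_cmult Ud[OF sT] hd[OF sT]
          has_real_derivative_integral[OF cG sT])
    then show "(V has_real_derivative V' s) (at s within {0..t})"
      by (rule has_field_derivative_subset) (use t in auto)
    have "K * k s * (exp (\<nu> * s) * norm (x s)) * exp (- K * h s) \<le> K * k s * U s * exp (- K * h s)"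
      by (intro mult_right_mono mult_left_mono xU sT) (use K k sT in auto)
    moreover have "exp (- K * h s) * (K * (exp (\<nu> * s) * G s)) \<le> 1 * (K * (exp (\<nu> * s) * G s))"
      by (rule mult_right_mono) (use K h0[OF sT] G sT in auto)
    ultimately show "V' s \<le> 0" unfolding q_def V'_def by (simp add: algebra_simps)
  qed
  then have 1: "U t * exp (- K * h t) \<le> K * norm (x 0) + K * integral {0..t} (\<lambda>s. exp (\<nu> * s) * G s)"
    unfolding V_def by (simp add: U_def h_def)
  let ?W = "norm (x 0) + integral {0..t} (\<lambda>s. exp (\<nu> * s) * G s)"
  have W0: "0 \<le> ?W"
    by (intro add_nonneg_nonneg norm_ge_zero integral_nonneg)
      (use t G in \<open>auto intro!: integrable_continuous_real continuous_intros continuous_on_subset[OF G(1)]\<close>)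
  have "U t = exp (K * h t) * (U t * exp (- K * h t))" by (simp add: exp_minus)
  also have "\<dots> \<le> exp (K * h t) * (K * ?W)"
    by (rule mult_left_mono) (use 1 in \<open>simp_all add: algebra_simps\<close>)
  also have "\<dots> \<le> exp (K * \<kappa>) * (K * ?W)"
    by (rule mult_right_mono) (use K hk W0 in auto)
  finally have "exp (\<nu> * t) * norm (x t) \<le> exp (K * \<kappa>) * (K * ?W)" using xU[OF t] by simp
  then have "norm (x t) \<le> exp (- \<nu> * t) * (exp (K * \<kappa>) * (K * ?W))"
    by (simp add: exp_minus field_simps)
  then show ?thesis unfolding decay_conv_eq by (simp add: algebra_simps)
qed

lemma perturbed_linear_ode_bound_square:
  fixes x :: "real \<Rightarrow> real^'d::finite"
  assumes d: "\<And>t. t \<in> {0..T} \<Longrightarrow> (x has_vector_derivative (B *v x t + p t)) (at t within {0..T})"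
    and K: "K > 0" and B: "\<And>s. 0 \<le> s \<Longrightarrow> opnorm (mexp (s *\<^sub>R B)) \<le> K * exp (- \<nu> * s)"
    and p: "\<And>t. t \<in> {0..T} \<Longrightarrow> norm (p t) \<le> k t * norm (x t) + G t"
    and k: "continuous_on {0..T} k" "\<And>t. t \<in> {0..T} \<Longrightarrow> 0 \<le> k t"
    and G: "continuous_on {0..T} G" "\<And>t. t \<in> {0..T} \<Longrightarrow> 0 \<le> G t"
    and k_le: "integral {0..T} k \<le> \<kappa>" and \<nu>: "\<nu> > 0"
    and t: "t \<in> {0..T}"
  shows "(norm (x t))\<^sup>2 \<le> 2 * (K * exp (K * \<kappa>))\<^sup>2 * ((norm (x 0))\<^sup>2 + decay_conv \<nu> (\<lambda>s. (G s)\<^sup>2) t / \<nu>)"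
proof -
  have ct: "continuous_on {0..t} G" by (rule continuous_on_subset[OF G(1)]) (use t in auto)
  have "norm (x t) \<le> K * exp (K * \<kappa>) * (exp (- \<nu> * t) * norm (x 0) + decay_conv \<nu> G t)"
    by (rule perturbed_linear_ode_bound[OF d K B p k G k_le t])
  also have "\<dots> \<le> K * exp (K * \<kappa>) * (1 * norm (x 0) + decay_conv \<nu> G t)"
    by (intro mult_left_mono add_right_mono mult_right_mono) (use K \<nu> t in auto)
  finally have "(norm (x t))\<^sup>2 \<le> (K * exp (K * \<kappa>) * (1 * norm (x 0) + decay_conv \<nu> G t))\<^sup>2"
    by (rule power_mono) simp
  also have "\<dots> = (K * exp (K * \<kappa>))\<^sup>2 * (norm (x 0) + decay_conv \<nu> G t)\<^sup>2"
    by (simp add: power_mult_distrib)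
  also have "\<dots> \<le> (K * exp (K * \<kappa>))\<^sup>2 * (2 * ((norm (x 0))\<^sup>2 + (decay_conv \<nu> G t)\<^sup>2))"
    by (rule mult_left_mono) (use sum_squares_bound[of "norm (x 0)" "decay_conv \<nu> G t"] in \<open>simp_all add: power2_sum\<close>)
  also have "\<dots> \<le> (K * exp (K * \<kappa>))\<^sup>2 * (2 * ((norm (x 0))\<^sup>2 + decay_conv \<nu> (\<lambda>s. (G s)\<^sup>2) t / \<nu>))"
    by (intro mult_left_mono add_left_mono decay_conv_square_le \<nu> ct) (use t in auto)
  finally show ?thesis by (simp only: mult_ac)
qed

section \<open>The Riccati equation\<close>

lemmas matrix_mult_simps =
  bounded_bilinear.add_left[OF bounded_bilinear_matrix_matrix_mult]
  bounded_bilinear.add_right[OF bounded_bilinear_matrix_matrix_mult]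
  bounded_bilinear.diff_left[OF bounded_bilinear_matrix_matrix_mult]
  bounded_bilinear.diff_right[OF bounded_bilinear_matrix_matrix_mult]
  bounded_bilinear.minus_left[OF bounded_bilinear_matrix_matrix_mult]
  bounded_bilinear.minus_right[OF bounded_bilinear_matrix_matrix_mult]

lemmas matrix_vector_simps =
  bounded_bilinear.add_left[OF bounded_bilinear_matrix_vector_mult]
  bounded_bilinear.add_right[OF bounded_bilinear_matrix_vector_mult]
  bounded_bilinear.diff_left[OF bounded_bilinear_matrix_vector_mult]
  bounded_bilinear.diff_right[OF bounded_bilinear_matrix_vector_mult]
  bounded_bilinear.minus_left[OF bounded_bilinear_matrix_vector_mult]
  bounded_bilinear.minus_right[OF bounded_bilinear_matrix_vector_mult]
  bounded_bilinear.scaleR_left[OF bounded_bilinear_matrix_vector_mult]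
  bounded_bilinear.scaleR_right[OF bounded_bilinear_matrix_vector_mult]

lemma bounded_linear_transpose: "bounded_linear (transpose :: real^'n^'m \<Rightarrow> real^'m^'n)"
  unfolding linear_conv_bounded_linear[symmetric]
  by (auto intro!: linearI simp: transpose_def vec_eq_iff)

lemmas transpose_simps =
  linear_add[OF bounded_linear.linear[OF bounded_linear_transpose]]
  linear_diff[OF bounded_linear.linear[OF bounded_linear_transpose]]
  linear_neg[OF bounded_linear.linear[OF bounded_linear_transpose]]

definition psd :: "'d::finite mat \<Rightarrow> bool" where
  "psd P \<longleftrightarrow> msym P \<and> (\<forall>x. 0 \<le> x \<bullet> (P *v x))"

lemma spd_imp_psd: "spd P \<Longrightarrow> psd P"
  unfolding spd_def psd_def by (metis inner_zero_left order.order_iff_strict)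

lemma msym_inner: "msym P \<Longrightarrow> (P *v x) \<bullet> y = x \<bullet> (P *v y)"
  by (simp add: inner_matrix_vector_left msym_def)

text \<open>Evaluating the form at x - P x / m yields P^2 \<le> m P without square roots or
  diagonalisation. The upper bound is assumed for the quadratic form and not for the norm, so that a
  Loewner bound can be used directly.\<close>

lemma psd_norm_square_le_quadratic:
  assumes P: "psd P" and m: "\<And>y. y \<bullet> (P *v y) \<le> m * (norm y)\<^sup>2" "0 < m"
  shows "(norm (P *v x))\<^sup>2 \<le> m * (x \<bullet> (P *v x))"
proof -
  let ?y = "P *v x"
  let ?z = "x - (1 / m) *\<^sub>R ?y"
  have s: "msym P" using P by (simp add: psd_def)
  have "0 \<le> ?z \<bullet> (P *v ?z)" using P by (simp add: psd_def)
  also have "\<dots> = x \<bullet> ?y - 2 * (norm ?y)\<^sup>2 / m + (?y \<bullet> (P *v ?y)) / m\<^sup>2"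
  proof -
    have e: "?y \<bullet> ?y = x \<bullet> (P *v ?y)" by (rule msym_inner[OF s])
    have n: "norm ?y * norm ?y = x \<bullet> (P *v ?y)"
      using e by (simp add: power2_norm_eq_inner flip: power2_eq_square)
    show ?thesis
      using m by (simp add: matrix_vector_simps inner_diff_left inner_diff_right e n power2_eq_square)
        (simp add: field_simps)
  qed
  also have "(?y \<bullet> (P *v ?y)) / m\<^sup>2 \<le> (m * (norm ?y)\<^sup>2) / m\<^sup>2"
    by (rule divide_right_mono[OF m(1)]) simp
  finally show ?thesis using m(2) by (simp add: field_simps power2_eq_square)
qed

lemma psd_quadratic_le: "opnorm P \<le> r \<Longrightarrow> x \<bullet> (P *v x) \<le> r * (norm x)\<^sup>2"
  using order_trans[OF norm_cauchy_schwarz mult_left_mono[OF norm_mult_vec_le norm_ge_zero], of P r x x]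
  by (simp add: power2_eq_square mult_ac)

lemma psd_norm_square_le:
  assumes "psd P" "opnorm P \<le> m" "0 < m"
  shows "(norm (P *v x))\<^sup>2 \<le> m * (x \<bullet> (P *v x))"
  by (rule psd_norm_square_le_quadratic[OF assms(1) psd_quadratic_le assms(3)]) (rule assms)

text \<open>Expand the nonnegative form at \<eta> v - u. The weight \<eta> stays free because one
  application lets it vary in time.\<close>

lemma psd_weighted_square:
  assumes P: "psd P" and \<eta>: "0 < \<eta>"
  shows "(v + u) \<bullet> (P *v (v + u)) \<le> (1 + \<eta>) * (v \<bullet> (P *v v)) + (1 + 1 / \<eta>) * (u \<bullet> (P *v u))"
proof -
  let ?z = "\<eta> *\<^sub>R v - u"
  have s: "msym P" using P by (simp add: psd_def)
  have vu: "u \<bullet> (P *v v) = v \<bullet> (P *v u)"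
    using msym_inner[OF s, of u v] by (simp add: inner_commute)
  have "0 \<le> ?z \<bullet> (P *v ?z)" using P by (simp add: psd_def)
  also have "\<dots> = \<eta> * (\<eta> * (v \<bullet> (P *v v))) - 2 * \<eta> * (v \<bullet> (P *v u)) + u \<bullet> (P *v u)"
    using vu by (simp add: matrix_vector_simps inner_diff_left inner_diff_right algebra_simps)
  finally have "2 * (v \<bullet> (P *v u)) \<le> \<eta> * (v \<bullet> (P *v v)) + (u \<bullet> (P *v u)) / \<eta>"
    using \<eta> by (simp add: field_simps)
  then show ?thesis
    using vu by (simp add: matrix_vector_simps inner_add_left inner_add_right algebra_simps)
qed

lemma spd_invertible:
  assumes "spd R" shows "invertible R"
proof -
  have "R *v x = 0 \<Longrightarrow> x = 0" for x
    using assms by (metis spd_def inner_zero_right less_irrefl)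
  then show ?thesis
    by (auto simp: invertible_left_inverse matrix_left_invertible_ker)
qed

lemma
  fixes A :: "real^'n::finite^'n"
  assumes "invertible A"
  shows matrix_inv_left: "matrix_inv A ** A = mat 1" and matrix_inv_right: "A ** matrix_inv A = mat 1"
  using someI_ex[OF assms[unfolded invertible_def]] by (simp_all add: matrix_inv_def)

lemma spd_matrix_inv:
  assumes R: "spd R" shows "spd (matrix_inv R)"
proof -
  note i = matrix_inv_left[OF spd_invertible[OF R]] matrix_inv_right[OF spd_invertible[OF R]]
  have s: "transpose R = R" using R by (simp add: spd_def msym_def)
  have "transpose (matrix_inv R) = transpose (matrix_inv R) ** (R ** matrix_inv R)" by (simp add: i)
  also have "\<dots> = transpose (R ** matrix_inv R) ** matrix_inv R"
    by (simp only: matrix_transpose_mul s matrix_mul_assoc)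
  finally have sym: "msym (matrix_inv R)" by (simp add: i msym_def transpose_mat)
  have "0 < x \<bullet> (matrix_inv R *v x)" if "x \<noteq> 0" for x
  proof -
    let ?y = "matrix_inv R *v x"
    have x: "x = R *v ?y" by (simp add: matrix_vector_mul_assoc i)
    with that have "?y \<noteq> 0" by auto
    then have "0 < ?y \<bullet> (R *v ?y)" using R by (simp add: spd_def)
    then show ?thesis using x by (simp add: inner_commute)
  qed
  with sym show ?thesis by (simp add: spd_def)
qed

lemma spd_inverse_vec:
  assumes "spd R"
  shows "R *v (matrix_inv R *v x) = x" "matrix_inv R *v (R *v x) = x"
  by (simp_all add: matrix_vector_mul_assoc matrix_inv_left matrix_inv_right spd_invertible assms)

lemma spd_norm_square_le:
  assumes R: "spd R" and r: "opnorm (matrix_inv R) \<le> r" "0 < r"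
  shows "(norm z)\<^sup>2 \<le> r * (z \<bullet> (R *v z))"
  using psd_norm_square_le[OF spd_imp_psd[OF spd_matrix_inv[OF R]] r, of "R *v z"]
  by (simp add: spd_inverse_vec[OF R] inner_commute)

text \<open>Along x' = B x the form <x, L x> is nonincreasing, and by stability it tends to 0. Its
  initial value is therefore nonnegative, and the initial vector is arbitrary.\<close>

lemma lyapunov_psd:
  assumes L: "msym L" and P: "\<And>x. 0 \<le> x \<bullet> (P *v x)"
    and eq: "L ** B + transpose B ** L = - P"
    and \<nu>: "\<nu> > 0" and B: "\<And>s. 0 \<le> s \<Longrightarrow> opnorm (mexp (s *\<^sub>R B)) \<le> K * exp (- \<nu> * s)"
  shows "psd L"
proof -
  have "0 \<le> \<xi> \<bullet> (L *v \<xi>)" for \<xi>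
  proof -
    define x where "x = (\<lambda>t. mexp (t *\<^sub>R B) *v \<xi>)"
    define f where "f = (\<lambda>t. x t \<bullet> (L *v x t))"
    have xd: "(x has_vector_derivative (B *v x t)) (at t within S)" for t S
      unfolding x_def
      using has_vector_derivative_mv[OF mexp_has_vector_derivative[of B t S] has_vector_derivative_const[of \<xi>]]
      by (simp add: matrix_vector_mul_assoc)
    have "f T \<le> f 0" if T: "0 \<le> T" for T
    proof (rule deriv_nonpos_imp_le[where f' = "\<lambda>t. - (x t \<bullet> (P *v x t))" and f = f and a = 0 and b = T])
      fix t assume "t \<in> {0..T}"
      have "x t \<bullet> ((L ** B + transpose B ** L) *v x t) = x t \<bullet> (L *v (B *v x t)) + (B *v x t) \<bullet> (L *v x t)"
        by (simp add: matrix_vector_simps matrix_vector_mul_assoc[symmetric] inner_add_right inner_matrix_vector_left)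
      with has_vector_derivative_inner[OF xd has_vector_derivative_mv[OF has_vector_derivative_const[of L] xd]]
      show "(f has_real_derivative - (x t \<bullet> (P *v x t))) (at t within {0..T})"
        unfolding f_def eq
        by (simp add: has_real_derivative_iff_has_vector_derivative matrix_vector_simps)
    qed (use T P in auto)
    moreover have "f T \<ge> - (opnorm L * (K * norm \<xi>)\<^sup>2) * exp (- (2 * \<nu>) * T)" if T: "0 \<le> T" for T
    proof -
      have n: "norm (x T) \<le> K * exp (- \<nu> * T) * norm \<xi>"
        unfolding x_def by (rule norm_mult_vec_le[OF B[OF T]])
      have "\<bar>f T\<bar> \<le> norm (x T) * (opnorm L * norm (x T))"
        unfolding f_def by (rule order_trans[OF Cauchy_Schwarz_ineq2])
          (intro mult_left_mono norm_matrix_vector_le_opnorm norm_ge_zero)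
      also have "\<dots> = opnorm L * (norm (x T))\<^sup>2" by (simp add: power2_eq_square)
      also have "\<dots> \<le> opnorm L * (K * exp (- \<nu> * T) * norm \<xi>)\<^sup>2"
        by (intro mult_left_mono power_mono n opnorm_nonneg) simp
      also have "(K * exp (- \<nu> * T) * norm \<xi>)\<^sup>2 = (K * norm \<xi>)\<^sup>2 * exp (- (2 * \<nu>) * T)"
        by (simp add: power_mult_distrib flip: exp_double) 
      finally show ?thesis by simp
    qed
    ultimately have le: "- (opnorm L * (K * norm \<xi>)\<^sup>2) * exp (- (2 * \<nu>) * T) \<le> f 0" if "0 \<le> T" for T
      using that by force
    have "((\<lambda>T. - (opnorm L * (K * norm \<xi>)\<^sup>2) * exp (- (2 * \<nu>) * T)) \<longlongrightarrow> - (opnorm L * (K * norm \<xi>)\<^sup>2) * 0) at_top"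
      using \<nu> by (intro tendsto_intros filterlim_compose[OF exp_at_bot]
          filterlim_tendsto_neg_mult_at_bot[OF tendsto_const] filterlim_ident) simp
    then have "- (opnorm L * (K * norm \<xi>)\<^sup>2) * 0 \<le> f 0"
      by (rule tendsto_upperbound) (use le in \<open>auto intro!: eventually_mono[OF eventually_ge_at_top[of 0]]\<close>)
    then show ?thesis by (simp add: f_def x_def mexp_0)
  qed
  with L show ?thesis by (simp add: psd_def)
qed

text \<open>The equation for \<open>E\<close> is the one satisfied by the difference of the stationary solution
  and the solution of the differential Riccati equation of the game.\<close>

lemma riccati_symmetric:
  fixes E :: "real \<Rightarrow> 'd::finite mat"
  assumes d: "\<And>t. t \<in> {0..T} \<Longrightarrow>
      (E has_vector_derivative - (E t ** B + transpose B ** E t + E t ** S ** E t)) (at t within {0..T})"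
    and S: "msym S" and ET: "msym (E T)" and t: "t \<in> {0..T}"
  shows "msym (E t)"
proof -
  \<comment> \<open>Twice the antisymmetric part. As \<open>S\<close> is symmetric, the quadratic
    terms factor and \<open>D\<close> solves the linear homogeneous equation D' = - (D M + M^T D)
    with D(T) = 0, so it vanishes by uniqueness.\<close>
  define D where "D = (\<lambda>t. E t - transpose (E t))"
  define M where "M = (\<lambda>t. B + S ** E t)"
  have S': "transpose S = S" using S by (simp add: msym_def)
  have cE: "continuous_on {0..T} E" using d by (rule continuous_on_vector_derivative)
  have cM: "continuous_on {0..T} M" unfolding M_def by (intro continuous_intros cE)
  have Dd: "(D has_vector_derivative - (D t ** M t + transpose (M t) ** D t)) (at t within {0..T})"
    if "t \<in> {0..T}" for t
  proof -
    have "(D has_vector_derivative - (E t ** B + transpose B ** E t + E t ** S ** E t)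
        - transpose (- (E t ** B + transpose B ** E t + E t ** S ** E t))) (at t within {0..T})"
      unfolding D_def
      by (intro has_vector_derivative_diff bounded_linear.has_vector_derivative[OF bounded_linear_transpose] d that)
    also have "- (E t ** B + transpose B ** E t + E t ** S ** E t)
        - transpose (- (E t ** B + transpose B ** E t + E t ** S ** E t)) = - (D t ** M t + transpose (M t) ** D t)"
      unfolding D_def M_def
      by (simp add: transpose_simps matrix_transpose_mul matrix_mult_simps S' matrix_mul_assoc)
    finally show ?thesis .
  qed
  obtain C where C: "C > 0" "\<And>(a :: 'd mat) (b :: 'd mat). norm (a ** b) \<le> norm a * norm b * C"
    using bounded_bilinear.pos_bounded[OF bounded_bilinear_matrix_matrix_mult] by blast
  have "bounded (M ` {0..T})" "bounded ((\<lambda>t. transpose (M t)) ` {0..T})"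
    by (intro compact_imp_bounded compact_continuous_image cM
        bounded_linear.continuous_on[OF bounded_linear_transpose] compact_Icc)+
  then obtain m1 m2 where m: "\<And>t. t \<in> {0..T} \<Longrightarrow> norm (M t) \<le> m1" "m1 > 0"
      "\<And>t. t \<in> {0..T} \<Longrightarrow> norm (transpose (M t)) \<le> m2" "m2 > 0"
    unfolding bounded_pos by (metis imageI)
  \<comment> \<open>A growth rate for the linear equation of \<open>D\<close>: |D'| \<le> c |D|.
    Then exp (2 c t) |D|^2 is nondecreasing, and its value 0 at T forces it to be 0 before.\<close>
  define c where "c = C * (m1 + m2)"
  define g where "g = (\<lambda>t. - exp (2 * c * t) * (D t \<bullet> D t))"
  let ?D' = "\<lambda>t. - (D t ** M t + transpose (M t) ** D t)"
  have "g T \<le> g t"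
  proof (rule deriv_nonpos_imp_le[where f = g and a = t and b = T
        and f' = "\<lambda>t. - (exp (2 * c * t) * (2 * c)) * (D t \<bullet> D t) + (D t \<bullet> ?D' t + ?D' t \<bullet> D t) * - exp (2 * c * t)"])
    fix s assume s: "s \<in> {t..T}"
    then have sT: "s \<in> {0..T}" using t by auto
    have "((\<lambda>t. D t \<bullet> D t) has_real_derivative (D s \<bullet> ?D' s + ?D' s \<bullet> D s)) (at s within {0..T})"
      using has_vector_derivative_inner[OF Dd[OF sT] Dd[OF sT]]
      by (simp add: has_real_derivative_iff_has_vector_derivative)
    moreover have "((\<lambda>t. - exp (2 * c * t)) has_real_derivative - (exp (2 * c * s) * (2 * c))) (at s within {0..T})"
      by (auto intro!: derivative_eq_intros)
    ultimately have "(g has_real_derivative - (exp (2 * c * s) * (2 * c)) * (D s \<bullet> D s)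
        + (D s \<bullet> ?D' s + ?D' s \<bullet> D s) * - exp (2 * c * s)) (at s within {0..T})"
      unfolding g_def by (rule DERIV_mult[rotated])
    then show "(g has_real_derivative - (exp (2 * c * s) * (2 * c)) * (D s \<bullet> D s)
        + (D s \<bullet> ?D' s + ?D' s \<bullet> D s) * - exp (2 * c * s)) (at s within {t..T})"
      by (rule has_field_derivative_subset) (use t in auto)
    have "norm (?D' s) \<le> norm (D s) * m1 * C + m2 * norm (D s) * C"
      unfolding norm_minus_cancel
    proof (rule order_trans[OF norm_triangle_ineq], rule add_mono)
      show "norm (D s ** M s) \<le> norm (D s) * m1 * C"
      proof -
        have "norm (D s) * norm (M s) * C \<le> norm (D s) * m1 * C"
          by (rule mult_right_mono[OF mult_left_mono[OF m(1)[OF sT] norm_ge_zero] less_imp_le[OF C(1)]])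
        with C(2)[of "D s" "M s"] show ?thesis by (rule order_trans)
      qed
      show "norm (transpose (M s) ** D s) \<le> m2 * norm (D s) * C"
      proof -
        have "norm (transpose (M s)) * norm (D s) * C \<le> m2 * norm (D s) * C"
          by (rule mult_right_mono[OF mult_right_mono[OF m(3)[OF sT] norm_ge_zero] less_imp_le[OF C(1)]])
        with C(2)[of "transpose (M s)" "D s"] show ?thesis by (rule order_trans)
      qed
    qed
    then have n: "norm (?D' s) \<le> c * norm (D s)" by (simp add: c_def algebra_simps)
    have "\<bar>D s \<bullet> ?D' s\<bar> \<le> norm (D s) * (c * norm (D s))"
      by (rule order_trans[OF Cauchy_Schwarz_ineq2]) (intro mult_left_mono n norm_ge_zero)
    also have "\<dots> = c * (D s \<bullet> D s)" by (simp add: power2_norm_eq_inner flip: power2_eq_square)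
    finally have "- (2 * c * (D s \<bullet> D s)) \<le> D s \<bullet> ?D' s + ?D' s \<bullet> D s" by (simp add: inner_commute)
    then have "exp (2 * c * s) * - (2 * c * (D s \<bullet> D s)) \<le> exp (2 * c * s) * (D s \<bullet> ?D' s + ?D' s \<bullet> D s)"
      by (rule mult_left_mono) simp
    then show "- (exp (2 * c * s) * (2 * c)) * (D s \<bullet> D s)
        + (D s \<bullet> ?D' s + ?D' s \<bullet> D s) * - exp (2 * c * s) \<le> 0" by (simp add: algebra_simps)
  qed (use t in auto)
  moreover have "D T = 0" using ET by (simp add: D_def msym_def)
  ultimately have "exp (2 * c * t) * (D t \<bullet> D t) \<le> 0" by (simp add: g_def)
  then have "D t \<bullet> D t \<le> 0" by (simp add: mult_le_0_iff)
  then have "D t = 0" by (metis inner_ge_zero inner_eq_zero_iff order_antisym)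
  then show ?thesis by (simp add: D_def msym_def)
qed

text \<open>Along the flow of the constant matrix \<open>B\<close> the form \<open>E\<close> decreases, and its terminal value is
  nonnegative.\<close>

lemma riccati_psd:
  fixes E :: "real \<Rightarrow> 'd::finite mat"
  assumes d: "\<And>t. t \<in> {0..T} \<Longrightarrow>
      (E has_vector_derivative - (E t ** B + transpose B ** E t + E t ** S ** E t)) (at t within {0..T})"
    and S: "psd S" and ET: "psd (E T)" and t: "t \<in> {0..T}"
  shows "psd (E t)"
proof -
  have s: "msym (E t)" if "t \<in> {0..T}" for t
    using riccati_symmetric[OF d _ _ that] S ET by (auto simp: psd_def)
  have "0 \<le> \<xi> \<bullet> (E t *v \<xi>)" for \<xi>
  proof -
    define y where "y = (\<lambda>s. mexp ((s - t) *\<^sub>R B) *v \<xi>)"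
    have yd: "(y has_vector_derivative (B *v y s)) (at s within A)" for s A
    proof -
      have "((\<lambda>s. mexp ((s - t) *\<^sub>R B)) has_vector_derivative 1 *\<^sub>R (B ** mexp ((s - t) *\<^sub>R B))) (at s within A)"
      proof -
        have "((\<lambda>s. s - t) has_real_derivative 1) (at s within A)"
          by (auto intro!: derivative_eq_intros)
        then show ?thesis
          using vector_diff_chain_within[of "\<lambda>s. s - t" 1 s A "\<lambda>u. mexp (u *\<^sub>R B)" "B ** mexp ((s - t) *\<^sub>R B)"]
            mexp_has_vector_derivative[of B "s - t"]
          by (simp add: o_def has_real_derivative_iff_has_vector_derivative)
      qed
      from has_vector_derivative_mv[OF this has_vector_derivative_const[of \<xi>]]
      show ?thesis unfolding y_def by (simp add: matrix_vector_mul_assoc)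
    qed
    define g where "g = (\<lambda>s. y s \<bullet> (E s *v y s))"
    have "g T \<le> g t"
    proof (rule deriv_nonpos_imp_le[where f = g and a = t and b = T
          and f' = "\<lambda>s. - ((E s *v y s) \<bullet> (S *v (E s *v y s)))"])
      fix u assume u: "u \<in> {t..T}"
      then have uT: "u \<in> {0..T}" using t by auto
      have "(E has_vector_derivative - (E u ** B + transpose B ** E u + E u ** S ** E u)) (at u within {t..T})"
        by (rule has_vector_derivative_within_subset[OF d[OF uT]]) (use t in auto)
      from has_vector_derivative_inner[OF yd has_vector_derivative_mv[OF this yd]]
      show "(g has_real_derivative - ((E u *v y u) \<bullet> (S *v (E u *v y u)))) (at u within {t..T})"
        unfolding g_def has_real_derivative_iff_has_vector_derivative
        using msym_inner[OF s[OF uT], of "y u" "S *v (E u *v y u)"]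
        by (simp add: matrix_vector_simps inner_add_right inner_diff_right inner_matrix_vector_left[of B]
            flip: matrix_vector_mul_assoc)
      show "- ((E u *v y u) \<bullet> (S *v (E u *v y u))) \<le> 0"
        using S by (simp add: psd_def)
    qed (use t in auto)
    moreover have "0 \<le> g T" using ET by (simp add: g_def psd_def)
    ultimately show ?thesis by (simp add: g_def y_def mexp_0)
  qed
  with s[OF t] show ?thesis by (simp add: psd_def)
qed

text \<open>The two factors 1/\<nu> have different origins: one is Jensen's inequality for the
  kernel, the other the integration of the convolution over [0,T].\<close>

lemma L2_gain:
  fixes x :: "real \<Rightarrow> real^'d::finite"
  assumes d: "\<And>t. t \<in> {0..T} \<Longrightarrow> (x has_vector_derivative (B *v x t + w t)) (at t within {0..T})"
    and w: "continuous_on {0..T} w" and x0: "x 0 = 0" and T: "0 \<le> T"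
    and K: "K > 0" and \<nu>: "\<nu> > 0" and B: "\<And>s. 0 \<le> s \<Longrightarrow> opnorm (mexp (s *\<^sub>R B)) \<le> K * exp (- \<nu> * s)"
  shows "integral {0..T} (\<lambda>t. (norm (x t))\<^sup>2) \<le> K\<^sup>2 / \<nu>\<^sup>2 * integral {0..T} (\<lambda>t. (norm (w t))\<^sup>2)"
proof -
  have cx: "continuous_on {0..T} x" using d by (rule continuous_on_vector_derivative)
  have cw: "continuous_on {0..T} (\<lambda>t. (norm (w t))\<^sup>2)" by (intro continuous_intros w)
  have p: "(norm (x t))\<^sup>2 \<le> K\<^sup>2 / \<nu> * decay_conv \<nu> (\<lambda>t. (norm (w t))\<^sup>2) t" if t: "t \<in> {0..T}" for t
  proof -
    have ct: "continuous_on {0..t} (\<lambda>t. norm (w t))"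
      by (intro continuous_intros continuous_on_subset[OF w]) (use t in auto)
    have "norm (x t) \<le> K * exp (K * 0) * (exp (- \<nu> * t) * norm (x 0) + decay_conv \<nu> (\<lambda>t. norm (w t)) t)"
      by (rule perturbed_linear_ode_bound[OF d K B, where k = "\<lambda>_. 0"])
        (use t in \<open>auto intro!: continuous_intros w\<close>)
    then have "norm (x t) \<le> K * decay_conv \<nu> (\<lambda>t. norm (w t)) t" by (simp add: x0)
    then have "(norm (x t))\<^sup>2 \<le> K\<^sup>2 * (decay_conv \<nu> (\<lambda>t. norm (w t)) t)\<^sup>2"
      unfolding power_mult_distrib[symmetric] by (rule power_mono) simp
    also have "\<dots> \<le> K\<^sup>2 * (decay_conv \<nu> (\<lambda>t. (norm (w t))\<^sup>2) t / \<nu>)"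
      by (intro mult_left_mono decay_conv_square_le \<nu> ct) (use t in auto)
    finally show ?thesis by simp
  qed
  have "integral {0..T} (\<lambda>t. (norm (x t))\<^sup>2) \<le> integral {0..T} (\<lambda>t. K\<^sup>2 / \<nu> * decay_conv \<nu> (\<lambda>t. (norm (w t))\<^sup>2) t)"
    by (rule integral_le) (intro integrable_continuous_real continuous_intros cx decay_conv_continuous cw p; simp)+
  also have "\<dots> = K\<^sup>2 / \<nu> * integral {0..T} (decay_conv \<nu> (\<lambda>t. (norm (w t))\<^sup>2))"
    by (simp only: integral_mult_right)
  also have "\<dots> \<le> K\<^sup>2 / \<nu> * (integral {0..T} (\<lambda>t. (norm (w t))\<^sup>2) / \<nu>)"
    by (rule mult_left_mono[OF integral_decay_conv_le[OF \<nu> T cw]]) (use \<nu> in auto)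
  finally show ?thesis by (simp add: power2_eq_square)
qed

section \<open>Coercivity\<close>

text \<open>With u = R^-1 E x, w = v + u and b = <x, E x>, the Riccati equation gives b' = <w, R w>
  - <v, R v>. On the other hand <u, R u> is at most r k exp (- l (T - t)) b, as E^2 \<le> |E| E.
  Thus the feedback is controlled by the very quantity in which the two integrals differ, and this
  closes into a scalar differential inequality for them.\<close>

lemma deviation_feedback_bound:
  fixes x :: "real \<Rightarrow> real^'d::finite"
  assumes R: "spd R" and r: "opnorm (matrix_inv R) \<le> r" "0 < r"
    and E: "\<And>t. t \<in> {0..T} \<Longrightarrow> (E has_vector_derivative
        - (E t ** B + transpose B ** E t + E t ** matrix_inv R ** E t)) (at t within {0..T})"
    and Ep: "\<And>t. t \<in> {0..T} \<Longrightarrow> psd (E t)"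
    and El: "\<And>t. t \<in> {0..T} \<Longrightarrow> opnorm (E t) \<le> k * exp (- l * (T - t))" and kl: "0 < k" "0 < l"
    and x: "\<And>t. t \<in> {0..T} \<Longrightarrow> (x has_vector_derivative
        (B *v x t + matrix_inv R *v (E t *v x t) + v t)) (at t within {0..T})"
    and x0: "x 0 = 0" and v: "continuous_on {0..T} v" and T: "0 \<le> T"
  shows "integral {0..T} (\<lambda>t. (v t + matrix_inv R *v (E t *v x t)) \<bullet> (R *v (v t + matrix_inv R *v (E t *v x t))))
    \<le> exp (r * k / l) * integral {0..T} (\<lambda>t. v t \<bullet> (R *v v t))"
proof -
  let ?Ri = "matrix_inv R"
  have cx: "continuous_on {0..T} x" using x by (rule continuous_on_vector_derivative)
  have cE: "continuous_on {0..T} E" using E by (rule continuous_on_vector_derivative)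
  define u where "u = (\<lambda>t. ?Ri *v (E t *v x t))"
  define w where "w = (\<lambda>t. v t + u t)"
  have cu: "continuous_on {0..T} u" unfolding u_def by (intro continuous_intros cx cE)
  have cw: "continuous_on {0..T} w" unfolding w_def by (intro continuous_intros cu v)
  define W where "W = (\<lambda>t. integral {0..t} (\<lambda>t. w t \<bullet> (R *v w t)))"
  define a where "a = (\<lambda>t. integral {0..t} (\<lambda>t. v t \<bullet> (R *v v t)))"
  define b where "b = (\<lambda>t. x t \<bullet> (E t *v x t))"
  have sR: "msym R" and sRi: "msym ?Ri"
    using R spd_matrix_inv[OF R] by (simp_all add: spd_def)
  have RRi: "R *v (?Ri *v y) = y" for y by (rule spd_inverse_vec[OF R])
  have Wd: "(W has_real_derivative w t \<bullet> (R *v w t)) (at t within {0..T})" if "t \<in> {0..T}" for t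
    unfolding W_def by (rule has_real_derivative_integral[OF _ that]) (intro continuous_intros cw)
  have ad: "(a has_real_derivative v t \<bullet> (R *v v t)) (at t within {0..T})" if "t \<in> {0..T}" for t
    unfolding a_def by (rule has_real_derivative_integral[OF _ that]) (intro continuous_intros v)
  have bd: "(b has_real_derivative w t \<bullet> (R *v w t) - v t \<bullet> (R *v v t)) (at t within {0..T})"
    if t: "t \<in> {0..T}" for t
  proof -
    have sE: "msym (E t)" using Ep[OF t] by (simp add: psd_def)
    have "(x has_vector_derivative (B *v x t + w t)) (at t within {0..T})"
      using x[OF t] by (simp add: w_def u_def add.assoc add.commute add.left_commute)
    note d = has_vector_derivative_inner[OF this has_vector_derivative_mv[OF E[OF t] this]]
    have "x t \<bullet> (E t *v (B *v x t + w t) + - (E t ** B + transpose B ** E t + E t ** ?Ri ** E t) *v x t)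
        + (B *v x t + w t) \<bullet> (E t *v x t) = 2 * (w t \<bullet> (E t *v x t)) - (E t *v x t) \<bullet> u t"
      using msym_inner[OF sE, of "x t" "w t"] msym_inner[OF sE, of "x t" "u t"]
      by (simp add: matrix_vector_simps inner_add_right inner_diff_right inner_add_left
          inner_matrix_vector_left[of B] inner_commute[of "E t *v x t"] u_def
          flip: matrix_vector_mul_assoc)
    also have "\<dots> = w t \<bullet> (R *v w t) - v t \<bullet> (R *v v t)"
    proof -
      have v: "v t = w t - u t" by (simp add: w_def)
      have Ru: "R *v u t = E t *v x t" by (simp add: u_def RRi)
      show ?thesis
        using msym_inner[OF sR, of "u t" "w t"]
        by (simp add: v matrix_vector_simps inner_diff_left inner_diff_right Ru inner_commute)
    qed
    finally show ?thesis
      using d unfolding b_def by (simp add: has_real_derivative_iff_has_vector_derivative)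
  qed
  have Wab: "W t - a t = b t" if t: "t \<in> {0..T}" for t
  proof -
    have z: "((\<lambda>t. W t - a t - b t) has_real_derivative 0) (at s within {0..t})" if "s \<in> {0..t}" for s
      using DERIV_subset[OF DERIV_diff[OF DERIV_diff[OF Wd ad] bd], of s "{0..t}"] that t by auto
    have "((\<lambda>_. 0) has_integral (W t - a t - b t) - (W 0 - a 0 - b 0)) {0..t}"
      using z t by (intro fundamental_theorem_of_calculus)
        (auto simp: has_real_derivative_iff_has_vector_derivative)
    then have "W t - a t - b t = W 0 - a 0 - b 0"
      by (metis eq_iff_diff_eq_0 has_integral_0_eq)
    then show ?thesis by (simp add: W_def a_def b_def x0)
  qed
  \<comment> \<open>The antiderivative of r k exp (- l (T - t)) that tends to 0 as t goes to minus
    infinity. It is positive on all of [0,T], so that exp h - 1 may be a denominator, and h(T) = r k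
    / l is the exponent of the claim.\<close>
  define h where "h = (\<lambda>t. r * k * exp (- l * (T - t)) / l)"
  define h' where "h' = (\<lambda>t. r * (k * exp (- l * (T - t))))"
  have hd: "(h has_real_derivative h' t) (at t within {0..T})" for t
    unfolding h_def h'_def using kl by (auto intro!: derivative_eq_intros)
  have hpos: "0 < h t" for t unfolding h_def using kl r by simp
  \<comment> \<open>Taking \<eta> = exp h - 1 in the weighted square gives W' \<le> e^h a' + e^h /
    (e^h - 1) h' b. With b = W - a this says that the derivative of W - e^h a is at most e^h h' /
    (e^h - 1) times W - e^h a itself. That coefficient is the logarithmic derivative of e^h - 1, so
    the quotient \<open>g\<close> is nonincreasing, and g(0) = 0.\<close>
  define g where "g = (\<lambda>t. (W t - exp (h t) * a t) / (exp (h t) - 1))"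
  define g' where "g' = (\<lambda>t. ((w t \<bullet> (R *v w t) - (exp (h t) * h' t * a t + v t \<bullet> (R *v v t) * exp (h t))) * (exp (h t) - 1)
      - (W t - exp (h t) * a t) * (exp (h t) * h' t - 0)) / ((exp (h t) - 1) * (exp (h t) - 1)))"
  have "g T \<le> g 0"
  proof (rule deriv_nonpos_imp_le[where f = g and f' = g' and a = 0 and b = T])
    fix t assume t: "t \<in> {0..T}"
    let ?e = "exp (h t)"
    have e: "?e > 1" using hpos by simp
    show "(g has_real_derivative g' t) (at t within {0..T})"
      unfolding g_def g'_def
      by (intro DERIV_divide DERIV_diff DERIV_mult DERIV_chain2[OF DERIV_exp] Wd[OF t] ad[OF t] hd DERIV_const)
        (use e in simp)
    have w0: "w t \<bullet> (R *v w t) \<le> (1 + (?e - 1)) * (v t \<bullet> (R *v v t)) + (1 + 1 / (?e - 1)) * (u t \<bullet> (R *v u t))"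
      unfolding w_def by (rule psd_weighted_square) (use e R spd_imp_psd in auto)
    have "u t \<bullet> (R *v u t) \<le> h' t * b t"
    proof -
      have "u t \<bullet> (R *v u t) = (E t *v x t) \<bullet> (?Ri *v (E t *v x t))"
        by (simp add: u_def RRi inner_commute)
      also have "\<dots> \<le> r * (norm (E t *v x t))\<^sup>2" by (rule psd_quadratic_le[OF r(1)])
      also have "\<dots> \<le> r * (k * exp (- l * (T - t)) * (x t \<bullet> (E t *v x t)))"
        using psd_norm_square_le[OF Ep[OF t] El[OF t]] kl r by (simp add: mult_left_mono)
      finally show ?thesis by (simp add: h'_def b_def)
    qed
    then have "(1 + 1 / (?e - 1)) * (u t \<bullet> (R *v u t)) \<le> (1 + 1 / (?e - 1)) * (h' t * b t)"
      by (rule mult_left_mono) (use e in simp)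
    moreover have "1 + 1 / (?e - 1) = ?e / (?e - 1)" using e by (simp add: field_simps)
    ultimately have w1: "w t \<bullet> (R *v w t) \<le> ?e * (v t \<bullet> (R *v v t)) + ?e / (?e - 1) * (h' t * b t)"
      using w0 by simp
    have "(w t \<bullet> (R *v w t) - ?e * (v t \<bullet> (R *v v t)) - ?e * h' t * a t) * (?e - 1) \<le> ?e * h' t * (b t - (?e - 1) * a t)"
    proof -
      have "w t \<bullet> (R *v w t) - ?e * (v t \<bullet> (R *v v t)) - ?e * h' t * a t \<le> ?e / (?e - 1) * (h' t * b t) - ?e * h' t * a t"
        using w1 by simp
      then have "(w t \<bullet> (R *v w t) - ?e * (v t \<bullet> (R *v v t)) - ?e * h' t * a t) * (?e - 1)
          \<le> (?e / (?e - 1) * (h' t * b t) - ?e * h' t * a t) * (?e - 1)"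
        by (rule mult_right_mono) (use e in simp)
      also have "\<dots> = ?e * h' t * (b t - (?e - 1) * a t)" using e by (simp add: field_simps)
      finally show ?thesis .
    qed
    also have "b t - (?e - 1) * a t = W t - ?e * a t" using Wab[OF t] by (simp add: algebra_simps)
    finally have "(w t \<bullet> (R *v w t) - (?e * h' t * a t + v t \<bullet> (R *v v t) * ?e)) * (?e - 1)
      - (W t - ?e * a t) * (?e * h' t - 0) \<le> 0" by (simp add: algebra_simps)
    then show "g' t \<le> 0" unfolding g'_def by (rule divide_nonpos_nonneg) simp
  qed (rule T)
  then have "g T \<le> 0" by (simp add: g_def W_def a_def)
  then have "W T \<le> exp (h T) * a T"
    using hpos[of T] by (simp add: g_def divide_le_0_iff)
  then show ?thesis by (simp add: W_def a_def h_def w_def u_def)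
qed

text \<open>The gain of the time-varying system exceeds that of the constant one at most by the factor
  \<open>exp (r k / l)\<close>, with no power of \<open>K\<close> in the exponent. A Gronwall argument would not give this.\<close>

lemma coercivity:
  fixes x :: "real \<Rightarrow> real^'d::finite"
  assumes R: "spd R" and r: "opnorm (matrix_inv R) \<le> r" "0 < r"
    and E: "\<And>t. t \<in> {0..T} \<Longrightarrow> (E has_vector_derivative
        - (E t ** B + transpose B ** E t + E t ** matrix_inv R ** E t)) (at t within {0..T})"
    and Ep: "\<And>t. t \<in> {0..T} \<Longrightarrow> psd (E t)"
    and El: "\<And>t. t \<in> {0..T} \<Longrightarrow> opnorm (E t) \<le> k * exp (- l * (T - t))" and kl: "0 < k" "0 < l"
    and K: "K > 0" and \<nu>: "\<nu> > 0" and B: "\<And>s. 0 \<le> s \<Longrightarrow> opnorm (mexp (s *\<^sub>R B)) \<le> K * exp (- \<nu> * s)"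
    and x: "\<And>t. t \<in> {0..T} \<Longrightarrow> (x has_vector_derivative
        (B *v x t + matrix_inv R *v (E t *v x t) + v t)) (at t within {0..T})"
    and x0: "x 0 = 0" and v: "continuous_on {0..T} v" and T: "0 \<le> T"
  shows "integral {0..T} (\<lambda>t. (norm (x t))\<^sup>2)
    \<le> K\<^sup>2 / \<nu>\<^sup>2 * r * exp (r * k / l) * integral {0..T} (\<lambda>t. v t \<bullet> (R *v v t))"
proof -
  let ?Ri = "matrix_inv R"
  have cx: "continuous_on {0..T} x" using x by (rule continuous_on_vector_derivative)
  have cE: "continuous_on {0..T} E" using E by (rule continuous_on_vector_derivative)
  define w where "w = (\<lambda>t. v t + ?Ri *v (E t *v x t))"
  have cw: "continuous_on {0..T} w" unfolding w_def by (intro continuous_intros cx cE v)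
  have gain: "integral {0..T} (\<lambda>t. (norm (x t))\<^sup>2) \<le> K\<^sup>2 / \<nu>\<^sup>2 * integral {0..T} (\<lambda>t. (norm (w t))\<^sup>2)"
  proof (rule L2_gain[where B = B and x = x and w = w and T = T, OF _ cw x0 T K \<nu>])
    show "(x has_vector_derivative B *v x t + w t) (at t within {0..T})" if "t \<in> {0..T}" for t
      using x[OF that] by (simp add: w_def add.assoc add.commute add.left_commute)
  qed (rule B)
  have "integral {0..T} (\<lambda>t. (norm (w t))\<^sup>2) \<le> integral {0..T} (\<lambda>t. r * (w t \<bullet> (R *v w t)))"
    by (rule integral_le) (intro integrable_continuous_real continuous_intros cw spd_norm_square_le[OF R r])+
  also have "\<dots> = r * integral {0..T} (\<lambda>t. w t \<bullet> (R *v w t))" by (simp only: integral_mult_right)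
  also have "\<dots> \<le> r * (exp (r * k / l) * integral {0..T} (\<lambda>t. v t \<bullet> (R *v v t)))"
    unfolding w_def
    by (rule mult_left_mono[OF deviation_feedback_bound[OF R r E Ep El kl x x0 v T]]) (use r in auto)
  finally have "K\<^sup>2 / \<nu>\<^sup>2 * integral {0..T} (\<lambda>t. (norm (w t))\<^sup>2)
      \<le> K\<^sup>2 / \<nu>\<^sup>2 * (r * (exp (r * k / l) * integral {0..T} (\<lambda>t. v t \<bullet> (R *v v t))))"
    by (rule mult_left_mono) simp
  with gain show ?thesis by (simp only: mult.assoc)
qed

section \<open>The weighted turnpike estimate\<close>

lemma integral_reverse:
  fixes g :: "real \<Rightarrow> real"
  assumes T: "0 \<le> T" and g: "continuous_on {0..T} g"
  shows "integral {0..T} (\<lambda>s. g (T - s)) = integral {0..T} g"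
proof -
  have "((\<lambda>s. - integral {0..T - s} g) has_real_derivative g (T - s)) (at s within {0..T})"
    if s: "s \<in> {0..T}" for s
  proof -
    have "((\<lambda>u. integral {0..u} g) has_real_derivative g (T - s)) (at (T - s) within ((\<lambda>s. T - s) ` {0..T}))"
      by (rule has_field_derivative_subset[OF has_real_derivative_integral[OF g]]) (use s in auto)
    moreover have "((\<lambda>s. T - s) has_real_derivative -1) (at s within {0..T})"
      by (auto intro!: derivative_eq_intros)
    ultimately have "((\<lambda>s. integral {0..T - s} g) has_real_derivative g (T - s) * - 1) (at s within {0..T})"
      using DERIV_image_chain[of "\<lambda>u. integral {0..u} g" "g (T - s)" "\<lambda>s. T - s" s "{0..T}" "-1"]
      by (simp add: o_def)
    from DERIV_minus[OF this] show ?thesis by simp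
  qed
  then have "((\<lambda>s. g (T - s)) has_integral (- integral {0..T - T} g) - (- integral {0..T - 0} g)) {0..T}"
    by (intro fundamental_theorem_of_calculus T) (auto simp: has_real_derivative_iff_has_vector_derivative)
  then show ?thesis by (simp add: integral_unique)
qed

lemma integral_exp_decay_le:
  fixes l T :: real
  assumes "0 < l" "0 \<le> T"
  shows "integral {0..T} (\<lambda>t. exp (- l * t)) \<le> 1 / l"
proof -
  have "((\<lambda>t. exp (- l * t)) has_integral (- exp (- l * T) / l) - (- exp (- l * 0) / l)) {0..T}"
    by (rule fundamental_theorem_of_calculus)
      (use assms in \<open>auto intro!: derivative_eq_intros simp flip: has_real_derivative_iff_has_vector_derivative\<close>)
  then show ?thesis using assms by (simp add: integral_unique field_simps)
qed

lemma integral_exp_decay_reverse_le: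
  fixes l T :: real
  assumes "0 < l" "0 \<le> T"
  shows "integral {0..T} (\<lambda>t. exp (- l * (T - t))) \<le> 1 / l"
proof -
  have "continuous_on {0..T} (\<lambda>t. exp (- l * t))" by (intro continuous_intros)
  from integral_reverse[OF assms(2) this] integral_exp_decay_le[OF assms] show ?thesis by simp
qed

lemma three_squares: "(a + b + c)\<^sup>2 \<le> 3 * (a\<^sup>2 + b\<^sup>2 + c\<^sup>2)" for a b c :: real
proof -
  have "0 \<le> (a - b)\<^sup>2 + (b - c)\<^sup>2 + (a - c)\<^sup>2" by simp
  then show ?thesis by (simp add: power2_eq_square algebra_simps)
qed

lemma young_product: "0 < \<delta> \<Longrightarrow> a * b \<le> \<delta> * b\<^sup>2 + a\<^sup>2 / (4 * \<delta>)" for a b \<delta> :: real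
proof -
  assume d: "0 < \<delta>"
  have "0 \<le> (2 * \<delta> * b - a)\<^sup>2" by simp
  then have "4 * \<delta> * (a * b) \<le> 4 * \<delta> * (\<delta> * b\<^sup>2) + a\<^sup>2"
    by (simp add: power2_eq_square algebra_simps)
  then show ?thesis using d by (simp add: field_simps)
qed

lemma inner_young: "0 < \<delta> \<Longrightarrow> u \<bullet> w \<le> \<delta> * (norm w)\<^sup>2 + (norm u)\<^sup>2 / (4 * \<delta>)"
  using young_product[of \<delta> "norm u" "norm w"] norm_cauchy_schwarz[of u w] by linarith

text \<open>The Gronwall factor, with \<open>K\<close> in the exponent, is harmless here: in the
  energy balance this constant multiplies only a small parameter or the data. The 3 comes from the
  square of a three-term forcing, and r^2 and 4 q^2 from the terms R^-1 z and 2 Q x.\<close>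

definition tp_C1 :: "real \<Rightarrow> real \<Rightarrow> real \<Rightarrow> real \<Rightarrow> real \<Rightarrow> real \<Rightarrow> real" where
  "tp_C1 K \<nu> r k l q = 2 * (K * exp (K * (r * k / l)))\<^sup>2 * (1 + 3 * (1 + r\<^sup>2 + 4 * q\<^sup>2) / \<nu>)"

text \<open>The number 75/8 is 5/4 * 1/2 * 5 * 3: a Young factor for x = y + e, the gain 1/2, a
  Young factor for the control, and the three-term square. The terms with K^2 / \<nu> stem from the
  free motion started at the initial deviation.\<close>

definition tp_C2 :: "real \<Rightarrow> real \<Rightarrow> real \<Rightarrow> real \<Rightarrow> real \<Rightarrow> real \<Rightarrow> real" where
  "tp_C2 K \<nu> r k cR \<gamma> = 75 / (8 * cR) * (1 + r\<^sup>2 * k\<^sup>2 * K\<^sup>2 / \<nu>) + 5 * \<gamma> * K\<^sup>2 / \<nu>"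

text \<open>The forward-backward system after weighting: \<psi> is the logarithmic derivative of the
  weight, \<open>f\<close> and \<open>h\<close> are the weighted forcings, and \<open>s\<close>
  bounds all data. Coercivity is an assumption of its own, so that its constant is not tied to the
  common parameters \<open>K\<close>, \<nu>, \<open>k\<close>, \<open>l\<close> used in the
  pointwise bounds.\<close>

locale turnpike_system =
  fixes N :: nat and T K \<nu> r k l cR q \<gamma> \<epsilon> s :: real
    and B R :: "nat \<Rightarrow> real^'d::finite^'d" and E :: "nat \<Rightarrow> real \<Rightarrow> real^'d^'d"
    and Q :: "nat \<Rightarrow> nat \<Rightarrow> real^'d^'d"
    and x z f h :: "nat \<Rightarrow> real \<Rightarrow> real^'d" and \<psi> :: "real \<Rightarrow> real"
  assumes T: "0 \<le> T" and K: "0 < K" and \<nu>: "0 < \<nu>" and r: "0 < r" and kl: "0 < k" "0 < l"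
    and cR: "0 < cR" and \<gamma>: "0 < \<gamma>" and \<epsilon>: "0 < \<epsilon>" "\<epsilon> \<le> 1" and s: "0 \<le> s"
    and B: "\<And>i t. i \<in> {1..N} \<Longrightarrow> 0 \<le> t \<Longrightarrow> opnorm (mexp (t *\<^sub>R B i)) \<le> K * exp (- \<nu> * t)"
    and R: "\<And>i. i \<in> {1..N} \<Longrightarrow> spd (R i)"
    and Rr: "\<And>i. i \<in> {1..N} \<Longrightarrow> opnorm (matrix_inv (R i)) \<le> r"
    and RcR: "\<And>i y. i \<in> {1..N} \<Longrightarrow> cR * (norm y)\<^sup>2 \<le> y \<bullet> (matrix_inv (R i) *v y)"
    and cE: "\<And>i. i \<in> {1..N} \<Longrightarrow> continuous_on {0..T} (E i)"
    and sE: "\<And>i t. i \<in> {1..N} \<Longrightarrow> t \<in> {0..T} \<Longrightarrow> msym (E i t)"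
    and El: "\<And>i t. i \<in> {1..N} \<Longrightarrow> t \<in> {0..T} \<Longrightarrow> opnorm (E i t) \<le> k * exp (- l * (T - t))"
    and coer: "\<And>i y v. i \<in> {1..N} \<Longrightarrow> (\<And>t. t \<in> {0..T} \<Longrightarrow> (y has_vector_derivative
          (B i *v y t + matrix_inv (R i) *v (E i t *v y t) + v t)) (at t within {0..T})) \<Longrightarrow>
        y 0 = 0 \<Longrightarrow> continuous_on {0..T} v \<Longrightarrow>
        \<gamma> * integral {0..T} (\<lambda>t. (norm (y t))\<^sup>2) \<le> 1 / 2 * integral {0..T} (\<lambda>t. v t \<bullet> (R i *v v t))"
    and xd: "\<And>i t. i \<in> {1..N} \<Longrightarrow> t \<in> {0..T} \<Longrightarrow> (x i has_vector_derivative
        (B i *v x i t + (matrix_inv (R i) *v (E i t *v x i t) + \<psi> t *\<^sub>R x i t + f i t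
          - matrix_inv (R i) *v z i t))) (at t within {0..T})"
    and zd: "\<And>i t. i \<in> {1..N} \<Longrightarrow> t \<in> {0..T} \<Longrightarrow> (z i has_vector_derivative
        (- (transpose (B i) *v z i t + E i t *v (matrix_inv (R i) *v z i t)) + \<psi> t *\<^sub>R z i t - h i t
          - 2 *\<^sub>R bmult N Q (\<lambda>j. x j t) i)) (at t within {0..T})"
    and c\<psi>: "continuous_on {0..T} \<psi>" and \<psi>: "\<And>t. t \<in> {0..T} \<Longrightarrow> \<bar>\<psi> t\<bar> \<le> \<epsilon>"
    and cf: "\<And>i. i \<in> {1..N} \<Longrightarrow> continuous_on {0..T} (f i)"
    and ch: "\<And>i. i \<in> {1..N} \<Longrightarrow> continuous_on {0..T} (h i)"
    and fs: "\<And>i. i \<in> {1..N} \<Longrightarrow> integral {0..T} (\<lambda>t. (norm (f i t))\<^sup>2) \<le> s"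
    and hs: "\<And>i. i \<in> {1..N} \<Longrightarrow> integral {0..T} (\<lambda>t. (norm (h i t))\<^sup>2) \<le> s"
    and x0: "\<And>i. i \<in> {1..N} \<Longrightarrow> (norm (x i 0))\<^sup>2 \<le> s"
    and zT: "\<And>i. i \<in> {1..N} \<Longrightarrow> (norm (z i T))\<^sup>2 \<le> s"
    and Qq: "\<And>y. (\<Sum>i\<in>{1..N}. (norm (bmult N Q y i))\<^sup>2) \<le> q\<^sup>2 * (\<Sum>i\<in>{1..N}. (norm (y i))\<^sup>2)"
    and Q\<gamma>: "\<And>y. - (\<gamma> / 2) * (\<Sum>i\<in>{1..N}. (norm (y i))\<^sup>2) \<le> (\<Sum>i\<in>{1..N}. y i \<bullet> bmult N Q y i)"
begin

definition "xI i = integral {0..T} (\<lambda>t. (norm (x i t))\<^sup>2)"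
definition "zI i = integral {0..T} (\<lambda>t. (norm (z i t))\<^sup>2)"
definition "ZI i = integral {0..T} (\<lambda>t. z i t \<bullet> (matrix_inv (R i) *v z i t))"
abbreviation "C1 \<equiv> tp_C1 K \<nu> r k l q"
abbreviation "C2 \<equiv> tp_C2 K \<nu> r k cR \<gamma>"

lemma cx: "i \<in> {1..N} \<Longrightarrow> continuous_on {0..T} (x i)"
  using xd by (rule continuous_on_vector_derivative)

lemma cz: "i \<in> {1..N} \<Longrightarrow> continuous_on {0..T} (z i)"
  using zd by (rule continuous_on_vector_derivative)

lemma cQx: "continuous_on {0..T} (\<lambda>t. bmult N Q (\<lambda>j. x j t) i)"
  unfolding bmult_def by (intro continuous_intros cx)

lemma xI_nonneg: "i \<in> {1..N} \<Longrightarrow> 0 \<le> xI i" and zI_nonneg: "i \<in> {1..N} \<Longrightarrow> 0 \<le> zI i"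
  unfolding xI_def zI_def
  by (intro integral_nonneg integrable_continuous_real continuous_intros cx cz; simp)+

lemma kernel_integral_le: "integral {0..T} (\<lambda>t. r * k * exp (- l * (T - t))) \<le> r * k / l"
proof -
  have "integral {0..T} (\<lambda>t. r * k * exp (- l * (T - t))) = r * k * integral {0..T} (\<lambda>t. exp (- l * (T - t)))"
    by (simp only: integral_mult_right)
  also have "\<dots> \<le> r * k * (1 / l)"
    by (rule mult_left_mono[OF integral_exp_decay_reverse_le]) (use kl r T in auto)
  finally show ?thesis by simp
qed

lemma integral_three_squares:
  fixes a b c :: "real \<Rightarrow> real"
  assumes "continuous_on {0..T} a" "continuous_on {0..T} b" "continuous_on {0..T} c"
  shows "integral {0..T} (\<lambda>t. (a t + b t + c t)\<^sup>2)
    \<le> 3 * (integral {0..T} (\<lambda>t. (a t)\<^sup>2) + integral {0..T} (\<lambda>t. (b t)\<^sup>2) + integral {0..T} (\<lambda>t. (c t)\<^sup>2))"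
proof -
  have "integral {0..T} (\<lambda>t. (a t + b t + c t)\<^sup>2) \<le> integral {0..T} (\<lambda>t. 3 * ((a t)\<^sup>2 + (b t)\<^sup>2 + (c t)\<^sup>2))"
    by (rule integral_le) (intro integrable_continuous_real continuous_intros assms three_squares)+
  also have "\<dots> = 3 * integral {0..T} (\<lambda>t. (a t)\<^sup>2 + (b t)\<^sup>2 + (c t)\<^sup>2)" by (simp only: integral_mult_right)
  also have "integral {0..T} (\<lambda>t. (a t)\<^sup>2 + (b t)\<^sup>2 + (c t)\<^sup>2)
      = integral {0..T} (\<lambda>t. (a t)\<^sup>2 + (b t)\<^sup>2) + integral {0..T} (\<lambda>t. (c t)\<^sup>2)"
    by (rule integral_add) (intro integrable_continuous_real continuous_intros assms)+
  also have "integral {0..T} (\<lambda>t. (a t)\<^sup>2 + (b t)\<^sup>2) = integral {0..T} (\<lambda>t. (a t)\<^sup>2) + integral {0..T} (\<lambda>t. (b t)\<^sup>2)"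
    by (rule integral_add) (intro integrable_continuous_real continuous_intros assms)+
  finally show ?thesis .
qed

lemma C1_ge: "2 * (K * exp (K * (r * k / l)))\<^sup>2 * (1 + 3 * m / \<nu>) \<le> C1" if "m \<le> 1 + r\<^sup>2 + 4 * q\<^sup>2"
  unfolding tp_C1_def using that \<nu> by (intro mult_left_mono add_left_mono divide_right_mono) auto

text \<open>The feedback by \<open>E\<close> enters Gronwall as the kernel, because its integral is
  bounded uniformly in T. The term with \<psi> is small but not integrable uniformly in T; it is put
  into the forcing and paid for by the L^2 norm of \<open>x\<close>.\<close>

lemma x_pointwise:
  assumes i: "i \<in> {1..N}" and t: "t \<in> {0..T}"
  shows "(norm (x i t))\<^sup>2 \<le> C1 * (s + xI i + zI i)"
proof -
  let ?K1 = "2 * (K * exp (K * (r * k / l)))\<^sup>2"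
  let ?Ri = "matrix_inv (R i)"
  define G where "G = (\<lambda>t. \<epsilon> * norm (x i t) + norm (f i t) + r * norm (z i t))"
  have cG: "continuous_on {0..T} G" unfolding G_def by (intro continuous_intros cx cf cz i)
  have "(norm (x i t))\<^sup>2 \<le> ?K1 * ((norm (x i 0))\<^sup>2 + decay_conv \<nu> (\<lambda>t. (G t)\<^sup>2) t / \<nu>)"
  proof (rule perturbed_linear_ode_bound_square[OF xd[OF i] K B[OF i], where k = "\<lambda>t. r * k * exp (- l * (T - t))"])
    fix t assume t: "t \<in> {0..T}"
    have "norm (?Ri *v (E i t *v x i t)) \<le> r * (k * exp (- l * (T - t)) * norm (x i t))"
      by (intro order_trans[OF norm_mult_vec_le[OF Rr[OF i]]] mult_left_mono norm_mult_vec_le El i t)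
        (use r in simp)
    moreover have "norm (\<psi> t *\<^sub>R x i t) \<le> \<epsilon> * norm (x i t)"
      using \<psi>[OF t] by (simp add: mult_right_mono)
    moreover have "norm (?Ri *v z i t) \<le> r * norm (z i t)" by (rule norm_mult_vec_le[OF Rr[OF i]])
    ultimately show "norm (?Ri *v (E i t *v x i t) + \<psi> t *\<^sub>R x i t + f i t - ?Ri *v z i t)
        \<le> r * k * exp (- l * (T - t)) * norm (x i t) + G t"
      unfolding G_def
      by (intro order_trans[OF norm_triangle_ineq4] order_trans[OF add_right_mono[OF norm_triangle_ineq]]
          order_trans[OF add_right_mono[OF add_right_mono[OF norm_triangle_ineq]]]) (simp add: mult.assoc)
    show "0 \<le> r * k * exp (- l * (T - t))" using r kl by simp
    show "0 \<le> G t" unfolding G_def using \<epsilon> r by simp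
  qed (assumption | rule \<nu> t kernel_integral_le | intro continuous_intros cG)+
  also have "\<dots> \<le> ?K1 * (s + 3 * (xI i + s + r\<^sup>2 * zI i) / \<nu>)"
  proof (intro mult_left_mono add_mono divide_right_mono x0 i)
    have "decay_conv \<nu> (\<lambda>t. (G t)\<^sup>2) t \<le> integral {0..T} (\<lambda>t. (G t)\<^sup>2)"
      by (rule decay_conv_le_integral[OF _ t]) (use \<nu> in \<open>auto intro!: continuous_intros cG\<close>)
    also have "\<dots> \<le> 3 * (integral {0..T} (\<lambda>t. (\<epsilon> * norm (x i t))\<^sup>2) + integral {0..T} (\<lambda>t. (norm (f i t))\<^sup>2)
        + integral {0..T} (\<lambda>t. (r * norm (z i t))\<^sup>2))"
      unfolding G_def by (rule integral_three_squares) (intro continuous_intros cx cf cz i)+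
    also have "integral {0..T} (\<lambda>t. (\<epsilon> * norm (x i t))\<^sup>2) = \<epsilon>\<^sup>2 * xI i"
      unfolding xI_def by (simp only: power_mult_distrib integral_mult_right)
    also have "integral {0..T} (\<lambda>t. (r * norm (z i t))\<^sup>2) = r\<^sup>2 * zI i"
      unfolding zI_def by (simp only: power_mult_distrib integral_mult_right)
    also have "\<epsilon>\<^sup>2 * xI i \<le> xI i"
      using \<epsilon> xI_nonneg[OF i] by (simp add: mult_left_le_one_le power_le_one)
    finally show "decay_conv \<nu> (\<lambda>t. (G t)\<^sup>2) t \<le> 3 * (xI i + s + r\<^sup>2 * zI i)" using fs[OF i] by simp
  qed (use \<nu> in auto)
  also have "\<dots> \<le> ?K1 * ((1 + 3 * (1 + r\<^sup>2) / \<nu>) * (s + xI i + zI i))"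
  proof (rule mult_left_mono)
    have "0 \<le> 3 * (r\<^sup>2 * (s + xI i) + zI i) / \<nu> + xI i + zI i"
      using s xI_nonneg[OF i] zI_nonneg[OF i] \<nu> by simp
    moreover have "(1 + 3 * (1 + r\<^sup>2) / \<nu>) * (s + xI i + zI i) - (s + 3 * (xI i + s + r\<^sup>2 * zI i) / \<nu>)
        = 3 * (r\<^sup>2 * (s + xI i) + zI i) / \<nu> + xI i + zI i"
      using \<nu> by (simp add: field_simps)
    ultimately show "s + 3 * (xI i + s + r\<^sup>2 * zI i) / \<nu> \<le> (1 + 3 * (1 + r\<^sup>2) / \<nu>) * (s + xI i + zI i)"
      by linarith
  qed simp
  also have "\<dots> \<le> C1 * (s + xI i + zI i)"
    unfolding mult.assoc[symmetric] 
    by (rule mult_right_mono[OF C1_ge]) (use s xI_nonneg[OF i] zI_nonneg[OF i] in auto)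
  finally show ?thesis .
qed

text \<open>The equation for \<open>z\<close> is stable backwards from its terminal value. The bound
  is stated for the sum over the players, since \<open>Q\<close> couples them and its norm controls
  only the sum.\<close>

lemma z_pointwise:
  assumes t: "t \<in> {0..T}"
  shows "(\<Sum>i\<in>{1..N}. (norm (z i t))\<^sup>2) \<le> C1 * (real N * s + (\<Sum>i\<in>{1..N}. xI i) + (\<Sum>i\<in>{1..N}. zI i))"
proof -
  let ?K1 = "2 * (K * exp (K * (r * k / l)))\<^sup>2"
  let ?Ri = "\<lambda>i. matrix_inv (R i)"
  let ?q = "\<lambda>i t. bmult N Q (\<lambda>j. x j t) i"
  let ?QI = "\<lambda>i. integral {0..T} (\<lambda>t. (norm (?q i t))\<^sup>2)"
  have one: "(norm (z i t))\<^sup>2 \<le> ?K1 * (s + 3 * (zI i + s + 4 * ?QI i) / \<nu>)" if i: "i \<in> {1..N}" for i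
  proof -
    \<comment> \<open>Time reversal makes the equation stable forwards, with matrix
      \<open>transpose (B i)\<close> and the terminal value of \<open>z\<close> as initial
      value.\<close>
    define y where "y = (\<lambda>u. z i (T - u))"
    define G where "G = (\<lambda>t. \<epsilon> * norm (z i t) + norm (h i t) + 2 * norm (?q i t))"
    define p where "p = (\<lambda>u. E i (T - u) *v (?Ri i *v y u) - \<psi> (T - u) *\<^sub>R y u + h i (T - u)
        + 2 *\<^sub>R ?q i (T - u))"
    have cG: "continuous_on {0..T} G" unfolding G_def by (intro continuous_intros ch cz cQx i)
    have rev: "continuous_on {0..T} (\<lambda>u. g (T - u))" if "continuous_on {0..T} g" for g :: "real \<Rightarrow> real"
      by (rule continuous_on_compose2[OF that]) (auto intro!: continuous_intros)
    have yd: "(y has_vector_derivative (transpose (B i) *v y u + p u)) (at u within {0..T})"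
      if u: "u \<in> {0..T}" for u
    proof -
      have Tu: "T - u \<in> {0..T}" using u by auto
      have "((\<lambda>u. T - u) has_vector_derivative -1) (at u within {0..T})"
        by (auto intro!: derivative_eq_intros simp flip: has_real_derivative_iff_has_vector_derivative)
      moreover have "(\<lambda>u. T - u) ` {0..T} \<subseteq> {0..T}" by auto
      ultimately have "(z i \<circ> (\<lambda>u. T - u) has_vector_derivative -1 *\<^sub>R
          (- (transpose (B i) *v z i (T - u) + E i (T - u) *v (?Ri i *v z i (T - u))) + \<psi> (T - u) *\<^sub>R z i (T - u)
            - h i (T - u) - 2 *\<^sub>R ?q i (T - u))) (at u within {0..T})"
        by (intro vector_diff_chain_within has_vector_derivative_within_subset[OF zd[OF i Tu]])
      then show ?thesis unfolding y_def p_def o_def by (simp add: algebra_simps)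
    qed
    have BT: "opnorm (mexp (u *\<^sub>R transpose (B i))) \<le> K * exp (- \<nu> * u)" if "0 \<le> u" for u
    proof -
      have "u *\<^sub>R transpose (B i) = transpose (u *\<^sub>R B i)"
        by (simp add: transpose_def vec_eq_iff)
      then show ?thesis using B[OF i that] by (simp add: mexp_transpose opnorm_transpose)
    qed
    have "(norm (y (T - t)))\<^sup>2 \<le> ?K1 * ((norm (y 0))\<^sup>2 + decay_conv \<nu> (\<lambda>u. (G (T - u))\<^sup>2) (T - t) / \<nu>)"
    proof (rule perturbed_linear_ode_bound_square[OF yd K BT, where k = "\<lambda>u. r * k * exp (- l * u)"])
      fix u assume u: "u \<in> {0..T}"
      then have Tu: "T - u \<in> {0..T}" by auto
      have "norm (E i (T - u) *v (?Ri i *v y u)) \<le> (k * exp (- l * (T - (T - u)))) * (r * norm (y u))"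
        by (intro order_trans[OF norm_mult_vec_le[OF El[OF i Tu]]] mult_left_mono norm_mult_vec_le Rr i)
          (use kl in simp)
      moreover have "norm (\<psi> (T - u) *\<^sub>R y u) \<le> \<epsilon> * norm (y u)"
        using \<psi>[OF Tu] by (simp add: mult_right_mono)
      ultimately show "norm (p u) \<le> r * k * exp (- l * u) * norm (y u) + G (T - u)"
        unfolding G_def p_def y_def
        by (intro order_trans[OF norm_triangle_ineq] order_trans[OF add_right_mono[OF norm_triangle_ineq]]
          order_trans[OF add_right_mono[OF add_right_mono[OF norm_triangle_ineq4]]]) (simp add: algebra_simps)
      show "0 \<le> r * k * exp (- l * u)" using r kl by simp
      show "0 \<le> G (T - u)" unfolding G_def using \<epsilon> by simp
    next
      have "integral {0..T} (\<lambda>u. r * k * exp (- l * u)) = r * k * integral {0..T} (\<lambda>u. exp (- l * u))"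
        by (simp only: integral_mult_right)
      also have "\<dots> \<le> r * k * (1 / l)"
        by (rule mult_left_mono[OF integral_exp_decay_le]) (use kl r T in auto)
      finally show "integral {0..T} (\<lambda>u. r * k * exp (- l * u)) \<le> r * k / l" by simp
      show "T - t \<in> {0..T}" using t by auto
    qed (assumption | rule \<nu> | intro continuous_intros rev cG)+
    also have "\<dots> \<le> ?K1 * (s + 3 * (zI i + s + 4 * ?QI i) / \<nu>)"
    proof (intro mult_left_mono add_mono divide_right_mono)
      show "(norm (y 0))\<^sup>2 \<le> s" using zT[OF i] by (simp add: y_def)
      have "decay_conv \<nu> (\<lambda>u. (G (T - u))\<^sup>2) (T - t) \<le> integral {0..T} (\<lambda>u. (G (T - u))\<^sup>2)"
        by (rule decay_conv_le_integral) (use \<nu> t in \<open>auto intro!: continuous_intros rev cG\<close>)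
      also have "\<dots> = integral {0..T} (\<lambda>u. (G u)\<^sup>2)"
        by (rule integral_reverse[OF T]) (intro continuous_intros cG)
      also have "\<dots> \<le> 3 * (integral {0..T} (\<lambda>t. (\<epsilon> * norm (z i t))\<^sup>2) + integral {0..T} (\<lambda>t. (norm (h i t))\<^sup>2)
          + integral {0..T} (\<lambda>t. (2 * norm (?q i t))\<^sup>2))"
        unfolding G_def by (rule integral_three_squares) (intro continuous_intros cz ch cQx i)+
      also have "integral {0..T} (\<lambda>t. (\<epsilon> * norm (z i t))\<^sup>2) = \<epsilon>\<^sup>2 * zI i"
        unfolding zI_def by (simp only: power_mult_distrib integral_mult_right)
      also have "integral {0..T} (\<lambda>t. (2 * norm (?q i t))\<^sup>2) = 2\<^sup>2 * ?QI i"
        by (simp only: power_mult_distrib integral_mult_right)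
      also have "\<epsilon>\<^sup>2 * zI i \<le> zI i"
        using \<epsilon> zI_nonneg[OF i] by (simp add: mult_left_le_one_le power_le_one)
      finally show "decay_conv \<nu> (\<lambda>u. (G (T - u))\<^sup>2) (T - t) \<le> 3 * (zI i + s + 4 * ?QI i)" using hs[OF i] by simp
    qed (use \<nu> in auto)
    finally show ?thesis by (simp add: y_def)
  qed
  let ?X = "\<Sum>i\<in>{1..N}. xI i" and ?Z = "\<Sum>i\<in>{1..N}. zI i" and ?S = "real N * s"
  have X0: "0 \<le> ?X" "0 \<le> ?Z" "0 \<le> ?S" using s xI_nonneg zI_nonneg by (auto intro!: sum_nonneg)
  have QI: "(\<Sum>i\<in>{1..N}. ?QI i) \<le> q\<^sup>2 * ?X"
  proof -
    have "(\<Sum>i\<in>{1..N}. ?QI i) = integral {0..T} (\<lambda>t. \<Sum>i\<in>{1..N}. (norm (?q i t))\<^sup>2)"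
      by (rule Henstock_Kurzweil_Integration.integral_sum[symmetric]) (auto intro!: integrable_continuous_real continuous_intros cQx)
    also have "\<dots> \<le> integral {0..T} (\<lambda>t. q\<^sup>2 * (\<Sum>i\<in>{1..N}. (norm (x i t))\<^sup>2))"
      by (rule integral_le) (intro integrable_continuous_real continuous_intros cQx cx Qq; simp)+
    also have "\<dots> = q\<^sup>2 * integral {0..T} (\<lambda>t. \<Sum>i\<in>{1..N}. (norm (x i t))\<^sup>2)"
      by (simp only: integral_mult_right)
    also have "integral {0..T} (\<lambda>t. \<Sum>i\<in>{1..N}. (norm (x i t))\<^sup>2) = ?X"
      unfolding xI_def by (rule Henstock_Kurzweil_Integration.integral_sum) (auto intro!: integrable_continuous_real continuous_intros cx)
    finally show ?thesis .
  qed
  have "(\<Sum>i\<in>{1..N}. (norm (z i t))\<^sup>2) \<le> (\<Sum>i\<in>{1..N}. ?K1 * (s + 3 * (zI i + s + 4 * ?QI i) / \<nu>))"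
    by (rule sum_mono) (rule one)
  also have "\<dots> = ?K1 * (?S + 3 * (?Z + ?S + 4 * (\<Sum>i\<in>{1..N}. ?QI i)) / \<nu>)"
    by (simp add: sum.distrib sum_distrib_left sum_divide_distrib[symmetric] flip: sum_distrib_left)
  also have "\<dots> \<le> ?K1 * (?S + 3 * (?Z + ?S + 4 * (q\<^sup>2 * ?X)) / \<nu>)"
    by (intro mult_left_mono add_left_mono divide_right_mono QI) (use \<nu> in auto)
  also have "\<dots> \<le> ?K1 * ((1 + 3 * (1 + 4 * q\<^sup>2) / \<nu>) * (?S + ?X + ?Z))"
  proof (rule mult_left_mono)
    have "0 \<le> 3 * (?X + 4 * q\<^sup>2 * (?S + ?Z)) / \<nu> + ?X + ?Z"
      using X0 \<nu> by simp
    moreover have "(1 + 3 * (1 + 4 * q\<^sup>2) / \<nu>) * (?S + ?X + ?Z) - (?S + 3 * (?Z + ?S + 4 * (q\<^sup>2 * ?X)) / \<nu>)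
        = 3 * (?X + 4 * q\<^sup>2 * (?S + ?Z)) / \<nu> + ?X + ?Z"
      using \<nu> by (simp add: field_simps)
    ultimately show "?S + 3 * (?Z + ?S + 4 * (q\<^sup>2 * ?X)) / \<nu> \<le> (1 + 3 * (1 + 4 * q\<^sup>2) / \<nu>) * (?S + ?X + ?Z)"
      by linarith
  qed simp
  also have "\<dots> \<le> C1 * (?S + ?X + ?Z)"
    unfolding mult.assoc[symmetric]
    by (rule mult_right_mono[OF C1_ge]) (use X0 in auto)
  finally show ?thesis .
qed

end

context turnpike_system
begin

abbreviation "X_tot \<equiv> \<Sum>i\<in>{1..N}. xI i"
abbreviation "Z_tot \<equiv> \<Sum>i\<in>{1..N}. zI i"
abbreviation "R_tot \<equiv> \<Sum>i\<in>{1..N}. ZI i"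

text \<open>Integrate the derivative of <x, z>. The form of \<open>Q\<close> contributes at most
  \<gamma> |x|^2. At each end one factor is given data and the other is not; Young's inequality puts
  1/\<delta> on the data and \<delta> on the unknown value, which the pointwise estimates bound by
  integrals. The parameter \<delta> is separated from \<epsilon> so that it can be fixed before
  \<epsilon>.\<close>

lemma energy_estimate:
  assumes \<delta>: "\<epsilon> \<le> \<delta>"
  shows "R_tot \<le> \<gamma> * X_tot + (2 + 2 * C1) * \<delta> * (X_tot + Z_tot) + (1 / \<delta> + 2 * \<delta> * C1) * (real N * s)"
proof -
  have dp: "0 < \<delta>" using \<epsilon> \<delta> by simp
  let ?q = "\<lambda>i t. bmult N Q (\<lambda>j. x j t) i"
  let ?S = "real N * s"
  have one: "ZI i \<le> \<delta> * C1 * (s + xI i + zI i) + s / (4 * \<delta>) + (\<delta> * (norm (z i 0))\<^sup>2 + s / (4 * \<delta>))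
      + 2 * - integral {0..T} (\<lambda>t. x i t \<bullet> ?q i t) + 2 * \<delta> * (xI i + zI i) + s / (2 * \<delta>)"
    if i: "i \<in> {1..N}" for i
  proof -
    let ?Ri = "matrix_inv (R i)"
    define d where "d = (\<lambda>t. 2 * \<psi> t * (x i t \<bullet> z i t) + f i t \<bullet> z i t - z i t \<bullet> (?Ri *v z i t)
      - x i t \<bullet> h i t - 2 * (x i t \<bullet> ?q i t))"
    have dd: "((\<lambda>t. x i t \<bullet> z i t) has_vector_derivative d t) (at t within {0..T})" if t: "t \<in> {0..T}" for t
    proof -
      have sR: "msym ?Ri" using spd_matrix_inv[OF R[OF i]] by (simp add: spd_def)
      \<comment> \<open>The feedback terms of the two equations cancel in <x, z>', because
        \<open>E\<close> and the inverse of \<open>R\<close> are symmetric.\<close>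
      have "(?Ri *v (E i t *v x i t)) \<bullet> z i t = x i t \<bullet> (E i t *v (?Ri *v z i t))"
        by (simp add: msym_inner[OF sR] msym_inner[OF sE[OF i t]])
      then show ?thesis
        unfolding d_def
        by (intro has_vector_derivative_eq_rhs[OF has_vector_derivative_inner[OF xd[OF i t] zd[OF i t]]])
          (simp add: inner_add_left inner_add_right inner_diff_left inner_diff_right
            inner_matrix_vector_left[of "B i"] inner_commute[of "z i t" "?Ri *v z i t"])
    qed
    have int: "integral {0..T} d = x i T \<bullet> z i T - x i 0 \<bullet> z i 0"
      using fundamental_theorem_of_calculus[OF T dd] by (rule integral_unique)
    have cd: "continuous_on {0..T} d" unfolding d_def
      by (intro continuous_intros c\<psi> cx cz cf ch cQx i)
    have "ZI i \<le> integral {0..T} (\<lambda>t. - d t + (2 * \<delta> * (norm (x i t))\<^sup>2 + 2 * \<delta> * (norm (z i t))\<^sup>2)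
        + (1 / (4 * \<delta>) * (norm (f i t))\<^sup>2 + 1 / (4 * \<delta>) * (norm (h i t))\<^sup>2) + - 2 * (x i t \<bullet> ?q i t))"
      unfolding ZI_def
    proof (rule integral_le)
      fix t assume t: "t \<in> {0..T}"
      have "2 * \<psi> t * (x i t \<bullet> z i t) \<le> \<bar>2 * \<psi> t * (x i t \<bullet> z i t)\<bar>" by (rule abs_ge_self)
      also have "\<dots> = \<bar>\<psi> t\<bar> * \<bar>2 * (x i t \<bullet> z i t)\<bar>" by (simp add: abs_mult)
      also have "\<dots> \<le> \<delta> * ((norm (x i t))\<^sup>2 + (norm (z i t))\<^sup>2)"
      proof (rule mult_mono)
        show "\<bar>\<psi> t\<bar> \<le> \<delta>" using \<psi>[OF t] \<delta> by simp
        have "\<bar>2 * (x i t \<bullet> z i t)\<bar> \<le> 2 * (norm (x i t) * norm (z i t))"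
          using Cauchy_Schwarz_ineq2[of "x i t" "z i t"] by (simp add: abs_mult)
        also have "\<dots> \<le> (norm (x i t))\<^sup>2 + (norm (z i t))\<^sup>2"
          using sum_squares_bound[of "norm (x i t)" "norm (z i t)"] by simp
        finally show "\<bar>2 * (x i t \<bullet> z i t)\<bar> \<le> (norm (x i t))\<^sup>2 + (norm (z i t))\<^sup>2" .
      qed (use dp in auto)
      finally have 1: "2 * \<psi> t * (x i t \<bullet> z i t) \<le> \<delta> * ((norm (x i t))\<^sup>2 + (norm (z i t))\<^sup>2)" .
      have 2: "f i t \<bullet> z i t \<le> \<delta> * (norm (z i t))\<^sup>2 + (norm (f i t))\<^sup>2 / (4 * \<delta>)"
        by (rule inner_young[OF dp])
      have 3: "- (x i t \<bullet> h i t) \<le> \<delta> * (norm (x i t))\<^sup>2 + (norm (h i t))\<^sup>2 / (4 * \<delta>)"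
        using inner_young[OF dp, of "- h i t" "x i t"] by (simp add: inner_commute)
      show "z i t \<bullet> (?Ri *v z i t) \<le> - d t + (2 * \<delta> * (norm (x i t))\<^sup>2 + 2 * \<delta> * (norm (z i t))\<^sup>2)
        + (1 / (4 * \<delta>) * (norm (f i t))\<^sup>2 + 1 / (4 * \<delta>) * (norm (h i t))\<^sup>2) + - 2 * (x i t \<bullet> ?q i t)"
        unfolding d_def using 1 2 3 by (simp add: algebra_simps)
    qed (intro integrable_continuous_real continuous_intros cd cx cz cf ch cQx i)+
    also have "\<dots> = - integral {0..T} d + (2 * \<delta> * xI i + 2 * \<delta> * zI i)
        + (1 / (4 * \<delta>) * integral {0..T} (\<lambda>t. (norm (f i t))\<^sup>2) + 1 / (4 * \<delta>) * integral {0..T} (\<lambda>t. (norm (h i t))\<^sup>2))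
        + - 2 * integral {0..T} (\<lambda>t. x i t \<bullet> ?q i t)"
    proof -
      let ?a = "\<lambda>t. - d t" and ?b = "\<lambda>t. 2 * \<delta> * (norm (x i t))\<^sup>2" and ?c = "\<lambda>t. 2 * \<delta> * (norm (z i t))\<^sup>2"
        and ?e = "\<lambda>t. 1 / (4 * \<delta>) * (norm (f i t))\<^sup>2" and ?g = "\<lambda>t. 1 / (4 * \<delta>) * (norm (h i t))\<^sup>2"
        and ?k = "\<lambda>t. - 2 * (x i t \<bullet> ?q i t)"
      have I: "?a integrable_on {0..T}" "?b integrable_on {0..T}" "?c integrable_on {0..T}"
        "?e integrable_on {0..T}" "?g integrable_on {0..T}" "?k integrable_on {0..T}"
        by (intro integrable_continuous_real continuous_intros cd cx cz cf ch cQx i)+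
      have "((\<lambda>t. ?a t + (?b t + ?c t) + (?e t + ?g t) + ?k t) has_integral
          integral {0..T} ?a + (integral {0..T} ?b + integral {0..T} ?c)
          + (integral {0..T} ?e + integral {0..T} ?g) + integral {0..T} ?k) {0..T}"
        by (intro has_integral_add integrable_integral I)
      then show ?thesis
        unfolding xI_def zI_def by (simp only: integral_unique integral_mult_right integral_neg)
    qed
    also have "\<dots> \<le> - integral {0..T} d + (2 * \<delta> * xI i + 2 * \<delta> * zI i)
        + (1 / (4 * \<delta>) * s + 1 / (4 * \<delta>) * s) + - 2 * integral {0..T} (\<lambda>t. x i t \<bullet> ?q i t)"
      by (intro add_mono mult_left_mono fs hs i order_refl) (use dp in auto)
    finally have main: "ZI i \<le> x i 0 \<bullet> z i 0 - x i T \<bullet> z i T + (2 * \<delta> * xI i + 2 * \<delta> * zI i)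
        + (1 / (4 * \<delta>) * s + 1 / (4 * \<delta>) * s) + - 2 * integral {0..T} (\<lambda>t. x i t \<bullet> ?q i t)"
      unfolding int by simp
    have "x i 0 \<bullet> z i 0 \<le> \<delta> * (norm (z i 0))\<^sup>2 + (norm (x i 0))\<^sup>2 / (4 * \<delta>)" by (rule inner_young[OF dp])
    also have "(norm (x i 0))\<^sup>2 / (4 * \<delta>) \<le> s / (4 * \<delta>)"
      by (rule divide_right_mono[OF x0[OF i]]) (use dp in simp)
    finally have b0: "x i 0 \<bullet> z i 0 \<le> \<delta> * (norm (z i 0))\<^sup>2 + s / (4 * \<delta>)" by simp
    have "- (x i T \<bullet> z i T) \<le> \<delta> * (norm (x i T))\<^sup>2 + (norm (z i T))\<^sup>2 / (4 * \<delta>)"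
      using inner_young[OF dp, of "- z i T" "x i T"] by (simp add: inner_commute)
    also have "(norm (z i T))\<^sup>2 / (4 * \<delta>) \<le> s / (4 * \<delta>)"
      by (rule divide_right_mono[OF zT[OF i]]) (use dp in simp)
    also have "\<delta> * (norm (x i T))\<^sup>2 \<le> \<delta> * (C1 * (s + xI i + zI i))"
      by (rule mult_left_mono[OF x_pointwise[OF i]]) (use dp T in auto)
    finally have bT: "- (x i T \<bullet> z i T) \<le> \<delta> * (C1 * (s + xI i + zI i)) + s / (4 * \<delta>)" by simp
    have e: "1 / (4 * \<delta>) * s + 1 / (4 * \<delta>) * s = s / (2 * \<delta>)" by simp
    show ?thesis using main b0 bT unfolding e by (simp only: distrib_left mult.assoc)
  qed
  have Qs: "(\<Sum>i\<in>{1..N}. - integral {0..T} (\<lambda>t. x i t \<bullet> ?q i t)) \<le> \<gamma> / 2 * X_tot"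
  proof -
    have "- (\<gamma> / 2) * X_tot = - (\<gamma> / 2) * integral {0..T} (\<lambda>t. \<Sum>i\<in>{1..N}. (norm (x i t))\<^sup>2)"
      unfolding xI_def
      by (subst Henstock_Kurzweil_Integration.integral_sum) (auto intro!: integrable_continuous_real continuous_intros cx)
    also have "\<dots> = integral {0..T} (\<lambda>t. - (\<gamma> / 2) * (\<Sum>i\<in>{1..N}. (norm (x i t))\<^sup>2))"
      by (simp only: integral_mult_right)
    also have "\<dots> \<le> integral {0..T} (\<lambda>t. \<Sum>i\<in>{1..N}. x i t \<bullet> ?q i t)"
      by (rule integral_le) (intro integrable_continuous_real continuous_intros cQx cx Q\<gamma>; simp)+
    also have "\<dots> = (\<Sum>i\<in>{1..N}. integral {0..T} (\<lambda>t. x i t \<bullet> ?q i t))"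
      by (rule Henstock_Kurzweil_Integration.integral_sum)
        (auto intro!: integrable_continuous_real continuous_intros cx cQx)
    finally show ?thesis by (simp add: sum_negf)
  qed
  have zs: "(\<Sum>i\<in>{1..N}. (norm (z i 0))\<^sup>2) \<le> C1 * (?S + X_tot + Z_tot)"
    by (rule z_pointwise) (use T in simp)
  have "R_tot \<le> (\<Sum>i\<in>{1..N}. \<delta> * C1 * (s + xI i + zI i) + s / (4 * \<delta>) + (\<delta> * (norm (z i 0))\<^sup>2 + s / (4 * \<delta>))
      + 2 * - integral {0..T} (\<lambda>t. x i t \<bullet> ?q i t) + 2 * \<delta> * (xI i + zI i) + s / (2 * \<delta>))"
    by (rule sum_mono) (rule one)
  also have "\<dots> = \<delta> * C1 * (?S + X_tot + Z_tot) + ?S / (4 * \<delta>) + (\<delta> * (\<Sum>i\<in>{1..N}. (norm (z i 0))\<^sup>2) + ?S / (4 * \<delta>))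
      + 2 * (\<Sum>i\<in>{1..N}. - integral {0..T} (\<lambda>t. x i t \<bullet> ?q i t)) + 2 * \<delta> * (X_tot + Z_tot) + ?S / (2 * \<delta>)"
    by (simp only: sum.distrib sum_distrib_left[symmetric] sum_constant card_atLeastAtMost) simp
  also have "\<dots> \<le> \<delta> * C1 * (?S + X_tot + Z_tot) + ?S / (4 * \<delta>) + (\<delta> * (C1 * (?S + X_tot + Z_tot)) + ?S / (4 * \<delta>))
      + 2 * (\<gamma> / 2 * X_tot) + 2 * \<delta> * (X_tot + Z_tot) + ?S / (2 * \<delta>)"
    by (intro add_mono mult_left_mono zs Qs order_refl) (use dp in auto)
  also have "\<dots> = \<gamma> * X_tot + (2 + 2 * C1) * \<delta> * (X_tot + Z_tot) + (1 / \<delta> + 2 * \<delta> * C1) * ?S"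
    using dp by (simp add: field_simps)
  finally show ?thesis .
qed

lemma inverse_quadratic_le:
  assumes i: "i \<in> {1..N}"
  shows "g \<bullet> (R i *v g) \<le> (norm g)\<^sup>2 / cR"
proof -
  let ?y = "R i *v g"
  have "cR * (norm ?y)\<^sup>2 \<le> ?y \<bullet> g" using RcR[OF i, of ?y] by (simp add: spd_inverse_vec[OF R[OF i]])
  also have "\<dots> \<le> norm ?y * norm g" by (rule norm_cauchy_schwarz)
  finally have "norm ?y * (cR * norm ?y) \<le> norm ?y * norm g" by (simp add: power2_eq_square mult_ac)
  then have n: "norm ?y \<le> norm g / cR"
    using cR by (cases "norm ?y = 0") (auto simp: field_simps)
  have "g \<bullet> ?y \<le> norm g * (norm g / cR)"
    by (rule order_trans[OF norm_cauchy_schwarz mult_left_mono[OF n]]) simp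
  then show ?thesis by (simp add: power2_eq_square)
qed

text \<open>Coercivity requires the initial value 0, so the free motion \<open>e\<close> is
  subtracted. The rest is driven by v = g - R^-1 z, and <v, R v> is essentially <z, R^-1 z>.
  Splitting off \<open>e\<close> and \<open>g\<close> costs a factor 5/4 each; with the gain 1/2
  this gives 25/32, still below 1.\<close>

lemma coercive_estimate:
  assumes \<delta>: "\<epsilon> \<le> \<delta>"
  shows "\<gamma> * X_tot \<le> 25 / 32 * R_tot + C2 * (\<delta> * X_tot + real N * s)"
proof -
  have one: "\<gamma> * xI i \<le> 25 / 32 * ZI i + C2 * (\<delta> * xI i + s)" if i: "i \<in> {1..N}" for i
  proof -
    let ?Ri = "matrix_inv (R i)"
    define e where "e = (\<lambda>t. mexp (t *\<^sub>R B i) *v x i 0)"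
    define y where "y = (\<lambda>t. x i t - e t)"
    \<comment> \<open>The last summand is the feedback acting on the free motion, which the equation
      for \<open>y\<close> has to see as an external input.\<close>
    define g where "g = (\<lambda>t. \<psi> t *\<^sub>R x i t + f i t + ?Ri *v (E i t *v e t))"
    define v where "v = (\<lambda>t. g t - ?Ri *v z i t)"
    have ce: "continuous_on {0..T} e" unfolding e_def by (intro continuous_intros)
    have cy: "continuous_on {0..T} y" unfolding y_def by (intro continuous_intros ce cx i)
    have cg: "continuous_on {0..T} g" unfolding g_def by (intro continuous_intros ce cx cf c\<psi> cE i)
    have cv: "continuous_on {0..T} v" unfolding v_def by (intro continuous_intros cg cz i)
    have ed: "(e has_vector_derivative (B i *v e t)) (at t within S)" for t S
      unfolding e_def
      using has_vector_derivative_mv[OF mexp_has_vector_derivative[of "B i" t S] has_vector_derivative_const[of "x i 0"]]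
      by (simp add: matrix_vector_mul_assoc)
    have yd: "(y has_vector_derivative (B i *v y t + ?Ri *v (E i t *v y t) + v t)) (at t within {0..T})"
      if t: "t \<in> {0..T}" for t
      using has_vector_derivative_diff[OF xd[OF i t] ed[of t "{0..T}"]]
      unfolding y_def[symmetric]
      by (rule has_vector_derivative_eq_rhs) (simp add: y_def v_def g_def matrix_vector_simps)
    have e_le: "norm (e t) \<le> K * norm (x i 0) * exp (- \<nu> * t)" if t: "t \<in> {0..T}" for t
      unfolding e_def using norm_mult_vec_le[OF B[OF i], of t "x i 0"] t by (simp add: mult_ac)
    have Ie: "integral {0..T} (\<lambda>t. (norm (e t))\<^sup>2) \<le> K\<^sup>2 * s / \<nu>"
    proof -
      have "integral {0..T} (\<lambda>t. (norm (e t))\<^sup>2) \<le> integral {0..T} (\<lambda>t. K\<^sup>2 * s * exp (- \<nu> * t))"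
      proof (rule integral_le)
        fix t assume t: "t \<in> {0..T}"
        have "(norm (e t))\<^sup>2 \<le> (K * norm (x i 0) * exp (- \<nu> * t))\<^sup>2"
          by (rule power_mono[OF e_le[OF t]]) simp
        also have "\<dots> = K\<^sup>2 * (norm (x i 0))\<^sup>2 * (exp (- \<nu> * t) * exp (- \<nu> * t))"
          by (simp add: power2_eq_square)
        also have "\<dots> \<le> K\<^sup>2 * s * (1 * exp (- \<nu> * t))"
          by (intro mult_mono x0 i order_refl) (use t \<nu> s in \<open>auto intro!: mult_nonneg_nonneg\<close>)
        finally show "(norm (e t))\<^sup>2 \<le> K\<^sup>2 * s * exp (- \<nu> * t)" by simp
      qed (intro integrable_continuous_real continuous_intros ce)+
      also have "\<dots> = K\<^sup>2 * s * integral {0..T} (\<lambda>t. exp (- \<nu> * t))" by (simp only: integral_mult_right)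
      also have "\<dots> \<le> K\<^sup>2 * s * (1 / \<nu>)"
        by (rule mult_left_mono[OF integral_exp_decay_le[OF \<nu> T]]) (use s in simp)
      finally show ?thesis by simp
    qed
    have Ig: "integral {0..T} (\<lambda>t. (norm (g t))\<^sup>2) \<le> 3 * (\<delta> * xI i + s + r\<^sup>2 * k\<^sup>2 * (K\<^sup>2 * s / \<nu>))"
    proof -
      have "integral {0..T} (\<lambda>t. (norm (g t))\<^sup>2)
          \<le> integral {0..T} (\<lambda>t. (\<epsilon> * norm (x i t) + norm (f i t) + r * k * norm (e t))\<^sup>2)"
      proof (rule integral_le)
        fix t assume t: "t \<in> {0..T}"
        have El': "opnorm (E i t) \<le> k"
        proof (rule order_trans[OF El[OF i t]])
          show "k * exp (- l * (T - t)) \<le> k" using kl t by (simp add: mult_le_cancel_left1)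
        qed
        have "norm (?Ri *v (E i t *v e t)) \<le> r * (k * norm (e t))"
          by (intro order_trans[OF norm_mult_vec_le[OF Rr[OF i]]] mult_left_mono norm_mult_vec_le El')
            (use r in simp)
        moreover have "norm (\<psi> t *\<^sub>R x i t) \<le> \<epsilon> * norm (x i t)"
          using \<psi>[OF t] by (simp add: mult_right_mono)
        moreover have "norm (g t) \<le> norm (\<psi> t *\<^sub>R x i t) + norm (f i t) + norm (?Ri *v (E i t *v e t))"
          unfolding g_def by (intro order_trans[OF norm_triangle_ineq] add_right_mono norm_triangle_ineq)
        ultimately have "norm (g t) \<le> \<epsilon> * norm (x i t) + norm (f i t) + r * k * norm (e t)"
          unfolding mult.assoc by linarith
        then show "(norm (g t))\<^sup>2 \<le> (\<epsilon> * norm (x i t) + norm (f i t) + r * k * norm (e t))\<^sup>2"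
          by (rule power_mono) simp
      qed (intro integrable_continuous_real continuous_intros cg cx cf ce i)+
      also have "\<dots> \<le> 3 * (integral {0..T} (\<lambda>t. (\<epsilon> * norm (x i t))\<^sup>2) + integral {0..T} (\<lambda>t. (norm (f i t))\<^sup>2)
          + integral {0..T} (\<lambda>t. (r * k * norm (e t))\<^sup>2))"
        by (rule integral_three_squares) (intro continuous_intros cx cf ce i)+
      also have "integral {0..T} (\<lambda>t. (\<epsilon> * norm (x i t))\<^sup>2) = \<epsilon>\<^sup>2 * xI i"
        unfolding xI_def by (simp only: power_mult_distrib integral_mult_right)
      also have "integral {0..T} (\<lambda>t. (r * k * norm (e t))\<^sup>2) = r\<^sup>2 * k\<^sup>2 * integral {0..T} (\<lambda>t. (norm (e t))\<^sup>2)"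
        by (simp only: power_mult_distrib integral_mult_right)
      also have "3 * (\<epsilon>\<^sup>2 * xI i + integral {0..T} (\<lambda>t. (norm (f i t))\<^sup>2) + r\<^sup>2 * k\<^sup>2 * integral {0..T} (\<lambda>t. (norm (e t))\<^sup>2))
          \<le> 3 * (\<delta> * xI i + s + r\<^sup>2 * k\<^sup>2 * (K\<^sup>2 * s / \<nu>))"
      proof (intro mult_left_mono add_mono fs i Ie mult_right_mono xI_nonneg)
        have "\<epsilon>\<^sup>2 \<le> \<epsilon>" using \<epsilon> by (simp add: power2_eq_square mult_left_le)
        then show "\<epsilon>\<^sup>2 \<le> \<delta>" using \<delta> by simp
      qed auto
      finally show ?thesis .
    qed
    have Iv: "integral {0..T} (\<lambda>t. v t \<bullet> (R i *v v t)) \<le> 5 / 4 * ZI i + 5 / cR * integral {0..T} (\<lambda>t. (norm (g t))\<^sup>2)"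
    proof -
      have "integral {0..T} (\<lambda>t. v t \<bullet> (R i *v v t))
          \<le> integral {0..T} (\<lambda>t. 5 / 4 * (z i t \<bullet> (?Ri *v z i t)) + 5 / cR * (norm (g t))\<^sup>2)"
      proof (rule integral_le)
        fix t
        have "v t \<bullet> (R i *v v t) = (- (?Ri *v z i t) + g t) \<bullet> (R i *v (- (?Ri *v z i t) + g t))"
          by (simp add: v_def)
        also have "\<dots> \<le> (1 + 1 / 4) * ((- (?Ri *v z i t)) \<bullet> (R i *v (- (?Ri *v z i t))))
            + (1 + 1 / (1 / 4)) * (g t \<bullet> (R i *v g t))"
          by (rule psd_weighted_square[OF spd_imp_psd[OF R[OF i]]]) simp
        also have "(- (?Ri *v z i t)) \<bullet> (R i *v (- (?Ri *v z i t))) = z i t \<bullet> (?Ri *v z i t)"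
          by (simp add: matrix_vector_simps spd_inverse_vec[OF R[OF i]] inner_commute)
        finally show "v t \<bullet> (R i *v v t) \<le> 5 / 4 * (z i t \<bullet> (?Ri *v z i t)) + 5 / cR * (norm (g t))\<^sup>2"
          using inverse_quadratic_le[OF i, of "g t"] by simp
      qed (intro integrable_continuous_real continuous_intros cg cv cz i)+
      also have "\<dots> = integral {0..T} (\<lambda>t. 5 / 4 * (z i t \<bullet> (?Ri *v z i t))) + integral {0..T} (\<lambda>t. 5 / cR * (norm (g t))\<^sup>2)"
        by (rule Henstock_Kurzweil_Integration.integral_add) (intro integrable_continuous_real continuous_intros cg cz i)+
      also have "\<dots> = 5 / 4 * ZI i + 5 / cR * integral {0..T} (\<lambda>t. (norm (g t))\<^sup>2)"
        unfolding ZI_def by (simp only: integral_mult_right)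
      finally show ?thesis .
    qed
    have "y 0 = 0" by (simp add: y_def e_def mexp_0)
    from coer[OF i yd this cv]
    have Iy: "\<gamma> * integral {0..T} (\<lambda>t. (norm (y t))\<^sup>2) \<le> 1 / 2 * integral {0..T} (\<lambda>t. v t \<bullet> (R i *v v t))" .
    have "xI i \<le> 5 / 4 * integral {0..T} (\<lambda>t. (norm (y t))\<^sup>2) + 5 * integral {0..T} (\<lambda>t. (norm (e t))\<^sup>2)"
    proof -
      have "xI i \<le> integral {0..T} (\<lambda>t. 5 / 4 * (norm (y t))\<^sup>2 + 5 * (norm (e t))\<^sup>2)"
        unfolding xI_def
      proof (rule integral_le)
        fix t
        have "norm (x i t) \<le> norm (y t) + norm (e t)"
          using norm_triangle_ineq[of "y t" "e t"] by (simp add: y_def)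
        then have "(norm (x i t))\<^sup>2 \<le> (norm (y t) + norm (e t))\<^sup>2" by (rule power_mono) simp
        also have "\<dots> \<le> 5 / 4 * (norm (y t))\<^sup>2 + 5 * (norm (e t))\<^sup>2"
          using zero_le_power2[of "norm (y t) - 4 * norm (e t)"] by (simp add: power2_eq_square algebra_simps)
        finally show "(norm (x i t))\<^sup>2 \<le> 5 / 4 * (norm (y t))\<^sup>2 + 5 * (norm (e t))\<^sup>2" .
      qed (intro integrable_continuous_real continuous_intros cx cy ce i)+
      also have "\<dots> = integral {0..T} (\<lambda>t. 5 / 4 * (norm (y t))\<^sup>2) + integral {0..T} (\<lambda>t. 5 * (norm (e t))\<^sup>2)"
        by (rule Henstock_Kurzweil_Integration.integral_add) (intro integrable_continuous_real continuous_intros cy ce)+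
      finally show ?thesis by (simp only: integral_mult_right)
    qed
    then have "\<gamma> * xI i \<le> \<gamma> * (5 / 4 * integral {0..T} (\<lambda>t. (norm (y t))\<^sup>2) + 5 * integral {0..T} (\<lambda>t. (norm (e t))\<^sup>2))"
      by (rule mult_left_mono) (use \<gamma> in simp)
    also have "\<dots> = 5 / 4 * (\<gamma> * integral {0..T} (\<lambda>t. (norm (y t))\<^sup>2)) + 5 * \<gamma> * integral {0..T} (\<lambda>t. (norm (e t))\<^sup>2)"
      by (simp add: algebra_simps)
    also have "\<dots> \<le> 5 / 4 * (1 / 2 * (5 / 4 * ZI i + 5 / cR * (3 * (\<delta> * xI i + s + r\<^sup>2 * k\<^sup>2 * (K\<^sup>2 * s / \<nu>)))))
        + 5 * \<gamma> * (K\<^sup>2 * s / \<nu>)"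
      by (intro add_mono mult_left_mono order_trans[OF Iy] order_trans[OF Iv] Ig Ie order_refl) (use cR \<gamma> in auto)
    also have "\<dots> = 25 / 32 * ZI i + (75 / (8 * cR) * (\<delta> * xI i) + C2 * s)"
      unfolding tp_C2_def using cR \<nu> by (simp add: field_simps)
    also have "\<dots> \<le> 25 / 32 * ZI i + (C2 * (\<delta> * xI i) + C2 * s)"
    proof (intro add_left_mono add_right_mono mult_right_mono)
      show "75 / (8 * cR) \<le> C2"
        unfolding tp_C2_def using cR \<nu> \<gamma> by (simp add: distrib_left)
      show "0 \<le> \<delta> * xI i" using xI_nonneg[OF i] \<epsilon> \<delta> by simp
    qed
    finally show ?thesis by (simp add: distrib_left)
  qed
  have "\<gamma> * X_tot = (\<Sum>i\<in>{1..N}. \<gamma> * xI i)" by (rule sum_distrib_left)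
  also have "\<dots> \<le> (\<Sum>i\<in>{1..N}. 25 / 32 * ZI i + C2 * (\<delta> * xI i + s))"
    by (rule sum_mono) (rule one)
  also have "\<dots> = 25 / 32 * R_tot + C2 * (\<delta> * X_tot + real N * s)"
    by (simp only: sum.distrib sum_distrib_left[symmetric] sum_constant card_atLeastAtMost) simp
  finally show ?thesis .
qed

lemma Z_tot_le: "cR * Z_tot \<le> R_tot"
  unfolding sum_distrib_left
proof (rule sum_mono)
  fix i assume i: "i \<in> {1..N}"
  have "cR * zI i = integral {0..T} (\<lambda>t. cR * (norm (z i t))\<^sup>2)"
    unfolding zI_def by (simp only: integral_mult_right)
  also have "\<dots> \<le> ZI i"
    unfolding ZI_def
    by (rule integral_le) (intro integrable_continuous_real continuous_intros cz i RcR)+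
  finally show "cR * zI i \<le> ZI i" .
qed

end

text \<open>Pure arithmetic on a = int |x|^2, \<zeta> = int |z|^2 and Z = int <z, R^-1 z>. Inserting
  the second inequality into the first leaves 7/32 of Z on the left; \<delta> is chosen so small
  that its terms consume at most 3/32, and 1/8 remains. The constants depend only on
  \<open>C1\<close>, \<open>C2\<close>, \<gamma> and \<open>cR\<close>.\<close>

lemma turnpike_absorption:
  fixes C1 C2 \<gamma> cR :: real
  assumes "0 \<le> C1" "0 \<le> C2" "0 < \<gamma>" "0 < cR"
  obtains \<delta> C where "0 < \<delta>" "\<delta> \<le> 1" "0 \<le> C"
    "\<And>a \<zeta> Z S. 0 \<le> a \<Longrightarrow> 0 \<le> \<zeta> \<Longrightarrow> 0 \<le> S \<Longrightarrow>
       Z \<le> \<gamma> * a + (2 + 2 * C1) * \<delta> * (a + \<zeta>) + (1 / \<delta> + 2 * \<delta> * C1) * S \<Longrightarrow>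
       \<gamma> * a \<le> 25 / 32 * Z + C2 * (\<delta> * a + S) \<Longrightarrow> cR * \<zeta> \<le> Z \<Longrightarrow> a + \<zeta> \<le> C * S"
proof -
  define C3 where "C3 = C2 + (2 + 2 * C1)"
  define m where "m = 2 / \<gamma> + 1 / cR"
  have m: "0 < m" unfolding m_def using assms by (simp add: add_pos_pos)
  have C3: "0 < C3" unfolding C3_def using assms by simp
  \<comment> \<open>The second entry absorbs C2 \<delta> a into \<gamma> a. With \<open>m\<close>,
    which converts Z into a bound for a + \<zeta>, the third keeps the \<delta>-terms below 3/32 of
    Z.\<close>
  define \<delta> where "\<delta> = min 1 (min (\<gamma> / (2 * (C2 + 1))) (3 / (32 * C3 * m)))"
  have d: "0 < \<delta>" "\<delta> \<le> 1" "\<delta> \<le> \<gamma> / (2 * (C2 + 1))" "\<delta> \<le> 3 / (32 * C3 * m)"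
    unfolding \<delta>_def using assms C3 m by auto
  have d1: "C2 * \<delta> \<le> \<gamma> / 2"
  proof -
    have "\<delta> * (2 * (C2 + 1)) \<le> \<gamma>" using d(3) assms by (simp add: pos_le_divide_eq)
    then show ?thesis using d(1) by (simp add: algebra_simps)
  qed
  have d2: "C3 * \<delta> * m \<le> 3 / 32"
  proof -
    have "\<delta> * (32 * C3 * m) \<le> 3" using d(4) C3 m by (simp add: pos_le_divide_eq)
    then show ?thesis by (simp add: algebra_simps)
  qed
  define C4 where "C4 = 1 / \<delta> + 2 * \<delta> * C1 + C2 + C3 * \<delta> * (2 / \<gamma>) * C2"
  have C4: "0 \<le> C4" unfolding C4_def using assms d C3 by (auto intro!: add_nonneg_nonneg mult_nonneg_nonneg)
  define C where "C = m * (8 * C4) + 2 / \<gamma> * C2"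
  show ?thesis
  proof (rule that)
    show "0 \<le> C" unfolding C_def using m C4 assms by (auto intro!: add_nonneg_nonneg mult_nonneg_nonneg)
    fix a \<zeta> Z S :: real
    assume a: "0 \<le> a" and \<zeta>: "0 \<le> \<zeta>" and S: "0 \<le> S"
      and 1: "Z \<le> \<gamma> * a + (2 + 2 * C1) * \<delta> * (a + \<zeta>) + (1 / \<delta> + 2 * \<delta> * C1) * S"
      and 2: "\<gamma> * a \<le> 25 / 32 * Z + C2 * (\<delta> * a + S)" and 3: "cR * \<zeta> \<le> Z"
    have Z: "0 \<le> Z" using 3 \<zeta> assms by (meson less_imp_le mult_nonneg_nonneg order_trans)
    have "C2 * \<delta> * a \<le> \<gamma> / 2 * a" by (rule mult_right_mono[OF d1 a])
    with 2 Z have "\<gamma> / 2 * a \<le> Z + C2 * S" by (simp add: algebra_simps)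
    then have a_le: "a \<le> 2 / \<gamma> * (Z + C2 * S)" using assms by (simp add: field_simps)
    have z_le: "\<zeta> \<le> 1 / cR * Z" using 3 assms by (simp add: field_simps)
    have az: "a + \<zeta> \<le> m * Z + 2 / \<gamma> * C2 * S"
      using a_le z_le unfolding m_def by (simp add: algebra_simps add_divide_distrib)
    have "C2 * (\<delta> * a) \<le> C2 * (\<delta> * (a + \<zeta>))"
      using assms d \<zeta> by (intro mult_left_mono) auto
    then have "7 / 32 * Z \<le> C3 * \<delta> * (a + \<zeta>) + (D + 2 * \<delta> * C1 + C2) * S" if "D = 1 / \<delta>" for D
      using 1[folded that] 2 unfolding C3_def by (simp add: algebra_simps)
    from this[OF refl] have "7 / 32 * Z \<le> C3 * \<delta> * (a + \<zeta>) + (1 / \<delta> + 2 * \<delta> * C1 + C2) * S" .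
    also have "C3 * \<delta> * (a + \<zeta>) \<le> C3 * \<delta> * (m * Z + 2 / \<gamma> * C2 * S)"
      by (rule mult_left_mono[OF az]) (use C3 d in simp)
    also have "\<dots> = C3 * \<delta> * m * Z + C3 * \<delta> * (2 / \<gamma>) * C2 * S" by (simp add: algebra_simps)
    also have "C3 * \<delta> * m * Z \<le> 3 / 32 * Z" by (rule mult_right_mono[OF d2 Z])
    finally have le: "7 / 32 * Z \<le> 3 / 32 * Z + C3 * \<delta> * (2 / \<gamma>) * C2 * S + (1 / \<delta> + 2 * \<delta> * C1 + C2) * S"
      by simp
    have "C4 * S = (1 / \<delta> + 2 * \<delta> * C1 + C2) * S + C3 * \<delta> * (2 / \<gamma>) * C2 * S"
      unfolding C4_def by (simp only: distrib_right)
    with le have "1 / 8 * Z \<le> C4 * S" by linarith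
    then have "m * Z \<le> m * (8 * C4 * S)" using m by (intro mult_left_mono) auto
    then show "a + \<zeta> \<le> C * S" using az unfolding C_def by (simp add: algebra_simps)
  qed (rule d)+
qed

section \<open>Deviation from the stationary solution and its two-sided decay\<close>

locale deviation_system =
  fixes N :: nat and T K \<nu> r k l cR q \<gamma> m :: real
    and B R :: "nat \<Rightarrow> real^'d::finite^'d" and E :: "nat \<Rightarrow> real \<Rightarrow> real^'d^'d"
    and Q :: "nat \<Rightarrow> nat \<Rightarrow> real^'d^'d" and mu rho :: "nat \<Rightarrow> real^'d"
    and x z :: "nat \<Rightarrow> real \<Rightarrow> real^'d"
  assumes T: "0 \<le> T" and K: "0 < K" and \<nu>: "0 < \<nu>" and r: "0 < r" and kl: "0 < k" "0 < l"
    and cR: "0 < cR" and \<gamma>: "0 < \<gamma>" and m: "0 \<le> m"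
    and B: "\<And>i t. i \<in> {1..N} \<Longrightarrow> 0 \<le> t \<Longrightarrow> opnorm (mexp (t *\<^sub>R B i)) \<le> K * exp (- \<nu> * t)"
    and R: "\<And>i. i \<in> {1..N} \<Longrightarrow> spd (R i)"
    and Rr: "\<And>i. i \<in> {1..N} \<Longrightarrow> opnorm (matrix_inv (R i)) \<le> r"
    and RcR: "\<And>i y. i \<in> {1..N} \<Longrightarrow> cR * (norm y)\<^sup>2 \<le> y \<bullet> (matrix_inv (R i) *v y)"
    and Ed: "\<And>i t. i \<in> {1..N} \<Longrightarrow> t \<in> {0..T} \<Longrightarrow> (E i has_vector_derivative
        - (E i t ** B i + transpose (B i) ** E i t + E i t ** matrix_inv (R i) ** E i t)) (at t within {0..T})"
    and Ep: "\<And>i t. i \<in> {1..N} \<Longrightarrow> t \<in> {0..T} \<Longrightarrow> psd (E i t)"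
    and El: "\<And>i t. i \<in> {1..N} \<Longrightarrow> t \<in> {0..T} \<Longrightarrow> opnorm (E i t) \<le> k * exp (- l * (T - t))"
    and coer: "\<And>i y v. i \<in> {1..N} \<Longrightarrow> (\<And>t. t \<in> {0..T} \<Longrightarrow> (y has_vector_derivative
          (B i *v y t + matrix_inv (R i) *v (E i t *v y t) + v t)) (at t within {0..T})) \<Longrightarrow>
        y 0 = 0 \<Longrightarrow> continuous_on {0..T} v \<Longrightarrow>
        \<gamma> * integral {0..T} (\<lambda>t. (norm (y t))\<^sup>2) \<le> 1 / 2 * integral {0..T} (\<lambda>t. v t \<bullet> (R i *v v t))"
    and xd: "\<And>i t. i \<in> {1..N} \<Longrightarrow> t \<in> {0..T} \<Longrightarrow> (x i has_vector_derivative
        (B i *v x i t + matrix_inv (R i) *v (E i t *v (x i t + mu i)) - matrix_inv (R i) *v z i t))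
        (at t within {0..T})"
    and zd: "\<And>i t. i \<in> {1..N} \<Longrightarrow> t \<in> {0..T} \<Longrightarrow> (z i has_vector_derivative
        (- (transpose (B i) *v z i t + E i t *v (matrix_inv (R i) *v (z i t + rho i)))
          - 2 *\<^sub>R bmult N Q (\<lambda>j. x j t) i)) (at t within {0..T})"
    and x0: "\<And>i. i \<in> {1..N} \<Longrightarrow> norm (x i 0) \<le> 2 * m"
    and zT: "\<And>i. i \<in> {1..N} \<Longrightarrow> norm (z i T) \<le> m"
    and mu_le: "\<And>i. i \<in> {1..N} \<Longrightarrow> norm (mu i) \<le> m"
    and rho_le: "\<And>i. i \<in> {1..N} \<Longrightarrow> norm (rho i) \<le> m"
    and Qq: "\<And>y. (\<Sum>i\<in>{1..N}. (norm (bmult N Q y i))\<^sup>2) \<le> q\<^sup>2 * (\<Sum>i\<in>{1..N}. (norm (y i))\<^sup>2)"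
    and Q\<gamma>: "\<And>y. - (\<gamma> / 2) * (\<Sum>i\<in>{1..N}. (norm (y i))\<^sup>2) \<le> (\<Sum>i\<in>{1..N}. y i \<bullet> bmult N Q y i)"

definition two_sided :: "real \<Rightarrow> real \<Rightarrow> real \<Rightarrow> real" where
  "two_sided \<epsilon> T t = exp (- \<epsilon> * t) + exp (- \<epsilon> * (T - t))"

lemma two_sided_pos: "0 < two_sided \<epsilon> T t"
  unfolding two_sided_def by (intro add_pos_pos) auto

lemma bmult_scaleR: "bmult N Q (\<lambda>j. c *\<^sub>R y j) i = c *\<^sub>R bmult N Q y i"
  by (simp add: bmult_def matrix_vector_simps scaleR_right.sum)

text \<open>Multiplication by \<phi> changes both equations only by \<psi> times the unknown, as
  \<phi>' = \<psi> \<phi> with |\<psi>| \<le> \<epsilon>. The data bound combines the squared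
  boundary value (2 m)^2 with the squared L^2 norm of the forcing.\<close>

lemma (in deviation_system) weighted_turnpike_system:
  assumes \<epsilon>: "0 < \<epsilon>" "\<epsilon> \<le> 1" "\<epsilon> \<le> l / 2"
  defines "\<phi> \<equiv> \<lambda>t. 1 / two_sided \<epsilon> T t"
  defines "\<psi> \<equiv> \<lambda>t. (\<epsilon> * exp (- \<epsilon> * t) - \<epsilon> * exp (- \<epsilon> * (T - t))) / two_sided \<epsilon> T t"
  shows "turnpike_system N T K \<nu> r k l cR q \<gamma> \<epsilon> (4 * m\<^sup>2 + (r * k * m)\<^sup>2 / l) B R E Q
    (\<lambda>i t. \<phi> t *\<^sub>R x i t) (\<lambda>i t. \<phi> t *\<^sub>R z i t)
    (\<lambda>i t. \<phi> t *\<^sub>R (matrix_inv (R i) *v (E i t *v mu i)))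
    (\<lambda>i t. \<phi> t *\<^sub>R (E i t *v (matrix_inv (R i) *v rho i))) \<psi>"
proof -
  let ?w = "two_sided \<epsilon> T"
  let ?s = "4 * m\<^sup>2 + (r * k * m)\<^sup>2 / l"
  have w: "0 < ?w t" for t by (rule two_sided_pos)
  have wd: "(?w has_real_derivative - (\<epsilon> * exp (- \<epsilon> * t) - \<epsilon> * exp (- \<epsilon> * (T - t)))) (at t within S)" for t S
    unfolding two_sided_def by (auto intro!: derivative_eq_intros)
  have \<phi>d: "(\<phi> has_real_derivative \<psi> t * \<phi> t) (at t within S)" for t S
    unfolding \<phi>_def \<psi>_def
    by (rule DERIV_cong[OF DERIV_divide[OF DERIV_const wd]]) (use w[of t] in \<open>auto simp: field_simps\<close>)
  have c\<phi>: "continuous_on {0..T} \<phi>"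
    using \<phi>d by (rule DERIV_continuous_on)
  have c\<psi>: "continuous_on {0..T} \<psi>"
  proof -
    have "continuous_on {0..T} ?w" using wd by (rule DERIV_continuous_on)
    then show ?thesis unfolding \<psi>_def using w by (intro continuous_intros) (auto simp: less_imp_neq[symmetric])
  qed
  have \<phi>0: "0 < \<phi> t" for t unfolding \<phi>_def using w by simp
  \<comment> \<open>At either end one of the two exponentials equals 1, so the weight does not
    enlarge boundary data.\<close>
  have \<phi>1: "\<phi> t \<le> 1" if "t = 0 \<or> t = T" for t
    unfolding \<phi>_def two_sided_def using that by (auto simp: field_simps add_pos_pos intro!: less_imp_le[OF exp_gt_zero])
  \<comment> \<open>The weight costs half of the rate \<open>l\<close>: the two-sided exponential is
    at least exp (- \<epsilon> (T - t)), hence at least exp (- (l / 2) (T - t)).\<close>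
  have \<phi>le: "(\<phi> t)\<^sup>2 * (exp (- l * (T - t)))\<^sup>2 \<le> exp (- l * (T - t))" if t: "t \<in> {0..T}" for t
  proof -
    have "\<phi> t * exp (- l * (T - t)) \<le> exp (- (l / 2) * (T - t))"
    proof -
      have "exp (- (l / 2) * (T - t)) \<le> exp (- \<epsilon> * (T - t))"
        using mult_right_mono[OF \<epsilon>(3), of "T - t"] t by simp
      also have "\<dots> \<le> ?w t" by (simp add: two_sided_def)
      finally have "exp (- (l / 2) * (T - t)) * exp (- (l / 2) * (T - t)) \<le> exp (- (l / 2) * (T - t)) * ?w t"
        by (rule mult_left_mono) simp
      then have "exp (- l * (T - t)) \<le> exp (- (l / 2) * (T - t)) * ?w t"
        by (simp add: exp_add[symmetric] algebra_simps)
      then show ?thesis unfolding \<phi>_def using w[of t] by (simp add: field_simps)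
    qed
    then have "(\<phi> t * exp (- l * (T - t)))\<^sup>2 \<le> (exp (- (l / 2) * (T - t)))\<^sup>2"
      by (rule power_mono) (use \<phi>0[of t] in simp)
    also have "\<dots> = exp (- l * (T - t))" by (simp flip: exp_double)
    finally show ?thesis by (simp add: power_mult_distrib)
  qed
  have cE: "continuous_on {0..T} (E i)" if "i \<in> {1..N}" for i
    using Ed[OF that] by (rule continuous_on_vector_derivative)
  have force: "integral {0..T} (\<lambda>t. (norm (\<phi> t *\<^sub>R g t))\<^sup>2) \<le> ?s"
    if cg: "continuous_on {0..T} g" and g: "\<And>t. t \<in> {0..T} \<Longrightarrow> norm (g t) \<le> r * k * m * exp (- l * (T - t))"
    for g :: "real \<Rightarrow> real^'d"
  proof -
    have "integral {0..T} (\<lambda>t. (norm (\<phi> t *\<^sub>R g t))\<^sup>2) \<le> integral {0..T} (\<lambda>t. (r * k * m)\<^sup>2 * exp (- l * (T - t)))"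
    proof (rule integral_le)
      fix t assume t: "t \<in> {0..T}"
      have "(norm (\<phi> t *\<^sub>R g t))\<^sup>2 = (\<phi> t)\<^sup>2 * (norm (g t))\<^sup>2" by (simp add: power_mult_distrib)
      also have "\<dots> \<le> (\<phi> t)\<^sup>2 * (r * k * m * exp (- l * (T - t)))\<^sup>2"
        by (intro mult_left_mono power_mono g t) auto
      also have "\<dots> = (r * k * m)\<^sup>2 * ((\<phi> t)\<^sup>2 * (exp (- l * (T - t)))\<^sup>2)" by (simp only: power_mult_distrib mult_ac)
      also have "\<dots> \<le> (r * k * m)\<^sup>2 * exp (- l * (T - t))" by (rule mult_left_mono[OF \<phi>le[OF t]]) simp
      finally show "(norm (\<phi> t *\<^sub>R g t))\<^sup>2 \<le> (r * k * m)\<^sup>2 * exp (- l * (T - t))" .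
    qed (intro integrable_continuous_real continuous_intros c\<phi> cg)+
    also have "\<dots> = (r * k * m)\<^sup>2 * integral {0..T} (\<lambda>t. exp (- l * (T - t)))" by (simp only: integral_mult_right)
    also have "\<dots> \<le> (r * k * m)\<^sup>2 * (1 / l)"
      by (rule mult_left_mono[OF integral_exp_decay_reverse_le]) (use kl T in auto)
    also have "\<dots> \<le> ?s" by simp
    finally show ?thesis .
  qed
  show ?thesis
  proof
    show "0 \<le> ?s" using kl by simp
    show "msym (E i t)" if "i \<in> {1..N}" "t \<in> {0..T}" for i t using Ep[OF that] by (simp add: psd_def)
    show "((\<lambda>t. \<phi> t *\<^sub>R x i t) has_vector_derivative B i *v (\<phi> t *\<^sub>R x i t)
        + (matrix_inv (R i) *v (E i t *v (\<phi> t *\<^sub>R x i t)) + \<psi> t *\<^sub>R \<phi> t *\<^sub>R x i t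
        + \<phi> t *\<^sub>R (matrix_inv (R i) *v (E i t *v mu i)) - matrix_inv (R i) *v (\<phi> t *\<^sub>R z i t))) (at t within {0..T})"
      if "i \<in> {1..N}" "t \<in> {0..T}" for i t
      by (rule has_vector_derivative_eq_rhs[OF has_vector_derivative_scaleR[OF \<phi>d xd[OF that]]])
        (simp add: matrix_vector_simps algebra_simps)
    show "((\<lambda>t. \<phi> t *\<^sub>R z i t) has_vector_derivative
        - (transpose (B i) *v (\<phi> t *\<^sub>R z i t) + E i t *v (matrix_inv (R i) *v (\<phi> t *\<^sub>R z i t)))
        + \<psi> t *\<^sub>R \<phi> t *\<^sub>R z i t - \<phi> t *\<^sub>R (E i t *v (matrix_inv (R i) *v rho i))
        - 2 *\<^sub>R bmult N Q (\<lambda>j. \<phi> t *\<^sub>R x j t) i) (at t within {0..T})"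
      if "i \<in> {1..N}" "t \<in> {0..T}" for i t
      by (rule has_vector_derivative_eq_rhs[OF has_vector_derivative_scaleR[OF \<phi>d zd[OF that]]])
        (simp add: matrix_vector_simps bmult_scaleR algebra_simps)
    show "\<bar>\<psi> t\<bar> \<le> \<epsilon>" if "t \<in> {0..T}" for t
    proof -
      have "\<bar>\<epsilon> * exp (- \<epsilon> * t) - \<epsilon> * exp (- \<epsilon> * (T - t))\<bar> \<le> \<bar>\<epsilon> * exp (- \<epsilon> * t)\<bar> + \<bar>\<epsilon> * exp (- \<epsilon> * (T - t))\<bar>"
        by (rule abs_triangle_ineq4)
      also have "\<dots> = \<epsilon> * ?w t" using \<epsilon> by (simp add: two_sided_def abs_mult distrib_left)
      finally show ?thesis unfolding \<psi>_def using w[of t] by (simp add: abs_divide pos_divide_le_eq)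
    qed
    fix i assume i: "i \<in> {1..N}"
    show "continuous_on {0..T} (\<lambda>t. \<phi> t *\<^sub>R (matrix_inv (R i) *v (E i t *v mu i)))"
      "continuous_on {0..T} (\<lambda>t. \<phi> t *\<^sub>R (E i t *v (matrix_inv (R i) *v rho i)))"
      by (intro continuous_intros c\<phi> cE i)+
    show "integral {0..T} (\<lambda>t. (norm (\<phi> t *\<^sub>R (matrix_inv (R i) *v (E i t *v mu i))))\<^sup>2) \<le> ?s"
    proof (rule force)
      fix t assume t: "t \<in> {0..T}"
      have "norm (matrix_inv (R i) *v (E i t *v mu i)) \<le> r * ((k * exp (- l * (T - t))) * m)"
        by (intro order_trans[OF norm_mult_vec_le[OF Rr[OF i]]] mult_left_mono
            order_trans[OF norm_mult_vec_le[OF El[OF i t]]] mu_le i) (use r kl in auto)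
      then show "norm (matrix_inv (R i) *v (E i t *v mu i)) \<le> r * k * m * exp (- l * (T - t))" by (simp add: mult_ac)
    qed (intro continuous_intros cE i)
    show "integral {0..T} (\<lambda>t. (norm (\<phi> t *\<^sub>R (E i t *v (matrix_inv (R i) *v rho i))))\<^sup>2) \<le> ?s"
    proof (rule force)
      fix t assume t: "t \<in> {0..T}"
      have "norm (E i t *v (matrix_inv (R i) *v rho i)) \<le> (k * exp (- l * (T - t))) * (r * m)"
        by (intro order_trans[OF norm_mult_vec_le[OF El[OF i t]]] mult_left_mono
            order_trans[OF norm_mult_vec_le[OF Rr[OF i]]] rho_le i) (use r kl in auto)
      then show "norm (E i t *v (matrix_inv (R i) *v rho i)) \<le> r * k * m * exp (- l * (T - t))" by (simp add: mult_ac)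
    qed (intro continuous_intros cE i)
    show "(norm (\<phi> 0 *\<^sub>R x i 0))\<^sup>2 \<le> ?s"
    proof -
      have "\<phi> 0 * norm (x i 0) \<le> 1 * (2 * m)"
        by (intro mult_mono x0 i \<phi>1) (use \<phi>0[of 0] in auto)
      then have "(norm (\<phi> 0 *\<^sub>R x i 0))\<^sup>2 \<le> (2 * m)\<^sup>2" using \<phi>0[of 0] by (intro power_mono) auto
      also have "\<dots> \<le> ?s" using kl by (simp add: power_mult_distrib)
      finally show ?thesis .
    qed
    show "(norm (\<phi> T *\<^sub>R z i T))\<^sup>2 \<le> ?s"
    proof -
      have "\<phi> T * norm (z i T) \<le> 1 * m"
        by (intro mult_mono zT i \<phi>1) (use \<phi>0[of T] in auto)
      then have "(norm (\<phi> T *\<^sub>R z i T))\<^sup>2 \<le> m\<^sup>2" using \<phi>0[of T] by (intro power_mono) auto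
      also have "\<dots> \<le> ?s" using kl by simp
      finally show ?thesis .
    qed
  next
    show "\<gamma> * integral {0..T} (\<lambda>t. (norm (y t))\<^sup>2) \<le> 1 / 2 * integral {0..T} (\<lambda>t. v t \<bullet> (R i *v v t))"
      if "i \<in> {1..N}" "\<And>t. t \<in> {0..T} \<Longrightarrow> (y has_vector_derivative
          (B i *v y t + matrix_inv (R i) *v (E i t *v y t) + v t)) (at t within {0..T})"
        "y 0 = 0" "continuous_on {0..T} v" for i y v
      by (rule coer[OF that])
  qed (fact T K \<nu> r kl cR \<gamma> \<epsilon> B R Rr RcR cE El | rule c\<psi> Qq Q\<gamma>)+
qed

text \<open>The quantifiers carry the uniformity: \<open>C\<close> and \<epsilon> are fixed by the
  scalar parameters before N, T and the matrices appear. The decay results from reading the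
  pointwise bound for the weighted \<open>z\<close> backwards.\<close>

lemma deviation_turnpike:
  fixes K \<nu> r k l cR q \<gamma> m :: real
  assumes pos: "0 < K" "0 < \<nu>" "0 < r" "0 < k" "0 < l" "0 < cR" "0 < \<gamma>"
  obtains C \<epsilon> where "0 \<le> C" "0 < \<epsilon>" "2 * \<epsilon> \<le> l" "4 * \<epsilon> \<le> \<nu>"
    "\<And>N T (B :: nat \<Rightarrow> real^'d::finite^'d) R E Q mu rho x z t.
      deviation_system N T K \<nu> r k l cR q \<gamma> m B R E Q mu rho x z \<Longrightarrow> t \<in> {0..T} \<Longrightarrow>
      (\<Sum>i\<in>{1..N}. (norm (z i t))\<^sup>2) \<le> C * real N * (two_sided \<epsilon> T t)\<^sup>2"
proof -
  let ?C1 = "tp_C1 K \<nu> r k l q" and ?C2 = "tp_C2 K \<nu> r k cR \<gamma>"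
  let ?s = "4 * m\<^sup>2 + (r * k * m)\<^sup>2 / l"
  have C1: "0 \<le> ?C1" unfolding tp_C1_def using pos by (intro mult_nonneg_nonneg add_nonneg_nonneg divide_nonneg_pos) auto
  have C2: "0 \<le> ?C2" unfolding tp_C2_def using pos by (intro mult_nonneg_nonneg add_nonneg_nonneg divide_nonneg_pos) auto
  have s: "0 \<le> ?s" using pos by simp
  obtain \<delta> C where \<delta>: "0 < \<delta>" "\<delta> \<le> 1" and C: "0 \<le> C" and abs:
    "\<And>a \<zeta> Z S. 0 \<le> a \<Longrightarrow> 0 \<le> \<zeta> \<Longrightarrow> 0 \<le> S \<Longrightarrow>
       Z \<le> \<gamma> * a + (2 + 2 * ?C1) * \<delta> * (a + \<zeta>) + (1 / \<delta> + 2 * \<delta> * ?C1) * S \<Longrightarrow>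
       \<gamma> * a \<le> 25 / 32 * Z + ?C2 * (\<delta> * a + S) \<Longrightarrow> cR * \<zeta> \<le> Z \<Longrightarrow> a + \<zeta> \<le> C * S"
    using turnpike_absorption[OF C1 C2 pos(7,6)] by metis
  \<comment> \<open>Below \<delta> for the absorption, below l / 2 for the weight, and below \<nu> /
    4 so that the doubled rate 2 \<epsilon> later survives the convolution with exp (- \<nu>
    t).\<close>
  define \<epsilon> where "\<epsilon> = min \<delta> (min (l / 2) (\<nu> / 4))"
  have \<epsilon>: "0 < \<epsilon>" "\<epsilon> \<le> \<delta>" "\<epsilon> \<le> l / 2" "\<epsilon> \<le> \<nu> / 4" unfolding \<epsilon>_def using \<delta> pos by auto
  show ?thesis
  proof (rule that)
    show "0 \<le> ?C1 * (1 + C) * ?s" using C1 C s by simp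
    fix N T and B :: "nat \<Rightarrow> real^'d::finite^'d" and R E Q mu rho x z t
    assume D: "deviation_system N T K \<nu> r k l cR q \<gamma> m B R E Q mu rho x z" and t: "t \<in> {0..T}"
    define \<phi> where "\<phi> = (\<lambda>t. 1 / two_sided \<epsilon> T t)"
    interpret tp: turnpike_system N T K \<nu> r k l cR q \<gamma> \<epsilon> ?s B R E Q
      "\<lambda>i t. \<phi> t *\<^sub>R x i t" "\<lambda>i t. \<phi> t *\<^sub>R z i t"
      "\<lambda>i t. \<phi> t *\<^sub>R (matrix_inv (R i) *v (E i t *v mu i))"
      "\<lambda>i t. \<phi> t *\<^sub>R (E i t *v (matrix_inv (R i) *v rho i))"
      "\<lambda>t. (\<epsilon> * exp (- \<epsilon> * t) - \<epsilon> * exp (- \<epsilon> * (T - t))) / two_sided \<epsilon> T t"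
      unfolding \<phi>_def
      by (rule deviation_system.weighted_turnpike_system[OF D]) (use \<epsilon> \<delta> in auto)
    have "tp.X_tot + tp.Z_tot \<le> C * (real N * ?s)"
      by (rule abs[OF _ _ _ tp.energy_estimate[OF \<epsilon>(2)] tp.coercive_estimate[OF \<epsilon>(2)] tp.Z_tot_le])
        (use s tp.xI_nonneg tp.zI_nonneg in \<open>auto intro!: sum_nonneg\<close>)
    then have "?C1 * (real N * ?s + tp.X_tot + tp.Z_tot) \<le> ?C1 * (real N * ?s + C * (real N * ?s))"
      by (intro mult_left_mono C1) simp
    with tp.z_pointwise[OF t]
    have "(\<Sum>i\<in>{1..N}. (norm (\<phi> t *\<^sub>R z i t))\<^sup>2) \<le> ?C1 * (real N * ?s + C * (real N * ?s))" by linarith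
    also have "(\<Sum>i\<in>{1..N}. (norm (\<phi> t *\<^sub>R z i t))\<^sup>2) = (\<Sum>i\<in>{1..N}. (norm (z i t))\<^sup>2) / (two_sided \<epsilon> T t)\<^sup>2"
      unfolding \<phi>_def by (simp add: power_mult_distrib power_divide sum_divide_distrib)
    finally show "(\<Sum>i\<in>{1..N}. (norm (z i t))\<^sup>2) \<le> ?C1 * (1 + C) * ?s * real N * (two_sided \<epsilon> T t)\<^sup>2"
      using two_sided_pos[of \<epsilon> T t] by (simp add: pos_divide_le_eq algebra_simps add_divide_distrib)
  qed (use \<epsilon> in auto)
qed

section \<open>Second moments\<close>

text \<open>The integrator is continuously differentiable and the integrand merely continuous.
  Matrix-valued \<open>F\<close> serves the integration by parts against Brownian paths, and the
  identity in place of \<open>F\<close> gives ordinary Riemann sums.\<close>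

lemma riemann_stieltjes_sum:
  fixes F :: "real \<Rightarrow> 'a::banach" and w :: "real \<Rightarrow> 'b::banach"
    and prod :: "'a \<Rightarrow> 'b \<Rightarrow> 'c::banach"
  assumes bl: "bounded_bilinear prod" and t: "0 < t"
    and F: "\<And>s. s \<in> {0..t} \<Longrightarrow> (F has_vector_derivative F' s) (at s within {0..t})"
    and F': "continuous_on {0..t} F'" and w: "continuous_on {0..t} w"
  shows "(\<lambda>n. \<Sum>k<n. prod (F (t * real (Suc k) / real n) - F (t * real k / real n)) (w (t * real k / real n)))
    \<longlonglongrightarrow> integral {0..t} (\<lambda>s. prod (F' s) (w s))"
proof -
  obtain C where C: "C > 0" "\<And>a b. norm (prod a b) \<le> norm a * norm b * C"
    using bounded_bilinear.pos_bounded[OF bl] by blast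
  have "bounded (F' ` {0..t})" by (intro compact_imp_bounded compact_continuous_image F' compact_Icc)
  then obtain b where b: "b > 0" "\<And>s. s \<in> {0..t} \<Longrightarrow> norm (F' s) \<le> b"
    unfolding bounded_pos by (metis imageI)
  have cp: "continuous_on {0..t} (\<lambda>s. prod (F' s) (w s))"
    by (rule bounded_bilinear.continuous_on[OF bl F' w])
  let ?S = "\<lambda>n. \<Sum>k<n. prod (F (t * real (Suc k) / real n) - F (t * real k / real n)) (w (t * real k / real n))"
  let ?I = "integral {0..t} (\<lambda>s. prod (F' s) (w s))"
  show ?thesis
  proof (rule LIMSEQ_I)
    fix \<epsilon> :: real assume \<epsilon>: "0 < \<epsilon>"
    \<comment> \<open>Each of the n pieces has error at most C b \<eta> t / n, so the total is
      \<epsilon> / 2.\<close>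
    define \<eta> where "\<eta> = \<epsilon> / (2 * (C * b * t))"
    have \<eta>: "0 < \<eta>" unfolding \<eta>_def using \<epsilon> C b t by simp
    have "uniformly_continuous_on {0..t} w" by (intro compact_uniformly_continuous w compact_Icc)
    then obtain d where d: "d > 0" "\<And>x y. x \<in> {0..t} \<Longrightarrow> y \<in> {0..t} \<Longrightarrow> dist x y < d \<Longrightarrow> dist (w x) (w y) < \<eta>"
      unfolding uniformly_continuous_on_def using \<eta> by metis
    obtain n0 :: nat where n0: "t / d < real n0" using reals_Archimedean2 by blast
    show "\<exists>no. \<forall>n\<ge>no. norm (?S n - ?I) < \<epsilon>"
    proof (intro exI[of _ "Suc n0"] allI impI)
      fix n assume n: "Suc n0 \<le> n"
      then have np: "0 < real n" by simp
      have "t < d * real n0" using n0 d by (simp add: pos_divide_less_eq mult.commute)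
      also have "\<dots> \<le> d * real n" using n d by simp
      finally have step: "t / real n < d" using np by (simp add: pos_divide_less_eq)
      define p where "p = (\<lambda>k. t * real k / real n)"
      have p0: "p 0 = 0" "p n = t" unfolding p_def using np by auto
      have p_in: "p k \<in> {0..t}" if "k \<le> n" for k
        unfolding p_def using that t np by (auto simp: divide_le_eq)
      have p_le: "p k \<le> p (Suc k)" for k unfolding p_def using t np by (simp add: divide_right_mono)
      have p_step: "p (Suc k) - p k = t / real n" for k
        unfolding p_def by (simp add: diff_divide_distrib[symmetric] algebra_simps)
      have piece: "norm (prod (F (p (Suc k)) - F (p k)) (w (p k)) - integral {p k..p (Suc k)} (\<lambda>s. prod (F' s) (w s)))
          \<le> C * b * \<eta> * (t / real n)" if k: "k < n" for k
      proof -
        have sub: "{p k..p (Suc k)} \<subseteq> {0..t}" using p_in[of k] p_in[of "Suc k"] k by auto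
        have "(F' has_integral (F (p (Suc k)) - F (p k))) {p k..p (Suc k)}"
          by (rule fundamental_theorem_of_calculus[OF p_le])
            (use sub in \<open>auto intro!: has_vector_derivative_within_subset[OF F]\<close>)
        from has_integral_linear[OF this bounded_bilinear.bounded_linear_left[OF bl, of "w (p k)"]]
        have 1: "((\<lambda>s. prod (F' s) (w (p k))) has_integral prod (F (p (Suc k)) - F (p k)) (w (p k))) {p k..p (Suc k)}"
          by (simp add: o_def)
        have 2: "((\<lambda>s. prod (F' s) (w s)) has_integral integral {p k..p (Suc k)} (\<lambda>s. prod (F' s) (w s))) {p k..p (Suc k)}"
          by (intro integrable_integral integrable_continuous_real continuous_on_subset[OF cp sub])
        have 3: "((\<lambda>s. prod (F' s) (w (p k)) - prod (F' s) (w s)) has_integral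
            (prod (F (p (Suc k)) - F (p k)) (w (p k)) - integral {p k..p (Suc k)} (\<lambda>s. prod (F' s) (w s)))) (cbox (p k) (p (Suc k)))"
          using has_integral_diff[OF 1 2] by simp
        have "norm (prod (F (p (Suc k)) - F (p k)) (w (p k)) - integral {p k..p (Suc k)} (\<lambda>s. prod (F' s) (w s)))
            \<le> C * b * \<eta> * measure lborel (cbox (p k) (p (Suc k)))"
        proof (rule has_integral_bound[OF _ 3])
          show "0 \<le> C * b * \<eta>" using C b \<eta> by simp
          fix s assume "s \<in> cbox (p k) (p (Suc k))"
          then have s: "p k \<le> s" "s \<le> p (Suc k)" "s \<in> {0..t}" using sub by auto
          have "dist (p k) s < d" using s p_step[of k] step by (simp add: dist_real_def)
          then have w: "norm (w (p k) - w s) \<le> \<eta>"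
            using d(2)[OF p_in s(3), of k] k by (simp add: dist_norm)
          have "norm (prod (F' s) (w (p k) - w s)) \<le> norm (F' s) * norm (w (p k) - w s) * C" by (rule C(2))
          also have "\<dots> \<le> b * \<eta> * C"
            by (intro mult_right_mono mult_mono b s w) (use C b in auto)
          finally show "norm (prod (F' s) (w (p k)) - prod (F' s) (w s)) \<le> C * b * \<eta>"
            by (simp add: bounded_bilinear.diff_right[OF bl] mult_ac)
        qed
        also have "measure lborel (cbox (p k) (p (Suc k))) = t / real n" using p_step[of k] p_le[of k] by simp
        finally show ?thesis .
      qed
      have split: "integral {0..p m} (\<lambda>s. prod (F' s) (w s)) = (\<Sum>k<m. integral {p k..p (Suc k)} (\<lambda>s. prod (F' s) (w s)))"
        if "m \<le> n" for m
        using that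
      proof (induction m)
        case 0
        then show ?case by (simp add: p0)
      next
        case (Suc m)
        have "integral {0..p m} (\<lambda>s. prod (F' s) (w s)) + integral {p m..p (Suc m)} (\<lambda>s. prod (F' s) (w s))
            = integral {0..p (Suc m)} (\<lambda>s. prod (F' s) (w s))"
          by (rule Henstock_Kurzweil_Integration.integral_combine)
            (use p_in[of m] p_in[of "Suc m"] p_le[of m] Suc.prems in
              \<open>auto intro!: integrable_continuous_real continuous_on_subset[OF cp]\<close>)
        then show ?case using Suc by simp
      qed
      have "?S n - ?I = (\<Sum>k<n. prod (F (p (Suc k)) - F (p k)) (w (p k)) - integral {p k..p (Suc k)} (\<lambda>s. prod (F' s) (w s)))"
        using split[of n] by (simp add: p0 sum_subtractf) (simp add: p_def)
      also have "norm \<dots> \<le> (\<Sum>k<n. C * b * \<eta> * (t / real n))"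
        by (rule sum_norm_le) (rule piece, simp)
      also have "\<dots> = \<epsilon> / 2" unfolding \<eta>_def using np C b t by (simp add: field_simps)
      finally show "norm (?S n - ?I) < \<epsilon>" using \<epsilon> by simp
    qed
  qed
qed

lemma riemann_sum:
  fixes f :: "real \<Rightarrow> real"
  assumes t: "0 \<le> t" and f: "continuous_on {0..t} f"
  shows "(\<lambda>n. \<Sum>k<n. t / real n * f (t * real k / real n)) \<longlonglongrightarrow> integral {0..t} f"
proof (cases "t = 0")
  case False
  then have "(\<lambda>n. \<Sum>k<n. (t * real (Suc k) / real n - t * real k / real n) * f (t * real k / real n))
      \<longlonglongrightarrow> integral {0..t} (\<lambda>s. 1 * f s)"
    using t f by (intro riemann_stieltjes_sum[OF bounded_bilinear_mult])
      (auto intro!: derivative_eq_intros simp flip: has_real_derivative_iff_has_vector_derivative)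
  then show ?thesis by (simp add: diff_divide_distrib[symmetric] algebra_simps)
qed simp

text \<open>Riemann sums and Fatou's lemma replace Fubini's theorem, so that no joint measurability in time and
  \<open>\<omega>\<close> is needed.\<close>

lemma nn_integral_time_integral_le:
  fixes F :: "real \<Rightarrow> 'a \<Rightarrow> real"
  assumes t: "0 \<le> t"
    and meas: "\<And>s. s \<in> {0..t} \<Longrightarrow> F s \<in> borel_measurable M"
    and cont: "AE \<omega> in M. continuous_on {0..t} (\<lambda>s. F s \<omega>)"
    and nonneg: "\<And>s \<omega>. s \<in> {0..t} \<Longrightarrow> 0 \<le> F s \<omega>"
    and le: "\<And>s. s \<in> {0..t} \<Longrightarrow> (\<integral>\<^sup>+\<omega>. ennreal (F s \<omega>) \<partial>M) \<le> ennreal (g s)"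
    and g: "continuous_on {0..t} g" "\<And>s. s \<in> {0..t} \<Longrightarrow> 0 \<le> g s"
  shows "(\<integral>\<^sup>+\<omega>. ennreal (integral {0..t} (\<lambda>s. F s \<omega>)) \<partial>M) \<le> ennreal (integral {0..t} g)"
proof -
  have p: "t * real k / real n \<in> {0..t}" if "k < n" for k n
    using that t by (auto simp: divide_le_eq mult_left_mono)
  define u where "u = (\<lambda>n \<omega>. ennreal (\<Sum>k<n. t / real n * F (t * real k / real n) \<omega>))"
  have um: "u n \<in> borel_measurable M" for n
    unfolding u_def by (intro measurable_compose[OF _ measurable_ennreal] borel_measurable_sum
        borel_measurable_times borel_measurable_const meas p) auto
  have "(\<integral>\<^sup>+\<omega>. ennreal (integral {0..t} (\<lambda>s. F s \<omega>)) \<partial>M) = (\<integral>\<^sup>+\<omega>. liminf (\<lambda>n. u n \<omega>) \<partial>M)"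
  proof (rule nn_integral_cong_AE, use cont in eventually_elim)
    fix \<omega> assume "continuous_on {0..t} (\<lambda>s. F s \<omega>)"
    from riemann_sum[OF t this] have "(\<lambda>n. u n \<omega>) \<longlonglongrightarrow> ennreal (integral {0..t} (\<lambda>s. F s \<omega>))"
      unfolding u_def by (rule tendsto_ennrealI)
    then show "ennreal (integral {0..t} (\<lambda>s. F s \<omega>)) = liminf (\<lambda>n. u n \<omega>)"
      by (simp add: lim_imp_Liminf)
  qed
  also have "\<dots> \<le> liminf (\<lambda>n. \<integral>\<^sup>+\<omega>. u n \<omega> \<partial>M)" by (rule nn_integral_liminf[OF um])
  also have "\<dots> \<le> liminf (\<lambda>n. ennreal (\<Sum>k<n. t / real n * g (t * real k / real n)))"
  proof (rule Liminf_mono, rule always_eventually, rule allI)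
    fix n
    have "(\<integral>\<^sup>+\<omega>. u n \<omega> \<partial>M) = (\<integral>\<^sup>+\<omega>. (\<Sum>k<n. ennreal (t / real n) * ennreal (F (t * real k / real n) \<omega>)) \<partial>M)"
      unfolding u_def
    proof (rule nn_integral_cong)
      fix \<omega>
      have "ennreal (\<Sum>k<n. t / real n * F (t * real k / real n) \<omega>)
          = (\<Sum>k<n. ennreal (t / real n * F (t * real k / real n) \<omega>))"
        by (rule sum_ennreal[symmetric]) (intro mult_nonneg_nonneg nonneg p; use t in simp)
      then show "ennreal (\<Sum>k<n. t / real n * F (t * real k / real n) \<omega>)
          = (\<Sum>k<n. ennreal (t / real n) * ennreal (F (t * real k / real n) \<omega>))"
        using t by (simp only: ennreal_mult' divide_nonneg_nonneg of_nat_0_le_iff)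
    qed
    also have "\<dots> = (\<Sum>k<n. ennreal (t / real n) * (\<integral>\<^sup>+\<omega>. ennreal (F (t * real k / real n) \<omega>) \<partial>M))"
      using meas p by (subst nn_integral_sum) (auto simp: nn_integral_cmult)
    also have "\<dots> \<le> (\<Sum>k<n. ennreal (t / real n) * ennreal (g (t * real k / real n)))"
      by (intro sum_mono mult_left_mono le p) auto
    also have "\<dots> = (\<Sum>k<n. ennreal (t / real n * g (t * real k / real n)))"
      using t by (simp only: ennreal_mult' divide_nonneg_nonneg of_nat_0_le_iff)
    also have "\<dots> = ennreal (\<Sum>k<n. t / real n * g (t * real k / real n))"
      by (rule sum_ennreal) (intro mult_nonneg_nonneg g p; use t in simp)
    finally show "(\<integral>\<^sup>+\<omega>. u n \<omega> \<partial>M) \<le> ennreal (\<Sum>k<n. t / real n * g (t * real k / real n))" .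
  qed
  also have "\<dots> = ennreal (integral {0..t} g)"
    by (intro lim_imp_Liminf tendsto_ennrealI riemann_sum t g) simp
  finally show ?thesis .
qed

section \<open>Second moments of Gaussian vectors, Brownian sums and stable linear equations\<close>

lemma (in prob_space) normal_nn_second_moment:
  assumes "0 < \<sigma>" "distributed M lborel X (normal_density \<mu> \<sigma>)"
  shows "(\<integral>\<^sup>+\<omega>. ennreal ((X \<omega> - \<mu>)\<^sup>2) \<partial>M) = ennreal (\<sigma>\<^sup>2)"
proof -
  have "integrable M (\<lambda>\<omega>. (X \<omega> - \<mu>)\<^sup>2)"
    using distributed_integrable[OF assms(2), of "\<lambda>x. (x - \<mu>)\<^sup>2"] integrable_normal_moment[OF assms(1), of \<mu> 2]
    by simp
  then show ?thesis
    using normal_distributed_variance[OF assms] normal_distributed_expectation[OF assms]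
    by (simp add: nn_integral_eq_integral)
qed

lemma inner_axis_one: "axis a (1::real) \<bullet> x = x $ a"
  by (simp add: inner_axis')

lemma norm_square_vec: "(norm (x :: real^'n))\<^sup>2 = (\<Sum>a\<in>UNIV. (x $ a)\<^sup>2)"
  by (simp only: power2_norm_eq_inner inner_vec_def) (simp add: power2_eq_square)

lemma (in prob_space) gaussian_vec_second_moment_le:
  fixes C :: "real^'d::finite^'d"
  assumes G: "gaussian_vec M X m C" and C: "spd C" "opnorm C \<le> b"
  shows "(\<integral>\<^sup>+\<omega>. ennreal ((norm (X \<omega> - m))\<^sup>2) \<partial>M) \<le> ennreal (real CARD('d) * b)"
proof -
  have Xm: "X \<in> borel_measurable M" using G by (simp add: gaussian_vec_def)
  have b0: "0 \<le> b" using C(2) opnorm_nonneg[of C] by linarith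
  have one: "(\<integral>\<^sup>+\<omega>. ennreal (((X \<omega> - m) $ a)\<^sup>2) \<partial>M) \<le> ennreal b" for a
  proof -
    let ?v = "axis a 1 :: real^'d"
    have v: "?v \<noteq> 0" by (simp add: axis_eq_0_iff)
    have pos: "0 < ?v \<bullet> (C *v ?v)" using C(1) v by (simp add: spd_def)
    have "distributed M lborel (\<lambda>\<omega>. ?v \<bullet> X \<omega>) (\<lambda>x. ennreal (normal_density (?v \<bullet> m) (sqrt (?v \<bullet> (C *v ?v))) x))"
      using G v by (simp add: gaussian_vec_def)
    from normal_nn_second_moment[OF _ this]
    have "(\<integral>\<^sup>+\<omega>. ennreal (((X \<omega> - m) $ a)\<^sup>2) \<partial>M) = ennreal (?v \<bullet> (C *v ?v))"
      using pos by (simp add: inner_axis_one)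
    also have "\<dots> \<le> ennreal b"
      using psd_quadratic_le[OF C(2), of ?v] by (intro ennreal_leI) simp
    finally show ?thesis .
  qed
  have "(\<integral>\<^sup>+\<omega>. ennreal ((norm (X \<omega> - m))\<^sup>2) \<partial>M) = (\<integral>\<^sup>+\<omega>. (\<Sum>a\<in>UNIV. ennreal (((X \<omega> - m) $ a)\<^sup>2)) \<partial>M)"
    unfolding norm_square_vec by (intro nn_integral_cong sum_ennreal[symmetric]) simp
  also have "\<dots> = (\<Sum>a\<in>UNIV. \<integral>\<^sup>+\<omega>. ennreal (((X \<omega> - m) $ a)\<^sup>2) \<partial>M)"
  proof (rule nn_integral_sum)
    fix a
    have "(\<lambda>\<omega>. axis a 1 \<bullet> (X \<omega> - m)) \<in> borel_measurable M"
      using Xm by (intro borel_measurable_inner borel_measurable_diff) auto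
    then show "(\<lambda>\<omega>. ennreal (((X \<omega> - m) $ a)\<^sup>2)) \<in> borel_measurable M"
      by (simp add: inner_axis_one)
  qed
  also have "\<dots> \<le> (\<Sum>a\<in>(UNIV::'d set). ennreal b)" by (rule sum_mono) (rule one)
  also have "\<dots> = ennreal (\<Sum>a\<in>(UNIV::'d set). b)"
    by (rule sum_ennreal) (rule b0)
  also have "\<dots> = ennreal (real CARD('d) * b)" by simp
  finally show ?thesis .
qed

text \<open>A sum of independent centred normal variables is normal, with the variances added; this
  gives the discrete Ito isometry for deterministic coefficients.\<close>

lemma (in prob_space) brownian_sum_second_moment_le:
  fixes W :: "real \<Rightarrow> 'a \<Rightarrow> real^'d::finite" and ts :: "nat \<Rightarrow> real"
  assumes W: "brownian M W" and ts: "0 \<le> ts 0" "\<And>k. k < n \<Longrightarrow> ts k < ts (Suc k)"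
  shows "(\<integral>\<^sup>+\<omega>. ennreal ((\<Sum>k<n. v k \<bullet> (W (ts (Suc k)) \<omega> - W (ts k) \<omega>))\<^sup>2) \<partial>M)
    \<le> ennreal (\<Sum>k<n. (ts (Suc k) - ts k) * (norm (v k))\<^sup>2)"
proof -
  let ?D = "\<lambda>k \<omega>. W (ts (Suc k)) \<omega> - W (ts k) \<omega>"
  \<comment> \<open>A zero coefficient would give a normal law of variance 0, which has no density;
    \<open>gaussian_vec\<close> accordingly speaks of nonzero functionals only.\<close>
  define I where "I = {k \<in> {..<n}. v k \<noteq> 0}"
  have sum_I: "(\<Sum>k<n. v k \<bullet> ?D k \<omega>) = (\<Sum>k\<in>I. v k \<bullet> ?D k \<omega>)" for \<omega>
    unfolding I_def by (rule sum.mono_neutral_right) auto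
  show ?thesis
  proof (cases "I = {}")
    case True
    then show ?thesis unfolding sum_I by simp
  next
    case False
    have ind: "indep_vars (\<lambda>_. borel) ?D {..<n}"
      and gv: "\<And>k. k < n \<Longrightarrow> gaussian_vec M (?D k) 0 ((ts (Suc k) - ts k) *\<^sub>R mat 1)"
      using W ts unfolding brownian_def by blast+
    have "indep_vars (\<lambda>_. borel) (\<lambda>k \<omega>. v k \<bullet> ?D k \<omega>) {..<n}"
      by (rule indep_vars_compose2[OF ind]) simp
    then have indI: "indep_vars (\<lambda>_. borel) (\<lambda>k \<omega>. v k \<bullet> ?D k \<omega>) I"
      by (rule indep_vars_subset) (auto simp: I_def)
    define \<sigma> where "\<sigma> = (\<lambda>k. sqrt ((ts (Suc k) - ts k) * (norm (v k))\<^sup>2))"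
    have \<sigma>: "0 < \<sigma> k" if "k \<in> I" for k
      unfolding \<sigma>_def using that ts(2)[of k] by (simp add: I_def)
    have "distributed M lborel (\<lambda>\<omega>. v k \<bullet> ?D k \<omega>) (normal_density 0 (\<sigma> k))" if "k \<in> I" for k
    proof -
      have "v k \<bullet> (((ts (Suc k) - ts k) *\<^sub>R mat 1) *v v k) = (ts (Suc k) - ts k) * (norm (v k))\<^sup>2"
        by (simp add: matrix_vector_simps power2_norm_eq_inner)
      moreover have "distributed M lborel (\<lambda>\<omega>. v k \<bullet> ?D k \<omega>)
          (\<lambda>x. ennreal (normal_density (v k \<bullet> 0) (sqrt (v k \<bullet> (((ts (Suc k) - ts k) *\<^sub>R mat 1) *v v k))) x))"
        using gv[of k] that unfolding gaussian_vec_def I_def by blast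
      ultimately show ?thesis by (simp add: \<sigma>_def)
    qed
    from sum_indep_normal[OF _ False indI \<sigma> this]
    have "distributed M lborel (\<lambda>\<omega>. \<Sum>k\<in>I. v k \<bullet> ?D k \<omega>) (normal_density 0 (sqrt (\<Sum>k\<in>I. (\<sigma> k)\<^sup>2)))"
      by (simp add: I_def)
    moreover have pos: "0 < (\<Sum>k\<in>I. (\<sigma> k)\<^sup>2)"
    proof (rule sum_pos[OF _ False])
      show "0 < (\<sigma> k)\<^sup>2" if "k \<in> I" for k using \<sigma>[OF that] by (rule zero_less_power)
    qed (simp add: I_def)
    ultimately have "(\<integral>\<^sup>+\<omega>. ennreal ((\<Sum>k\<in>I. v k \<bullet> ?D k \<omega>)\<^sup>2) \<partial>M) = ennreal (\<Sum>k\<in>I. (\<sigma> k)\<^sup>2)"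
      using normal_nn_second_moment[of "sqrt (\<Sum>k\<in>I. (\<sigma> k)\<^sup>2)" "\<lambda>\<omega>. \<Sum>k\<in>I. v k \<bullet> ?D k \<omega>" 0] by simp
    also have "(\<Sum>k\<in>I. (\<sigma> k)\<^sup>2) = (\<Sum>k\<in>I. (ts (Suc k) - ts k) * (norm (v k))\<^sup>2)"
      by (rule sum.cong) (use ts(2) in \<open>auto simp: \<sigma>_def I_def less_imp_le\<close>)
    also have "\<dots> \<le> (\<Sum>k<n. (ts (Suc k) - ts k) * (norm (v k))\<^sup>2)"
      by (rule sum_mono2) (use ts(2) in \<open>auto simp: I_def less_imp_le\<close>)
    finally show ?thesis unfolding sum_I by (simp add: ennreal_leI)
  qed
qed

text \<open>Coordinate by coordinate the sum is scalar, with coefficient vectors S^T P^T e_a. Their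
  squared length is the form of S S^T at P^T e_a; since \<open>b\<close> bounds half of that matrix,
  the factor 2 appears, and the dimension counts the coordinates.\<close>

lemma (in prob_space) brownian_matrix_sum_second_moment_le:
  fixes W :: "real \<Rightarrow> 'a \<Rightarrow> real^'d::finite" and P :: "nat \<Rightarrow> real^'d^'d"
  assumes W: "brownian M W" and ts: "0 \<le> ts 0" "\<And>k. k < n \<Longrightarrow> ts k < ts (Suc k)"
    and S: "opnorm ((1 / 2) *\<^sub>R (S ** transpose S)) \<le> b"
  shows "(\<integral>\<^sup>+\<omega>. ennreal ((norm (\<Sum>k<n. (P k ** S) *v (W (ts (Suc k)) \<omega> - W (ts k) \<omega>)))\<^sup>2) \<partial>M)
    \<le> ennreal (real CARD('d) * (\<Sum>k<n. (ts (Suc k) - ts k) * (2 * b * (opnorm (P k))\<^sup>2)))"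
proof -
  let ?D = "\<lambda>k \<omega>. W (ts (Suc k)) \<omega> - W (ts k) \<omega>"
  let ?v = "\<lambda>a k. transpose S *v (transpose (P k) *v axis a 1)"
  let ?B = "\<Sum>k<n. (ts (Suc k) - ts k) * (2 * b * (opnorm (P k))\<^sup>2)"
  have b0: "0 \<le> b" using S opnorm_nonneg order_trans by blast
  have B0: "0 \<le> ?B" using ts(2) b0 by (intro sum_nonneg mult_nonneg_nonneg) (auto simp: less_imp_le)
  have comp: "(\<Sum>k<n. (P k ** S) *v ?D k \<omega>) $ a = (\<Sum>k<n. ?v a k \<bullet> ?D k \<omega>)" for a \<omega>
  proof -
    have "(\<Sum>k<n. (P k ** S) *v ?D k \<omega>) $ a = (\<Sum>k<n. ((P k ** S) *v ?D k \<omega>) $ a)" by simp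
    also have "\<dots> = (\<Sum>k<n. axis a 1 \<bullet> ((P k ** S) *v ?D k \<omega>))" by (simp only: inner_axis_one)
    also have "\<dots> = (\<Sum>k<n. ?v a k \<bullet> ?D k \<omega>)"
      by (rule sum.cong[OF refl]) (simp add: dot_lmul_matrix matrix_vector_mul_assoc)
    finally show ?thesis .
  qed
  have v_le: "(norm (?v a k))\<^sup>2 \<le> 2 * b * (opnorm (P k))\<^sup>2" for a k
  proof -
    let ?u = "transpose (P k) *v axis a 1"
    have "(norm (?v a k))\<^sup>2 = ?u \<bullet> ((S ** transpose S) *v ?u)"
      by (simp add: power2_norm_eq_inner dot_lmul_matrix flip: matrix_vector_mul_assoc)
    also have "\<dots> = 2 * (?u \<bullet> (((1 / 2) *\<^sub>R (S ** transpose S)) *v ?u))"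
      by (simp add: matrix_vector_simps)
    also have "\<dots> \<le> 2 * (b * (norm ?u)\<^sup>2)"
      by (intro mult_left_mono psd_quadratic_le S) simp
    also have "\<dots> \<le> 2 * (b * (opnorm (P k) * norm (axis a (1::real) :: real^'d))\<^sup>2)"
      by (intro mult_left_mono power_mono norm_transpose_vec_le b0) auto
    finally show ?thesis by simp
  qed
  have one: "(\<integral>\<^sup>+\<omega>. ennreal (((\<Sum>k<n. (P k ** S) *v ?D k \<omega>) $ a)\<^sup>2) \<partial>M) \<le> ennreal ?B" for a
  proof -
    have "(\<integral>\<^sup>+\<omega>. ennreal (((\<Sum>k<n. (P k ** S) *v ?D k \<omega>) $ a)\<^sup>2) \<partial>M)
        \<le> ennreal (\<Sum>k<n. (ts (Suc k) - ts k) * (norm (?v a k))\<^sup>2)"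
      unfolding comp by (rule brownian_sum_second_moment_le[OF W ts])
    also have "\<dots> \<le> ennreal ?B"
      by (intro ennreal_leI sum_mono mult_left_mono v_le) (use ts(2) in \<open>auto simp: less_imp_le\<close>)
    finally show ?thesis .
  qed
  have Dm: "?D k \<in> borel_measurable M" if "k < n" for k
  proof -
    have pos: "0 \<le> ts j" if "j \<le> n" for j
      using that
    proof (induction j)
      case (Suc j)
      then show ?case using ts(2)[of j] by simp
    qed (simp add: ts)
    show ?thesis
      using W pos[of k] pos[of "Suc k"] that unfolding brownian_def
      by (intro borel_measurable_diff) auto
  qed
  have "(\<integral>\<^sup>+\<omega>. ennreal ((norm (\<Sum>k<n. (P k ** S) *v ?D k \<omega>))\<^sup>2) \<partial>M)
      = (\<integral>\<^sup>+\<omega>. (\<Sum>a\<in>UNIV. ennreal (((\<Sum>k<n. (P k ** S) *v ?D k \<omega>) $ a)\<^sup>2)) \<partial>M)"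
    unfolding norm_square_vec by (intro nn_integral_cong sum_ennreal[symmetric]) simp
  also have "\<dots> = (\<Sum>a\<in>UNIV. \<integral>\<^sup>+\<omega>. ennreal (((\<Sum>k<n. (P k ** S) *v ?D k \<omega>) $ a)\<^sup>2) \<partial>M)"
    unfolding comp
    by (rule nn_integral_sum)
      (intro measurable_compose[OF _ measurable_ennreal] borel_measurable_power borel_measurable_sum
        borel_measurable_inner borel_measurable_const Dm, simp)
  also have "\<dots> \<le> (\<Sum>a\<in>(UNIV::'d set). ennreal ?B)" by (rule sum_mono) (rule one)
  also have "\<dots> = ennreal (\<Sum>a\<in>(UNIV::'d set). ?B)" by (rule sum_ennreal) (rule B0)
  also have "\<dots> = ennreal (real CARD('d) * ?B)" by simp
  finally show ?thesis .
qed

text \<open>Integration by parts turns the stochastic convolution into a pathwise limit of sums over Brownian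
  increments. Their second moments are computed exactly and do not involve the norm of \<open>B\<close>.\<close>

lemma convolution_path_limit:
  fixes \<xi> w :: "real \<Rightarrow> real^'d::finite"
  assumes t: "0 < t" and c\<xi>: "continuous_on {0..t} \<xi>" and w: "continuous_on {0..t} w" and w0: "w 0 = 0"
    and eq: "\<And>s. s \<in> {0..t} \<Longrightarrow> \<xi> s = \<xi>0 + integral {0..s} (\<lambda>u. B *v \<xi> u) + S *v w s"
  shows "(\<lambda>n. \<Sum>k<n. (mexp ((t - t * real (Suc k) / real n) *\<^sub>R B) ** S) *v
      (w (t * real (Suc k) / real n) - w (t * real k / real n)))
    \<longlonglongrightarrow> \<xi> t - mexp (t *\<^sub>R B) *v \<xi>0"
proof -
  note bl = bounded_bilinear_matrix_vector_mult
  define L where "L = (\<lambda>s. mexp ((t - s) *\<^sub>R B) ** S)"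
  define L' where "L' = (\<lambda>s. - (B ** mexp ((t - s) *\<^sub>R B)) ** S)"
  have Ld: "(L has_vector_derivative L' s) (at s within {0..t})" for s
    using has_vector_derivative_mm[OF mexp_reverse_has_vector_derivative[of t B s "{0..t}"] has_vector_derivative_const[of S]]
    unfolding L_def L'_def by simp
  have cL': "continuous_on {0..t} L'"
    unfolding L'_def by (intro continuous_intros)
  let ?I = "integral {0..t} (\<lambda>s. L' s *v w s)"
  have lim: "(\<lambda>n. \<Sum>k<n. (L (t * real (Suc k) / real n) - L (t * real k / real n)) *v w (t * real k / real n)) \<longlonglongrightarrow> ?I"
    by (rule riemann_stieltjes_sum[OF bl t Ld cL' w])
  \<comment> \<open>Summation by parts moves the increments from the rough path to the smooth factor
    \<open>L\<close>. The boundary term at 0 vanishes with \<open>w 0\<close>, and \<open>w\<close>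
    is then evaluated at left end points, as the limit of Stieltjes sums requires.\<close>
  have abel: "(\<Sum>k<n. L (t * real (Suc k) / real n) *v (w (t * real (Suc k) / real n) - w (t * real k / real n)))
      = L t *v w t - (\<Sum>k<n. (L (t * real (Suc k) / real n) - L (t * real k / real n)) *v w (t * real k / real n))"
    if n: "0 < n" for n
  proof -
    let ?f = "\<lambda>k. L (t * real k / real n) *v w (t * real k / real n)"
    have "(\<Sum>k<n. ?f (Suc k) - ?f k) = ?f n - ?f 0" by (rule sum_lessThan_telescope)
    also have "\<dots> = L t *v w t" using n by (simp add: w0)
    finally have "L t *v w t = (\<Sum>k<n. ?f (Suc k) - ?f k)" by simp
    then show ?thesis
      by (simp add: sum_subtractf[symmetric] matrix_vector_simps algebra_simps del: of_nat_Suc)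
  qed
  have "(\<lambda>n. L t *v w t - (\<Sum>k<n. (L (t * real (Suc k) / real n) - L (t * real k / real n)) *v w (t * real k / real n)))
      \<longlonglongrightarrow> L t *v w t - ?I"
    by (intro tendsto_diff tendsto_const lim)
  moreover have "\<forall>\<^sub>F n in sequentially. L t *v w t
      - (\<Sum>k<n. (L (t * real (Suc k) / real n) - L (t * real k / real n)) *v w (t * real k / real n))
      = (\<Sum>k<n. L (t * real (Suc k) / real n) *v (w (t * real (Suc k) / real n) - w (t * real k / real n)))"
    using eventually_gt_at_top[of 0] by eventually_elim (rule abel[symmetric])
  ultimately have "(\<lambda>n. \<Sum>k<n. L (t * real (Suc k) / real n) *v (w (t * real (Suc k) / real n) - w (t * real k / real n)))
      \<longlonglongrightarrow> L t *v w t - ?I"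
    by (rule Lim_transform_eventually)
  moreover have "L t *v w t - ?I = \<xi> t - mexp (t *\<^sub>R B) *v \<xi>0"
  proof -
    \<comment> \<open>The path minus its noise term. It is differentiable and solves a linear
      equation with forcing B S w, which variation of constants integrates; that integrand is the
      negative of the Stieltjes limit.\<close>
    define \<zeta> where "\<zeta> = (\<lambda>s. \<xi>0 + integral {0..s} (\<lambda>u. B *v \<xi> u))"
    have \<xi>_eq: "\<xi> s = \<zeta> s + S *v w s" if "s \<in> {0..t}" for s
      using eq[OF that] by (simp add: \<zeta>_def)
    have "(\<zeta> has_vector_derivative (B *v \<zeta> s + B *v (S *v w s))) (at s within {0..t})" if s: "s \<in> {0..t}" for s
    proof -
      have "continuous_on {0..t} (\<lambda>u. B *v \<xi> u)" by (intro continuous_intros c\<xi>)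
      from has_vector_derivative_add[OF has_vector_derivative_const[of \<xi>0] integral_has_vector_derivative[OF this s]]
      show ?thesis unfolding \<zeta>_def[symmetric] using \<xi>_eq[OF s] by (simp add: matrix_vector_simps)
    qed
    from variation_of_constants[OF this, of t] t
    have "((\<lambda>s. mexp ((t - s) *\<^sub>R B) *v (B *v (S *v w s))) has_integral (\<zeta> t - mexp (t *\<^sub>R B) *v \<zeta> 0)) {0..t}"
      by simp
    from has_integral_neg[OF this]
    have "((\<lambda>s. L' s *v w s) has_integral - (\<zeta> t - mexp (t *\<^sub>R B) *v \<zeta> 0)) {0..t}"
      unfolding L'_def by (simp add: matrix_vector_simps matrix_vector_mul_assoc mexp_scale_commute
          matrix_mul_assoc matrix_mult_simps)
    then have "?I = - (\<zeta> t - mexp (t *\<^sub>R B) *v \<zeta> 0)" by (rule integral_unique)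
    then show ?thesis using \<xi>_eq[of t] t by (simp add: L_def mexp_0 \<zeta>_def)
  qed
  ultimately show ?thesis unfolding L_def by simp
qed

text \<open>Centring at \<mu>, a rest point of the drift, removes the constant term. What remains
  after subtracting the free motion is an almost sure limit of sums over Brownian increments.
  Fatou's lemma bounds its second moment by a limit of Riemann sums for the integral of exp (- 2
  \<nu> (t - s)).\<close>

lemma (in prob_space) stable_linear_sde_second_moment_le:
  fixes X W :: "real \<Rightarrow> 'a \<Rightarrow> real^'d::finite"
  assumes W: "brownian M W" and t: "0 \<le> t"
    and Xm: "X t \<in> borel_measurable M" and x0m: "x0 \<in> borel_measurable M"
    and K: "K > 0" and \<nu>: "\<nu> > 0" and B: "\<And>s. 0 \<le> s \<Longrightarrow> opnorm (mexp (s *\<^sub>R B)) \<le> K * exp (- \<nu> * s)"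
    and S: "opnorm ((1 / 2) *\<^sub>R (S ** transpose S)) \<le> b"
    and B\<mu>: "B *v \<mu> = p"
    and eq: "AE \<omega> in M. continuous_on {0..} (\<lambda>t. X t \<omega>) \<and> (\<forall>t\<ge>0. X t \<omega> = x0 \<omega>
        + integral {0..t} (\<lambda>s. B *v X s \<omega> - p) + S *v W t \<omega>)"
    and v0: "(\<integral>\<^sup>+\<omega>. ennreal ((norm (x0 \<omega> - \<mu>))\<^sup>2) \<partial>M) \<le> ennreal v" "0 \<le> v"
  shows "(\<integral>\<^sup>+\<omega>. ennreal ((norm (X t \<omega>))\<^sup>2) \<partial>M)
    \<le> ennreal (3 * (real CARD('d) * b * K\<^sup>2 / \<nu> + K\<^sup>2 * v + (norm \<mu>)\<^sup>2))"
proof -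
  have b0: "0 \<le> b" using S opnorm_nonneg order_trans by blast
  let ?c = "real CARD('d) * (2 * b * K\<^sup>2)"
  have c0: "0 \<le> ?c" using b0 by simp
  have Wc: "AE \<omega> in M. W 0 \<omega> = 0 \<and> continuous_on {0..} (\<lambda>t. W t \<omega>)"
    using W unfolding brownian_def by blast
  let ?Y = "\<lambda>\<omega>. X t \<omega> - \<mu> - mexp (t *\<^sub>R B) *v (x0 \<omega> - \<mu>)"
  have path: "AE \<omega> in M. W 0 \<omega> = 0 \<and> continuous_on {0..t} (\<lambda>s. W s \<omega>) \<and> continuous_on {0..t} (\<lambda>s. X s \<omega> - \<mu>)
      \<and> (\<forall>s\<in>{0..t}. X s \<omega> - \<mu> = (x0 \<omega> - \<mu>) + integral {0..s} (\<lambda>u. B *v (X u \<omega> - \<mu>)) + S *v W s \<omega>)"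
    using eq Wc
  proof eventually_elim
    case (elim \<omega>)
    have "continuous_on {0..t} (\<lambda>s. X s \<omega>)" "continuous_on {0..t} (\<lambda>s. W s \<omega>)"
      using elim by (auto intro: continuous_on_subset)
    then show ?case using elim by (auto simp: matrix_vector_simps B\<mu> intro!: continuous_intros)
  qed
  have Y: "(\<integral>\<^sup>+\<omega>. ennreal ((norm (?Y \<omega>))\<^sup>2) \<partial>M) \<le> ennreal (?c / (2 * \<nu>))"
  proof (cases "t = 0")
    \<comment> \<open>At time 0 the partition would have increments of length 0, and the variable is
      0 almost surely.\<close>
    case True
    have "(\<integral>\<^sup>+\<omega>. ennreal ((norm (?Y \<omega>))\<^sup>2) \<partial>M) = (\<integral>\<^sup>+\<omega>. 0 \<partial>M)"
    proof (rule nn_integral_cong_AE, use path in eventually_elim)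
      fix \<omega> assume a: "W 0 \<omega> = 0 \<and> continuous_on {0..t} (\<lambda>s. W s \<omega>) \<and> continuous_on {0..t} (\<lambda>s. X s \<omega> - \<mu>)
        \<and> (\<forall>s\<in>{0..t}. X s \<omega> - \<mu> = (x0 \<omega> - \<mu>) + integral {0..s} (\<lambda>u. B *v (X u \<omega> - \<mu>)) + S *v W s \<omega>)"
      then have "X 0 \<omega> - \<mu> = (x0 \<omega> - \<mu>) + integral {0..0} (\<lambda>u. B *v (X u \<omega> - \<mu>)) + S *v W 0 \<omega>"
        using True by (metis atLeastAtMost_iff order_refl)
      then show "ennreal ((norm (?Y \<omega>))\<^sup>2) = 0" using a True by (simp add: mexp_0)
    qed
    then show ?thesis by simp
  next
    case False
    then have tp: "0 < t" using t by simp
    define ts where "ts = (\<lambda>(n::nat) (k::nat). t * real k / real n)"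
    define Y where "Y = (\<lambda>n \<omega>. \<Sum>k<n. (mexp ((t - ts n (Suc k)) *\<^sub>R B) ** S) *v (W (ts n (Suc k)) \<omega> - W (ts n k) \<omega>))"
    have ts0: "0 \<le> ts n k" for n k unfolding ts_def using t by simp
    have Ym: "Y n \<in> borel_measurable M" for n
    proof -
      have "W (ts n k) \<in> borel_measurable M" for k
        using W ts0 unfolding brownian_def by blast
      then show ?thesis unfolding Y_def
        by (intro borel_measurable_sum borel_measurable_continuous_on[where f = "\<lambda>x. _ *v x"] borel_measurable_diff)
          (auto intro!: continuous_intros)
    qed
    have "(\<integral>\<^sup>+\<omega>. ennreal ((norm (?Y \<omega>))\<^sup>2) \<partial>M) = (\<integral>\<^sup>+\<omega>. liminf (\<lambda>n. ennreal ((norm (Y n \<omega>))\<^sup>2)) \<partial>M)"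
    proof (rule nn_integral_cong_AE, use path in eventually_elim)
      fix \<omega> assume a: "W 0 \<omega> = 0 \<and> continuous_on {0..t} (\<lambda>s. W s \<omega>) \<and> continuous_on {0..t} (\<lambda>s. X s \<omega> - \<mu>)
        \<and> (\<forall>s\<in>{0..t}. X s \<omega> - \<mu> = (x0 \<omega> - \<mu>) + integral {0..s} (\<lambda>u. B *v (X u \<omega> - \<mu>)) + S *v W s \<omega>)"
      have "(\<lambda>n. Y n \<omega>) \<longlonglongrightarrow> ?Y \<omega>"
        unfolding Y_def ts_def
        by (rule convolution_path_limit[OF tp, where \<xi> = "\<lambda>s. X s \<omega> - \<mu>" and w = "\<lambda>s. W s \<omega>"]) (use a in auto)
      then have "(\<lambda>n. ennreal ((norm (Y n \<omega>))\<^sup>2)) \<longlonglongrightarrow> ennreal ((norm (?Y \<omega>))\<^sup>2)"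
        by (intro tendsto_ennrealI tendsto_power tendsto_norm)
      from lim_imp_Liminf[OF sequentially_bot this]
      show "ennreal ((norm (?Y \<omega>))\<^sup>2) = liminf (\<lambda>n. ennreal ((norm (Y n \<omega>))\<^sup>2))" by (rule sym)
    qed
    also have "\<dots> \<le> liminf (\<lambda>n. \<integral>\<^sup>+\<omega>. ennreal ((norm (Y n \<omega>))\<^sup>2) \<partial>M)"
      using Ym by (intro nn_integral_liminf) simp
    \<comment> \<open>The sums evaluate the exponential at right end points, the Riemann sums at
      left ones; the shift by one step is the factor exp (2 \<nu> t / n), which tends to 1.\<close>
    also have "\<dots> \<le> liminf (\<lambda>n. ennreal (?c * (exp (2 * \<nu> * (t / real n)) * (\<Sum>k<n. t / real n * exp (- (2 * \<nu>) * (t - t * real k / real n))))))"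
    proof (rule Liminf_mono, rule eventually_mono[OF eventually_gt_at_top[of 0]])
      fix n :: nat assume n: "0 < n"
      have step: "ts n (Suc k) - ts n k = t / real n" for k
        unfolding ts_def by (simp add: diff_divide_distrib[symmetric] algebra_simps)
      have "(\<integral>\<^sup>+\<omega>. ennreal ((norm (Y n \<omega>))\<^sup>2) \<partial>M)
          \<le> ennreal (real CARD('d) * (\<Sum>k<n. (ts n (Suc k) - ts n k) * (2 * b * (opnorm (mexp ((t - ts n (Suc k)) *\<^sub>R B)))\<^sup>2)))"
        unfolding Y_def
      proof (rule brownian_matrix_sum_second_moment_le[OF W _ _ S])
        show "ts n k < ts n (Suc k)" for k using step[of k] tp n by (simp add: algebra_simps)
      qed (simp add: ts0)
      also have "\<dots> \<le> ennreal (?c * (exp (2 * \<nu> * (t / real n)) * (\<Sum>k<n. t / real n * exp (- (2 * \<nu>) * (t - t * real k / real n)))))"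
      proof (rule ennreal_leI)
        have "(ts n (Suc k) - ts n k) * (2 * b * (opnorm (mexp ((t - ts n (Suc k)) *\<^sub>R B)))\<^sup>2)
            \<le> 2 * b * K\<^sup>2 * (exp (2 * \<nu> * (t / real n)) * (t / real n * exp (- (2 * \<nu>) * (t - t * real k / real n))))"
          if k: "k < n" for k
        proof -
          have "ts n (Suc k) \<le> t" unfolding ts_def using k n t by (simp add: divide_le_eq mult_left_mono)
          then have "(opnorm (mexp ((t - ts n (Suc k)) *\<^sub>R B)))\<^sup>2 \<le> (K * exp (- \<nu> * (t - ts n (Suc k))))\<^sup>2"
            by (intro power_mono B opnorm_nonneg) simp
          also have "\<dots> = K\<^sup>2 * exp (- (2 * \<nu>) * (t - ts n (Suc k)))"
            by (simp add: power_mult_distrib mult.assoc flip: exp_double)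
          also have "- (2 * \<nu>) * (t - ts n (Suc k)) = 2 * \<nu> * (t / real n) + - (2 * \<nu>) * (t - t * real k / real n)"
            using step[of k] by (simp add: ts_def algebra_simps add_divide_distrib)
          finally have "(opnorm (mexp ((t - ts n (Suc k)) *\<^sub>R B)))\<^sup>2
              \<le> K\<^sup>2 * (exp (2 * \<nu> * (t / real n)) * exp (- (2 * \<nu>) * (t - t * real k / real n)))"
            by (simp only: exp_add)
          then have "(t / real n) * (2 * b * (opnorm (mexp ((t - ts n (Suc k)) *\<^sub>R B)))\<^sup>2)
              \<le> (t / real n) * (2 * b * (K\<^sup>2 * (exp (2 * \<nu> * (t / real n)) * exp (- (2 * \<nu>) * (t - t * real k / real n)))))"
            using t b0 by (intro mult_left_mono) auto
          then show ?thesis unfolding step by (simp only: mult_ac)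
        qed
        then have "(\<Sum>k<n. (ts n (Suc k) - ts n k) * (2 * b * (opnorm (mexp ((t - ts n (Suc k)) *\<^sub>R B)))\<^sup>2))
            \<le> (\<Sum>k<n. 2 * b * K\<^sup>2 * (exp (2 * \<nu> * (t / real n)) * (t / real n * exp (- (2 * \<nu>) * (t - t * real k / real n)))))"
          by (intro sum_mono) simp
        then have "real CARD('d) * (\<Sum>k<n. (ts n (Suc k) - ts n k) * (2 * b * (opnorm (mexp ((t - ts n (Suc k)) *\<^sub>R B)))\<^sup>2))
            \<le> real CARD('d) * (\<Sum>k<n. 2 * b * K\<^sup>2 * (exp (2 * \<nu> * (t / real n)) * (t / real n * exp (- (2 * \<nu>) * (t - t * real k / real n)))))"
          by (rule mult_left_mono) simp
        then show "real CARD('d) * (\<Sum>k<n. (ts n (Suc k) - ts n k) * (2 * b * (opnorm (mexp ((t - ts n (Suc k)) *\<^sub>R B)))\<^sup>2))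
            \<le> ?c * (exp (2 * \<nu> * (t / real n)) * (\<Sum>k<n. t / real n * exp (- (2 * \<nu>) * (t - t * real k / real n))))"
          by (simp only: sum_distrib_left[symmetric] mult.assoc)
      qed
      finally show "(\<integral>\<^sup>+\<omega>. ennreal ((norm (Y n \<omega>))\<^sup>2) \<partial>M)
        \<le> ennreal (?c * (exp (2 * \<nu> * (t / real n)) * (\<Sum>k<n. t / real n * exp (- (2 * \<nu>) * (t - t * real k / real n)))))" .
    qed
    also have "\<dots> = ennreal (?c * (exp (2 * \<nu> * 0) * integral {0..t} (\<lambda>s. exp (- (2 * \<nu>) * (t - s)))))"
      by (intro lim_imp_Liminf tendsto_ennrealI tendsto_mult tendsto_const tendsto_exp riemann_sum t
          lim_const_over_n continuous_intros) simp
    also have "\<dots> \<le> ennreal (?c * (1 * (1 / (2 * \<nu>))))"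
      using integral_exp_decay_reverse_le[of "2 * \<nu>" t] \<nu> t c0 by (intro ennreal_leI mult_left_mono) auto
    finally show ?thesis by simp
  qed
  \<comment> \<open>Three summands: the noise part, the free motion of x0 - \<mu>, which never
    exceeds K times its start, and \<mu>.\<close>
  have n3: "(norm (X t \<omega>))\<^sup>2 \<le> 3 * ((norm (?Y \<omega>))\<^sup>2 + K\<^sup>2 * (norm (x0 \<omega> - \<mu>))\<^sup>2 + (norm \<mu>)\<^sup>2)" for \<omega>
  proof -
    have n: "norm (mexp (t *\<^sub>R B) *v (x0 \<omega> - \<mu>)) \<le> K * norm (x0 \<omega> - \<mu>)"
    proof (rule norm_mult_vec_le[OF order_trans[OF B[OF t]]])
      show "K * exp (- \<nu> * t) \<le> K" using K \<nu> t by (simp add: mult_le_cancel_left1)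
    qed
    have X_eq: "?Y \<omega> + mexp (t *\<^sub>R B) *v (x0 \<omega> - \<mu>) + \<mu> = X t \<omega>" by simp
    have "norm (?Y \<omega> + mexp (t *\<^sub>R B) *v (x0 \<omega> - \<mu>) + \<mu>)
        \<le> norm (?Y \<omega>) + norm (mexp (t *\<^sub>R B) *v (x0 \<omega> - \<mu>)) + norm \<mu>"
      by (intro order_trans[OF norm_triangle_ineq] add_right_mono norm_triangle_ineq)
    then have "norm (X t \<omega>) \<le> norm (?Y \<omega>) + norm (mexp (t *\<^sub>R B) *v (x0 \<omega> - \<mu>)) + norm \<mu>"
      unfolding X_eq .
    then have "norm (X t \<omega>) \<le> norm (?Y \<omega>) + K * norm (x0 \<omega> - \<mu>) + norm \<mu>" using n by linarith
    then have "(norm (X t \<omega>))\<^sup>2 \<le> (norm (?Y \<omega>) + K * norm (x0 \<omega> - \<mu>) + norm \<mu>)\<^sup>2" by (rule power_mono) simp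
    also have "\<dots> \<le> 3 * ((norm (?Y \<omega>))\<^sup>2 + (K * norm (x0 \<omega> - \<mu>))\<^sup>2 + (norm \<mu>)\<^sup>2)" by (rule three_squares)
    finally show ?thesis by (simp only: power_mult_distrib)
  qed
  have xm: "(\<lambda>\<omega>. x0 \<omega> - \<mu>) \<in> borel_measurable M" using x0m by (intro borel_measurable_diff) auto
  have Ym: "?Y \<in> borel_measurable M"
    by (intro borel_measurable_diff Xm borel_measurable_const borel_measurable_continuous_on[where f = "\<lambda>x. _ *v x"] xm x0m)
      (auto intro!: continuous_intros)
  have "(\<integral>\<^sup>+\<omega>. ennreal ((norm (X t \<omega>))\<^sup>2) \<partial>M)
      \<le> (\<integral>\<^sup>+\<omega>. 3 * (ennreal ((norm (?Y \<omega>))\<^sup>2) + ennreal (K\<^sup>2) * ennreal ((norm (x0 \<omega> - \<mu>))\<^sup>2) + ennreal ((norm \<mu>)\<^sup>2)) \<partial>M)"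
  proof (rule nn_integral_mono)
    fix \<omega>
    have "ennreal ((norm (X t \<omega>))\<^sup>2) \<le> ennreal (3 * ((norm (?Y \<omega>))\<^sup>2 + K\<^sup>2 * (norm (x0 \<omega> - \<mu>))\<^sup>2 + (norm \<mu>)\<^sup>2))"
      by (rule ennreal_leI[OF n3])
    also have "\<dots> = 3 * (ennreal ((norm (?Y \<omega>))\<^sup>2) + ennreal (K\<^sup>2) * ennreal ((norm (x0 \<omega> - \<mu>))\<^sup>2) + ennreal ((norm \<mu>)\<^sup>2))"
      by (simp add: ennreal_mult ennreal_plus)
    finally show "ennreal ((norm (X t \<omega>))\<^sup>2)
      \<le> 3 * (ennreal ((norm (?Y \<omega>))\<^sup>2) + ennreal (K\<^sup>2) * ennreal ((norm (x0 \<omega> - \<mu>))\<^sup>2) + ennreal ((norm \<mu>)\<^sup>2))" .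
  qed
  also have "\<dots> = 3 * ((\<integral>\<^sup>+\<omega>. ennreal ((norm (?Y \<omega>))\<^sup>2) \<partial>M)
      + ennreal (K\<^sup>2) * (\<integral>\<^sup>+\<omega>. ennreal ((norm (x0 \<omega> - \<mu>))\<^sup>2) \<partial>M) + ennreal ((norm \<mu>)\<^sup>2))"
    using Ym xm by (simp add: nn_integral_cmult nn_integral_add emeasure_space_1)
  also have "\<dots> \<le> 3 * (ennreal (?c / (2 * \<nu>)) + ennreal (K\<^sup>2) * ennreal (v) + ennreal ((norm \<mu>)\<^sup>2))"
    by (intro mult_left_mono add_mono Y v0 order_refl) auto
  also have "\<dots> = ennreal (3 * (real CARD('d) * b * K\<^sup>2 / \<nu> + K\<^sup>2 * v + (norm \<mu>)\<^sup>2))"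
  proof -
    have e: "?c / (2 * \<nu>) = real CARD('d) * b * K\<^sup>2 / \<nu>" by simp
    have "0 \<le> real CARD('d) * b * K\<^sup>2 / \<nu>" using b0 \<nu> by simp
    moreover have "3 * (ennreal a + ennreal (K\<^sup>2) * ennreal v + ennreal ((norm \<mu>)\<^sup>2))
        = ennreal (3 * (a + K\<^sup>2 * v + (norm \<mu>)\<^sup>2))" if "0 \<le> a" for a
      using that v0(2) by (simp add: ennreal_mult ennreal_plus)
    ultimately show ?thesis unfolding e by blast
  qed
  finally show ?thesis .
qed

section \<open>Deviation of states and controls\<close>

lemma state_deviation_square_le:
  fixes Y X w :: "real \<Rightarrow> real^'d::finite" and E :: "real \<Rightarrow> real^'d^'d"
  assumes K: "0 < K" and \<nu>: "0 < \<nu>" and r: "0 < r" and kl: "0 < k" "0 < l"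
    and B: "\<And>s. 0 \<le> s \<Longrightarrow> opnorm (mexp (s *\<^sub>R B)) \<le> K * exp (- \<nu> * s)"
    and P: "opnorm P \<le> r"
    and cE: "continuous_on {0..T} E" and El: "\<And>t. t \<in> {0..T} \<Longrightarrow> opnorm (E t) \<le> k * exp (- l * (T - t))"
    and cz: "continuous_on {0..T} z"
    and cY: "continuous_on {0..T} Y" and cX: "continuous_on {0..T} X"
    and Y: "\<And>t. t \<in> {0..T} \<Longrightarrow> Y t = init
      + integral {0..t} (\<lambda>s. (B + P ** E s) *v Y s - P *v (z s + \<rho>)) + S *v w t"
    and X: "\<And>t. t \<in> {0..T} \<Longrightarrow> X t = init + integral {0..t} (\<lambda>s. B *v X s - P *v \<rho>) + S *v w t"
    and t: "t \<in> {0..T}"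
  shows "(norm (Y t - X t))\<^sup>2 \<le> 2 * (K * exp (K * (r * k / l)))\<^sup>2 / \<nu>
    * decay_conv \<nu> (\<lambda>s. 2 * r\<^sup>2 * (k\<^sup>2 * (exp (- l * (T - s)))\<^sup>2 * (norm (X s))\<^sup>2 + (norm (z s))\<^sup>2)) t"
proof -
  have T: "0 \<le> T" using t by auto
  define e where "e = (\<lambda>t. Y t - X t)"
  \<comment> \<open>Neither state is differentiable, but the common noise cancels in their
    difference, whose integral equation has a continuous integrand. So \<open>e\<close> is a
    classical solution, with \<open>p\<close> as its perturbation.\<close>
  define p where "p = (\<lambda>s. P *v (E s *v e s) + P *v (E s *v X s) - P *v z s)"
  have ce: "continuous_on {0..T} e" unfolding e_def by (intro continuous_intros cY cX)
  have cp: "continuous_on {0..T} p" unfolding p_def by (intro continuous_intros ce cE cX cz)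
  have ei: "e t = integral {0..t} (\<lambda>s. B *v e s + p s)" if t: "t \<in> {0..T}" for t
  proof -
    have sub: "{0..t} \<subseteq> {0..T}" using t by auto
    have "e t = integral {0..t} (\<lambda>s. (B + P ** E s) *v Y s - P *v (z s + \<rho>)) - integral {0..t} (\<lambda>s. B *v X s - P *v \<rho>)"
      unfolding e_def Y[OF t] X[OF t] by simp
    also have "\<dots> = integral {0..t} (\<lambda>s. ((B + P ** E s) *v Y s - P *v (z s + \<rho>)) - (B *v X s - P *v \<rho>))"
      by (rule Henstock_Kurzweil_Integration.integral_diff[symmetric];
        intro integrable_continuous_real continuous_on_subset[OF _ sub] continuous_intros cE cY cz cX)
    also have "\<dots> = integral {0..t} (\<lambda>s. B *v e s + p s)"
      by (simp add: e_def p_def matrix_vector_simps algebra_simps flip: matrix_vector_mul_assoc)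
    finally show ?thesis .
  qed
  have ed: "(e has_vector_derivative (B *v e t + p t)) (at t within {0..T})" if t: "t \<in> {0..T}" for t
  proof -
    have "continuous_on {0..T} (\<lambda>s. B *v e s + p s)" by (intro continuous_intros ce cp)
    from has_vector_derivative_transform[OF t ei integral_has_vector_derivative[OF this t]]
    show ?thesis .
  qed
  \<comment> \<open>The term with E e is left to the Gronwall kernel; the forcing keeps only E X and
    \<open>z\<close>.\<close>
  define G where "G = (\<lambda>s. r * (k * exp (- l * (T - s)) * norm (X s)) + r * norm (z s))"
  have cG: "continuous_on {0..T} G" unfolding G_def by (intro continuous_intros cX cz)
  have "(norm (e t))\<^sup>2 \<le> 2 * (K * exp (K * (r * k / l)))\<^sup>2 * ((norm (e 0))\<^sup>2 + decay_conv \<nu> (\<lambda>s. (G s)\<^sup>2) t / \<nu>)"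
  proof (rule perturbed_linear_ode_bound_square[OF ed K B, where k = "\<lambda>t. r * k * exp (- l * (T - t))"])
    fix t assume t: "t \<in> {0..T}"
    have PE: "norm (P *v (E t *v y)) \<le> r * (k * exp (- l * (T - t)) * norm y)" for y
      by (intro order_trans[OF norm_mult_vec_le[OF P]] mult_left_mono norm_mult_vec_le El t) (use r in simp)
    have "norm (p t) \<le> norm (P *v (E t *v e t)) + norm (P *v (E t *v X t)) + norm (P *v z t)"
      unfolding p_def by (intro order_trans[OF norm_triangle_ineq4] add_right_mono norm_triangle_ineq)
    then show "norm (p t) \<le> r * k * exp (- l * (T - t)) * norm (e t) + G t"
      unfolding G_def using PE[of "e t"] PE[of "X t"] norm_mult_vec_le[OF P, of "z t"] by (simp add: mult.assoc)
    show "0 \<le> r * k * exp (- l * (T - t))" "0 \<le> G t" unfolding G_def using r kl by simp_all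
  next
    have "integral {0..T} (\<lambda>t. r * k * exp (- l * (T - t))) = r * k * integral {0..T} (\<lambda>t. exp (- l * (T - t)))"
      by (simp only: integral_mult_right)
    also have "\<dots> \<le> r * k * (1 / l)"
      by (rule mult_left_mono[OF integral_exp_decay_reverse_le]) (use kl r T in auto)
    finally show "integral {0..T} (\<lambda>t. r * k * exp (- l * (T - t))) \<le> r * k / l" by simp
  qed (assumption | rule \<nu> t | intro continuous_intros cG)+
  moreover have "e 0 = 0" using ei[of 0] T by simp
  moreover have "decay_conv \<nu> (\<lambda>s. (G s)\<^sup>2) t
      \<le> decay_conv \<nu> (\<lambda>s. 2 * r\<^sup>2 * (k\<^sup>2 * (exp (- l * (T - s)))\<^sup>2 * (norm (X s))\<^sup>2 + (norm (z s))\<^sup>2)) t"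
  proof (rule decay_conv_mono)
    have sub: "{0..t} \<subseteq> {0..T}" using t by auto
    show "continuous_on {0..t} (\<lambda>s. (G s)\<^sup>2)"
      by (intro continuous_on_subset[OF _ sub] continuous_intros cG)
    show "continuous_on {0..t} (\<lambda>s. 2 * r\<^sup>2 * (k\<^sup>2 * (exp (- l * (T - s)))\<^sup>2 * (norm (X s))\<^sup>2 + (norm (z s))\<^sup>2))"
      by (intro continuous_on_subset[OF _ sub] continuous_intros cX cz)
    fix s
    have "(G s)\<^sup>2 = r\<^sup>2 * (k * exp (- l * (T - s)) * norm (X s) + norm (z s))\<^sup>2"
      unfolding G_def by (simp add: power_mult_distrib flip: distrib_left)
    also have "\<dots> \<le> r\<^sup>2 * (2 * ((k * exp (- l * (T - s)) * norm (X s))\<^sup>2 + (norm (z s))\<^sup>2))"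
      by (rule mult_left_mono)
        (use sum_squares_bound[of "k * exp (- l * (T - s)) * norm (X s)" "norm (z s)"] in \<open>simp_all add: power2_sum\<close>)
    finally show "(G s)\<^sup>2 \<le> 2 * r\<^sup>2 * (k\<^sup>2 * (exp (- l * (T - s)))\<^sup>2 * (norm (X s))\<^sup>2 + (norm (z s))\<^sup>2)"
      by (simp only: power_mult_distrib mult_ac)
  qed
  then have "2 * (K * exp (K * (r * k / l)))\<^sup>2 * (decay_conv \<nu> (\<lambda>s. (G s)\<^sup>2) t / \<nu>)
      \<le> 2 * (K * exp (K * (r * k / l)))\<^sup>2 * (decay_conv \<nu> (\<lambda>s. 2 * r\<^sup>2 * (k\<^sup>2 * (exp (- l * (T - s)))\<^sup>2 * (norm (X s))\<^sup>2 + (norm (z s))\<^sup>2)) t / \<nu>)"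
    by (intro mult_left_mono divide_right_mono) (use \<nu> in auto)
  ultimately show ?thesis unfolding e_def by simp
qed

text \<open>The control deviation is P applied to L'(y - x) - (L - L') x + z. Writing L' as L minus
  a difference of norm at most \<open>k\<close> bounds it by 2 k, while the decaying bound
  \<open>c\<close> is kept for the term that multiplies \<open>x\<close>.\<close>

lemma control_deviation_square_le:
  fixes P :: "real^'d::finite^'d"
  assumes P: "opnorm P \<le> r" and r: "0 < r" and L: "opnorm L \<le> k" and E: "opnorm (L - L') \<le> c" "c \<le> k"
  shows "(norm (P *v (L' *v y) + P *v (z + \<rho>) - (P *v (L *v x) + P *v \<rho>)))\<^sup>2
    \<le> 3 * r\<^sup>2 * (4 * k\<^sup>2 * (norm (y - x))\<^sup>2 + c\<^sup>2 * (norm x)\<^sup>2 + (norm z)\<^sup>2)"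
proof -
  have c: "0 \<le> c" using E(1) opnorm_nonneg order_trans by blast
  have k: "0 \<le> k" using L opnorm_nonneg order_trans by blast
  have L'_le: "norm (L' *v u) \<le> 2 * k * norm u" for u
  proof -
    have "L' *v u = L *v u - (L - L') *v u" by (simp add: matrix_vector_simps)
    then have "norm (L' *v u) \<le> norm (L *v u) + norm ((L - L') *v u)" by (metis norm_triangle_ineq4)
    also have "\<dots> \<le> k * norm u + k * norm u"
      by (intro add_mono norm_mult_vec_le L order_trans[OF E(1) E(2)])
    finally show ?thesis by simp
  qed
  have eq: "P *v (L' *v y) + P *v (z + \<rho>) - (P *v (L *v x) + P *v \<rho>)
      = P *v (L' *v (y - x) - (L - L') *v x + z)"
    by (simp add: matrix_vector_simps)
  have "norm (L' *v (y - x) - (L - L') *v x + z) \<le> norm (L' *v (y - x)) + norm ((L - L') *v x) + norm z"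
    by (intro order_trans[OF norm_triangle_ineq] add_right_mono norm_triangle_ineq4)
  also have "\<dots> \<le> 2 * k * norm (y - x) + c * norm x + norm z"
    by (intro add_mono L'_le norm_mult_vec_le E order_refl)
  finally have n: "norm (L' *v (y - x) - (L - L') *v x + z) \<le> 2 * k * norm (y - x) + c * norm x + norm z" .
  have "norm (P *v (L' *v (y - x) - (L - L') *v x + z)) \<le> r * (2 * k * norm (y - x) + c * norm x + norm z)"
    by (rule order_trans[OF norm_mult_vec_le[OF P] mult_left_mono[OF n]]) (use r in simp)
  then have "(norm (P *v (L' *v (y - x) - (L - L') *v x + z)))\<^sup>2 \<le> (r * (2 * k * norm (y - x) + c * norm x + norm z))\<^sup>2"
    by (rule power_mono) simp
  also have "\<dots> = r\<^sup>2 * (2 * k * norm (y - x) + c * norm x + norm z)\<^sup>2" by (simp only: power_mult_distrib)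
  also have "\<dots> \<le> r\<^sup>2 * (3 * ((2 * k * norm (y - x))\<^sup>2 + (c * norm x)\<^sup>2 + (norm z)\<^sup>2))"
    by (intro mult_left_mono three_squares) simp
  finally show ?thesis unfolding eq by (simp add: power_mult_distrib algebra_simps)
qed

lemma two_sided_square_le: "(two_sided \<epsilon> T t)\<^sup>2 \<le> 2 * two_sided (2 * \<epsilon>) T t"
proof -
  have "(two_sided \<epsilon> T t)\<^sup>2 \<le> 2 * ((exp (- \<epsilon> * t))\<^sup>2 + (exp (- \<epsilon> * (T - t)))\<^sup>2)"
    unfolding two_sided_def using sum_squares_bound[of "exp (- \<epsilon> * t)" "exp (- \<epsilon> * (T - t))"]
    by (simp add: power2_sum)
  also have "\<dots> = 2 * two_sided (2 * \<epsilon>) T t"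
    unfolding two_sided_def by (simp add: mult.assoc flip: exp_double)
  finally show ?thesis .
qed

lemma continuous_on_two_sided [continuous_intros]: "continuous_on S (two_sided \<epsilon> T)"
  unfolding two_sided_def by (intro continuous_intros)

text \<open>Half of the rate \<nu> transports exp (- \<epsilon> s) to time t, and the other half
  remains integrable. The backward exponential needs no transport, being increasing in s.\<close>

lemma decay_conv_two_sided_le:
  assumes \<nu>: "0 < \<nu>" and \<epsilon>: "0 \<le> \<epsilon>" "2 * \<epsilon> \<le> \<nu>" and t: "t \<in> {0..T}"
  shows "decay_conv \<nu> (two_sided \<epsilon> T) t \<le> 2 / \<nu> * two_sided \<epsilon> T t"
proof -
  have "decay_conv \<nu> (two_sided \<epsilon> T) t \<le> integral {0..t} (\<lambda>s. two_sided \<epsilon> T t * exp (- (\<nu> / 2) * (t - s)))"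
    unfolding decay_conv_def
  proof (rule integral_le)
    fix s assume s: "s \<in> {0..t}"
    have "\<epsilon> * (t - s) \<le> \<nu> / 2 * (t - s)" using \<epsilon> s by (intro mult_right_mono) auto
    then have "exp (- \<nu> * (t - s)) * exp (- \<epsilon> * s) \<le> exp (- \<epsilon> * t) * exp (- (\<nu> / 2) * (t - s))"
      unfolding exp_add[symmetric] by (simp add: field_simps)
    moreover have "exp (- \<nu> * (t - s)) * exp (- \<epsilon> * (T - s)) \<le> exp (- (\<nu> / 2) * (t - s)) * exp (- \<epsilon> * (T - t))"
      using s \<nu> \<epsilon> by (intro mult_mono) (auto intro!: mult_left_mono simp: mult_right_mono)
    ultimately show "exp (- \<nu> * (t - s)) * two_sided \<epsilon> T s \<le> two_sided \<epsilon> T t * exp (- (\<nu> / 2) * (t - s))"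
      unfolding two_sided_def by (simp only: distrib_left distrib_right mult_ac) 
  qed (intro integrable_continuous_real continuous_intros)+
  also have "\<dots> = two_sided \<epsilon> T t * integral {0..t} (\<lambda>s. exp (- (\<nu> / 2) * (t - s)))"
    by (simp only: integral_mult_right)
  also have "\<dots> \<le> two_sided \<epsilon> T t * (1 / (\<nu> / 2))"
    by (intro mult_left_mono integral_exp_decay_reverse_le) (use \<nu> t two_sided_pos[of \<epsilon> T t] in auto)
  finally show ?thesis by (simp add: mult.commute)
qed

text \<open>The pathwise bound depends on \<omega> only through |X|^2, so taking expectations
  replaces the random forcing by the deterministic \<open>g\<close>. The control part adds 12 r^2
  k^2 times the state part and 3/2 of the forcing at time t, the latter because 3 r^2 is 3/2 times
  the factor 2 r^2 in \<open>g\<close>.\<close>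

lemma (in prob_space) gap_second_moment_le:
  fixes Y X w :: "real \<Rightarrow> 'a \<Rightarrow> real^'d::finite" and E :: "real \<Rightarrow> real^'d^'d"
  assumes K: "0 < K" and \<nu>: "0 < \<nu>" and r: "0 < r" and kl: "0 < k" "0 < l"
    and B: "\<And>s. 0 \<le> s \<Longrightarrow> opnorm (mexp (s *\<^sub>R B)) \<le> K * exp (- \<nu> * s)"
    and P: "opnorm P \<le> r" and L: "opnorm L \<le> k"
    and cE: "continuous_on {0..T} E" and El: "\<And>t. t \<in> {0..T} \<Longrightarrow> opnorm (E t) \<le> k * exp (- l * (T - t))"
    and cz: "continuous_on {0..T} z"
    and Ym: "\<And>t. t \<in> {0..T} \<Longrightarrow> Y t \<in> borel_measurable M" and Xm: "\<And>t. t \<in> {0..T} \<Longrightarrow> X t \<in> borel_measurable M"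
    and Y: "AE \<omega> in M. continuous_on {0..T} (\<lambda>t. Y t \<omega>) \<and> (\<forall>t\<in>{0..T}. Y t \<omega> = init \<omega>
      + integral {0..t} (\<lambda>s. (B + P ** E s) *v Y s \<omega> - P *v (z s + \<rho>)) + S *v w t \<omega>)"
    and X: "AE \<omega> in M. continuous_on {0..} (\<lambda>t. X t \<omega>) \<and> (\<forall>t\<ge>0. X t \<omega> = init \<omega>
      + integral {0..t} (\<lambda>s. B *v X s \<omega> - P *v \<rho>) + S *v w t \<omega>)"
    and X2: "\<And>t. t \<in> {0..T} \<Longrightarrow> (\<integral>\<^sup>+\<omega>. ennreal ((norm (X t \<omega>))\<^sup>2) \<partial>M) \<le> ennreal m2" and m2: "0 \<le> m2"
    and t: "t \<in> {0..T}"
  defines "g \<equiv> \<lambda>s. 2 * r\<^sup>2 * (k\<^sup>2 * (exp (- l * (T - s)))\<^sup>2 * m2 + (norm (z s))\<^sup>2)"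
  shows "(\<integral>\<^sup>+\<omega>. ennreal ((norm (Y t \<omega> - X t \<omega>))\<^sup>2
      + (norm (P *v ((L - E t) *v Y t \<omega>) + P *v (z t + \<rho>) - (P *v (L *v X t \<omega>) + P *v \<rho>)))\<^sup>2) \<partial>M)
    \<le> ennreal ((1 + 12 * r\<^sup>2 * k\<^sup>2) * (2 * (K * exp (K * (r * k / l)))\<^sup>2 / \<nu>) * decay_conv \<nu> g t + 3 / 2 * g t)"
proof -
  let ?A = "2 * (K * exp (K * (r * k / l)))\<^sup>2 / \<nu>"
  let ?C = "1 + 12 * r\<^sup>2 * k\<^sup>2"
  have A0: "0 \<le> ?A" using \<nu> by simp
  have sub: "{0..t} \<subseteq> {0..T}" using t by auto
  define H where "H = (\<lambda>s \<omega>. 2 * r\<^sup>2 * (k\<^sup>2 * (exp (- l * (T - s)))\<^sup>2 * (norm (X s \<omega>))\<^sup>2 + (norm (z s))\<^sup>2))"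
  have H0: "0 \<le> H s \<omega>" for s \<omega> unfolding H_def by simp
  have g0: "0 \<le> g s" for s unfolding g_def using m2 by simp
  have cg: "continuous_on {0..T} g" unfolding g_def by (intro continuous_intros cz)
  have Hm: "H s \<in> borel_measurable M" if "s \<in> {0..T}" for s
    unfolding H_def using Xm[OF that] by simp
  have H_int: "(\<integral>\<^sup>+\<omega>. ennreal (c * H s \<omega>) \<partial>M) \<le> ennreal (c * g s)" if s: "s \<in> {0..T}" and c: "0 \<le> c" for s c
  proof -
    let ?a = "c * (2 * r\<^sup>2 * (k\<^sup>2 * (exp (- l * (T - s)))\<^sup>2))" and ?b = "c * (2 * r\<^sup>2 * (norm (z s))\<^sup>2)"
    have a0: "0 \<le> ?a" and b0: "0 \<le> ?b" using c by auto
    have "(\<integral>\<^sup>+\<omega>. ennreal (c * H s \<omega>) \<partial>M) = (\<integral>\<^sup>+\<omega>. ennreal ?a * ennreal ((norm (X s \<omega>))\<^sup>2) + ennreal ?b \<partial>M)"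
    proof (rule nn_integral_cong)
      fix \<omega>
      have "c * H s \<omega> = ?a * (norm (X s \<omega>))\<^sup>2 + ?b" by (simp add: H_def algebra_simps)
      then show "ennreal (c * H s \<omega>) = ennreal ?a * ennreal ((norm (X s \<omega>))\<^sup>2) + ennreal ?b"
        using a0 b0 by (simp only: ennreal_plus ennreal_mult zero_le_power2 mult_nonneg_nonneg)
    qed
    also have "\<dots> = ennreal ?a * (\<integral>\<^sup>+\<omega>. ennreal ((norm (X s \<omega>))\<^sup>2) \<partial>M) + ennreal ?b"
      using Xm[OF s] by (simp add: nn_integral_add nn_integral_cmult emeasure_space_1)
    also have "\<dots> \<le> ennreal ?a * ennreal m2 + ennreal ?b"
      by (intro add_mono mult_left_mono X2 s order_refl) simp
    also have "\<dots> = ennreal (?a * m2 + ?b)"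
      using a0 b0 m2 by (simp only: ennreal_plus ennreal_mult mult_nonneg_nonneg)
    also have "?a * m2 + ?b = c * g s" by (simp add: g_def algebra_simps)
    finally show ?thesis .
  qed
  have conv: "(\<integral>\<^sup>+\<omega>. ennreal (decay_conv \<nu> (\<lambda>s. ?A * H s \<omega>) t) \<partial>M) \<le> ennreal (decay_conv \<nu> (\<lambda>s. ?A * g s) t)"
    unfolding decay_conv_def mult.assoc[symmetric]
  proof (rule nn_integral_time_integral_le)
    show "0 \<le> t" using t by simp
    show "(\<lambda>\<omega>. exp (- \<nu> * (t - s)) * ?A * H s \<omega>) \<in> borel_measurable M" if "s \<in> {0..t}" for s
      using Hm[of s] that sub by auto
    show "AE \<omega> in M. continuous_on {0..t} (\<lambda>s. exp (- \<nu> * (t - s)) * ?A * H s \<omega>)"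
      using X
    proof eventually_elim
      case (elim \<omega>)
      have "continuous_on {0..t} (\<lambda>s. X s \<omega>)"
        by (rule continuous_on_subset[of "{0..}"]) (use elim in auto)
      then show ?case unfolding H_def
        by (intro continuous_on_mult_left continuous_intros continuous_on_subset[OF cz sub])
    qed
    have c: "0 \<le> exp (- \<nu> * (t - s)) * ?A" for s using A0 by (intro mult_nonneg_nonneg) auto
    show "0 \<le> exp (- \<nu> * (t - s)) * ?A * H s \<omega>" for s \<omega> by (intro mult_nonneg_nonneg[OF c] H0)
    show "(\<integral>\<^sup>+\<omega>. ennreal (exp (- \<nu> * (t - s)) * ?A * H s \<omega>) \<partial>M) \<le> ennreal (exp (- \<nu> * (t - s)) * ?A * g s)"
      if "s \<in> {0..t}" for s
      by (rule H_int[OF _ c]) (use that sub in auto)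
    show "continuous_on {0..t} (\<lambda>s. exp (- \<nu> * (t - s)) * ?A * g s)"
      by (intro continuous_on_mult continuous_on_const continuous_on_exp continuous_on_diff continuous_on_id
          continuous_on_subset[OF cg sub])
    show "0 \<le> exp (- \<nu> * (t - s)) * ?A * g s" for s by (intro mult_nonneg_nonneg[OF c] g0)
  qed
  have path: "AE \<omega> in M. (norm (Y t \<omega> - X t \<omega>))\<^sup>2 \<le> ?A * decay_conv \<nu> (\<lambda>s. H s \<omega>) t"
    using X Y
  proof eventually_elim
    case (elim \<omega>)
    show ?case unfolding H_def
    proof (rule state_deviation_square_le[OF K \<nu> r kl B P cE El cz _ _ _ _ t,
          where init = "init \<omega>" and S = S and w = "\<lambda>t. w t \<omega>" and \<rho> = \<rho>])
      show "continuous_on {0..T} (\<lambda>s. X s \<omega>)"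
        by (rule continuous_on_subset[of "{0..}"]) (use elim in auto)
    qed (use elim in auto)
  qed
  have e_int: "(\<integral>\<^sup>+\<omega>. ennreal ((norm (Y t \<omega> - X t \<omega>))\<^sup>2) \<partial>M) \<le> ennreal (?A * decay_conv \<nu> g t)"
  proof -
    have "(\<integral>\<^sup>+\<omega>. ennreal ((norm (Y t \<omega> - X t \<omega>))\<^sup>2) \<partial>M)
        \<le> (\<integral>\<^sup>+\<omega>. ennreal (decay_conv \<nu> (\<lambda>s. ?A * H s \<omega>) t) \<partial>M)"
      unfolding decay_conv_cmult
      by (rule nn_integral_mono_AE) (use path in eventually_elim, rule ennreal_leI)
    with conv show ?thesis unfolding decay_conv_cmult by (rule order_trans[rotated])
  qed
  have El': "opnorm (L - (L - E t)) \<le> k * exp (- l * (T - t))" using El[OF t] by simp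
  have kk: "k * exp (- l * (T - t)) \<le> k" using kl t by (simp add: mult_le_cancel_left1)
  have "(\<integral>\<^sup>+\<omega>. ennreal ((norm (Y t \<omega> - X t \<omega>))\<^sup>2
      + (norm (P *v ((L - E t) *v Y t \<omega>) + P *v (z t + \<rho>) - (P *v (L *v X t \<omega>) + P *v \<rho>)))\<^sup>2) \<partial>M)
    \<le> (\<integral>\<^sup>+\<omega>. ennreal ?C * ennreal ((norm (Y t \<omega> - X t \<omega>))\<^sup>2) + ennreal (3 / 2 * H t \<omega>) \<partial>M)"
  proof (rule nn_integral_mono)
    fix \<omega>
    note control_deviation_square_le[OF P r L El' kk, of "Y t \<omega>" "z t" \<rho> "X t \<omega>"]
    also have "3 * r\<^sup>2 * (4 * k\<^sup>2 * (norm (Y t \<omega> - X t \<omega>))\<^sup>2 + (k * exp (- l * (T - t)))\<^sup>2 * (norm (X t \<omega>))\<^sup>2 + (norm (z t))\<^sup>2)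
        = 12 * r\<^sup>2 * k\<^sup>2 * (norm (Y t \<omega> - X t \<omega>))\<^sup>2 + 3 / 2 * H t \<omega>"
      unfolding H_def power_mult_distrib by (simp add: algebra_simps)
    finally have "(norm (Y t \<omega> - X t \<omega>))\<^sup>2
        + (norm (P *v ((L - E t) *v Y t \<omega>) + P *v (z t + \<rho>) - (P *v (L *v X t \<omega>) + P *v \<rho>)))\<^sup>2
        \<le> ?C * (norm (Y t \<omega> - X t \<omega>))\<^sup>2 + 3 / 2 * H t \<omega>" by (simp add: algebra_simps)
    then have "ennreal ((norm (Y t \<omega> - X t \<omega>))\<^sup>2
        + (norm (P *v ((L - E t) *v Y t \<omega>) + P *v (z t + \<rho>) - (P *v (L *v X t \<omega>) + P *v \<rho>)))\<^sup>2)
        \<le> ennreal (?C * (norm (Y t \<omega> - X t \<omega>))\<^sup>2 + 3 / 2 * H t \<omega>)" by (rule ennreal_leI)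
    also have "\<dots> = ennreal ?C * ennreal ((norm (Y t \<omega> - X t \<omega>))\<^sup>2) + ennreal (3 / 2 * H t \<omega>)"
    proof -
      have "0 \<le> ?C" "0 \<le> 3 / 2 * H t \<omega>" using H0[of t \<omega>] by simp_all
      then show ?thesis by (simp only: ennreal_plus ennreal_mult zero_le_power2 mult_nonneg_nonneg)
    qed
    finally show "ennreal ((norm (Y t \<omega> - X t \<omega>))\<^sup>2
        + (norm (P *v ((L - E t) *v Y t \<omega>) + P *v (z t + \<rho>) - (P *v (L *v X t \<omega>) + P *v \<rho>)))\<^sup>2)
        \<le> ennreal ?C * ennreal ((norm (Y t \<omega> - X t \<omega>))\<^sup>2) + ennreal (3 / 2 * H t \<omega>)" .
  qed
  also have "\<dots> = ennreal ?C * (\<integral>\<^sup>+\<omega>. ennreal ((norm (Y t \<omega> - X t \<omega>))\<^sup>2) \<partial>M) + (\<integral>\<^sup>+\<omega>. ennreal (3 / 2 * H t \<omega>) \<partial>M)"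
    using Ym[OF t] Xm[OF t] Hm[OF t] by (simp add: nn_integral_add nn_integral_cmult)
  also have "\<dots> \<le> ennreal ?C * ennreal (?A * decay_conv \<nu> g t) + ennreal (3 / 2 * g t)"
    by (intro add_mono mult_left_mono e_int H_int t) auto
  also have "\<dots> = ennreal (?C * ?A * decay_conv \<nu> g t + 3 / 2 * g t)"
  proof -
    have "0 \<le> ?C" "0 \<le> ?A * decay_conv \<nu> g t" "0 \<le> 3 / 2 * g t"
      using A0 g0[of t] decay_conv_nonneg[OF continuous_on_subset[OF cg sub] g0]
      by (simp_all only: mult_nonneg_nonneg) auto
    then show ?thesis by (simp only: ennreal_plus ennreal_mult mult_nonneg_nonneg mult.assoc)
  qed
  finally show ?thesis .
qed

section \<open>The game\<close>

lemma spd_opnorm_pos: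
  fixes P :: "real^'d::finite^'d"
  assumes "spd P" shows "0 < opnorm P"
proof (rule ccontr)
  assume "\<not> 0 < opnorm P"
  then have "opnorm P = 0" using opnorm_nonneg[of P] by simp
  then have z: "P *v x = 0" for x using norm_matrix_vector_le_opnorm[of P x] by simp
  have "(axis undefined 1 :: real^'d) \<noteq> 0" by (simp add: axis_eq_0_iff)
  then have "0 < (axis undefined 1 :: real^'d) \<bullet> (P *v axis undefined 1)"
    using assms unfolding spd_def by blast
  then show False unfolding z by simp
qed

lemma opnorm_uminus: "opnorm (- P) = opnorm P"
proof -
  have "(*v) (- P) = (\<lambda>x. - (P *v x))" by (auto simp: fun_eq_iff matrix_vector_simps)
  then show ?thesis unfolding opnorm_def by (simp add: onorm_neg)
qed

lemma bmult_bQ_eq: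
  assumes i: "i \<in> {1..N}"
  shows "F1 N Q xb i y - F1 N Q xb i y' = bmult N (bQ Q) (\<lambda>j. y j - y' j) i"
proof -
  have "bmult N (bQ Q) (\<lambda>j. y j - y' j) i = (\<Sum>j\<in>{1..N} - {i}. Q i i j *v (y j - y' j))"
    unfolding bmult_def bQ_def using i
    by (subst sum.remove[of _ i]) (auto intro!: sum.cong)
  also have "\<dots> = F1 N Q xb i y - F1 N Q xb i y'"
    unfolding F1_def by (simp add: sum_subtractf[symmetric] matrix_vector_simps)
  finally show ?thesis ..
qed

text \<open>Two kinds of constants. \<open>K\<close>, \<nu>, \<open>k\<close>, \<open>l\<close> are
  common to all players and enter where a large constant is harmless. For coercivity every player
  keeps constants of its own: the largest \<open>KL\<close> and the smallest \<open>lamL\<close> may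
  belong to different players, and their quotient could exceed every exponent occurring in
  (A2).\<close>

locale game_data =
  fixes M :: "'a measure" and N :: nat
    and A sg R :: "nat \<Rightarrow> real^'d::finite^'d" and Q :: "nat \<Rightarrow> nat \<Rightarrow> nat \<Rightarrow> real^'d^'d"
    and xb :: "nat \<Rightarrow> nat \<Rightarrow> real^'d" and mu0 :: "nat \<Rightarrow> real^'d" and Sig0 :: "nat \<Rightarrow> real^'d^'d"
    and x0 :: "nat \<Rightarrow> 'a \<Rightarrow> real^'d" and W :: "nat \<Rightarrow> real \<Rightarrow> 'a \<Rightarrow> real^'d"
    and Lam Sig :: "nat \<Rightarrow> real^'d^'d" and mu rho :: "nat \<Rightarrow> real^'d" and c :: "nat \<Rightarrow> real"
    and LamT SigT :: "nat \<Rightarrow> real \<Rightarrow> real \<Rightarrow> real^'d^'d" and muT rhoT :: "nat \<Rightarrow> real \<Rightarrow> real \<Rightarrow> real^'d"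
    and kapT :: "nat \<Rightarrow> real \<Rightarrow> real \<Rightarrow> real"
    and XT :: "nat \<Rightarrow> real \<Rightarrow> real \<Rightarrow> 'a \<Rightarrow> real^'d" and X :: "nat \<Rightarrow> real \<Rightarrow> 'a \<Rightarrow> real^'d"
    and K \<nu> r k l cR q \<gamma> b :: real
  assumes setting: "setting M N A sg R Q xb mu0 Sig0 x0 W Lam Sig mu rho c LamT SigT muT rhoT kapT XT X"
    and pos: "0 < K" "0 < \<nu>" "0 < r" "0 < k" "0 < l" "0 < cR" "0 < \<gamma>" "0 \<le> b"
    and mexp_le: "\<And>i s. i \<in> {1..N} \<Longrightarrow> 0 \<le> s \<Longrightarrow>
      opnorm (mexp (s *\<^sub>R (A i - matrix_inv (R i) ** Lam i))) \<le> K * exp (- \<nu> * s)"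
    and LamT_le: "\<And>i T t. i \<in> {1..N} \<Longrightarrow> 0 < T \<Longrightarrow> t \<in> {0..T} \<Longrightarrow>
      opnorm (LamT i T t - Lam i) \<le> k * exp (- l * (T - t))"
    and Rr: "\<And>i. i \<in> {1..N} \<Longrightarrow> opnorm (matrix_inv (R i)) \<le> r"
    and RcR: "\<And>i y. i \<in> {1..N} \<Longrightarrow> cR * (norm y)\<^sup>2 \<le> y \<bullet> (matrix_inv (R i) *v y)"
    and gamma_le: "\<And>i. i \<in> {1..N} \<Longrightarrow> \<exists>K' \<nu>' k' l'. 0 < K' \<and> 0 < \<nu>' \<and> 0 < k' \<and> 0 < l' \<and>
      (\<forall>s\<ge>0. opnorm (mexp (s *\<^sub>R (A i - matrix_inv (R i) ** Lam i))) \<le> K' * exp (- \<nu>' * s)) \<and>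
      (\<forall>T>0. \<forall>t\<in>{0..T}. opnorm (LamT i T t - Lam i) \<le> k' * exp (- l' * (T - t))) \<and>
      \<gamma> * (K'\<^sup>2 / \<nu>'\<^sup>2 * opnorm (matrix_inv (R i)) * exp (opnorm (matrix_inv (R i)) * k' / l')) \<le> 1 / 2"
    and Qq: "\<And>y. (\<Sum>i\<in>{1..N}. (norm (bmult N (bQ Q) y i))\<^sup>2) \<le> q\<^sup>2 * (\<Sum>i\<in>{1..N}. (norm (y i))\<^sup>2)"
    and Q\<gamma>: "\<And>y. - (\<gamma> / 2) * (\<Sum>i\<in>{1..N}. (norm (y i))\<^sup>2) \<le> (\<Sum>i\<in>{1..N}. y i \<bullet> bmult N (bQ Q) y i)"
    and mu0_le: "\<And>i. i \<in> {1..N} \<Longrightarrow> norm (mu0 i) \<le> b"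
    and mu_le: "\<And>i. i \<in> {1..N} \<Longrightarrow> norm (mu i) \<le> b"
    and rho_le: "\<And>i. i \<in> {1..N} \<Longrightarrow> norm (rho i) \<le> b"
    and vsig_le: "\<And>i. i \<in> {1..N} \<Longrightarrow> opnorm (vsig sg i) \<le> b"
    and Sig0_le: "\<And>i. i \<in> {1..N} \<Longrightarrow> opnorm (matrix_inv (Sig0 i)) \<le> b"
begin

definition "B i = A i - matrix_inv (R i) ** Lam i"
definition "E i T t = Lam i - LamT i T t"

lemma R_spd: "i \<in> {1..N} \<Longrightarrow> spd (R i)" and Q_spd: "i \<in> {1..N} \<Longrightarrow> spd (Q i i i)"
  using setting by (simp_all add: setting_def A1_def)

lemma Ri_psd: "i \<in> {1..N} \<Longrightarrow> psd (matrix_inv (R i))"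
  by (intro spd_imp_psd spd_matrix_inv R_spd)

lemma Ri_transpose: "i \<in> {1..N} \<Longrightarrow> transpose (matrix_inv (R i)) = matrix_inv (R i)"
  using Ri_psd by (simp add: psd_def msym_def)

lemma AR:
  assumes "i \<in> {1..N}"
  shows "Lam i ** A i + transpose (A i) ** Lam i - Lam i ** matrix_inv (R i) ** Lam i + 2 *\<^sub>R Q i i i = 0"
    and "B i *v mu i = matrix_inv (R i) *v rho i"
    and "transpose (B i) *v rho i + 2 *\<^sub>R F1 N Q xb i mu = 0"
    and "msym (Lam i)"
  using setting assms by (simp_all add: setting_def AR_sol_def B_def)

lemma FR:
  assumes "i \<in> {1..N}" "0 < T"
  shows "t \<in> {0..T} \<Longrightarrow> (LamT i T has_vector_derivative
            (- (LamT i T t ** A i + transpose (A i) ** LamT i T t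
                - LamT i T t ** matrix_inv (R i) ** LamT i T t + 2 *\<^sub>R Q i i i))) (at t within {0..T})"
    and "t \<in> {0..T} \<Longrightarrow> (muT i T has_vector_derivative
            ((A i - matrix_inv (R i) ** LamT i T t) *v muT i T t - matrix_inv (R i) *v rhoT i T t))
            (at t within {0..T})"
    and "t \<in> {0..T} \<Longrightarrow> (rhoT i T has_vector_derivative
            (- (transpose (A i - matrix_inv (R i) ** LamT i T t) *v rhoT i T t
                + 2 *\<^sub>R F1 N Q xb i (\<lambda>j. muT j T t)))) (at t within {0..T})"
    and "muT i T 0 = mu0 i" "LamT i T T = 0" "rhoT i T T = 0"
  using setting assms unfolding setting_def FR_sol_def by simp_all

lemma A_eq: "A i - matrix_inv (R i) ** LamT i T t = B i + matrix_inv (R i) ** E i T t"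
  by (simp add: B_def E_def matrix_mult_simps)

lemma B_transpose: "i \<in> {1..N} \<Longrightarrow> transpose (B i) = transpose (A i) - Lam i ** matrix_inv (R i)"
  using AR(4)[of i] Ri_transpose[of i] by (simp add: B_def transpose_simps matrix_transpose_mul msym_def)

text \<open>Rewritten with B = A - R^-1 Lam, the algebraic Riccati equation is a Lyapunov equation
  for the stable matrix \<open>B\<close> with negative semidefinite right-hand side.\<close>

lemma Lam_psd:
  assumes i: "i \<in> {1..N}" shows "psd (Lam i)"
proof (rule lyapunov_psd[OF AR(4)[OF i], where B = "B i" and P = "Lam i ** matrix_inv (R i) ** Lam i + 2 *\<^sub>R Q i i i"])
  show "0 \<le> x \<bullet> ((Lam i ** matrix_inv (R i) ** Lam i + 2 *\<^sub>R Q i i i) *v x)" for x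
  proof -
    have "x \<bullet> ((Lam i ** matrix_inv (R i) ** Lam i + 2 *\<^sub>R Q i i i) *v x)
        = (Lam i *v x) \<bullet> (matrix_inv (R i) *v (Lam i *v x)) + 2 * (x \<bullet> (Q i i i *v x))"
      using msym_inner[OF AR(4)[OF i], of x "matrix_inv (R i) *v (Lam i *v x)"]
      by (simp add: matrix_vector_simps inner_add_right flip: matrix_vector_mul_assoc)
    then show ?thesis using Ri_psd[OF i] spd_imp_psd[OF Q_spd[OF i]] by (simp add: psd_def)
  qed
  have "Lam i ** B i + transpose (B i) ** Lam i + (Lam i ** matrix_inv (R i) ** Lam i + 2 *\<^sub>R Q i i i)
      = Lam i ** A i + transpose (A i) ** Lam i - Lam i ** matrix_inv (R i) ** Lam i + 2 *\<^sub>R Q i i i"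
    unfolding B_transpose[OF i] by (simp add: B_def matrix_mult_simps matrix_mul_assoc)
  then show "Lam i ** B i + transpose (B i) ** Lam i = - (Lam i ** matrix_inv (R i) ** Lam i + 2 *\<^sub>R Q i i i)"
    using AR(1)[OF i] by (simp only: eq_neg_iff_add_eq_0)
  show "0 < \<nu>" by (rule pos)
  show "opnorm (mexp (s *\<^sub>R B i)) \<le> K * exp (- \<nu> * s)" if "0 \<le> s" for s
    using mexp_le[OF i that] by (simp add: B_def)
qed

lemma E_riccati:
  assumes i: "i \<in> {1..N}" and t: "t \<in> {0..T}" and T: "0 < T"
  shows "(E i T has_vector_derivative
    - (E i T t ** B i + transpose (B i) ** E i T t + E i T t ** matrix_inv (R i) ** E i T t)) (at t within {0..T})"
proof -
  let ?L = "LamT i T t" and ?P = "matrix_inv (R i)"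
  have "((\<lambda>t. Lam i - LamT i T t) has_vector_derivative 0 - - (?L ** A i + transpose (A i) ** ?L
                - ?L ** ?P ** ?L + 2 *\<^sub>R Q i i i)) (at t within {0..T})"
    by (intro has_vector_derivative_diff has_vector_derivative_const FR(1)[OF i T t])
  moreover have "0 - - (?L ** A i + transpose (A i) ** ?L - ?L ** ?P ** ?L + 2 *\<^sub>R Q i i i)
      = - (E i T t ** B i + transpose (B i) ** E i T t + E i T t ** ?P ** E i T t)
        + (Lam i ** A i + transpose (A i) ** Lam i - Lam i ** ?P ** Lam i + 2 *\<^sub>R Q i i i)"
    unfolding B_transpose[OF i] by (simp add: E_def B_def matrix_mult_simps matrix_mul_assoc)
  ultimately show ?thesis using AR(1)[OF i] by (simp add: E_def[abs_def])
qed

text \<open>\<open>LamT\<close> vanishes at T, so the terminal value of \<open>E\<close> is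
  \<open>Lam\<close> itself; the backward flow preserves its sign.\<close>

lemma E_psd:
  assumes i: "i \<in> {1..N}" and T: "0 < T" and t: "t \<in> {0..T}"
  shows "psd (E i T t)"
proof (rule riccati_psd[OF E_riccati[OF i _ T] Ri_psd[OF i] _ t])
  show "psd (E i T T)" using Lam_psd[OF i] FR(5)[OF i T] by (simp add: E_def)
qed

lemma E_continuous: "i \<in> {1..N} \<Longrightarrow> 0 < T \<Longrightarrow> continuous_on {0..T} (E i T)"
  by (rule continuous_on_vector_derivative) (rule E_riccati)

lemma E_le: "i \<in> {1..N} \<Longrightarrow> 0 < T \<Longrightarrow> t \<in> {0..T} \<Longrightarrow> opnorm (E i T t) \<le> k * exp (- l * (T - t))"
  using LamT_le[of i T t] opnorm_uminus[of "LamT i T t - Lam i"] by (simp add: E_def)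

text \<open>The decay estimate taken at the end of the horizon, where \<open>LamT\<close> is 0, is
  already a bound for \<open>Lam\<close>.\<close>

lemma Lam_le: "i \<in> {1..N} \<Longrightarrow> opnorm (Lam i) \<le> k"
  using E_le[of i 1 1] by (simp add: E_def FR)

text \<open>Here the player's own rates and the exact norm of its inverse cost matrix are used,
  since the common constants might violate the smallness condition on \<gamma>.\<close>

lemma coercive:
  assumes i: "i \<in> {1..N}" and T: "0 < T"
    and y: "\<And>t. t \<in> {0..T} \<Longrightarrow> (y has_vector_derivative
          (B i *v y t + matrix_inv (R i) *v (E i T t *v y t) + v t)) (at t within {0..T})"
    and y0: "y 0 = 0" and v: "continuous_on {0..T} v"
  shows "\<gamma> * integral {0..T} (\<lambda>t. (norm (y t))\<^sup>2) \<le> 1 / 2 * integral {0..T} (\<lambda>t. v t \<bullet> (R i *v v t))"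
proof -
  let ?r = "opnorm (matrix_inv (R i))"
  obtain K' \<nu>' k' l' where p: "0 < K'" "0 < \<nu>'" "0 < k'" "0 < l'"
    and m: "\<forall>s\<ge>0. opnorm (mexp (s *\<^sub>R (A i - matrix_inv (R i) ** Lam i))) \<le> K' * exp (- \<nu>' * s)"
    and L: "\<forall>T>0. \<forall>t\<in>{0..T}. opnorm (LamT i T t - Lam i) \<le> k' * exp (- l' * (T - t))"
    and g: "\<gamma> * (K'\<^sup>2 / \<nu>'\<^sup>2 * ?r * exp (?r * k' / l')) \<le> 1 / 2"
    using gamma_le[OF i] by (elim exE conjE) (rule that; assumption)
  have I0: "0 \<le> integral {0..T} (\<lambda>t. v t \<bullet> (R i *v v t))"
    using spd_imp_psd[OF R_spd[OF i]]
    by (intro integral_nonneg integrable_continuous_real continuous_intros v) (simp add: psd_def)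
  have "integral {0..T} (\<lambda>t. (norm (y t))\<^sup>2)
      \<le> K'\<^sup>2 / \<nu>'\<^sup>2 * ?r * exp (?r * k' / l') * integral {0..T} (\<lambda>t. v t \<bullet> (R i *v v t))"
  proof (rule coercivity[OF R_spd[OF i] order_refl _ E_riccati[OF i _ T] E_psd[OF i T] _ p(3,4) p(1,2) _ y y0 v])
    show "0 < ?r" by (rule spd_opnorm_pos[OF spd_matrix_inv[OF R_spd[OF i]]])
    show "opnorm (E i T t) \<le> k' * exp (- l' * (T - t))" if "t \<in> {0..T}" for t
      using L[rule_format, OF T that] opnorm_uminus[of "LamT i T t - Lam i"] by (simp add: E_def)
    show "opnorm (mexp (s *\<^sub>R B i)) \<le> K' * exp (- \<nu>' * s)" if "0 \<le> s" for s
      using m[rule_format, OF that] by (simp add: B_def)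
  qed (use T in auto)
  then have "\<gamma> * integral {0..T} (\<lambda>t. (norm (y t))\<^sup>2)
      \<le> \<gamma> * (K'\<^sup>2 / \<nu>'\<^sup>2 * ?r * exp (?r * k' / l') * integral {0..T} (\<lambda>t. v t \<bullet> (R i *v v t)))"
    by (rule mult_left_mono) (use pos in simp)
  also have "\<dots> = \<gamma> * (K'\<^sup>2 / \<nu>'\<^sup>2 * ?r * exp (?r * k' / l')) * integral {0..T} (\<lambda>t. v t \<bullet> (R i *v v t))"
    by (simp only: mult.assoc)
  also have "\<dots> \<le> 1 / 2 * integral {0..T} (\<lambda>t. v t \<bullet> (R i *v v t))"
    by (rule mult_right_mono[OF g I0])
  finally show ?thesis .
qed

lemma deviation:
  assumes T: "0 < T"
  shows "deviation_system N T K \<nu> r k l cR q \<gamma> b B R (\<lambda>i. E i T) (bQ Q) mu rho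
    (\<lambda>i t. muT i T t - mu i) (\<lambda>i t. rhoT i T t - rho i)"
proof
  show "0 \<le> T" using T by simp
  fix i t assume i: "i \<in> {1..N}"
  let ?P = "matrix_inv (R i)"
  show "cR * (norm y)\<^sup>2 \<le> y \<bullet> (?P *v y)" for y by (rule RcR[OF i])
  show "opnorm (mexp (t *\<^sub>R B i)) \<le> K * exp (- \<nu> * t)" if "0 \<le> t"
    using mexp_le[OF i that] by (simp add: B_def)
  show "norm (muT i T 0 - mu i) \<le> 2 * b"
    using norm_triangle_ineq4[of "mu0 i" "mu i"] mu0_le[OF i] mu_le[OF i] by (simp add: FR(4)[OF i T])
  show "norm (rhoT i T T - rho i) \<le> b" using rho_le[OF i] by (simp add: FR(6)[OF i T])
  show "\<gamma> * integral {0..T} (\<lambda>t. (norm (y t))\<^sup>2) \<le> 1 / 2 * integral {0..T} (\<lambda>t. v t \<bullet> (R i *v v t))"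
    if "\<And>t. t \<in> {0..T} \<Longrightarrow> (y has_vector_derivative
          (B i *v y t + ?P *v (E i T t *v y t) + v t)) (at t within {0..T})"
      "y 0 = 0" "continuous_on {0..T} v" for y v
    by (rule coercive[OF i T that])
  assume t: "t \<in> {0..T}"
  show "((\<lambda>t. muT i T t - mu i) has_vector_derivative B i *v (muT i T t - mu i)
      + ?P *v (E i T t *v (muT i T t - mu i + mu i)) - ?P *v (rhoT i T t - rho i)) (at t within {0..T})"
    by (rule has_vector_derivative_eq_rhs[OF has_vector_derivative_diff[OF FR(2)[OF i T t] has_vector_derivative_const]])
      (simp add: A_eq matrix_vector_simps AR(2)[OF i] flip: matrix_vector_mul_assoc)
  show "((\<lambda>t. rhoT i T t - rho i) has_vector_derivative
      - (transpose (B i) *v (rhoT i T t - rho i) + E i T t *v (?P *v (rhoT i T t - rho i + rho i)))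
      - 2 *\<^sub>R bmult N (bQ Q) (\<lambda>j. muT j T t - mu j) i) (at t within {0..T})"
  proof (rule has_vector_derivative_eq_rhs[OF has_vector_derivative_diff[OF FR(3)[OF i T t] has_vector_derivative_const]])
    have sE: "transpose (E i T t) = E i T t" using E_psd[OF i T t] by (simp add: psd_def msym_def)
    have "transpose (A i - ?P ** LamT i T t) *v rhoT i T t = transpose (B i) *v rhoT i T t + E i T t *v (?P *v rhoT i T t)"
      unfolding A_eq transpose_simps matrix_transpose_mul sE Ri_transpose[OF i]
      by (simp only: matrix_vector_simps matrix_vector_mul_assoc)
    \<comment> \<open>\<open>F1\<close> is affine in the means, and the stationary equation
      expresses its value at \<open>mu\<close> by \<open>rho\<close>; the difference is the linear
      coupling by the off-diagonal blocks.\<close>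
    moreover have "2 *\<^sub>R F1 N Q xb i (\<lambda>j. muT j T t) = 2 *\<^sub>R bmult N (bQ Q) (\<lambda>j. muT j T t - mu j) i
        - transpose (B i) *v rho i"
      using AR(3)[OF i] unfolding bmult_bQ_eq[OF i, symmetric, of Q _ mu xb]
      by (simp only: scaleR_diff_right diff_diff_eq add.commute) simp
    ultimately show "- (transpose (A i - ?P ** LamT i T t) *v rhoT i T t + 2 *\<^sub>R F1 N Q xb i (\<lambda>j. muT j T t)) - 0
        = - (transpose (B i) *v (rhoT i T t - rho i) + E i T t *v (?P *v (rhoT i T t - rho i + rho i)))
          - 2 *\<^sub>R bmult N (bQ Q) (\<lambda>j. muT j T t - mu j) i"
      by (simp only: matrix_vector_simps diff_add_cancel) (simp add: algebra_simps)
  qed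
qed (fact pos | rule R_spd Rr E_riccati[OF _ _ T] E_psd[OF _ T] E_le[OF _ T] mu_le rho_le Qq Q\<gamma>; assumption)+

text \<open>The value furnished by the bound for stable linear equations. The middle term bounds the
  second moment of x0 - mu by twice that of x0 - mu0 plus 2 (2 b)^2.\<close>

definition "m2 = 3 * (real CARD('d) * b * K\<^sup>2 / \<nu> + K\<^sup>2 * (2 * (real CARD('d) * b + 4 * b\<^sup>2)) + b\<^sup>2)"

lemma prob: "prob_space M" using setting by (simp add: setting_def prob_setup_def)

lemma X_second_moment_le:
  assumes i: "i \<in> {1..N}" and t: "0 \<le> t"
  shows "(\<integral>\<^sup>+\<omega>. ennreal ((norm (X i t \<omega>))\<^sup>2) \<partial>M) \<le> ennreal m2"
proof -
  interpret prob_space M by (rule prob)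
  have G: "gaussian_vec M (x0 i) (mu0 i) (matrix_inv (Sig0 i))" and W: "brownian M (W i)"
    using setting i by (simp_all add: setting_def prob_setup_def)
  have S0: "spd (matrix_inv (Sig0 i))" using setting i by (intro spd_matrix_inv) (simp add: setting_def data_ok_def)
  have x0m: "x0 i \<in> borel_measurable M" using G by (simp add: gaussian_vec_def)
  have xm: "(\<lambda>\<omega>. ennreal ((norm (x0 i \<omega> - mu0 i))\<^sup>2)) \<in> borel_measurable M" using x0m by simp
  let ?d = "real CARD('d)"
  have "(\<integral>\<^sup>+\<omega>. ennreal ((norm (x0 i \<omega> - mu i))\<^sup>2) \<partial>M)
      \<le> (\<integral>\<^sup>+\<omega>. ennreal 2 * ennreal ((norm (x0 i \<omega> - mu0 i))\<^sup>2) + ennreal (8 * b\<^sup>2) \<partial>M)"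
  proof (rule nn_integral_mono)
    fix \<omega>
    have "norm (x0 i \<omega> - mu i) \<le> norm (x0 i \<omega> - mu0 i) + norm (mu0 i - mu i)"
      using norm_triangle_ineq[of "x0 i \<omega> - mu0 i" "mu0 i - mu i"] by simp
    also have "norm (mu0 i - mu i) \<le> 2 * b"
      using norm_triangle_ineq4[of "mu0 i" "mu i"] mu0_le[OF i] mu_le[OF i] by simp
    finally have "(norm (x0 i \<omega> - mu i))\<^sup>2 \<le> (norm (x0 i \<omega> - mu0 i) + 2 * b)\<^sup>2"
      by (intro power_mono) auto
    also have "\<dots> \<le> 2 * (norm (x0 i \<omega> - mu0 i))\<^sup>2 + 8 * b\<^sup>2"
      using sum_squares_bound[of "norm (x0 i \<omega> - mu0 i)" "2 * b"] by (simp add: power2_sum power_mult_distrib)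
    finally have "ennreal ((norm (x0 i \<omega> - mu i))\<^sup>2) \<le> ennreal (2 * (norm (x0 i \<omega> - mu0 i))\<^sup>2 + 8 * b\<^sup>2)"
      by (rule ennreal_leI)
    then show "ennreal ((norm (x0 i \<omega> - mu i))\<^sup>2) \<le> ennreal 2 * ennreal ((norm (x0 i \<omega> - mu0 i))\<^sup>2) + ennreal (8 * b\<^sup>2)"
      by (simp add: ennreal_mult ennreal_plus)
  qed
  also have "\<dots> = ennreal 2 * (\<integral>\<^sup>+\<omega>. ennreal ((norm (x0 i \<omega> - mu0 i))\<^sup>2) \<partial>M) + ennreal (8 * b\<^sup>2)"
    using xm by (simp add: nn_integral_add nn_integral_cmult emeasure_space_1)
  also have "\<dots> \<le> ennreal 2 * ennreal (?d * b) + ennreal (8 * b\<^sup>2)"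
    by (intro add_mono mult_left_mono gaussian_vec_second_moment_le[OF G S0 Sig0_le[OF i]] order_refl) simp
  also have "\<dots> = ennreal (2 * (?d * b + 4 * b\<^sup>2))"
  proof -
    have "0 \<le> ?d * b" using pos(8) by simp
    then have "ennreal 2 * ennreal (?d * b) + ennreal (8 * b\<^sup>2) = ennreal (2 * (?d * b) + 8 * b\<^sup>2)"
      by (simp only: ennreal_plus ennreal_mult mult_nonneg_nonneg zero_le_power2 zero_le_numeral)
    then show ?thesis by (simp only: distrib_left mult.assoc[symmetric]) simp
  qed
  finally have v: "(\<integral>\<^sup>+\<omega>. ennreal ((norm (x0 i \<omega> - mu i))\<^sup>2) \<partial>M) \<le> ennreal (2 * (?d * b + 4 * b\<^sup>2))" .
  have ER: "\<forall>t\<ge>0. X i t \<in> borel_measurable M" "AE \<omega> in M. continuous_on {0..} (\<lambda>t. X i t \<omega>) \<and> (\<forall>t\<ge>0.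
         X i t \<omega> = x0 i \<omega> + integral {0..t} (\<lambda>s. B i *v X i s \<omega> - matrix_inv (R i) *v rho i) + sg i *v W i t \<omega>)"
    using setting i unfolding setting_def ER_state_def B_def by auto
  have "(\<integral>\<^sup>+\<omega>. ennreal ((norm (X i t \<omega>))\<^sup>2) \<partial>M)
      \<le> ennreal (3 * (?d * b * K\<^sup>2 / \<nu> + K\<^sup>2 * (2 * (?d * b + 4 * b\<^sup>2)) + (norm (mu i))\<^sup>2))"
  proof (rule stable_linear_sde_second_moment_le[OF W t _ x0m pos(1,2) _ _ AR(2)[OF i] ER(2) v])
    show "X i t \<in> borel_measurable M" using ER(1) t by simp
    show "opnorm (mexp (s *\<^sub>R B i)) \<le> K * exp (- \<nu> * s)" if "0 \<le> s" for s
      using mexp_le[OF i that] by (simp add: B_def)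
    show "opnorm ((1 / 2) *\<^sub>R (sg i ** transpose (sg i))) \<le> b" using vsig_le[OF i] by (simp add: vsig_def)
  qed (use pos in simp)
  also have "\<dots> \<le> ennreal m2"
    unfolding m2_def by (intro ennreal_leI mult_left_mono add_left_mono power_mono mu_le i) auto
  finally show ?thesis .
qed

lemma gap_measurable:
  assumes i: "i \<in> {1..N}" and t: "t \<in> {0..T}" and T: "0 < T"
  shows "gap M R Lam rho LamT rhoT XT X T t i \<in> borel_measurable M"
proof -
  have m: "XT i T t \<in> borel_measurable M" "X i t \<in> borel_measurable M"
    using setting i t T unfolding setting_def FH_state_def ER_state_def by auto
  have cm: "(\<lambda>\<omega>. ctrl P L \<rho> (f \<omega>)) \<in> borel_measurable M" if "f \<in> borel_measurable M"
    for P L :: "real^'d^'d" and \<rho> and f :: "'a \<Rightarrow> real^'d"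
    unfolding ctrl_def using that
    by (rule borel_measurable_continuous_on[rotated]) (auto intro!: continuous_intros)
  show ?thesis
    unfolding gap_def[abs_def]
    using m cm[OF m(1)] cm[OF m(2)] by simp
qed

text \<open>Only the sum of the |z_i|^2 is controlled, so the players are added up before the
  convolution is estimated. The squared two-sided exponential of rate \<epsilon> becomes one of rate
  2 \<epsilon>, and the forcing by E X decays at least as fast.\<close>

lemma gap_sum_le:
  assumes T: "0 < T" and t: "t \<in> {0..T}" and \<epsilon>: "0 < \<epsilon>" "2 * \<epsilon> \<le> l" "4 * \<epsilon> \<le> \<nu>"
    and C: "\<And>t. t \<in> {0..T} \<Longrightarrow> (\<Sum>i\<in>{1..N}. (norm (rhoT i T t - rho i))\<^sup>2) \<le> C * real N * (two_sided \<epsilon> T t)\<^sup>2"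
    and C0: "0 \<le> C"
  shows "(\<Sum>i\<in>{1..N}. \<integral>\<^sup>+\<omega>. ennreal (gap M R Lam rho LamT rhoT XT X T t i \<omega>) \<partial>M)
    \<le> ennreal (real N * (((1 + 12 * r\<^sup>2 * k\<^sup>2) * (2 * (K * exp (K * (r * k / l)))\<^sup>2 / \<nu>) * (2 / \<nu>) + 3 / 2)
        * (2 * r\<^sup>2 * (k\<^sup>2 * m2 + 2 * C)) * two_sided (2 * \<epsilon>) T t))"
proof -
  interpret prob_space M by (rule prob)
  let ?A = "(1 + 12 * r\<^sup>2 * k\<^sup>2) * (2 * (K * exp (K * (r * k / l)))\<^sup>2 / \<nu>)"
  let ?z = "\<lambda>i t. rhoT i T t - rho i"
  let ?D = "2 * r\<^sup>2 * (k\<^sup>2 * m2 + 2 * C)"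
  define g where "g = (\<lambda>i s. 2 * r\<^sup>2 * (k\<^sup>2 * (exp (- l * (T - s)))\<^sup>2 * m2 + (norm (?z i s))\<^sup>2))"
  have m2: "0 \<le> m2" unfolding m2_def using pos by (intro mult_nonneg_nonneg add_nonneg_nonneg divide_nonneg_pos) auto
  have A0: "0 \<le> ?A" using pos by (intro mult_nonneg_nonneg divide_nonneg_pos) auto
  have g0: "0 \<le> g i s" for i s unfolding g_def using m2 by simp
  have cz: "continuous_on {0..T} (?z i)" if "i \<in> {1..N}" for i
  proof -
    have "continuous_on {0..T} (rhoT i T)" by (rule continuous_on_vector_derivative) (rule FR(3)[OF that T])
    then show ?thesis by (intro continuous_intros)
  qed
  have cg: "continuous_on {0..T} (g i)" if "i \<in> {1..N}" for i
    unfolding g_def by (intro continuous_intros cz that)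
  have sub: "{0..t} \<subseteq> {0..T}" using t by auto
  have one: "(\<integral>\<^sup>+\<omega>. ennreal (gap M R Lam rho LamT rhoT XT X T t i \<omega>) \<partial>M)
      \<le> ennreal (?A * decay_conv \<nu> (g i) t + 3 / 2 * g i t)" if i: "i \<in> {1..N}" for i
  proof -
    have XTm: "XT i T t \<in> borel_measurable M" if "t \<in> {0..T}" for t
      using setting i T that unfolding setting_def FH_state_def by auto
    have Xm: "X i t \<in> borel_measurable M" if "t \<in> {0..T}" for t
      using setting i that unfolding setting_def ER_state_def by auto
    have FH: "AE \<omega> in M. continuous_on {0..T} (\<lambda>t. XT i T t \<omega>) \<and> (\<forall>t\<in>{0..T}. XT i T t \<omega> = x0 i \<omega>
        + integral {0..t} (\<lambda>s. (B i + matrix_inv (R i) ** E i T s) *v XT i T s \<omega> - matrix_inv (R i) *v (?z i s + rho i))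
        + sg i *v W i t \<omega>)"
      using setting i T unfolding setting_def FH_state_def A_eq by simp
    have ER: "AE \<omega> in M. continuous_on {0..} (\<lambda>t. X i t \<omega>) \<and> (\<forall>t\<ge>0.
         X i t \<omega> = x0 i \<omega> + integral {0..t} (\<lambda>s. B i *v X i s \<omega> - matrix_inv (R i) *v rho i) + sg i *v W i t \<omega>)"
      using setting i unfolding setting_def ER_state_def B_def by auto
    have "(\<integral>\<^sup>+\<omega>. ennreal ((norm (XT i T t \<omega> - X i t \<omega>))\<^sup>2
      + (norm (matrix_inv (R i) *v ((Lam i - E i T t) *v XT i T t \<omega>) + matrix_inv (R i) *v (?z i t + rho i)
        - (matrix_inv (R i) *v (Lam i *v X i t \<omega>) + matrix_inv (R i) *v rho i)))\<^sup>2) \<partial>M)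
      \<le> ennreal (?A * decay_conv \<nu> (g i) t + 3 / 2 * g i t)"
      unfolding g_def
    proof (rule gap_second_moment_le[OF pos(1,2,3,4,5) _ Rr[OF i] Lam_le[OF i] E_continuous[OF i T] E_le[OF i T] cz[OF i]
          XTm Xm FH ER _ m2 t])
      show "opnorm (mexp (s *\<^sub>R B i)) \<le> K * exp (- \<nu> * s)" if "0 \<le> s" for s
        using mexp_le[OF i that] by (simp add: B_def)
      show "(\<integral>\<^sup>+\<omega>. ennreal ((norm (X i s \<omega>))\<^sup>2) \<partial>M) \<le> ennreal m2" if "s \<in> {0..T}" for s
        by (rule X_second_moment_le[OF i]) (use that in simp)
    qed
    then show ?thesis unfolding gap_def ctrl_def by (simp add: E_def)
  qed
  have gsum: "(\<Sum>i\<in>{1..N}. g i s) \<le> real N * ?D * two_sided (2 * \<epsilon>) T s" if s: "s \<in> {0..T}" for s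
  proof -
    have "2 * \<epsilon> * (T - s) \<le> l * (T - s)" by (rule mult_right_mono[OF \<epsilon>(2)]) (use s in simp)
    moreover have "l * (T - s) \<le> 2 * (l * (T - s))" using s pos by simp
    ultimately have "(exp (- l * (T - s)))\<^sup>2 \<le> exp (- (2 * \<epsilon>) * (T - s))"
      unfolding exp_double[symmetric] by simp
    then have e: "(exp (- l * (T - s)))\<^sup>2 \<le> two_sided (2 * \<epsilon>) T s"
      unfolding two_sided_def by (rule order_trans) simp
    have "(\<Sum>i\<in>{1..N}. g i s) = 2 * r\<^sup>2 * (real N * (k\<^sup>2 * (exp (- l * (T - s)))\<^sup>2 * m2) + (\<Sum>i\<in>{1..N}. (norm (?z i s))\<^sup>2))"
      unfolding g_def by (simp only: sum_distrib_left[symmetric] sum.distrib sum_constant card_atLeastAtMost) simp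
    also have "\<dots> \<le> 2 * r\<^sup>2 * (real N * (k\<^sup>2 * two_sided (2 * \<epsilon>) T s * m2) + C * real N * (2 * two_sided (2 * \<epsilon>) T s))"
      by (intro mult_left_mono add_mono mult_right_mono e order_trans[OF C[OF s]] two_sided_square_le)
        (use m2 C0 in auto)
    also have "\<dots> = real N * ?D * two_sided (2 * \<epsilon>) T s" by (simp add: algebra_simps)
    finally show ?thesis .
  qed
  have "(\<Sum>i\<in>{1..N}. \<integral>\<^sup>+\<omega>. ennreal (gap M R Lam rho LamT rhoT XT X T t i \<omega>) \<partial>M)
      \<le> (\<Sum>i\<in>{1..N}. ennreal (?A * decay_conv \<nu> (g i) t + 3 / 2 * g i t))"
    by (rule sum_mono) (rule one)
  also have "\<dots> = ennreal (\<Sum>i\<in>{1..N}. ?A * decay_conv \<nu> (g i) t + 3 / 2 * g i t)"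
  proof (rule sum_ennreal)
    fix i assume i: "i \<in> {1..N}"
    have "0 \<le> decay_conv \<nu> (g i) t"
      by (rule decay_conv_nonneg[OF continuous_on_subset[OF cg[OF i] sub] g0])
    then show "0 \<le> ?A * decay_conv \<nu> (g i) t + 3 / 2 * g i t"
      using g0[of i t] by (intro add_nonneg_nonneg mult_nonneg_nonneg[OF A0] mult_nonneg_nonneg[of "3 / 2"]) auto
  qed
  also have "\<dots> \<le> ennreal (real N * ((?A * (2 / \<nu>) + 3 / 2) * ?D * two_sided (2 * \<epsilon>) T t))"
  proof (rule ennreal_leI)
    have "(\<Sum>i\<in>{1..N}. decay_conv \<nu> (g i) t) = decay_conv \<nu> (\<lambda>s. \<Sum>i\<in>{1..N}. g i s) t"
      unfolding decay_conv_def sum_distrib_left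
      by (rule Henstock_Kurzweil_Integration.integral_sum[symmetric])
        (simp, rule decay_conv_integrable[OF continuous_on_subset[OF cg sub]], assumption)
    also have "\<dots> \<le> decay_conv \<nu> (\<lambda>s. real N * ?D * two_sided (2 * \<epsilon>) T s) t"
    proof (rule decay_conv_mono)
      show "continuous_on {0..t} (\<lambda>s. \<Sum>i\<in>{1..N}. g i s)"
        by (intro continuous_on_sum continuous_on_subset[OF cg sub])
      show "continuous_on {0..t} (\<lambda>s. real N * ?D * two_sided (2 * \<epsilon>) T s)"
        by (intro continuous_on_mult_left continuous_on_two_sided)
      show "(\<Sum>i\<in>{1..N}. g i s) \<le> real N * ?D * two_sided (2 * \<epsilon>) T s" if "s \<in> {0..t}" for s
        using gsum that sub by blast
    qed
    also have "\<dots> = real N * ?D * decay_conv \<nu> (two_sided (2 * \<epsilon>) T) t" by (rule decay_conv_cmult)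
    also have "\<dots> \<le> real N * ?D * (2 / \<nu> * two_sided (2 * \<epsilon>) T t)"
      by (intro mult_left_mono decay_conv_two_sided_le) (use pos \<epsilon> t m2 C0 in auto)
    finally have d: "(\<Sum>i\<in>{1..N}. decay_conv \<nu> (g i) t) \<le> real N * ?D * (2 / \<nu> * two_sided (2 * \<epsilon>) T t)" .
    have "(\<Sum>i\<in>{1..N}. ?A * decay_conv \<nu> (g i) t + 3 / 2 * g i t)
        = ?A * (\<Sum>i\<in>{1..N}. decay_conv \<nu> (g i) t) + 3 / 2 * (\<Sum>i\<in>{1..N}. g i t)"
      by (simp only: sum.distrib sum_distrib_left)
    also have "\<dots> \<le> ?A * (real N * ?D * (2 / \<nu> * two_sided (2 * \<epsilon>) T t)) + 3 / 2 * (real N * ?D * two_sided (2 * \<epsilon>) T t)"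
      by (intro add_mono mult_left_mono d gsum t A0) simp
    also have "\<dots> = real N * ((?A * (2 / \<nu>) + 3 / 2) * ?D * two_sided (2 * \<epsilon>) T t)"
      by (simp only: distrib_left distrib_right mult_ac)
    finally show "(\<Sum>i\<in>{1..N}. ?A * decay_conv \<nu> (g i) t + 3 / 2 * g i t)
        \<le> real N * ((?A * (2 / \<nu>) + 3 / 2) * ?D * two_sided (2 * \<epsilon>) T t)" .
  qed
  finally show ?thesis .
qed

end

section \<open>Norm and spectrum of block matrices\<close>

lemma bnorm2_bmult_le_sum:
  "bnorm2 N (bmult N M y) \<le> (\<Sum>i\<in>{1..N}. (\<Sum>j\<in>{1..N}. opnorm (M i j))\<^sup>2) * bnorm2 N y"
  unfolding bnorm2_def[of N "bmult N M y"] sum_distrib_right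
proof (rule sum_mono)
  fix i
  have y: "norm (y j) \<le> sqrt (bnorm2 N y)" if "j \<in> {1..N}" for j
  proof (rule real_le_rsqrt)
    show "(norm (y j))\<^sup>2 \<le> bnorm2 N y"
      unfolding bnorm2_def by (rule member_le_sum) (use that in auto)
  qed
  have n0: "0 \<le> bnorm2 N y" unfolding bnorm2_def by (intro sum_nonneg) simp
  have "norm (bmult N M y i) \<le> (\<Sum>j\<in>{1..N}. opnorm (M i j) * sqrt (bnorm2 N y))"
    unfolding bmult_def
    by (rule sum_norm_le) (intro order_trans[OF norm_matrix_vector_le_opnorm] mult_left_mono y opnorm_nonneg)
  then have "(norm (bmult N M y i))\<^sup>2 \<le> ((\<Sum>j\<in>{1..N}. opnorm (M i j)) * sqrt (bnorm2 N y))\<^sup>2"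
    unfolding sum_distrib_right by (rule power_mono) simp
  then show "(norm (bmult N M y i))\<^sup>2 \<le> (\<Sum>j\<in>{1..N}. opnorm (M i j))\<^sup>2 * bnorm2 N y"
    using n0 by (simp add: power_mult_distrib)
qed

lemma bnorm2_nonneg: "0 \<le> bnorm2 N y"
  unfolding bnorm2_def by (intro sum_nonneg) simp

lemma bnorm2_scaleR: "bnorm2 N (\<lambda>i. c *\<^sub>R y i) = c\<^sup>2 * bnorm2 N y"
  unfolding bnorm2_def sum_distrib_left by (simp add: power_mult_distrib)

text \<open>\<open>bopnorm\<close> is a supremum of reals, which has its intended meaning only for a
  bounded set; a crude blockwise bound supplies this.\<close>

lemma bdd_above_bopnorm: "bdd_above {sqrt (bnorm2 N (bmult N M y)) | y. bnorm2 N y \<le> 1}"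
proof (rule bdd_aboveI)
  let ?C = "\<Sum>i\<in>{1..N}. (\<Sum>j\<in>{1..N}. opnorm (M i j))\<^sup>2"
  fix s assume "s \<in> {sqrt (bnorm2 N (bmult N M y)) | y. bnorm2 N y \<le> 1}"
  then obtain y where s: "s = sqrt (bnorm2 N (bmult N M y))" and y: "bnorm2 N y \<le> 1" by blast
  have "?C * bnorm2 N y \<le> ?C * 1" by (rule mult_left_mono[OF y]) (intro sum_nonneg, simp)
  with bnorm2_bmult_le_sum[of N M y] have "bnorm2 N (bmult N M y) \<le> ?C" by linarith
  then show "s \<le> sqrt ?C" unfolding s by simp
qed

lemma bopnorm_nonneg: "0 \<le> bopnorm N M"
proof -
  have "sqrt (bnorm2 N (bmult N M (\<lambda>_. 0))) \<le> bopnorm N M"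
    unfolding bopnorm_def by (rule cSup_upper[OF _ bdd_above_bopnorm]) (auto simp: bnorm2_def)
  then show ?thesis using bnorm2_nonneg[of N "bmult N M (\<lambda>_. 0)"] by (meson order_trans real_sqrt_ge_zero)
qed

lemma bnorm2_bmult_le: "bnorm2 N (bmult N M y) \<le> (bopnorm N M)\<^sup>2 * bnorm2 N y"
proof (cases "bnorm2 N y = 0")
  case True
  then show ?thesis using bnorm2_bmult_le_sum[of N M y] by simp
next
  case False
  then have p: "0 < bnorm2 N y" using bnorm2_nonneg[of N y] by simp
  let ?c = "1 / sqrt (bnorm2 N y)"
  have "sqrt (bnorm2 N (bmult N M (\<lambda>i. ?c *\<^sub>R y i))) \<le> bopnorm N M"
    unfolding bopnorm_def
  proof (rule cSup_upper[OF _ bdd_above_bopnorm])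
    have "bnorm2 N (\<lambda>i. ?c *\<^sub>R y i) \<le> 1" unfolding bnorm2_scaleR using p by (simp add: power_divide)
    then show "sqrt (bnorm2 N (bmult N M (\<lambda>i. ?c *\<^sub>R y i))) \<in> {sqrt (bnorm2 N (bmult N M y)) | y. bnorm2 N y \<le> 1}"
      by blast
  qed
  then have "bnorm2 N (bmult N M (\<lambda>i. ?c *\<^sub>R y i)) \<le> (bopnorm N M)\<^sup>2"
    by (metis real_sqrt_le_iff real_sqrt_pow2 bnorm2_nonneg real_sqrt_ge_zero power_mono)
  moreover have "bmult N M (\<lambda>i. ?c *\<^sub>R y i) = (\<lambda>i. ?c *\<^sub>R bmult N M y i)"
    by (rule ext) (rule bmult_scaleR)
  ultimately show ?thesis using p by (simp add: bnorm2_scaleR power_divide field_simps)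
qed

lemma bmult_bRinv: "i \<in> {1..N} \<Longrightarrow> bmult N (bRinv R) y i = matrix_inv (R i) *v y i"
  unfolding bmult_def bRinv_def by (subst sum.remove[of _ i]) (auto intro!: sum.neutral)

lemma bnorm2_single:
  assumes "i \<in> {1..N}" shows "bnorm2 N (\<lambda>j. if j = i then v else 0) = (norm v)\<^sup>2"
  unfolding bnorm2_def by (subst sum.remove[of _ i]) (use assms in \<open>auto intro!: sum.neutral\<close>)

lemma bmult_bRinv_single:
  assumes "i \<in> {1..N}"
  shows "bnorm2 N (bmult N (bRinv R) (\<lambda>j. if j = i then v else 0)) = (norm (matrix_inv (R i) *v v))\<^sup>2"
proof -
  have "bnorm2 N (bmult N (bRinv R) (\<lambda>j. if j = i then v else 0))
      = bnorm2 N (\<lambda>j. if j = i then matrix_inv (R i) *v v else 0)"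
    unfolding bnorm2_def by (rule sum.cong[OF refl]) (simp add: bmult_bRinv)
  then show ?thesis using assms by (simp add: bnorm2_single)
qed

text \<open>Test the block diagonal matrix on vectors with a single nonzero block.\<close>

lemma opnorm_le_bopnorm_bRinv:
  assumes i: "i \<in> {1..N}" shows "opnorm (matrix_inv (R i)) \<le> bopnorm N (bRinv R)"
proof (rule opnorm_leI)
  fix v
  have "(norm (matrix_inv (R i) *v v))\<^sup>2 \<le> (bopnorm N (bRinv R) * norm v)\<^sup>2"
    using bnorm2_bmult_le[of N "bRinv R" "\<lambda>j. if j = i then v else 0"]
    unfolding bmult_bRinv_single[OF i] bnorm2_single[OF i] by (simp add: power_mult_distrib)
  then show "norm (matrix_inv (R i) *v v) \<le> bopnorm N (bRinv R) * norm v"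
    by (rule power2_le_imp_le) (simp add: bopnorm_nonneg)
qed

text \<open>Eigenvectors for distinct eigenvalues are orthogonal, and a family of pairwise
  orthogonal vectors is finite. One chosen eigenvector per eigenvalue makes the correspondence
  injective.\<close>

lemma symmetric_eigenvalues_finite:
  fixes P :: "real^'d::finite^'d"
  assumes P: "msym P" shows "finite {e. \<exists>v. v \<noteq> 0 \<and> P *v v = e *\<^sub>R v}"
proof -
  let ?E = "{e. \<exists>v. v \<noteq> 0 \<and> P *v v = e *\<^sub>R v}"
  obtain f where f: "\<And>e. e \<in> ?E \<Longrightarrow> f e \<noteq> 0 \<and> P *v f e = e *\<^sub>R f e"
    using bchoice[of ?E "\<lambda>e v. v \<noteq> 0 \<and> P *v v = e *\<^sub>R v"] by blast
  have orth: "f e \<bullet> f e' = 0" if "e \<in> ?E" "e' \<in> ?E" "e \<noteq> e'" for e e'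
  proof -
    have "(P *v f e) \<bullet> f e' = f e \<bullet> (P *v f e')" by (rule msym_inner[OF P])
    then have "(e - e') * (f e \<bullet> f e') = 0" using f[OF that(1)] f[OF that(2)] by (simp add: algebra_simps)
    then show ?thesis using that(3) by simp
  qed
  have "inj_on f ?E"
    by (rule inj_onI) (metis (no_types, lifting) orth f inner_eq_zero_iff)
  moreover have "finite (f ` ?E)"
  proof (rule pairwise_orthogonal_imp_finite, unfold pairwise_def orthogonal_def, intro ballI impI)
    fix u w assume "u \<in> f ` ?E" "w \<in> f ` ?E" "u \<noteq> w"
    then obtain e e' where "e \<in> ?E" "e' \<in> ?E" "u = f e" "w = f e'" "e \<noteq> e'" by blast
    then show "u \<bullet> w = 0" using orth by blast
  qed
  ultimately show ?thesis by (rule finite_imageD[rotated])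
qed

text \<open>Let e be the minimum of the quadratic form on the unit sphere, attained at v. Then P - e
  is positive semidefinite and its form vanishes at v. For such matrices the form bounds |(P - e)
  v|^2, so v lies in the kernel.\<close>

lemma symmetric_eigenvalue_exists:
  fixes P :: "real^'d::finite^'d"
  assumes P: "msym P" shows "\<exists>e v. v \<noteq> 0 \<and> P *v v = e *\<^sub>R v"
proof -
  have ne: "axis undefined 1 \<in> sphere (0 :: real^'d) 1" by simp
  obtain v where v: "v \<in> sphere 0 1" and min: "\<And>y. y \<in> sphere 0 1 \<Longrightarrow> v \<bullet> (P *v v) \<le> y \<bullet> (P *v y)"
  proof -
    have "continuous_on (sphere (0 :: real^'d) 1) (\<lambda>y. y \<bullet> (P *v y))" by (intro continuous_intros)
    from continuous_attains_inf[OF compact_sphere _ this] ne show thesis using that by blast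
  qed
  let ?e = "v \<bullet> (P *v v)"
  let ?S = "P - ?e *\<^sub>R mat 1"
  have Sv: "?S *v y = P *v y - ?e *\<^sub>R y" for y by (simp add: matrix_vector_simps)
  have psd: "psd ?S"
    unfolding psd_def
  proof
    show "msym ?S" using P by (simp add: msym_def transpose_simps transpose_mat transpose_scalar)
    show "\<forall>y. 0 \<le> y \<bullet> (?S *v y)"
    proof
      fix y :: "real^'d"
      show "0 \<le> y \<bullet> (?S *v y)"
      proof (cases "y = 0")
        case False
        let ?u = "(1 / norm y) *\<^sub>R y"
        have "?e \<le> ?u \<bullet> (P *v ?u)" by (rule min) (use False in simp)
        also have "\<dots> = (y \<bullet> (P *v y)) / (norm y)\<^sup>2"
          by (simp add: matrix_vector_simps power2_eq_square)
        finally have "?e * (norm y)\<^sup>2 \<le> y \<bullet> (P *v y)" using False by (simp add: pos_le_divide_eq)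
        then show ?thesis unfolding Sv by (simp add: inner_diff_right power2_norm_eq_inner)
      qed simp
    qed
  qed
  have vv: "v \<bullet> v = 1" using v by (simp add: norm_eq_1)
  have "(norm (?S *v v))\<^sup>2 \<le> (opnorm ?S + 1) * (v \<bullet> (?S *v v))"
    by (rule psd_norm_square_le[OF psd]) (use opnorm_nonneg[of ?S] in auto)
  also have "v \<bullet> (?S *v v) = 0" unfolding Sv by (simp add: inner_diff_right vv)
  finally have "?S *v v = 0" by simp
  then have "P *v v = ?e *\<^sub>R v" unfolding Sv by simp
  moreover have "v \<noteq> 0" using vv by auto
  ultimately show ?thesis by blast
qed

text \<open>\<open>Min\<close> is meaningful only on a finite nonempty set, hence the two preceding
  results. The minimum is then itself an eigenvalue, so the norm bounds it.\<close>

lemma Min_beigenvalues_le: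
  assumes N: "1 \<le> N" and R: "\<And>i. i \<in> {1..N} \<Longrightarrow> spd (R i)"
  shows "Min (beigenvalues N (bRinv R)) \<le> bopnorm N (bRinv R)"
proof -
  have sym: "msym (matrix_inv (R i))" if "i \<in> {1..N}" for i
    using spd_matrix_inv[OF R[OF that]] by (simp add: spd_def)
  have "beigenvalues N (bRinv R) \<subseteq> (\<Union>i\<in>{1..N}. {e. \<exists>v. v \<noteq> 0 \<and> matrix_inv (R i) *v v = e *\<^sub>R v})"
    unfolding beigenvalues_def bnz_def by (auto simp: bmult_bRinv)
  then have fin: "finite (beigenvalues N (bRinv R))"
    by (rule finite_subset) (use symmetric_eigenvalues_finite[OF sym] in auto)
  have one: "1 \<in> {1..N}" using N by simp
  obtain e v where v: "v \<noteq> 0" "matrix_inv (R 1) *v v = e *\<^sub>R v"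
    using symmetric_eigenvalue_exists[OF sym[OF one]] by blast
  have "e \<in> beigenvalues N (bRinv R)"
    unfolding beigenvalues_def bnz_def
    by (rule CollectI, rule exI[of _ "\<lambda>j. if j = 1 then v else 0"]) (use one v in \<open>auto simp: bmult_bRinv\<close>)
  then have "Min (beigenvalues N (bRinv R)) \<in> beigenvalues N (bRinv R)"
    using fin by (intro Min_in) auto
  then obtain y where y: "bnz N y" and e: "\<And>i. i \<in> {1..N} \<Longrightarrow> bmult N (bRinv R) y i = Min (beigenvalues N (bRinv R)) *\<^sub>R y i"
    unfolding beigenvalues_def by blast
  let ?l = "Min (beigenvalues N (bRinv R))"
  have "bnorm2 N (bmult N (bRinv R) y) = bnorm2 N (\<lambda>i. ?l *\<^sub>R y i)"
    unfolding bnorm2_def by (rule sum.cong[OF refl]) (simp add: e)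
  then have le: "?l\<^sup>2 * bnorm2 N y \<le> (bopnorm N (bRinv R))\<^sup>2 * bnorm2 N y"
    using bnorm2_bmult_le[of N "bRinv R" y] by (simp add: bnorm2_scaleR)
  have "0 < bnorm2 N y"
    unfolding bnorm2_def using y unfolding bnz_def by (auto intro!: sum_pos2)
  with le have "?l\<^sup>2 \<le> (bopnorm N (bRinv R))\<^sup>2" by simp
  then show ?thesis by (rule power2_le_imp_le) (rule bopnorm_nonneg)
qed

text \<open>The connection between (A2) and the coercivity constant. Bounding the least eigenvalue
  of the block matrix by its norm cancels one of the two powers of the norm in the denominator. The
  squared constant \<open>KN\<close> contains the exponential twice, and coercivity asks for it only
  once.\<close>

lemma gamma_bound_coercivity:
  assumes N: "1 \<le> N" and R: "\<And>i. i \<in> {1..N} \<Longrightarrow> spd (R i)"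
    and pos: "\<And>i. i \<in> {1..N} \<Longrightarrow> 0 < K i \<and> 0 < lam i \<and> 0 < KL i \<and> 0 < lamL i"
    and \<gamma>: "0 < \<gamma>" "\<gamma> < gamma_bound N R K lam KL lamL" and i: "i \<in> {1..N}"
  shows "\<gamma> * ((K i)\<^sup>2 / (lam i)\<^sup>2 * opnorm (matrix_inv (R i)) * exp (opnorm (matrix_inv (R i)) * KL i / lamL i)) \<le> 1 / 2"
proof -
  let ?a = "opnorm (matrix_inv (R i))" and ?p = "bopnorm N (bRinv R)"
  let ?Kn = "KN N R K KL lamL" and ?ln = "lamN N lam"
  let ?x = "?a * KL i / lamL i"
  have a: "0 < ?a" by (rule spd_opnorm_pos[OF spd_matrix_inv[OF R[OF i]]])
  have ap: "?a \<le> ?p" by (rule opnorm_le_bopnorm_bRinv[OF i])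
  have p: "0 < ?p" using a ap by simp
  have x: "0 \<le> ?x" using a pos[OF i] by simp
  have ln: "0 < ?ln" "?ln \<le> lam i"
    unfolding lamN_def using pos i by (auto simp: Min_gr_iff intro!: Min_le)
  have Kn: "K i * exp ?x \<le> ?Kn"
    unfolding KN_def using i by (intro Max_ge) (auto simp: mult.commute intro!: image_eqI[of _ _ i])
  have Kn0: "0 < ?Kn" using Kn pos[OF i] by (meson exp_gt_zero less_le_trans mult_pos_pos)
  have "\<gamma> \<le> ?ln\<^sup>2 / (2 * ?Kn\<^sup>2 * ?p\<^sup>2) * ?p"
    using \<gamma>(2) unfolding gamma_bound_def
    by (rule less_imp_le[OF less_le_trans]) (intro mult_left_mono Min_beigenvalues_le N R; simp)
  also have "\<dots> = ?ln\<^sup>2 / (2 * ?Kn\<^sup>2 * ?p)" using p by (simp add: power2_eq_square)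
  finally have 1: "\<gamma> * (2 * ?Kn\<^sup>2 * ?p) \<le> ?ln\<^sup>2" using Kn0 p by (simp add: pos_le_divide_eq)
  have "(K i)\<^sup>2 * exp ?x * ?a \<le> (K i)\<^sup>2 * (exp ?x)\<^sup>2 * ?p"
  proof (intro mult_mono)
    have "exp ?x * 1 \<le> exp ?x * exp ?x" using x by (intro mult_left_mono) auto
    then show "exp ?x \<le> (exp ?x)\<^sup>2" by (simp add: power2_eq_square)
  qed (use a ap in auto)
  also have "\<dots> \<le> ?Kn\<^sup>2 * ?p"
    unfolding power_mult_distrib[symmetric]
    by (intro mult_right_mono power_mono Kn) (use pos[OF i] p in auto)
  finally have "\<gamma> * (2 * ((K i)\<^sup>2 * exp ?x * ?a)) \<le> \<gamma> * (2 * (?Kn\<^sup>2 * ?p))"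
    using \<gamma>(1) by (intro mult_left_mono) auto
  also have "\<dots> \<le> ?ln\<^sup>2" using 1 by (simp add: mult.assoc)
  also have "\<dots> \<le> (lam i)\<^sup>2" using ln by (intro power_mono) auto
  finally have "2 * (\<gamma> * ((K i)\<^sup>2 * exp ?x * ?a)) \<le> (lam i)\<^sup>2" by (simp add: mult.left_commute)
  then have "2 * (\<gamma> * ((K i)\<^sup>2 * exp ?x * ?a)) / (lam i)\<^sup>2 \<le> 1"
    using pos[OF i] by (simp add: pos_divide_le_eq)
  then show ?thesis by (simp add: mult_ac)
qed

lemma bspd_bshift_lower:
  assumes "bspd N (bshift M c)"
  shows "- c * (\<Sum>i\<in>{1..N}. (norm (y i))\<^sup>2) \<le> (\<Sum>i\<in>{1..N}. y i \<bullet> bmult N M y i)"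
proof -
  have sh: "bmult N (bshift M c) y i = bmult N M y i + c *\<^sub>R y i" if i: "i \<in> {1..N}" for i
  proof -
    have "bmult N (bshift M c) y i = (\<Sum>j\<in>{1..N}. M i j *v y j + (if i = j then c *\<^sub>R y j else 0))"
      unfolding bmult_def bshift_def by (rule sum.cong[OF refl]) (simp add: matrix_vector_simps)
    then show ?thesis using i by (simp add: sum.distrib bmult_def)
  qed
  have "0 \<le> (\<Sum>i\<in>{1..N}. y i \<bullet> bmult N (bshift M c) y i)"
  proof (cases "bnz N y")
    case True
    then show ?thesis using assms unfolding bspd_def by (auto intro: less_imp_le)
  next
    case False
    then have "y i = 0" if "i \<in> {1..N}" for i using that by (auto simp: bnz_def)
    then show ?thesis by simp
  qed
  also have "\<dots> = (\<Sum>i\<in>{1..N}. y i \<bullet> bmult N M y i) + c * (\<Sum>i\<in>{1..N}. (norm (y i))\<^sup>2)"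
    by (simp add: sh inner_add_right sum.distrib sum_distrib_left power2_norm_eq_inner)
  finally show ?thesis by simp
qed

text \<open>From R^2 \<le> m R, evaluated at the preimage of y under R.\<close>

lemma spd_inverse_lower:
  assumes R: "spd R" and m: "\<And>y. y \<bullet> (R *v y) \<le> m * (norm y)\<^sup>2" "0 < m"
  shows "1 / m * (norm y)\<^sup>2 \<le> y \<bullet> (matrix_inv R *v y)"
  using psd_norm_square_le_quadratic[OF spd_imp_psd[OF R] m, of "matrix_inv R *v y"] m(2)
  by (simp add: spd_inverse_vec[OF R] inner_commute field_simps)

lemma spd_inverse_opnorm_le:
  assumes R: "spd R" and m: "\<And>y. m * (norm y)\<^sup>2 \<le> y \<bullet> (R *v y)" "0 < m"
  shows "opnorm (matrix_inv R) \<le> 1 / m"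
proof (rule opnorm_leI)
  fix x
  let ?y = "matrix_inv R *v x"
  have "m * (norm ?y)\<^sup>2 \<le> ?y \<bullet> x" using m(1)[of ?y] by (simp add: spd_inverse_vec[OF R])
  also have "\<dots> \<le> norm ?y * norm x" by (rule norm_cauchy_schwarz)
  finally have "norm ?y * (m * norm ?y) \<le> norm ?y * norm x" by (simp add: power2_eq_square mult_ac)
  then have "m * norm ?y \<le> norm x" by (cases "norm ?y = 0") auto
  then show "norm ?y \<le> 1 / m * norm x" using m(2) by (simp add: field_simps)
qed

section \<open>From nonnegative integrals to expectations, and the choice of constants\<close>

lemma integral_le_of_nn_integral_le:
  fixes f :: "'a \<Rightarrow> real"
  assumes "\<And>x. 0 \<le> f x" "(\<integral>\<^sup>+x. ennreal (f x) \<partial>M) \<le> ennreal c" "0 \<le> c"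
  shows "integral\<^sup>L M f \<le> c"
proof (cases "integrable M f")
  case True
  then have "(\<integral>\<^sup>+x. ennreal (f x) \<partial>M) = ennreal (integral\<^sup>L M f)"
    by (rule nn_integral_eq_integral) (use assms in simp)
  with assms(2,3) show ?thesis by (simp add: ennreal_le_iff)
\<comment> \<open>A function that is not integrable has Bochner integral 0, which the nonnegative
  bound also covers.\<close>
qed (use assms in \<open>simp add: not_integrable_integral_eq\<close>)

lemma gap_nonneg: "0 \<le> gap M R Lam rho LamT rhoT XT X T t i \<omega>"
  by (simp add: gap_def)

lemma two_sided_antimono:
  assumes "l' \<le> l" "t \<in> {0..T}" shows "two_sided l T t \<le> two_sided l' T t"
  unfolding two_sided_def using assms
  by (intro add_mono) (auto intro!: mult_right_mono)

text \<open>\<open>D\<close> and \<open>e\<close> are chosen from the scalar parameters alone,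
  before the game is given. Applied to parameters that serve infinitely many N at once, this yields
  the uniform estimate.\<close>

lemma game_turnpike:
  fixes K \<nu> r k l cR q \<gamma> b :: real
  assumes pos: "0 < K" "0 < \<nu>" "0 < r" "0 < k" "0 < l" "0 < cR" "0 < \<gamma>" "0 \<le> b"
  obtains D e where "0 < D" "0 < e"
    "\<And>(M :: 'a measure) N (A :: nat \<Rightarrow> real^'d::finite^'d) sg R Q xb mu0 Sig0 x0 W Lam Sig mu rho c LamT SigT muT rhoT kapT XT X T t.
      game_data M N A sg R Q xb mu0 Sig0 x0 W Lam Sig mu rho c LamT SigT muT rhoT kapT XT X K \<nu> r k l cR q \<gamma> b \<Longrightarrow>
      0 < T \<Longrightarrow> t \<in> {0..T} \<Longrightarrow>
      (\<Sum>i\<in>{1..N}. \<integral>\<^sup>+\<omega>. ennreal (gap M R Lam rho LamT rhoT XT X T t i \<omega>) \<partial>M)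
        \<le> ennreal (real N * (D * two_sided e T t))"
proof -
  obtain C \<epsilon> where C0: "0 \<le> C" and \<epsilon>: "0 < \<epsilon>" "2 * \<epsilon> \<le> l" "4 * \<epsilon> \<le> \<nu>"
    and C: "\<And>N T (B :: nat \<Rightarrow> real^'d::finite^'d) R E Q mu rho x z t.
      deviation_system N T K \<nu> r k l cR q \<gamma> b B R E Q mu rho x z \<Longrightarrow> t \<in> {0..T} \<Longrightarrow>
      (\<Sum>i\<in>{1..N}. (norm (z i t))\<^sup>2) \<le> C * real N * (two_sided \<epsilon> T t)\<^sup>2"
    by (rule deviation_turnpike[OF pos(1-7), of q b]) (rule that; assumption)
  let ?m2 = "3 * (real CARD('d) * b * K\<^sup>2 / \<nu> + K\<^sup>2 * (2 * (real CARD('d) * b + 4 * b\<^sup>2)) + b\<^sup>2)"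
  let ?D = "((1 + 12 * r\<^sup>2 * k\<^sup>2) * (2 * (K * exp (K * (r * k / l)))\<^sup>2 / \<nu>) * (2 / \<nu>) + 3 / 2)
        * (2 * r\<^sup>2 * (k\<^sup>2 * ?m2 + 2 * C))"
  have D0: "0 \<le> ?D"
    using pos C0 by (intro mult_nonneg_nonneg add_nonneg_nonneg divide_nonneg_pos) auto
  show ?thesis
  proof (rule that)
    \<comment> \<open>The constant found is only nonnegative; adding 1 makes it positive.\<close>
    show "0 < ?D + 1" using D0 by linarith
    show "0 < 2 * \<epsilon>" using \<epsilon> by simp
    fix M :: "'a measure" and N and A :: "nat \<Rightarrow> real^'d::finite^'d"
      and sg R Q xb mu0 Sig0 x0 W Lam Sig mu rho c LamT SigT muT rhoT kapT XT X and T t :: real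
    assume G: "game_data M N A sg R Q xb mu0 Sig0 x0 W Lam Sig mu rho c LamT SigT muT rhoT kapT XT X K \<nu> r k l cR q \<gamma> b"
      and T: "0 < T" and t: "t \<in> {0..T}"
    interpret game_data M N A sg R Q xb mu0 Sig0 x0 W Lam Sig mu rho c LamT SigT muT rhoT kapT XT X K \<nu> r k l cR q \<gamma> b
      by (rule G)
    have "(\<Sum>i\<in>{1..N}. \<integral>\<^sup>+\<omega>. ennreal (gap M R Lam rho LamT rhoT XT X T t i \<omega>) \<partial>M)
        \<le> ennreal (real N * (?D * two_sided (2 * \<epsilon>) T t))"
      using gap_sum_le[OF T t \<epsilon> C[OF deviation[OF T]] C0] unfolding m2_def by simp
    also have "\<dots> \<le> ennreal (real N * ((?D + 1) * two_sided (2 * \<epsilon>) T t))"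
      using two_sided_pos[of "2 * \<epsilon>" T t] by (intro ennreal_leI mult_left_mono mult_right_mono) auto
    finally show "(\<Sum>i\<in>{1..N}. \<integral>\<^sup>+\<omega>. ennreal (gap M R Lam rho LamT rhoT XT X T t i \<omega>) \<partial>M)
        \<le> ennreal (real N * ((?D + 1) * two_sided (2 * \<epsilon>) T t))" .
  qed
qed

text \<open>A single player's gap is bounded by the sum over all players, which costs the factor N;
  the average does not pay it.\<close>

lemma (in game_data) expected_gap_le:
  assumes T: "0 < T" and t: "t \<in> {0..T}" and D: "0 \<le> D"
    and le: "(\<Sum>i\<in>{1..N}. \<integral>\<^sup>+\<omega>. ennreal (gap M R Lam rho LamT rhoT XT X T t i \<omega>) \<partial>M)
        \<le> ennreal (real N * (D * two_sided e T t))"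
  shows "i \<in> {1..N} \<Longrightarrow> integral\<^sup>L M (gap M R Lam rho LamT rhoT XT X T t i) \<le> real N * D * two_sided e T t"
    and "1 / real N * integral\<^sup>L M (\<lambda>\<omega>. \<Sum>i\<in>{1..N}. gap M R Lam rho LamT rhoT XT X T t i \<omega>) \<le> D * two_sided e T t"
proof -
  let ?g = "gap M R Lam rho LamT rhoT XT X T t"
  have N: "2 \<le> N" using setting by (simp add: setting_def)
  have b0: "0 \<le> real N * (D * two_sided e T t)" using D two_sided_pos[of e T t] by simp
  show "integral\<^sup>L M (?g i) \<le> real N * D * two_sided e T t" if i: "i \<in> {1..N}"
  proof (rule integral_le_of_nn_integral_le)
    have "(\<integral>\<^sup>+\<omega>. ennreal (?g i \<omega>) \<partial>M) \<le> (\<Sum>i\<in>{1..N}. \<integral>\<^sup>+\<omega>. ennreal (?g i \<omega>) \<partial>M)"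
      by (rule member_le_sum) (use i in auto)
    also note le
    finally show "(\<integral>\<^sup>+\<omega>. ennreal (?g i \<omega>) \<partial>M) \<le> ennreal (real N * D * two_sided e T t)"
      by (simp only: mult.assoc)
  qed (use b0 in \<open>simp_all add: gap_nonneg mult.assoc\<close>)
  have "integral\<^sup>L M (\<lambda>\<omega>. \<Sum>i\<in>{1..N}. ?g i \<omega>) \<le> real N * (D * two_sided e T t)"
  proof (rule integral_le_of_nn_integral_le)
    have "(\<integral>\<^sup>+\<omega>. ennreal (\<Sum>i\<in>{1..N}. ?g i \<omega>) \<partial>M) = (\<integral>\<^sup>+\<omega>. (\<Sum>i\<in>{1..N}. ennreal (?g i \<omega>)) \<partial>M)"
      by (intro nn_integral_cong sum_ennreal[symmetric] gap_nonneg)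
    also have "\<dots> = (\<Sum>i\<in>{1..N}. \<integral>\<^sup>+\<omega>. ennreal (?g i \<omega>) \<partial>M)"
      by (intro nn_integral_sum measurable_compose[OF gap_measurable[OF _ t T] measurable_ennreal])
    finally show "(\<integral>\<^sup>+\<omega>. ennreal (\<Sum>i\<in>{1..N}. ?g i \<omega>) \<partial>M) \<le> ennreal (real N * (D * two_sided e T t))"
      using le by simp
    show "0 \<le> (\<Sum>i\<in>{1..N}. ?g i \<omega>)" for \<omega> by (intro sum_nonneg gap_nonneg)
  qed (rule b0)
  then show "1 / real N * integral\<^sup>L M (\<lambda>\<omega>. \<Sum>i\<in>{1..N}. ?g i \<omega>) \<le> D * two_sided e T t"
    using N by (simp add: field_simps)
qed

text \<open>For a single N every finite family of constants has a common bound. Sums of nonnegative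
  terms act as upper bounds and are more convenient than maxima; only the rates need minima. The
  players' own rates are passed on for coercivity.\<close>

lemma setting_game_data:
  fixes A :: "nat \<Rightarrow> real^'d::finite^'d"
  assumes S: "setting M N A sg R Q xb mu0 Sig0 x0 W Lam Sig mu rho c LamT SigT muT rhoT kapT XT X"
  obtains K \<nu> r k l cR q \<gamma> b where "0 < K" "0 < \<nu>" "0 < r" "0 < k" "0 < l" "0 < cR" "0 < \<gamma>" "0 \<le> b"
    "game_data M N A sg R Q xb mu0 Sig0 x0 W Lam Sig mu rho c LamT SigT muT rhoT kapT XT X K \<nu> r k l cR q \<gamma> b"
proof -
  have N: "1 \<le> N" and A2: "A2 N A R Q Lam LamT" and A1: "A1 N A sg R Q"
    using S by (simp_all add: setting_def)
  have R: "spd (R i)" if "i \<in> {1..N}" for i using A1 that by (simp add: A1_def)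
  obtain K lam KL lamL \<gamma> where rc: "rate_consts N A R Lam LamT K lam KL lamL"
    and \<gamma>: "0 < \<gamma>" "\<gamma> < gamma_bound N R K lam KL lamL" "bspd N (bshift (bQ Q) (\<gamma>/2))"
    using A2 unfolding A2_def by (elim exE conjE) (rule that; assumption)
  have pos: "0 < K i \<and> 0 < lam i \<and> 0 < KL i \<and> 0 < lamL i" if "i \<in> {1..N}" for i
    using rc that unfolding rate_consts_def by blast
  have ex: "opnorm (mexp (s *\<^sub>R (A i - matrix_inv (R i) ** Lam i))) \<le> K i * exp (- lam i * s)"
    if "i \<in> {1..N}" "0 \<le> s" for i s
    using rc that unfolding rate_consts_def by blast
  have LT: "opnorm (LamT i T t - Lam i) \<le> KL i * exp (- lamL i * (T - t))"
    if "i \<in> {1..N}" "0 < T" "t \<in> {0..T}" for i T t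
    using rc that unfolding rate_consts_def by blast
  have one: "1 \<in> {1..N}" using N by simp
  have ne: "{1..N} \<noteq> {}" using one by blast
  define K' where "K' = (\<Sum>i\<in>{1..N}. K i)"
  define \<nu> where "\<nu> = Min (lam ` {1..N})"
  define r where "r = (\<Sum>i\<in>{1..N}. opnorm (matrix_inv (R i)))"
  define k where "k = (\<Sum>i\<in>{1..N}. KL i)"
  define l where "l = Min (lamL ` {1..N})"
  define m where "m = (\<Sum>i\<in>{1..N}. opnorm (R i))"
  define b where "b = (\<Sum>i\<in>{1..N}. norm (mu0 i) + norm (mu i) + norm (rho i) + opnorm (vsig sg i) + opnorm (matrix_inv (Sig0 i)))"
  have K': "0 < K'" "\<And>i. i \<in> {1..N} \<Longrightarrow> K i \<le> K'"
    unfolding K'_def by (rule sum_pos[OF _ ne]; use pos in simp) (rule member_le_sum; use pos in \<open>auto intro: less_imp_le\<close>)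
  have k: "0 < k" "\<And>i. i \<in> {1..N} \<Longrightarrow> KL i \<le> k"
    unfolding k_def by (rule sum_pos[OF _ ne]; use pos in simp) (rule member_le_sum; use pos in \<open>auto intro: less_imp_le\<close>)
  have \<nu>: "0 < \<nu>" "\<And>i. i \<in> {1..N} \<Longrightarrow> \<nu> \<le> lam i"
    unfolding \<nu>_def using pos ne by (auto simp: Min_gr_iff)
  have l: "0 < l" "\<And>i. i \<in> {1..N} \<Longrightarrow> l \<le> lamL i"
    unfolding l_def using pos ne by (auto simp: Min_gr_iff)
  have r: "0 < r" "\<And>i. i \<in> {1..N} \<Longrightarrow> opnorm (matrix_inv (R i)) \<le> r"
    unfolding r_def by (rule sum_pos[OF _ ne]; simp add: spd_opnorm_pos spd_matrix_inv R)
      (rule member_le_sum; simp add: opnorm_nonneg)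
  have m: "0 < m" "\<And>i. i \<in> {1..N} \<Longrightarrow> opnorm (R i) \<le> m"
    unfolding m_def by (rule sum_pos[OF _ ne]; simp add: spd_opnorm_pos R)
      (rule member_le_sum; simp add: opnorm_nonneg)
  have b0: "0 \<le> b" unfolding b_def by (intro sum_nonneg add_nonneg_nonneg opnorm_nonneg norm_ge_zero)
  have b: "norm (mu0 i) + norm (mu i) + norm (rho i) + opnorm (vsig sg i) + opnorm (matrix_inv (Sig0 i)) \<le> b"
    if "i \<in> {1..N}" for i
    unfolding b_def
    by (rule member_le_sum[of i "{1..N}"]) (use that in \<open>auto intro!: add_nonneg_nonneg opnorm_nonneg\<close>)
  have "game_data M N A sg R Q xb mu0 Sig0 x0 W Lam Sig mu rho c LamT SigT muT rhoT kapT XT X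
      K' \<nu> r k l (1 / m) (bopnorm N (bQ Q)) \<gamma> b"
  proof
    show "0 < 1 / m" using m by simp
    show "(\<Sum>i\<in>{1..N}. (norm (bmult N (bQ Q) y i))\<^sup>2) \<le> (bopnorm N (bQ Q))\<^sup>2 * (\<Sum>i\<in>{1..N}. (norm (y i))\<^sup>2)" for y
      using bnorm2_bmult_le[of N "bQ Q" y] by (simp add: bnorm2_def)
    show "- (\<gamma> / 2) * (\<Sum>i\<in>{1..N}. (norm (y i))\<^sup>2) \<le> (\<Sum>i\<in>{1..N}. y i \<bullet> bmult N (bQ Q) y i)" for y
      by (rule bspd_bshift_lower[OF \<gamma>(3)])
    fix i assume i: "i \<in> {1..N}"
    show "opnorm (mexp (s *\<^sub>R (A i - matrix_inv (R i) ** Lam i))) \<le> K' * exp (- \<nu> * s)" if s: "0 \<le> s" for s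
    proof (rule order_trans[OF ex[OF i s]])
      show "K i * exp (- lam i * s) \<le> K' * exp (- \<nu> * s)"
        using K'(1) K'(2)[OF i] mult_right_mono[OF \<nu>(2)[OF i] s] by (intro mult_mono) auto
    qed
    show "opnorm (LamT i T t - Lam i) \<le> k * exp (- l * (T - t))" if T: "0 < T" and t: "t \<in> {0..T}" for T t
    proof (rule order_trans[OF LT[OF i T t]])
      show "KL i * exp (- lamL i * (T - t)) \<le> k * exp (- l * (T - t))"
        using k(1) k(2)[OF i] mult_right_mono[OF l(2)[OF i], of "T - t"] t by (intro mult_mono) auto
    qed
    show "1 / m * (norm y)\<^sup>2 \<le> y \<bullet> (matrix_inv (R i) *v y)" for y
      by (rule spd_inverse_lower[OF R[OF i] psd_quadratic_le[OF m(2)[OF i]] m(1)])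
    show "\<exists>K' \<nu>' k' l'. 0 < K' \<and> 0 < \<nu>' \<and> 0 < k' \<and> 0 < l' \<and>
      (\<forall>s\<ge>0. opnorm (mexp (s *\<^sub>R (A i - matrix_inv (R i) ** Lam i))) \<le> K' * exp (- \<nu>' * s)) \<and>
      (\<forall>T>0. \<forall>t\<in>{0..T}. opnorm (LamT i T t - Lam i) \<le> k' * exp (- l' * (T - t))) \<and>
      \<gamma> * (K'\<^sup>2 / \<nu>'\<^sup>2 * opnorm (matrix_inv (R i)) * exp (opnorm (matrix_inv (R i)) * k' / l')) \<le> 1 / 2"
    proof (rule exI[of _ "K i"], rule exI[of _ "lam i"], rule exI[of _ "KL i"], rule exI[of _ "lamL i"], intro conjI allI impI ballI)
      show "\<gamma> * ((K i)\<^sup>2 / (lam i)\<^sup>2 * opnorm (matrix_inv (R i)) * exp (opnorm (matrix_inv (R i)) * KL i / lamL i)) \<le> 1 / 2"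
        by (rule gamma_bound_coercivity[OF N R pos \<gamma>(1,2) i])
    qed (use pos[OF i] ex[OF i] LT[OF i] in auto)
    show "norm (mu0 i) \<le> b" "norm (mu i) \<le> b" "norm (rho i) \<le> b" "opnorm (vsig sg i) \<le> b" "opnorm (matrix_inv (Sig0 i)) \<le> b"
      using b[OF i] opnorm_nonneg[of "vsig sg i"] opnorm_nonneg[of "matrix_inv (Sig0 i)"]
        norm_ge_zero[of "mu0 i"] norm_ge_zero[of "mu i"] norm_ge_zero[of "rho i"] by linarith+
  qed (fact S K'(1) \<nu>(1) r k(1) l(1) \<gamma>(1) b0 | rule r; assumption)+
  then show ?thesis
    by (rule that[rotated -1]) (use K' \<nu> r k l m \<gamma> b0 in auto)
qed

text \<open>The Loewner bounds on \<open>R\<close> become 1 / bl for the norm of the inverse and 1 /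
  bu for its lower bound. All parameters are thus independent of N, provided \<gamma> lies below the
  bound for that N.\<close>

lemma uniform_game_data:
  fixes A :: "nat \<Rightarrow> real^'d::finite^'d"
  assumes S: "setting M N A sg R Q xb mu0 Sig0 x0 W Lam Sig mu rho c LamT SigT muT rhoT kapT XT X"
    and rc: "rate_consts N A R Lam LamT (\<lambda>_. K) (\<lambda>_. lam) (\<lambda>_. KL) (\<lambda>_. lamL)"
    and \<gamma>: "0 < \<gamma>" "\<gamma> < gamma_bound N R (\<lambda>_. K) (\<lambda>_. lam) (\<lambda>_. KL) (\<lambda>_. lamL)" "bspd N (bshift (bQ Q) (\<gamma>/2))"
    and R_bounds: "\<And>i. i \<in> {1..N} \<Longrightarrow> loewner_le (bl *\<^sub>R mat 1) (R i) \<and> loewner_le (R i) (bu *\<^sub>R mat 1)"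
    and bl: "0 < bl" and bu: "0 < bu" and q: "bopnorm N (bQ Q) \<le> q"
    and b: "\<And>i. i \<in> {1..N} \<Longrightarrow> norm (mu0 i) \<le> b \<and> norm (mu i) \<le> b \<and> norm (rho i) \<le> b
      \<and> opnorm (vsig sg i) \<le> b \<and> opnorm (matrix_inv (Sig0 i)) \<le> b" and b0: "0 \<le> b"
  shows "game_data M N A sg R Q xb mu0 Sig0 x0 W Lam Sig mu rho c LamT SigT muT rhoT kapT XT X
      K lam (1 / bl) KL lamL (1 / bu) q \<gamma> b"
proof -
  have N: "1 \<le> N" and A1: "A1 N A sg R Q" using S by (simp_all add: setting_def)
  have R: "spd (R i)" if "i \<in> {1..N}" for i using A1 that by (simp add: A1_def)
  have one: "1 \<in> {1..N}" using N by simp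
  have pos: "0 < K" "0 < lam" "0 < KL" "0 < lamL" using rc one unfolding rate_consts_def by blast+
  have ex: "opnorm (mexp (s *\<^sub>R (A i - matrix_inv (R i) ** Lam i))) \<le> K * exp (- lam * s)"
    if "i \<in> {1..N}" "0 \<le> s" for i s
    using rc that unfolding rate_consts_def by blast
  have LT: "opnorm (LamT i T t - Lam i) \<le> KL * exp (- lamL * (T - t))"
    if "i \<in> {1..N}" "0 < T" "t \<in> {0..T}" for i T t
    using rc that unfolding rate_consts_def by blast
  have lower: "bl * (norm y)\<^sup>2 \<le> y \<bullet> (R i *v y)" and upper: "y \<bullet> (R i *v y) \<le> bu * (norm y)\<^sup>2"
    if i: "i \<in> {1..N}" for i y
    using R_bounds[OF i] unfolding loewner_le_def
    by (auto simp: matrix_vector_simps inner_diff_right power2_norm_eq_inner)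
  show ?thesis
  proof
    show "0 < 1 / bl" "0 < 1 / bu" using bl bu by simp_all
    show "(\<Sum>i\<in>{1..N}. (norm (bmult N (bQ Q) y i))\<^sup>2) \<le> q\<^sup>2 * (\<Sum>i\<in>{1..N}. (norm (y i))\<^sup>2)" for y
    proof -
      have "(bopnorm N (bQ Q))\<^sup>2 * bnorm2 N y \<le> q\<^sup>2 * bnorm2 N y"
        by (intro mult_right_mono power_mono q bopnorm_nonneg bnorm2_nonneg)
      with bnorm2_bmult_le[of N "bQ Q" y] show ?thesis by (simp add: bnorm2_def)
    qed
    show "- (\<gamma> / 2) * (\<Sum>i\<in>{1..N}. (norm (y i))\<^sup>2) \<le> (\<Sum>i\<in>{1..N}. y i \<bullet> bmult N (bQ Q) y i)" for y
      by (rule bspd_bshift_lower[OF \<gamma>(3)])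
    fix i assume i: "i \<in> {1..N}"
    show "opnorm (matrix_inv (R i)) \<le> 1 / bl"
      by (rule spd_inverse_opnorm_le[OF R[OF i] lower[OF i] bl])
    show "1 / bu * (norm y)\<^sup>2 \<le> y \<bullet> (matrix_inv (R i) *v y)" for y
      by (rule spd_inverse_lower[OF R[OF i] upper[OF i] bu])
    show "\<exists>K' \<nu>' k' l'. 0 < K' \<and> 0 < \<nu>' \<and> 0 < k' \<and> 0 < l' \<and>
      (\<forall>s\<ge>0. opnorm (mexp (s *\<^sub>R (A i - matrix_inv (R i) ** Lam i))) \<le> K' * exp (- \<nu>' * s)) \<and>
      (\<forall>T>0. \<forall>t\<in>{0..T}. opnorm (LamT i T t - Lam i) \<le> k' * exp (- l' * (T - t))) \<and>
      \<gamma> * (K'\<^sup>2 / \<nu>'\<^sup>2 * opnorm (matrix_inv (R i)) * exp (opnorm (matrix_inv (R i)) * k' / l')) \<le> 1 / 2"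
    proof (rule exI[of _ K], rule exI[of _ lam], rule exI[of _ KL], rule exI[of _ lamL], intro conjI allI impI ballI)
      show "\<gamma> * (K\<^sup>2 / lam\<^sup>2 * opnorm (matrix_inv (R i)) * exp (opnorm (matrix_inv (R i)) * KL / lamL)) \<le> 1 / 2"
        using gamma_bound_coercivity[OF N R _ \<gamma>(1,2) i] pos by simp
    qed (use pos ex[OF i] LT[OF i] in auto)
    show "norm (mu0 i) \<le> b" "norm (mu i) \<le> b" "norm (rho i) \<le> b" "opnorm (vsig sg i) \<le> b" "opnorm (matrix_inv (Sig0 i)) \<le> b"
      using b[OF i] by simp_all
  qed (fact S pos \<gamma>(1) b0 | rule ex LT; assumption)+
qed

lemma setting_turnpike:
  fixes M :: "'a measure" and A :: "nat \<Rightarrow> real^'d::finite^'d"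
  assumes S: "setting M N A sg R Q xb mu0 Sig0 x0 W Lam Sig mu rho c LamT SigT muT rhoT kapT XT X"
  obtains D e where "0 < D" "0 < e"
    "\<And>T t i. 0 < T \<Longrightarrow> t \<in> {0..T} \<Longrightarrow> i \<in> {1..N} \<Longrightarrow>
      integral\<^sup>L M (gap M R Lam rho LamT rhoT XT X T t i) \<le> real N * D * two_sided e T t"
    "\<And>T t. 0 < T \<Longrightarrow> t \<in> {0..T} \<Longrightarrow>
      1 / real N * integral\<^sup>L M (\<lambda>\<omega>. \<Sum>i\<in>{1..N}. gap M R Lam rho LamT rhoT XT X T t i \<omega>) \<le> D * two_sided e T t"
proof -
  obtain K \<nu> r k l cR q \<gamma> b where pos: "0 < K" "0 < \<nu>" "0 < r" "0 < k" "0 < l" "0 < cR" "0 < \<gamma>" "0 \<le> b"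
    and G: "game_data M N A sg R Q xb mu0 Sig0 x0 W Lam Sig mu rho c LamT SigT muT rhoT kapT XT X K \<nu> r k l cR q \<gamma> b"
    by (rule setting_game_data[OF S])
  obtain D e where De: "0 < D" "0 < e" and
    le: "\<And>(M :: 'a measure) N (A :: nat \<Rightarrow> real^'d::finite^'d) sg R Q xb mu0 Sig0 x0 W Lam Sig mu rho c LamT SigT muT rhoT kapT XT X T t.
      game_data M N A sg R Q xb mu0 Sig0 x0 W Lam Sig mu rho c LamT SigT muT rhoT kapT XT X K \<nu> r k l cR q \<gamma> b \<Longrightarrow>
      0 < T \<Longrightarrow> t \<in> {0..T} \<Longrightarrow>
      (\<Sum>i\<in>{1..N}. \<integral>\<^sup>+\<omega>. ennreal (gap M R Lam rho LamT rhoT XT X T t i \<omega>) \<partial>M)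
        \<le> ennreal (real N * (D * two_sided e T t))"
    by (rule game_turnpike[OF pos, of q]) (rule that; assumption)
  show ?thesis
  proof (rule that[OF De])
    fix T t :: real
    assume T: "0 < T" and t: "t \<in> {0..T}"
    note bounds = game_data.expected_gap_le[OF G T t less_imp_le[OF De(1)] le[OF G T t]]
    show "1 / real N * integral\<^sup>L M (\<lambda>\<omega>. \<Sum>i\<in>{1..N}. gap M R Lam rho LamT rhoT XT X T t i \<omega>) \<le> D * two_sided e T t"
      by (rule bounds(2))
    show "integral\<^sup>L M (gap M R Lam rho LamT rhoT XT X T t i) \<le> real N * D * two_sided e T t" if "i \<in> {1..N}" for i
      by (rule bounds(1)[OF that])
  qed
qed

theorem mainTheorem10:
  fixes M :: "nat \<Rightarrow> 'a measure"
    and A sg R Sig0 Lam Sig :: "nat \<Rightarrow> nat \<Rightarrow> real^'d::finite^'d"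
    and Q :: "nat \<Rightarrow> nat \<Rightarrow> nat \<Rightarrow> nat \<Rightarrow> real^'d^'d"
    and xb :: "nat \<Rightarrow> nat \<Rightarrow> nat \<Rightarrow> real^'d"
    and mu0 mu rho :: "nat \<Rightarrow> nat \<Rightarrow> real^'d"
    and c :: "nat \<Rightarrow> nat \<Rightarrow> real"
    and x0 :: "nat \<Rightarrow> nat \<Rightarrow> 'a \<Rightarrow> real^'d"
    and W :: "nat \<Rightarrow> nat \<Rightarrow> real \<Rightarrow> 'a \<Rightarrow> real^'d"
    and LamT SigT :: "nat \<Rightarrow> nat \<Rightarrow> real \<Rightarrow> real \<Rightarrow> real^'d^'d"
    and muT rhoT :: "nat \<Rightarrow> nat \<Rightarrow> real \<Rightarrow> real \<Rightarrow> real^'d"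
    and kapT :: "nat \<Rightarrow> nat \<Rightarrow> real \<Rightarrow> real \<Rightarrow> real"
    and XT :: "nat \<Rightarrow> nat \<Rightarrow> real \<Rightarrow> real \<Rightarrow> 'a \<Rightarrow> real^'d"
    and X :: "nat \<Rightarrow> nat \<Rightarrow> real \<Rightarrow> 'a \<Rightarrow> real^'d"
  shows
    "(\<forall>N. setting (M N) N (A N) (sg N) (R N) (Q N) (xb N) (mu0 N) (Sig0 N) (x0 N) (W N)
             (Lam N) (Sig N) (mu N) (rho N) (c N) (LamT N) (SigT N) (muT N) (rhoT N) (kapT N)
             (XT N) (X N)
        \<longrightarrow> (\<exists>K l. 0 < K \<and> 0 < l \<and> (\<forall>T>0. \<forall>t\<in>{0..T}. \<forall>i\<in>{1..N}.
               prob_space.expectation (M N)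
                 (gap (M N) (R N) (Lam N) (rho N) (LamT N) (rhoT N) (XT N) (X N) T t i)
               \<le> K * (exp (- l * t) + exp (- l * (T - t))))))
   \<and> ((\<forall>N\<ge>2. setting (M N) N (A N) (sg N) (R N) (Q N) (xb N) (mu0 N) (Sig0 N) (x0 N) (W N)
             (Lam N) (Sig N) (mu N) (rho N) (c N) (LamT N) (SigT N) (muT N) (rhoT N) (kapT N)
             (XT N) (X N))
       \<and> A3 A R Q Lam \<and> A4 A R Q Lam LamT \<and> A6 sg Q xb mu0 Sig0 Sig mu rho
       \<longrightarrow> (\<exists>K l. 0 < K \<and> 0 < l \<and> (\<forall>N\<ge>2. \<forall>T>0. \<forall>t\<in>{0..T}.
               (1 / real N) * prob_space.expectation (M N)
                 (\<lambda>\<omega>. \<Sum>i\<in>{1..N}.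
                    gap (M N) (R N) (Lam N) (rho N) (LamT N) (rhoT N) (XT N) (X N) T t i \<omega>)
               \<le> K * (exp (- l * t) + exp (- l * (T - t))))))"
proof (intro conjI allI impI)
  fix N
  assume S: "setting (M N) N (A N) (sg N) (R N) (Q N) (xb N) (mu0 N) (Sig0 N) (x0 N) (W N)
             (Lam N) (Sig N) (mu N) (rho N) (c N) (LamT N) (SigT N) (muT N) (rhoT N) (kapT N)
             (XT N) (X N)"
  obtain D e where De: "0 < D" "0 < e" and
    le: "\<And>T t i. 0 < T \<Longrightarrow> t \<in> {0..T} \<Longrightarrow> i \<in> {1..N} \<Longrightarrow>
      integral\<^sup>L (M N) (gap (M N) (R N) (Lam N) (rho N) (LamT N) (rhoT N) (XT N) (X N) T t i)
        \<le> real N * D * two_sided e T t"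
    by (rule setting_turnpike[OF S]) (rule that; assumption)
  have N: "2 \<le> N" using S by (simp add: setting_def)
  show "\<exists>K l. 0 < K \<and> 0 < l \<and> (\<forall>T>0. \<forall>t\<in>{0..T}. \<forall>i\<in>{1..N}.
               prob_space.expectation (M N)
                 (gap (M N) (R N) (Lam N) (rho N) (LamT N) (rhoT N) (XT N) (X N) T t i)
               \<le> K * (exp (- l * t) + exp (- l * (T - t))))"
  \<comment> \<open>Here N is fixed, so it may enter the constant.\<close>
  proof (rule exI[of _ "real N * D"], rule exI[of _ e], intro conjI allI impI ballI)
    show "0 < real N * D" using De N by simp
  qed (use De le[unfolded two_sided_def] in auto)
next
  assume H: "(\<forall>N\<ge>2. setting (M N) N (A N) (sg N) (R N) (Q N) (xb N) (mu0 N) (Sig0 N) (x0 N) (W N)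
             (Lam N) (Sig N) (mu N) (rho N) (c N) (LamT N) (SigT N) (muT N) (rhoT N) (kapT N)
             (XT N) (X N))
       \<and> A3 A R Q Lam \<and> A4 A R Q Lam LamT \<and> A6 sg Q xb mu0 Sig0 Sig mu rho"
  then have A3: "A3 A R Q Lam" and A4: "A4 A R Q Lam LamT" and A6: "A6 sg Q xb mu0 Sig0 Sig mu rho"
    and S: "\<And>N. 2 \<le> N \<Longrightarrow> setting (M N) N (A N) (sg N) (R N) (Q N) (xb N) (mu0 N) (Sig0 N) (x0 N) (W N)
             (Lam N) (Sig N) (mu N) (rho N) (c N) (LamT N) (SigT N) (muT N) (rhoT N) (kapT N)
             (XT N) (X N)"
    by blast+
  \<comment> \<open>The claim for one N with given constants; it is monotone in both, which allows
    finitely many cases to be merged.\<close>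
  define bd where "bd = (\<lambda>N D e. \<forall>T>0. \<forall>t\<in>{0..T}.
      1 / real N * integral\<^sup>L (M N) (\<lambda>\<omega>. \<Sum>i\<in>{1..N}.
        gap (M N) (R N) (Lam N) (rho N) (LamT N) (rhoT N) (XT N) (X N) T t i \<omega>) \<le> D * two_sided e T t)"
  have bd_mono: "bd N D' e'" if "bd N D e" "0 \<le> D" "D \<le> D'" "e' \<le> e" for N D e D' e'
    unfolding bd_def
  proof (intro allI impI ballI)
    fix T t :: real assume T: "0 < T" and t: "t \<in> {0..T}"
    have "D * two_sided e T t \<le> D' * two_sided e' T t"
      using that two_sided_antimono[OF that(4) t] two_sided_pos[of e T t] by (intro mult_mono) auto
    with that(1) T t show "1 / real N * integral\<^sup>L (M N) (\<lambda>\<omega>. \<Sum>i\<in>{1..N}.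
        gap (M N) (R N) (Lam N) (rho N) (LamT N) (rhoT N) (XT N) (X N) T t i \<omega>) \<le> D' * two_sided e' T t"
      unfolding bd_def by (meson order_trans)
  qed
  \<comment> \<open>Both alternatives of (A3) contain these bounds on \<open>R\<close>.\<close>
  obtain bl bu where bl: "0 < bl" and bu: "0 < bu" and
    Rb: "\<And>N i. 2 \<le> N \<Longrightarrow> i \<in> {1..N} \<Longrightarrow> loewner_le (bl *\<^sub>R mat 1) (R N i) \<and> loewner_le (R N i) (bu *\<^sub>R mat 1)"
    using A3 unfolding A3_def by (elim disjE exE conjE) (rule that; blast)+
  obtain K lam KL lamL \<gamma> b2 where
    rc: "\<And>N. 2 \<le> N \<Longrightarrow> rate_consts N (A N) (R N) (Lam N) (LamT N) (\<lambda>_. K) (\<lambda>_. lam) (\<lambda>_. KL) (\<lambda>_. lamL)"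
    and \<gamma>: "0 < \<gamma>" and lim: "ereal \<gamma> < Liminf sequentially
              (\<lambda>N. ereal (gamma_bound N (R N) (\<lambda>_. K) (\<lambda>_. lam) (\<lambda>_. KL) (\<lambda>_. lamL)))"
    and sp: "\<And>N. 2 \<le> N \<Longrightarrow> bspd N (bshift (bQ (Q N)) (\<gamma>/2))"
    and b2: "\<And>N. 2 \<le> N \<Longrightarrow> bopnorm N (bQ (Q N)) \<le> b2"
    using A4 unfolding A4_def by (elim exE conjE) (rule that; blast)
  obtain b3 where b3: "\<And>N i. 2 \<le> N \<Longrightarrow> i \<in> {1..N} \<Longrightarrow> norm (mu0 N i) \<le> b3 \<and> norm (mu N i) \<le> b3 \<and> norm (rho N i) \<le> b3
      \<and> opnorm (vsig (sg N) i) \<le> b3 \<and> opnorm (matrix_inv (Sig0 N i)) \<le> b3"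
    using A6 unfolding A6_def by (elim exE) (rule that; blast)
  have b3_nonneg: "0 \<le> b3" using b3[of 2 1] by (auto intro: order_trans[OF norm_ge_zero])
  have "1 \<in> {1..2::nat}" by simp
  then have cpos: "0 < K" "0 < lam" "0 < KL" "0 < lamL"
    using rc[OF order_refl] unfolding rate_consts_def by blast+
  \<comment> \<open>Being strictly below the liminf puts \<gamma> below the bound only eventually;
    earlier N may violate it and need separate constants.\<close>
  have "\<forall>\<^sub>F N in sequentially. ereal \<gamma> < ereal (gamma_bound N (R N) (\<lambda>_. K) (\<lambda>_. lam) (\<lambda>_. KL) (\<lambda>_. lamL))"
    by (rule less_LiminfD[OF lim])
  then obtain N0 where N0: "\<And>N. N0 \<le> N \<Longrightarrow> \<gamma> < gamma_bound N (R N) (\<lambda>_. K) (\<lambda>_. lam) (\<lambda>_. KL) (\<lambda>_. lamL)"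
    unfolding eventually_sequentially by auto
  have ipos: "0 < 1 / bl" "0 < 1 / bu" using bl bu by simp_all
  obtain D1 e1 where D1: "0 < D1" "0 < e1" and
    le: "\<And>(M :: 'a measure) N (A :: nat \<Rightarrow> real^'d::finite^'d) sg R Q xb mu0 Sig0 x0 W Lam Sig mu rho c LamT SigT muT rhoT kapT XT X T t.
      game_data M N A sg R Q xb mu0 Sig0 x0 W Lam Sig mu rho c LamT SigT muT rhoT kapT XT X
        K lam (1 / bl) KL lamL (1 / bu) b2 \<gamma> b3 \<Longrightarrow>
      0 < T \<Longrightarrow> t \<in> {0..T} \<Longrightarrow>
      (\<Sum>i\<in>{1..N}. \<integral>\<^sup>+\<omega>. ennreal (gap M R Lam rho LamT rhoT XT X T t i \<omega>) \<partial>M)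
        \<le> ennreal (real N * (D1 * two_sided e1 T t))"
    by (rule game_turnpike[OF cpos(1,2) ipos(1) cpos(3,4) ipos(2) \<gamma> b3_nonneg, of b2]) (rule that; assumption)
  have tail: "bd N D1 e1" if N: "2 \<le> N" "N0 \<le> N" for N
    unfolding bd_def
  proof (intro allI impI ballI)
    fix T t :: real assume T: "0 < T" and t: "t \<in> {0..T}"
    note G = uniform_game_data[OF S[OF N(1)] rc[OF N(1)] \<gamma> N0[OF N(2)] sp[OF N(1)] Rb[OF N(1)] bl bu b2[OF N(1)] b3[OF N(1)] b3_nonneg]
    show "1 / real N * integral\<^sup>L (M N) (\<lambda>\<omega>. \<Sum>i\<in>{1..N}.
        gap (M N) (R N) (Lam N) (rho N) (LamT N) (rhoT N) (XT N) (X N) T t i \<omega>) \<le> D1 * two_sided e1 T t"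
      by (rule game_data.expected_gap_le(2)[OF G T t less_imp_le[OF D1(1)] le[OF G T t]])
  qed
  \<comment> \<open>The finitely many early N each obey (A2) through their own
    \<open>setting\<close>. Induction collects the largest constant and the smallest rate.\<close>
  have head: "\<exists>D e. 0 < D \<and> 0 < e \<and> (\<forall>N. 2 \<le> N \<and> N < n \<longrightarrow> bd N D e)" for n
  proof (induction n)
    case 0
    show ?case by (intro exI[of _ 1]) simp
  next
    case (Suc n)
    then obtain D e where IH: "0 < D" "0 < e" "\<And>N. 2 \<le> N \<Longrightarrow> N < n \<Longrightarrow> bd N D e" by blast
    show ?case
    proof (cases "2 \<le> n")
      case True
      obtain D' e' where De': "0 < D'" "0 < e'" and
        le': "\<And>T t. 0 < T \<Longrightarrow> t \<in> {0..T} \<Longrightarrow> 1 / real n * integral\<^sup>L (M n) (\<lambda>\<omega>. \<Sum>i\<in>{1..n}.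
          gap (M n) (R n) (Lam n) (rho n) (LamT n) (rhoT n) (XT n) (X n) T t i \<omega>) \<le> D' * two_sided e' T t"
        by (rule setting_turnpike[OF S[OF True]]) (rule that; assumption)
      have "bd n D' e'" unfolding bd_def by (intro allI impI ballI le')
      note n = De' this
      have "bd N (max D D') (min e e')" if "2 \<le> N" "N < Suc n" for N
      proof (cases "N = n")
        case True
        then show ?thesis using bd_mono[OF n(3), of "max D D'" "min e e'"] n(1) by simp
      next
        case False
        then show ?thesis using bd_mono[OF IH(3), of N "max D D'" "min e e'"] IH(1) that by simp
      qed
      then show ?thesis using IH n by (intro exI[of _ "max D D'"] exI[of _ "min e e'"]) auto
    next
      case False
      then show ?thesis using IH by (intro exI[of _ D] exI[of _ e]) auto
    qed
  qed
  obtain D2 e2 where D2: "0 < D2" "0 < e2" "\<And>N. 2 \<le> N \<Longrightarrow> N < N0 \<Longrightarrow> bd N D2 e2"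
    using head[of N0] by blast
  have all: "bd N (max D1 D2) (min e1 e2)" if "2 \<le> N" for N
  proof (cases "N < N0")
    case True
    show ?thesis by (rule bd_mono[OF D2(3)[OF that True]]) (use D2 in auto)
  next
    case False
    then have "N0 \<le> N" by simp
    show ?thesis by (rule bd_mono[OF tail[OF that \<open>N0 \<le> N\<close>]]) (use D1 in auto)
  qed
  show "\<exists>K l. 0 < K \<and> 0 < l \<and> (\<forall>N\<ge>2. \<forall>T>0. \<forall>t\<in>{0..T}.
               (1 / real N) * prob_space.expectation (M N)
                 (\<lambda>\<omega>. \<Sum>i\<in>{1..N}.
                    gap (M N) (R N) (Lam N) (rho N) (LamT N) (rhoT N) (XT N) (X N) T t i \<omega>)
               \<le> K * (exp (- l * t) + exp (- l * (T - t))))"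
  proof (rule exI[of _ "max D1 D2"], rule exI[of _ "min e1 e2"], intro conjI)
    show "\<forall>N\<ge>2. \<forall>T>0. \<forall>t\<in>{0..T}. 1 / real N * prob_space.expectation (M N)
                 (\<lambda>\<omega>. \<Sum>i\<in>{1..N}.
                    gap (M N) (R N) (Lam N) (rho N) (LamT N) (rhoT N) (XT N) (X N) T t i \<omega>)
               \<le> max D1 D2 * (exp (- min e1 e2 * t) + exp (- min e1 e2 * (T - t)))"
      using all unfolding bd_def two_sided_def by blast
  qed (use D1 D2 in auto)
qed

end
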